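(* Assume the standing setup, either Setting A or Setting B, the Gibbs-measure and observable conventions and complex-perturbation quantities below, and the following: (a) $\operatorname{ess\,sup}_\omega E_\omega<\infty$; (b) in Setting A, additionally $\tilde H_\omega\le\gamma_{\theta\omega}^\alpha-1$ $\mathbb P$-a.s.; (c) for some $p>16$, $\bar D_\omega\in L^{2p}(\mathbb P)$ and $K_\omega$, $M_\omega$, $\sup|\tilde u_\omega|$ belong to $L^p(\mathbb P)$; (d) there is a constant $\sigma>0$ with $\sigma^2=\lim_n\frac1n\sigma^2_{\omega,n}$ for $\mathbb P$-a.e. $\omega$. Then for $\mathbb P$-a.e. $\omega$, $$\sup_{t\in\mathbb R}\big|\mu_\omega(S^\omega_n\tilde u\le t\sigma_{\omega,n})-\Phi(t)\big|=O\big(n^{-(1/2-8/p)}\big),$$ where $\Phi$ is the standard normal distribution function and $S^\omega_n\tilde u=\sum_{j=0}^{n-1}\tilde u_{\theta^j\omega}\circ T^j_\omega$.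
   Context: Standing setup. $(\Omega,\mathcal F,\mathbb P)$ is a probability space and $\theta:\Omega\to\Omega$ is invertible, measurable, $\mathbb P$-preserving and ergodic. $(\mathcal X,d)$ is a compact metric space with $\operatorname{diam}\mathcal X\le1$; $\mathcal E\subset\Omega\times\mathcal X$ is $\mathcal F\otimes\mathcal B(\mathcal X)$-measurable with compact fibres $\mathcal E_\omega=\{x:(\omega,x)\in\mathcal E\}$; $T_\omega:\mathcal E_\omega\to\mathcal E_{\theta\omega}$ are maps with $(\omega,x)\mapsto T_\omega x$ measurable, and $T^n_\omega=T_{\theta^{n-1}\omega}\circ\cdots\circ T_\omega$. "Random variable" means a measurable function of $\omega$. An exponent $\alpha\in(0,1]$ is fixed. For $g:\mathcal E_\omega\to\mathbb C$ let $v(g)=\sup_{x\ne x'}|g(x)-g(x')|/d(x,x')^\alpha$ and $\|g\|=\sup|g|+v(g)$; $\mathcal H_\omega$ is the space of real functions $g$ on $\mathcal E_\omega$ with $\|g\|<\infty$, and $\mathbf 1$ is the constant function $1$. A measurable potential $\phi:\mathcal E\to\mathbb R$ is given with $\phi_\omega=\phi(\omega,\cdot)$ bounded. The transfer operator is $\mathcal L_\omega g(x)=\sum_{y\in T_\omega^{-1}\{x\}}e^{\phi_\omega(y)}g(y)$, $x\in\mathcal E_{\theta\omega}$, and $\mathcal L^n_\omega=\mathcal L_{\theta^{n-1}\omega}\circ\cdots\circ\mathcal L_\omega$. Write $\rho_{\omega,n}=\prod_{j=0}^{n-1}\rho(\theta^j\omega)$ and $\lambda_{\omega,n}=\prod_{j=0}^{n-1}\lambda_{\theta^j\omega}$.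 Setting A (properly expanding maps). There are random variables $\gamma_\omega>1$, $H_\omega\ge0$, $D_\omega<\infty$ such that $\mathbb P$-a.s.: for every $x\in\mathcal E_{\theta\omega}$ the preimages are listed as $T_\omega^{-1}\{x\}=\{y_{i,\omega}(x):i\in I_\omega\}$ (index set $I_\omega$ finite or countable, independent of $x$, $i\mapsto y_{i,\omega}(x)$ bijective), and for all $x,x'\in\mathcal E_{\theta\omega}$ and $i\in I_\omega$: $d(y_{i,\omega}(x),y_{i,\omega}(x'))\le\gamma_\omega^{-1}d(x,x')$ and $|\phi_\omega(y_{i,\omega}(x))-\phi_\omega(y_{i,\omega}(x'))|\le H_\omega d(x,x')^\alpha$; moreover $H_\omega\le\gamma_{\theta\omega}^\alpha-1$ and $\sup_{x\in\mathcal E_{\theta\omega}}\sum_{y\in T_\omega^{-1}\{x\}}e^{\phi_\omega(y)}\le D_\omega$. In Setting A put $q(\omega)=(H_\omega+1)\gamma_{\theta\omega}^{-\alpha}$, $D(\omega)=\gamma_{\theta\omega}^\alpha+2\ln\frac{1+q(\omega)}{1-q(\omega)}$, $\rho(\omega)=\tanh(D(\omega)/4)$ (with $\rho(\omega)=1$ if $q(\omega)=1$), $B_\omega=24e^{4\gamma_\omega^\alpha}(1+\gamma_\omega^\alpha)^2$, $B_{\omega,1}=e^{\gamma_\omega^\alpha}$, $K_\omega=(1+\gamma_\omega^\alpha)e^{\gamma_\omega^\alpha}$, $M_\omega=8(1-e^{-\gamma_\omega^\alpha})^{-2}$, and $\mathcal C_\omega=\{g\in\mathcal H_\omega:g\ge0,\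 g(x)\le e^{\gamma_\omega^\alpha d(x,x')^\alpha}g(x')\ \forall x,x'\in\mathcal E_\omega\}$. Setting B (partially expanding maps). There are random variables $l_\omega\ge1$, $\sigma_\omega>1$ and positive integer valued $q_\omega<d_\omega$ such that $\mathbb P$-a.s. every $x\in\mathcal E_{\theta\omega}$ has exactly $d_\omega$ preimages, listed as $T_\omega^{-1}\{x\}=\{y_{1,\omega}(x),\dots,y_{d_\omega,\omega}(x)\}$, and for all $x,x'\in\mathcal E_{\theta\omega}$: $d(y_{i,\omega}(x),y_{i,\omega}(x'))\le l_\omega d(x,x')$ for $i\le q_\omega$ and $d(y_{i,\omega}(x),y_{i,\omega}(x'))\le\sigma_\omega^{-1}d(x,x')$ for $q_\omega<i\le d_\omega$. Let $a_\omega=(q_\omega l_\omega^\alpha+(d_\omega-q_\omega)\sigma_\omega^{-\alpha})/d_\omega$, $\varepsilon_\omega=\sup\phi_\omega-\inf\phi_\omega$, $H_\omega=\max_{i\le d_\omega}v(\phi_\omega\circ y_{i,\omega})$ (assumed finite), and assume $s_\omega:=e^{\varepsilon_\omega}a_\omega<1$ and $e^{\varepsilon_\omega}H_\omega\le(s_{\theta\omega}^{-1}-1)/(1+s_\omega^{-1})$. In Setting B put $\zeta_\omega=s_{\theta\omega}\big(1+(1+s_\omega^{-1})e^{\varepsilon_\omega}H_\omega\big)$, $D(\omega)=2\ln\frac{1+\zeta_\omega}{1-\zeta_\omega}+2\ln(1+\zeta_\omega s_\omega^{-1})$, $\rho(\omega)=\tanh(D(\omega)/4)$ (with $\rho(\omega)=1$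 if $\zeta_\omega=1$), $B_\omega=12(1+2s_\omega^{-1})^4$, $B_{\omega,1}=1+s_\omega^{-1}$, $K_\omega=1+2s_\omega^{-1}$, $M_\omega=6s_\omega^{-1}$, $D_\omega=d_\omega e^{\sup|\phi_\omega|}$, and $\mathcal C_\omega=\{g\in\mathcal H_\omega:g>0,\ v(g)\le s_\omega^{-1}\inf g\}$. Gibbs measures. In either setting, $\mathbb P$-a.s. the limits $\nu_\omega(g)=\lim_n\mathcal L^n_\omega g(x_n)/\mathcal L^n_\omega\mathbf 1(x_n)$ ($g\in\mathcal H_\omega$, any $x_n\in\mathcal E_{\theta^n\omega}$), $\lambda_\omega=\nu_{\theta\omega}(\mathcal L_\omega\mathbf 1)$ and $h_\omega=\lim_n\mathcal L^n_{\theta^{-n}\omega}\mathbf 1/\lambda_{\theta^{-n}\omega,n}$ exist, $\nu_\omega$ is a Borel probability measure, and $\mu_\omega:=h_\omega\nu_\omega$ is the random Gibbs measure; it satisfies $(T_\omega)_*\mu_\omega=\mu_{\theta\omega}$. Observables. $u:\mathcal E\to\mathbb R$ is measurable with $u_\omega=u(\omega,\cdot)\in\mathcal H_\omega$; $\tilde u_\omega=u_\omega-\mu_\omega(u_\omega)$; $S^\omega_nu=\sum_{j=0}^{n-1}u_{\theta^j\omega}\circ T^j_\omega$, viewed as a random variable on $(\mathcal E_\omega,\mu_\omega)$; $\sigma^2_{\omega,n}=\mathrm{Var}_{\mu_\omega}(S^\omega_nu)$. Complex-perturbation quantities. In Setting A: $\tilde H_\omega=\gamma_\omega^{-\alpha}v(u_\omega)+H_\omega$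 and $c_0(\omega)=3\sup|\tilde u_\omega|+\tilde H_\omega/(\gamma_{\theta\omega}^\alpha-1-\tilde H_\omega)$. In Setting B: $\tilde H_\omega=H_\omega$ and $c_0(\omega)=32s_{\theta\omega}(1+2s_\omega^{-1})e^{\sup|\tilde u_\omega|+2\sup|\phi_\omega|}\|\tilde u_\omega\|(1+H_\omega)/(1-\zeta_\omega)$. In both settings: $E_\omega=c_0(\omega)\big(1+\cosh(7D(\omega)/2)\big)$ and $\bar D_\omega=16e^{\sup|\tilde u_\omega|}(1+v(u_\omega))(1+\tilde H_\omega)D_\omega$. *)

theory Defs
  imports "HOL-Probability.Probability"
begin

definition fib :: "('w \<times> 'x) set \<Rightarrow> 'w \<Rightarrow> 'x set" where
  "fib E \<omega> = {x. (\<omega>, x) \<in> E}"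

fun iterT :: "('w \<Rightarrow> 'w) \<Rightarrow> ('w \<Rightarrow> 'x \<Rightarrow> 'x) \<Rightarrow> nat \<Rightarrow> 'w \<Rightarrow> 'x \<Rightarrow> 'x" where
  "iterT \<theta> T 0 \<omega> = id"
| "iterT \<theta> T (Suc n) \<omega> = T ((\<theta> ^^ n) \<omega>) \<circ> iterT \<theta> T n \<omega>"

text \<open>Hoelder seminorm v(g) on S (value 0 if S has fewer than two points).\<close>
definition hvar :: "real \<Rightarrow> 'x::metric_space set \<Rightarrow> ('x \<Rightarrow> real) \<Rightarrow> real" where
  "hvar \<alpha> S g = Sup (insert 0 {\<bar>g x - g x'\<bar> / dist x x' powr \<alpha> | x x'. x \<in> S \<and> x' \<in> S \<and> x \<noteq> x'})"

text \<open>sup |g| on S (value 0 on the empty set).\<close>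
definition supabs :: "'x set \<Rightarrow> ('x \<Rightarrow> real) \<Rightarrow> real" where
  "supabs S g = Sup (insert 0 ((\<lambda>x. \<bar>g x\<bar>) ` S))"

definition hnorm :: "real \<Rightarrow> 'x::metric_space set \<Rightarrow> ('x \<Rightarrow> real) \<Rightarrow> real" where
  "hnorm \<alpha> S g = supabs S g + hvar \<alpha> S g"

text \<open>Membership in the Hoelder space H: \<parallel>g\<parallel> < \<infinity>, i.e. g bounded and alpha-Hoelder on S.\<close>
definition holder_space :: "real \<Rightarrow> 'x::metric_space set \<Rightarrow> ('x \<Rightarrow> real) \<Rightarrow> bool" where
  "holder_space \<alpha> S g \<longleftrightarrow> bounded (g ` S) \<and>
     (\<exists>C. \<forall>x\<in>S. \<forall>x'\<in>S. \<bar>g x - g x'\<bar> \<le> C * dist x x' powr \<alpha>)"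

definition Lop :: "('w \<times> 'x) set \<Rightarrow> ('w \<Rightarrow> 'x \<Rightarrow> 'x) \<Rightarrow> ('w \<Rightarrow> 'x \<Rightarrow> real) \<Rightarrow> 'w
                    \<Rightarrow> ('x \<Rightarrow> real) \<Rightarrow> 'x \<Rightarrow> real" where
  "Lop E T \<phi> \<omega> g x = (\<Sum>\<^sub>\<infinity>y\<in>{y \<in> fib E \<omega>. T \<omega> y = x}. exp (\<phi> \<omega> y) * g y)"

fun Lit :: "('w \<times> 'x) set \<Rightarrow> ('w \<Rightarrow> 'x \<Rightarrow> 'x) \<Rightarrow> ('w \<Rightarrow> 'x \<Rightarrow> real) \<Rightarrow> ('w \<Rightarrow> 'w) \<Rightarrow> nat
            \<Rightarrow> 'w \<Rightarrow> ('x \<Rightarrow> real) \<Rightarrow> 'x \<Rightarrow> real" where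
  "Lit E T \<phi> \<theta> 0 \<omega> g = g"
| "Lit E T \<phi> \<theta> (Suc n) \<omega> g = Lop E T \<phi> ((\<theta> ^^ n) \<omega>) (Lit E T \<phi> \<theta> n \<omega> g)"

definition Ssum :: "('w \<Rightarrow> 'w) \<Rightarrow> ('w \<Rightarrow> 'x \<Rightarrow> 'x) \<Rightarrow> ('w \<Rightarrow> 'x \<Rightarrow> real) \<Rightarrow> nat \<Rightarrow> 'w \<Rightarrow> 'x \<Rightarrow> real" where
  "Ssum \<theta> T f n \<omega> x = (\<Sum>j<n. f ((\<theta> ^^ j) \<omega>) (iterT \<theta> T j \<omega> x))"

definition ergodic :: "'w measure \<Rightarrow> ('w \<Rightarrow> 'w) \<Rightarrow> bool" where
  "ergodic P \<theta> \<longleftrightarrow> (\<forall>A\<in>sets P. \<theta> -` A \<inter> space P = A \<longrightarrow> measure P A = 0 \<or> measure P A = 1)"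

definition thinv :: "'w measure \<Rightarrow> ('w \<Rightarrow> 'w) \<Rightarrow> 'w \<Rightarrow> 'w" where
  "thinv P \<theta> = the_inv_into (space P) \<theta>"

definition standing_setup ::
  "'w measure \<Rightarrow> ('w \<Rightarrow> 'w) \<Rightarrow> 'x::metric_space set \<Rightarrow> ('w \<times> 'x) set \<Rightarrow> ('w \<Rightarrow> 'x \<Rightarrow> 'x)
   \<Rightarrow> ('w \<Rightarrow> 'x \<Rightarrow> real) \<Rightarrow> real \<Rightarrow> bool" where
  "standing_setup P \<theta> X E T \<phi> \<alpha> \<longleftrightarrow>
     prob_space P \<and>
     bij_betw \<theta> (space P) (space P) \<and> \<theta> \<in> measurable P P \<and> thinv P \<theta> \<in> measurable P P \<and>
     distr P P \<theta> = P \<and> ergodic P \<theta> \<and>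
     compact X \<and> diameter X \<le> 1 \<and>
     E \<subseteq> space P \<times> X \<and> E \<in> sets (P \<Otimes>\<^sub>M borel) \<and>
     (\<forall>\<omega>\<in>space P. compact (fib E \<omega>)) \<and>
     (\<forall>\<omega>\<in>space P. \<forall>x\<in>fib E \<omega>. T \<omega> x \<in> fib E (\<theta> \<omega>)) \<and>
     (\<lambda>(\<omega>, x). T \<omega> x) \<in> borel_measurable (restrict_space (P \<Otimes>\<^sub>M borel) E) \<and>
     0 < \<alpha> \<and> \<alpha> \<le> 1 \<and>
     (\<lambda>(\<omega>, x). \<phi> \<omega> x) \<in> borel_measurable (restrict_space (P \<Otimes>\<^sub>M borel) E) \<and>
     (\<forall>\<omega>\<in>space P. bounded (\<phi> \<omega> ` fib E \<omega>))"

definition conformal_family ::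
  "'w measure \<Rightarrow> ('w \<Rightarrow> 'w) \<Rightarrow> ('w \<times> 'x::metric_space) set \<Rightarrow> ('w \<Rightarrow> 'x \<Rightarrow> 'x)
   \<Rightarrow> ('w \<Rightarrow> 'x \<Rightarrow> real) \<Rightarrow> real \<Rightarrow> ('w \<Rightarrow> 'x measure) \<Rightarrow> bool" where
  "conformal_family P \<theta> E T \<phi> \<alpha> \<nu> \<longleftrightarrow>
     (AE \<omega> in P. prob_space (\<nu> \<omega>) \<and> sets (\<nu> \<omega>) = sets (restrict_space borel (fib E \<omega>)) \<and>
        (\<forall>g. holder_space \<alpha> (fib E \<omega>) g \<longrightarrow>
           (\<forall>xs. (\<forall>n. xs n \<in> fib E ((\<theta> ^^ n) \<omega>)) \<longrightarrow>
              (\<lambda>n. Lit E T \<phi> \<theta> n \<omega> g (xs n) / Lit E T \<phi> \<theta> n \<omega> (\<lambda>_. 1) (xs n))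
                \<longlonglongrightarrow> integral\<^sup>L (\<nu> \<omega>) g)))"

definition glam :: "('w \<Rightarrow> 'x measure) \<Rightarrow> ('w \<times> 'x) set \<Rightarrow> ('w \<Rightarrow> 'x \<Rightarrow> 'x) \<Rightarrow> ('w \<Rightarrow> 'x \<Rightarrow> real)
                    \<Rightarrow> ('w \<Rightarrow> 'w) \<Rightarrow> 'w \<Rightarrow> real" where
  "glam \<nu> E T \<phi> \<theta> \<omega> = integral\<^sup>L (\<nu> (\<theta> \<omega>)) (Lop E T \<phi> \<omega> (\<lambda>_. 1))"

definition glamn :: "('w \<Rightarrow> 'x measure) \<Rightarrow> ('w \<times> 'x) set \<Rightarrow> ('w \<Rightarrow> 'x \<Rightarrow> 'x) \<Rightarrow> ('w \<Rightarrow> 'x \<Rightarrow> real)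
                    \<Rightarrow> ('w \<Rightarrow> 'w) \<Rightarrow> 'w \<Rightarrow> nat \<Rightarrow> real" where
  "glamn \<nu> E T \<phi> \<theta> \<omega> n = (\<Prod>j<n. glam \<nu> E T \<phi> \<theta> ((\<theta> ^^ j) \<omega>))"

definition gh :: "'w measure \<Rightarrow> ('w \<Rightarrow> 'x measure) \<Rightarrow> ('w \<times> 'x) set \<Rightarrow> ('w \<Rightarrow> 'x \<Rightarrow> 'x)
                  \<Rightarrow> ('w \<Rightarrow> 'x \<Rightarrow> real) \<Rightarrow> ('w \<Rightarrow> 'w) \<Rightarrow> 'w \<Rightarrow> 'x \<Rightarrow> real" where
  "gh P \<nu> E T \<phi> \<theta> \<omega> x =
     lim (\<lambda>n. Lit E T \<phi> \<theta> n ((thinv P \<theta> ^^ n) \<omega>) (\<lambda>_. 1) x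
               / glamn \<nu> E T \<phi> \<theta> ((thinv P \<theta> ^^ n) \<omega>) n)"

definition gibbs :: "'w measure \<Rightarrow> ('w \<Rightarrow> 'x measure) \<Rightarrow> ('w \<times> 'x) set \<Rightarrow> ('w \<Rightarrow> 'x \<Rightarrow> 'x)
                  \<Rightarrow> ('w \<Rightarrow> 'x \<Rightarrow> real) \<Rightarrow> ('w \<Rightarrow> 'w) \<Rightarrow> 'w \<Rightarrow> 'x measure" where
  "gibbs P \<nu> E T \<phi> \<theta> \<omega> = density (\<nu> \<omega>) (\<lambda>x. ennreal (gh P \<nu> E T \<phi> \<theta> \<omega> x))"

definition observable ::
  "'w measure \<Rightarrow> ('w \<times> 'x::metric_space) set \<Rightarrow> real \<Rightarrow> ('w \<Rightarrow> 'x \<Rightarrow> real) \<Rightarrow> bool" where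
  "observable P E \<alpha> u \<longleftrightarrow>
     (\<lambda>(\<omega>, x). u \<omega> x) \<in> borel_measurable (restrict_space (P \<Otimes>\<^sub>M borel) E) \<and>
     (AE \<omega> in P. holder_space \<alpha> (fib E \<omega>) (u \<omega>))"

definition ucent :: "('w \<Rightarrow> 'x measure) \<Rightarrow> ('w \<Rightarrow> 'x \<Rightarrow> real) \<Rightarrow> 'w \<Rightarrow> 'x \<Rightarrow> real" where
  "ucent \<mu> u \<omega> x = u \<omega> x - integral\<^sup>L (\<mu> \<omega>) (u \<omega>)"

definition svar :: "('w \<Rightarrow> 'x measure) \<Rightarrow> ('w \<Rightarrow> 'w) \<Rightarrow> ('w \<Rightarrow> 'x \<Rightarrow> 'x) \<Rightarrow> ('w \<Rightarrow> 'x \<Rightarrow> real)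
                    \<Rightarrow> 'w \<Rightarrow> nat \<Rightarrow> real" where
  "svar \<mu> \<theta> T u \<omega> n =
     integral\<^sup>L (\<mu> \<omega>) (\<lambda>x. (Ssum \<theta> T u n \<omega> x - integral\<^sup>L (\<mu> \<omega>) (Ssum \<theta> T u n \<omega>))\<^sup>2)"

definition Phi :: "real \<Rightarrow> real" where
  "Phi t = cdf (density lborel std_normal_density) t"

text \<open>Branch data: I omega is the index set (a subset of nat, i.e. finite or countable),
  y omega i x is the i-th preimage of x.\<close>
definition setting_A ::
  "'w measure \<Rightarrow> ('w \<Rightarrow> 'w) \<Rightarrow> ('w \<times> 'x::metric_space) set \<Rightarrow> ('w \<Rightarrow> 'x \<Rightarrow> 'x)
   \<Rightarrow> ('w \<Rightarrow> 'x \<Rightarrow> real) \<Rightarrow> real \<Rightarrow> ('w \<Rightarrow> nat set) \<Rightarrow> ('w \<Rightarrow> nat \<Rightarrow> 'x \<Rightarrow> 'x)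
   \<Rightarrow> ('w \<Rightarrow> real) \<Rightarrow> ('w \<Rightarrow> real) \<Rightarrow> ('w \<Rightarrow> real) \<Rightarrow> bool" where
  "setting_A P \<theta> E T \<phi> \<alpha> I y \<gamma> H D \<longleftrightarrow>
     \<gamma> \<in> borel_measurable P \<and> H \<in> borel_measurable P \<and> D \<in> borel_measurable P \<and>
     (AE \<omega> in P. \<gamma> \<omega> > 1 \<and> H \<omega> \<ge> 0 \<and>
        (\<forall>x\<in>fib E (\<theta> \<omega>). bij_betw (\<lambda>i. y \<omega> i x) (I \<omega>) {z \<in> fib E \<omega>. T \<omega> z = x}) \<and>
        (\<forall>x\<in>fib E (\<theta> \<omega>). \<forall>x'\<in>fib E (\<theta> \<omega>). \<forall>i\<in>I \<omega>.
            dist (y \<omega> i x) (y \<omega> i x') \<le> dist x x' / \<gamma> \<omega> \<and>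
            \<bar>\<phi> \<omega> (y \<omega> i x) - \<phi> \<omega> (y \<omega> i x')\<bar> \<le> H \<omega> * dist x x' powr \<alpha>) \<and>
        H \<omega> \<le> \<gamma> (\<theta> \<omega>) powr \<alpha> - 1 \<and>
        (\<forall>x\<in>fib E (\<theta> \<omega>). (\<lambda>z. exp (\<phi> \<omega> z)) summable_on {z \<in> fib E \<omega>. T \<omega> z = x} \<and>
            (\<Sum>\<^sub>\<infinity>z\<in>{z \<in> fib E \<omega>. T \<omega> z = x}. exp (\<phi> \<omega> z)) \<le> D \<omega>))"

definition qA :: "('w \<Rightarrow> 'w) \<Rightarrow> real \<Rightarrow> ('w \<Rightarrow> real) \<Rightarrow> ('w \<Rightarrow> real) \<Rightarrow> 'w \<Rightarrow> real" where
  "qA \<theta> \<alpha> \<gamma> H \<omega> = (H \<omega> + 1) * \<gamma> (\<theta> \<omega>) powr (-\<alpha>)"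

text \<open>D(omega) in Setting A (finite only when q(omega) < 1).\<close>
definition DA :: "('w \<Rightarrow> 'w) \<Rightarrow> real \<Rightarrow> ('w \<Rightarrow> real) \<Rightarrow> ('w \<Rightarrow> real) \<Rightarrow> 'w \<Rightarrow> real" where
  "DA \<theta> \<alpha> \<gamma> H \<omega> = \<gamma> (\<theta> \<omega>) powr \<alpha> + 2 * ln ((1 + qA \<theta> \<alpha> \<gamma> H \<omega>) / (1 - qA \<theta> \<alpha> \<gamma> H \<omega>))"

definition KA :: "real \<Rightarrow> ('w \<Rightarrow> real) \<Rightarrow> 'w \<Rightarrow> real" where
  "KA \<alpha> \<gamma> \<omega> = (1 + \<gamma> \<omega> powr \<alpha>) * exp (\<gamma> \<omega> powr \<alpha>)"

definition MA :: "real \<Rightarrow> ('w \<Rightarrow> real) \<Rightarrow> 'w \<Rightarrow> real" where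
  "MA \<alpha> \<gamma> \<omega> = 8 * (1 - exp (- (\<gamma> \<omega> powr \<alpha>))) powr (-2)"

definition setting_B ::
  "'w measure \<Rightarrow> ('w \<Rightarrow> 'w) \<Rightarrow> ('w \<times> 'x::metric_space) set \<Rightarrow> ('w \<Rightarrow> 'x \<Rightarrow> 'x)
   \<Rightarrow> ('w \<Rightarrow> nat \<Rightarrow> 'x \<Rightarrow> 'x) \<Rightarrow> ('w \<Rightarrow> real) \<Rightarrow> ('w \<Rightarrow> real) \<Rightarrow> ('w \<Rightarrow> nat) \<Rightarrow> ('w \<Rightarrow> nat) \<Rightarrow> bool" where
  "setting_B P \<theta> E T y l sg q d \<longleftrightarrow>
     l \<in> borel_measurable P \<and> sg \<in> borel_measurable P \<and>
     q \<in> measurable P (count_space UNIV) \<and> d \<in> measurable P (count_space UNIV) \<and>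
     (AE \<omega> in P. l \<omega> \<ge> 1 \<and> sg \<omega> > 1 \<and> 0 < q \<omega> \<and> q \<omega> < d \<omega> \<and>
        (\<forall>x\<in>fib E (\<theta> \<omega>). bij_betw (\<lambda>i. y \<omega> i x) {1..d \<omega>} {z \<in> fib E \<omega>. T \<omega> z = x}) \<and>
        (\<forall>x\<in>fib E (\<theta> \<omega>). \<forall>x'\<in>fib E (\<theta> \<omega>).
            (\<forall>i\<in>{1..q \<omega>}. dist (y \<omega> i x) (y \<omega> i x') \<le> l \<omega> * dist x x') \<and>
            (\<forall>i\<in>{q \<omega><..d \<omega>}. dist (y \<omega> i x) (y \<omega> i x') \<le> dist x x' / sg \<omega>)))"

definition aB :: "real \<Rightarrow> ('w \<Rightarrow> real) \<Rightarrow> ('w \<Rightarrow> real) \<Rightarrow> ('w \<Rightarrow> nat) \<Rightarrow> ('w \<Rightarrow> nat) \<Rightarrow> 'w \<Rightarrow> real" where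
  "aB \<alpha> l sg q d \<omega> =
     (real (q \<omega>) * l \<omega> powr \<alpha> + real (d \<omega> - q \<omega>) * sg \<omega> powr (-\<alpha>)) / real (d \<omega>)"

definition epsB :: "('w \<times> 'x) set \<Rightarrow> ('w \<Rightarrow> 'x \<Rightarrow> real) \<Rightarrow> 'w \<Rightarrow> real" where
  "epsB E \<phi> \<omega> = (SUP x\<in>fib E \<omega>. \<phi> \<omega> x) - (INF x\<in>fib E \<omega>. \<phi> \<omega> x)"

definition HB :: "('w \<Rightarrow> 'w) \<Rightarrow> ('w \<times> 'x::metric_space) set \<Rightarrow> ('w \<Rightarrow> 'x \<Rightarrow> real) \<Rightarrow> real
                  \<Rightarrow> ('w \<Rightarrow> nat \<Rightarrow> 'x \<Rightarrow> 'x) \<Rightarrow> ('w \<Rightarrow> nat) \<Rightarrow> 'w \<Rightarrow> real" where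
  "HB \<theta> E \<phi> \<alpha> y d \<omega> = Max ((\<lambda>i. hvar \<alpha> (fib E (\<theta> \<omega>)) (\<lambda>x. \<phi> \<omega> (y \<omega> i x))) ` {1..d \<omega>})"

definition sB :: "('w \<times> 'x) set \<Rightarrow> ('w \<Rightarrow> 'x \<Rightarrow> real) \<Rightarrow> real \<Rightarrow> ('w \<Rightarrow> real) \<Rightarrow> ('w \<Rightarrow> real)
                  \<Rightarrow> ('w \<Rightarrow> nat) \<Rightarrow> ('w \<Rightarrow> nat) \<Rightarrow> 'w \<Rightarrow> real" where
  "sB E \<phi> \<alpha> l sg q d \<omega> = exp (epsB E \<phi> \<omega>) * aB \<alpha> l sg q d \<omega>"

definition setting_B_cond ::
  "'w measure \<Rightarrow> ('w \<Rightarrow> 'w) \<Rightarrow> ('w \<times> 'x::metric_space) set \<Rightarrow> ('w \<Rightarrow> 'x \<Rightarrow> real) \<Rightarrow> real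
   \<Rightarrow> ('w \<Rightarrow> nat \<Rightarrow> 'x \<Rightarrow> 'x) \<Rightarrow> ('w \<Rightarrow> real) \<Rightarrow> ('w \<Rightarrow> real) \<Rightarrow> ('w \<Rightarrow> nat) \<Rightarrow> ('w \<Rightarrow> nat) \<Rightarrow> bool" where
  "setting_B_cond P \<theta> E \<phi> \<alpha> y l sg q d \<longleftrightarrow>
     (AE \<omega> in P.
        (\<forall>i\<in>{1..d \<omega>}. holder_space \<alpha> (fib E (\<theta> \<omega>)) (\<lambda>x. \<phi> \<omega> (y \<omega> i x))) \<and>
        sB E \<phi> \<alpha> l sg q d \<omega> < 1 \<and>
        exp (epsB E \<phi> \<omega>) * HB \<theta> E \<phi> \<alpha> y d \<omega>
          \<le> (1 / sB E \<phi> \<alpha> l sg q d (\<theta> \<omega>) - 1) / (1 + 1 / sB E \<phi> \<alpha> l sg q d \<omega>))"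

definition zetaB :: "('w \<Rightarrow> 'w) \<Rightarrow> ('w \<Rightarrow> real) \<Rightarrow> ('w \<Rightarrow> real) \<Rightarrow> ('w \<Rightarrow> real) \<Rightarrow> 'w \<Rightarrow> real" where
  "zetaB \<theta> s eps H \<omega> = s (\<theta> \<omega>) * (1 + (1 + 1 / s \<omega>) * exp (eps \<omega>) * H \<omega>)"

text \<open>D(omega) in Setting B (finite only when zeta < 1).\<close>
definition DB :: "('w \<Rightarrow> 'w) \<Rightarrow> ('w \<Rightarrow> real) \<Rightarrow> ('w \<Rightarrow> real) \<Rightarrow> ('w \<Rightarrow> real) \<Rightarrow> 'w \<Rightarrow> real" where
  "DB \<theta> s eps H \<omega> =
     2 * ln ((1 + zetaB \<theta> s eps H \<omega>) / (1 - zetaB \<theta> s eps H \<omega>))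
     + 2 * ln (1 + zetaB \<theta> s eps H \<omega> / s \<omega>)"

definition KB :: "('w \<Rightarrow> real) \<Rightarrow> 'w \<Rightarrow> real" where
  "KB s \<omega> = 1 + 2 / s \<omega>"

definition MB :: "('w \<Rightarrow> real) \<Rightarrow> 'w \<Rightarrow> real" where
  "MB s \<omega> = 6 / s \<omega>"

definition DomB :: "('w \<times> 'x) set \<Rightarrow> ('w \<Rightarrow> 'x \<Rightarrow> real) \<Rightarrow> ('w \<Rightarrow> nat) \<Rightarrow> 'w \<Rightarrow> real" where
  "DomB E \<phi> d \<omega> = real (d \<omega>) * exp (supabs (fib E \<omega>) (\<phi> \<omega>))"

definition HtA :: "('w \<times> 'x::metric_space) set \<Rightarrow> real \<Rightarrow> ('w \<Rightarrow> 'x \<Rightarrow> real) \<Rightarrow> ('w \<Rightarrow> real)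
                   \<Rightarrow> ('w \<Rightarrow> real) \<Rightarrow> 'w \<Rightarrow> real" where
  "HtA E \<alpha> u \<gamma> H \<omega> = \<gamma> \<omega> powr (-\<alpha>) * hvar \<alpha> (fib E \<omega>) (u \<omega>) + H \<omega>"

text \<open>Setting A: c_0(omega) (finite only when H~_omega < gamma_{theta omega}^alpha - 1).\<close>
definition c0A :: "('w \<Rightarrow> 'w) \<Rightarrow> ('w \<times> 'x::metric_space) set \<Rightarrow> real \<Rightarrow> ('w \<Rightarrow> 'x \<Rightarrow> real)
                   \<Rightarrow> ('w \<Rightarrow> 'x \<Rightarrow> real) \<Rightarrow> ('w \<Rightarrow> real) \<Rightarrow> ('w \<Rightarrow> real) \<Rightarrow> 'w \<Rightarrow> real" where
  "c0A \<theta> E \<alpha> u ut \<gamma> H \<omega> =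
     3 * supabs (fib E \<omega>) (ut \<omega>)
     + HtA E \<alpha> u \<gamma> H \<omega> / (\<gamma> (\<theta> \<omega>) powr \<alpha> - 1 - HtA E \<alpha> u \<gamma> H \<omega>)"

text \<open>Setting B: c_0(omega); here H~ = H.\<close>
definition c0B :: "('w \<Rightarrow> 'w) \<Rightarrow> ('w \<times> 'x::metric_space) set \<Rightarrow> real \<Rightarrow> ('w \<Rightarrow> 'x \<Rightarrow> real)
                   \<Rightarrow> ('w \<Rightarrow> 'x \<Rightarrow> real) \<Rightarrow> ('w \<Rightarrow> real) \<Rightarrow> ('w \<Rightarrow> real) \<Rightarrow> ('w \<Rightarrow> real) \<Rightarrow> 'w \<Rightarrow> real" where
  "c0B \<theta> E \<alpha> \<phi> ut s eps H \<omega> =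
     32 * s (\<theta> \<omega>) * (1 + 2 / s \<omega>)
     * exp (supabs (fib E \<omega>) (ut \<omega>) + 2 * supabs (fib E \<omega>) (\<phi> \<omega>))
     * hnorm \<alpha> (fib E \<omega>) (ut \<omega>) * (1 + H \<omega>) / (1 - zetaB \<theta> s eps H \<omega>)"

definition Equant :: "('w \<Rightarrow> real) \<Rightarrow> ('w \<Rightarrow> real) \<Rightarrow> 'w \<Rightarrow> real" where
  "Equant c0 Dfun \<omega> = c0 \<omega> * (1 + cosh (7 * Dfun \<omega> / 2))"

definition Dbar :: "('w \<times> 'x::metric_space) set \<Rightarrow> real \<Rightarrow> ('w \<Rightarrow> 'x \<Rightarrow> real) \<Rightarrow> ('w \<Rightarrow> 'x \<Rightarrow> real)
                    \<Rightarrow> ('w \<Rightarrow> real) \<Rightarrow> ('w \<Rightarrow> real) \<Rightarrow> 'w \<Rightarrow> real" where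
  "Dbar E \<alpha> u ut Ht Dom \<omega> =
     16 * exp (supabs (fib E \<omega>) (ut \<omega>)) * (1 + hvar \<alpha> (fib E \<omega>) (u \<omega>)) * (1 + Ht \<omega>) * Dom \<omega>"

definition inLp :: "'w measure \<Rightarrow> real \<Rightarrow> ('w \<Rightarrow> real) \<Rightarrow> bool" where
  "inLp P p f \<longleftrightarrow> f \<in> borel_measurable P \<and> integrable P (\<lambda>\<omega>. \<bar>f \<omega>\<bar> powr p)"

end

theory Submission
  imports Defs "HOL-Complex_Analysis.Complex_Analysis" "HOL-Real_Asymp.Real_Asymp"
begin

text \<open>The moment generating function \<open>F\<^sub>n(z)\<close> of the Birkhoff sum under the Gibbs measure is an integral of
  iterated perturbed transfer operators.  The real operators contract the cones \<open>C\<^sub>\<omega>\<close>, and by the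
  complex cone technique a small complex perturbation still maps the complexified cones into each
  other.  Hence \<open>F\<^sub>n\<close> has no zeros on a disc whose radius \<open>r\<^sub>n\<close> is governed by the first \<open>n\<close> fibres, and
  \<open>F\<^sub>n\<close> grows there by a factor at most \<open>3 K\<close> in each step.  Borel--Caratheodory applied to
  \<open>ln F\<^sub>n\<close> controls its third-order Taylor remainder, and Esseen's smoothing inequality turns this
  into a Berry--Esseen bound of order \<open>1 / (r\<^sub>n \<sigma>\<^sub>n) + A\<^sub>n / (r\<^sub>n \<sigma>\<^sub>n)\<^sup>3\<close> with \<open>A\<^sub>n\<close> of order
  \<open>n ln n\<close>.  In Setting A the radius is constant, since it only sees \<open>ess sup E\<close>; in Setting B
  integrability gives \<open>r\<^sub>n \<ge> c n powr (- 9 / (4 p))\<close> almost surely.  Speed of mixing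
  plays no role: ergodicity is only needed for the recurrence that makes \<open>h\<^sub>\<omega>\<close> exist.\<close>

section \<open>Esseen's smoothing inequality\<close>

text \<open>\<open>conformal_family\<close> provides limits of quotients on Hoelder functions, but
  not \<open>h\<close>: the density, its equation and the invariance of the Gibbs measure are
  derived from cone contraction. This needs contraction factors bounded away from 1 infinitely often
  in the past, and that recurrence is read off from the observable: if it were almost surely
  constant on fibres, \<sigma> would be 0, so on a set of positive measure \<open>U\<close> is
  bounded below and \<open>W\<close> above, and \<open>U * \<Gamma> \<le> W\<close> bounds \<Gamma>
  there. Cones are cut out by finite point functionals, so that complex functions are tested by the
  same functionals and pointwise limits stay inside. A step with cross-ratio constant \<Gamma>
  tolerates relative errors 1 / (6 \<Gamma>). In Setting B, \<Gamma> contains s at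
  \<open>\<theta> \<omega>\<close> while \<open>DB\<close> contains s at \<omega>, so the bound on E
  does not control \<Gamma>; the radius pays an extra factor
  \<open>KB s (\<theta> \<omega>)\<close>. The loss in the radius enters cubed, 27 / (4p) < 8 / p,
  and the gap absorbs the logarithm.\<close>

definition tent :: "real \<Rightarrow> real" where
  "tent t = max 0 (1 - \<bar>t\<bar>)"

text \<open>The Fejer kernel, introduced as the Fourier transform of the triangle, so that its own
  transform vanishes outside [-1,1]: smoothing at scale 1/T then sees characteristic functions on
  [-T,T] only. It is left unnormalised.\<close>

definition fejer :: "real \<Rightarrow> real" where
  "fejer x = (LINT t|lborel. tent t * cos (t * x))"

lemma tent_bounds: "0 \<le> tent t" "tent t \<le> 1" "\<bar>tent t\<bar> \<le> indicator {-1..1} t"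
  by (auto simp: tent_def indicator_def)

lemma measurable_tent [measurable]: "tent \<in> borel_measurable borel"
  unfolding tent_def[abs_def] by measurable

lemma integrable_tent: "integrable lborel tent"
  by (rule Bochner_Integration.integrable_bound[of _ "indicator {-1..1} :: real \<Rightarrow> real"])
     (use tent_bounds(3) in auto)

lemma integrable_tent_mult:
  fixes g :: "real \<Rightarrow> 'b::{banach, second_countable_topology}"
  assumes [measurable]: "g \<in> borel_measurable borel" and B: "\<And>t. norm (g t) \<le> B"
  shows "integrable lborel (\<lambda>t. tent t *\<^sub>R g t)"
proof (rule Bochner_Integration.integrable_bound)
  show "integrable lborel (\<lambda>t. B * tent t)" using integrable_tent by simp
  have "norm (tent t *\<^sub>R g t) \<le> norm (B * tent t)" for t
  proof -
    have "tent t * norm (g t) \<le> tent t * \<bar>B\<bar>"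
      using B[of t] tent_bounds(1)[of t] by (intro mult_left_mono) auto
    then show ?thesis using tent_bounds(1)[of t] by (simp add: abs_mult mult.commute)
  qed
  then show "AE t in lborel. norm (tent t *\<^sub>R g t) \<le> norm (B * tent t)" by simp
qed measurable

lemma fejer_eq:
  assumes x: "x \<noteq> 0"
  shows "fejer x = 2 * (1 - cos x) / x\<^sup>2"
proof -
  \<comment> \<open>The endpoint values are those of the antiderivative
    \<open>(1 + t) * sin (t * x) / x + cos (t * x) / x\<^sup>2\<close>.\<close>
  have 1: "((\<lambda>t. (1 + t) * cos (t * x)) has_integral
      ((1 + 0) * sin (0 * x) / x + cos (0 * x) / x\<^sup>2 - ((1 + (-1)) * sin ((-1) * x) / x + cos ((-1) * x) / x\<^sup>2))) {-1..0}"
    by (rule fundamental_theorem_of_calculus)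
       (use x in \<open>auto intro!: derivative_eq_intros simp flip: has_real_derivative_iff_has_vector_derivative
          simp: field_simps power2_eq_square\<close>)
  have 2: "((\<lambda>t. (1 - t) * cos (t * x)) has_integral
      ((1 - 1) * sin (1 * x) / x - cos (1 * x) / x\<^sup>2 - ((1 - 0) * sin (0 * x) / x - cos (0 * x) / x\<^sup>2))) {0..1}"
    by (rule fundamental_theorem_of_calculus)
       (use x in \<open>auto intro!: derivative_eq_intros simp flip: has_real_derivative_iff_has_vector_derivative
          simp: field_simps power2_eq_square\<close>)
  have i1: "((\<lambda>t. tent t * cos (t * x)) has_integral (1 - cos x) / x\<^sup>2) {-1..0}"
    using has_integral_eq[OF _ 1, of "\<lambda>t. tent t * cos (t * x)"]
    by (simp add: tent_def diff_divide_distrib)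
  have i2: "((\<lambda>t. tent t * cos (t * x)) has_integral (1 - cos x) / x\<^sup>2) {0..1}"
    using has_integral_eq[OF _ 2, of "\<lambda>t. tent t * cos (t * x)"]
    by (simp add: tent_def diff_divide_distrib)
  have "((\<lambda>t. tent t * cos (t * x)) has_integral (1 - cos x) / x\<^sup>2 + (1 - cos x) / x\<^sup>2) {-1..1}"
    by (rule Henstock_Kurzweil_Integration.has_integral_combine[OF _ _ i1 i2]) auto
  then have I: "((\<lambda>t. tent t * cos (t * x)) has_integral 2 * (1 - cos x) / x\<^sup>2) UNIV"
    by (subst has_integral_on_superset[where S="{-1..1}"]) (auto simp: tent_def)
  have "integrable lborel (\<lambda>t. tent t * cos (t * x))"
    using integrable_tent_mult[of "\<lambda>t. cos (t * x)" 1] by simp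
  from has_integral_integral_lborel[OF this] I show ?thesis
    unfolding fejer_def by (rule has_integral_unique)
qed

lemma fejer_nonneg: "0 \<le> fejer x"
proof (cases "x = 0")
  case True
  then show ?thesis unfolding fejer_def using tent_bounds(1) by (simp add: integral_nonneg_AE)
qed (simp add: fejer_eq)

lemma measurable_fejer [measurable]: "fejer \<in> borel_measurable borel"
  unfolding fejer_def[abs_def] by measurable

lemma fejer_le: "fejer x \<le> 2 / x\<^sup>2 + 2 / x\<^sup>2" if "x \<noteq> 0"
proof -
  have "2 * (1 - cos x) \<le> 4" using cos_ge_minus_one[of x] by argo
  then show ?thesis using that by (simp add: fejer_eq divide_right_mono)
qed

lemma fejer_le_2: "fejer x \<le> 2"
proof -
  have "fejer x \<le> (LINT t|lborel. indicator {-1..1::real} t)"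
    unfolding fejer_def
  proof (rule Bochner_Integration.integral_mono)
    show "integrable lborel (\<lambda>t. tent t * cos (t * x))"
      using integrable_tent_mult[of "\<lambda>t. cos (t * x)" 1] by simp
    show "tent t * cos (t * x) \<le> indicator {- 1..1} t" for t
    proof -
      have "tent t * cos (t * x) \<le> \<bar>tent t\<bar> * \<bar>cos (t * x)\<bar>" by (metis abs_ge_self abs_mult)
      also have "\<dots> \<le> \<bar>tent t\<bar> * 1" by (intro mult_left_mono) auto
      finally show ?thesis using tent_bounds(3)[of t] by simp
    qed
  qed simp
  then show ?thesis by simp
qed

text \<open>Near 0 the crude bound 2 is available, far out 4 / x^2; the constant 8 covers both
  ranges and produces an integrable majorant.\<close>

lemma fejer_le_inverse: "fejer x \<le> 8 * inverse (1 + x\<^sup>2)"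
proof (cases "x\<^sup>2 \<le> 1")
  case True
  then have "8 * inverse (1 + x\<^sup>2) \<ge> 2"
    by (simp add: field_simps add_pos_nonneg)
  with fejer_le_2[of x] show ?thesis by linarith
next
  case False
  then have "x \<noteq> 0" by auto
  from fejer_le[OF this] have "fejer x \<le> 4 / x\<^sup>2" by simp
  also have "\<dots> \<le> 8 * inverse (1 + x\<^sup>2)" using False \<open>x \<noteq> 0\<close> by (simp add: field_simps add_pos_nonneg)
  finally show ?thesis .
qed

lemma integrable_fejer: "integrable lborel fejer"
proof (rule Bochner_Integration.integrable_bound)
  have "set_integrable lborel (einterval (-\<infinity>) \<infinity>) (\<lambda>x. inverse (1 + x\<^sup>2))"
    by (rule integrable_inverse_1_plus_square)
  then show "integrable lborel (\<lambda>x. 8 * inverse (1 + x\<^sup>2 :: real))"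
    by (simp add: set_integrable_def)
  show "AE x in lborel. norm (fejer x) \<le> norm (8 * inverse (1 + x\<^sup>2))"
    using fejer_le_inverse fejer_nonneg by (auto intro!: AE_I2)
qed measurable

text \<open>A vanishing integral would make the kernel zero almost everywhere, but on [1,2] it is
  positive because cos x < 1 there. The exact value of the mass never enters.\<close>

lemma fejer_mass: "0 < (LINT x|lborel. fejer x)"
proof (rule ccontr)
  assume "\<not> ?thesis"
  moreover have "0 \<le> (LINT x|lborel. fejer x)" by (simp add: fejer_nonneg)
  ultimately have "(LINT x|lborel. fejer x) = 0" by linarith
  then have "AE x in lborel. fejer x = 0"
    using integral_nonneg_eq_0_iff_AE[OF integrable_fejer] fejer_nonneg by simp
  then have "AE x in lborel. x \<notin> {1..2::real}"
  proof (eventually_elim)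
    case (elim x)
    show ?case
    proof
      assume x: "x \<in> {1..2}"
      then have "cos x < 1"
        using cos_monotone_0_pi[of 0 x] pi_gt3 by auto
      with elim x show False by (simp add: fejer_eq)
    qed
  qed
  then have "emeasure lborel {x. \<not> x \<notin> {1..2::real}} = 0"
    by (subst AE_iff_measurable[symmetric, where M=lborel and P="\<lambda>x. x \<notin> {1..2::real}"]) auto
  also have "{x. \<not> x \<notin> {1..2::real}} = {1..2}" by auto
  finally show False by simp
qed

lemma integrable_indicator_Times:
  assumes "sigma_finite_measure N" "A \<in> sets M" "B \<in> sets N" "emeasure M A < \<infinity>" "emeasure N B < \<infinity>"
  shows "integrable (M \<Otimes>\<^sub>M N) (indicator (A \<times> B) :: _ \<Rightarrow> real)"
  using assms sigma_finite_measure.emeasure_pair_measure_Times[OF assms(1-3)]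
  by (intro integrable_real_indicator) (auto simp: ennreal_mult_less_top)

text \<open>Parseval's identity for the interval [b, a] against the Fejer kernel: writing the kernel
  as the transform of \<open>tent\<close> and exchanging integrals twice turns smoothed masses into
  an integral over characteristic functions. \<open>J\<close> is the Fourier transform of the
  interval; its finite length keeps every integrand absolutely integrable.\<close>

lemma smoothed_distribution_eq:
  assumes M: "real_distribution M" and T: "0 < T" and ab: "b \<le> a"
  defines "J \<equiv> \<lambda>t. LINT s|lborel. indicator {b..a} s *\<^sub>R iexp (-(t * T * s))"
  shows "(LINT v|lborel. fejer v * measure M {b + v/T..a + v/T}) = T * Re (LINT t|lborel. tent t *\<^sub>R (char M (t * T) * J t))"
    and "\<And>t. norm (J t) \<le> (a - b)" "J \<in> borel_measurable borel"
proof -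
  interpret real_distribution M by fact
  interpret P: pair_sigma_finite lborel M ..
  have [measurable]: "J \<in> borel_measurable borel"
    unfolding J_def by measurable
  then show "J \<in> borel_measurable borel" .
  have Jb: "norm (J t) \<le> a - b" for t
  proof -
    have "norm (J t) \<le> (LINT s|lborel. indicator {b..a} s)"
      unfolding J_def
    proof (rule Bochner_Integration.integral_norm_bound_integral)
      show int: "integrable lborel (indicator {b..a} :: real \<Rightarrow> real)"
        by (simp add: integrable_indicator_iff space_pair_measure emeasure_lborel_Icc_eq)
      show "integrable lborel (\<lambda>s. indicator {b..a} s *\<^sub>R iexp (-(t * T * s)))"
        by (rule Bochner_Integration.integrable_bound[OF int]) (auto simp: norm_mult)
    qed (simp add: norm_mult)
    then show ?thesis using ab by simp
  qed
  then show "\<And>t. norm (J t) \<le> (a - b)" .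
  have inner: "(LINT s|lborel. indicator {b..a} s * fejer (T * (x - s))) = Re (LINT t|lborel. tent t *\<^sub>R (iexp (t * T * x) * J t))" for x
  proof -
    have F: "fejer v = Re (LINT t|lborel. tent t *\<^sub>R iexp (t * v))" for v
    proof -
      have "Re (LINT t|lborel. tent t *\<^sub>R iexp (t * v)) = (LINT t|lborel. Re (tent t *\<^sub>R iexp (t * v)))"
        by (rule integral_Re[symmetric]) (rule integrable_tent_mult[of _ 1], auto)
      also have "\<dots> = fejer v" unfolding fejer_def by (simp add: Re_exp)
      finally show ?thesis by simp
    qed
    let ?f = "\<lambda>s t. (indicator {b..a} s * tent t) *\<^sub>R iexp (t * (T * (x - s)))"
    have int: "integrable (lborel \<Otimes>\<^sub>M lborel) (\<lambda>(s, t). ?f s t)"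
    proof (rule Bochner_Integration.integrable_bound)
      show "integrable (lborel \<Otimes>\<^sub>M lborel) (indicator ({b..a} \<times> {-1..1::real}) :: _ \<Rightarrow> real)"
        by (intro integrable_indicator_Times)
          (simp_all add: lborel.sigma_finite_measure_axioms emeasure_lborel_Icc_eq)
      show "AE st in lborel \<Otimes>\<^sub>M lborel. norm ((\<lambda>(s,t). ?f s t) st) \<le> norm (indicator ({b..a} \<times> {-1..1::real}) st :: real)"
        by (auto simp: tent_def indicator_def norm_mult intro!: AE_I2 split: if_splits)
    qed measurable
    have "(LINT s|lborel. indicator {b..a} s * fejer (T * (x - s))) = (LINT s|lborel. Re (LINT t|lborel. ?f s t))"
    proof (intro Bochner_Integration.integral_cong refl)
      fix s
      have "(LINT t|lborel. ?f s t) = (LINT t|lborel. indicator {b..a} s *\<^sub>R (tent t *\<^sub>R iexp (t * (T * (x - s)))))"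
        by (simp)
      also have "\<dots> = indicator {b..a} s *\<^sub>R (LINT t|lborel. (tent t *\<^sub>R iexp (t * (T * (x - s)))))"
        by (rule integral_scaleR_right)
      finally show "indicator {b..a} s * fejer (T * (x - s)) = Re (LINT t|lborel. ?f s t)"
        by (simp add: F)
    qed
    also have "\<dots> = Re (LINT s|lborel. (LINT t|lborel. ?f s t))"
      by (rule integral_Re) (use lborel_pair.integrable_fst[OF int] in simp)
    also have "(LINT s|lborel. (LINT t|lborel. ?f s t)) = (LINT t|lborel. (LINT s|lborel. ?f s t))"
      by (rule lborel_pair.Fubini_integral[OF int, symmetric])
    also have "\<dots> = (LINT t|lborel. tent t *\<^sub>R (iexp (t * T * x) * J t))"
    proof (intro Bochner_Integration.integral_cong refl)
      fix t
      have "(LINT s|lborel. ?f s t) = (LINT s|lborel. (tent t *\<^sub>R iexp (t * T * x)) * (indicator {b..a} s *\<^sub>R iexp (-(t * T * s))))"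
        by (intro Bochner_Integration.integral_cong refl) (simp add: algebra_simps exp_diff exp_minus scaleR_conv_of_real divide_inverse)
      also have "\<dots> = (tent t *\<^sub>R iexp (t * T * x)) * J t"
        unfolding J_def by (rule integral_mult_right_zero)
      finally show "(LINT s|lborel. ?f s t) = tent t *\<^sub>R (iexp (t * T * x) * J t)" by simp
    qed
    finally show ?thesis .
  qed
  \<comment> \<open>The substitution v = T * (x - s) turns the moving interval that has to contain x
    into the fixed interval [b, a] for s.\<close>
  have subst: "(LINT v|lborel. fejer v * indicator {b + v/T..a + v/T} x) = T * (LINT s|lborel. indicator {b..a} s * fejer (T * (x - s)))" for x
  proof -
    have "(LINT v|lborel. fejer v * indicator {b + v/T..a + v/T} x)
       = \<bar>- T\<bar> *\<^sub>R (LINT s|lborel. fejer (T * x + (- T) * s) * indicator {b + (T * x + (- T) * s)/T..a + (T * x + (- T) * s)/T} x)"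
      by (rule lborel_integral_real_affine) (use T in simp)
    also have "\<dots> = T * (LINT s|lborel. indicator {b..a} s * fejer (T * (x - s)))"
    proof -
      have *: "(T * x + (- T) * s)/T = x - s" for s using T by (simp add: field_simps)
      have "fejer (T * x + (- T) * s) * indicator {b + (T * x + (- T) * s)/T..a + (T * x + (- T) * s)/T} x
         = indicator {b..a} s * fejer (T * (x - s))" for s
        unfolding * by (auto simp: indicator_def right_diff_distrib)
      then show ?thesis using T by simp
    qed
    finally show ?thesis .
  qed
  let ?g = "\<lambda>v x. fejer v * indicator {b + v/T..a + v/T} x"
  have int: "integrable (lborel \<Otimes>\<^sub>M M) (\<lambda>(v, x). ?g v x)"
  proof (rule P.Fubini_integrable)
    show "integrable lborel (\<lambda>v. LINT x|M. norm (case (v, x) of (v, x) \<Rightarrow> ?g v x))"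
    proof (rule Bochner_Integration.integrable_bound[OF integrable_fejer])
      show "AE v in lborel. norm (LINT x|M. norm (case (v, x) of (v, x) \<Rightarrow> ?g v x)) \<le> norm (fejer v)"
      proof (rule AE_I2)
        fix v
        have "(LINT x|M. norm (?g v x)) = (LINT x|M. fejer v * indicator {b + v/T..a + v/T} x)"
          by (intro Bochner_Integration.integral_cong refl) (simp add: fejer_nonneg abs_mult)
        also have "\<dots> = fejer v * measure M {b + v/T..a + v/T}" by simp
        also have "\<dots> \<le> fejer v * 1" by (intro mult_left_mono prob_le_1 fejer_nonneg)
        finally show "norm (LINT x|M. norm (case (v, x) of (v, x) \<Rightarrow> ?g v x)) \<le> norm (fejer v)"
          by (simp add: fejer_nonneg abs_mult)
      qed
      have [measurable]: "(\<lambda>(v,x). indicator {b + v/T..a + v/T} x :: real) \<in> borel_measurable (borel \<Otimes>\<^sub>M borel)"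
      proof -
        have "(\<lambda>(v,x). indicator {b + v/T..a + v/T} x :: real) = (\<lambda>(v,x). if b + v/T \<le> x \<and> x \<le> a + v/T then 1 else 0)"
          by (auto simp: indicator_def fun_eq_iff)
        then show ?thesis by simp
      qed
      show "(\<lambda>v. LINT x|M. norm (case (v, x) of (v, x) \<Rightarrow> ?g v x)) \<in> borel_measurable lborel"
        by (simp, measurable)
    qed
    have "(\<lambda>(v,x). ?g v x) = (\<lambda>(v,x). if b + v/T \<le> x \<and> x \<le> a + v/T then fejer v else 0)"
      by (auto simp: indicator_def fun_eq_iff)
    then show "(\<lambda>(v, x). ?g v x) \<in> borel_measurable (lborel \<Otimes>\<^sub>M M)" by simp
    show "AE v in lborel. integrable M (\<lambda>x. case (v, x) of (v, x) \<Rightarrow> ?g v x)"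
      by (auto intro!: AE_I2 simp: emeasure_eq_measure)
  qed
  have intR: "integrable M (\<lambda>x. LINT t|lborel. tent t *\<^sub>R (iexp (t * T * x) * J t))" and
    intR2: "integrable (lborel \<Otimes>\<^sub>M M) (\<lambda>(t, x). tent t *\<^sub>R (iexp (t * T * x) * J t))"
  proof -
    show *: "integrable (lborel \<Otimes>\<^sub>M M) (\<lambda>(t, x). tent t *\<^sub>R (iexp (t * T * x) * J t))"
    proof (rule Bochner_Integration.integrable_bound)
      show "integrable (lborel \<Otimes>\<^sub>M M) (\<lambda>tx. (a - b) * indicator ({-1..1::real} \<times> (UNIV::real set)) tx)"
        by (intro integrable_mult_right integrable_indicator_Times)
          (simp_all add: sigma_finite_measure_axioms emeasure_lborel_Icc_eq less_top[symmetric])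
      show "AE tx in lborel \<Otimes>\<^sub>M M. norm ((\<lambda>(t,x). tent t *\<^sub>R (iexp (t * T * x) * J t)) tx)
         \<le> norm ((a - b) * indicator ({-1..1::real} \<times> (UNIV::real set)) tx)"
      proof (rule AE_I2, clarify)
        fix t x
        have "\<bar>tent t\<bar> * norm (J t) \<le> indicator {-1..1} t * (a - b)"
          using tent_bounds(3) Jb by (intro mult_mono) auto
        then show "norm (tent t *\<^sub>R (iexp (t * T * x) * J t)) \<le> norm ((a - b) * indicator ({-1..1::real} \<times> (UNIV::real set)) (t, x))"
          using ab by (cases "-1 \<le> t \<and> t \<le> 1") (auto simp: norm_mult indicator_def)
      qed
    qed measurable
    show "integrable M (\<lambda>x. LINT t|lborel. tent t *\<^sub>R (iexp (t * T * x) * J t))"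
      using P.integrable_snd[OF *] by simp
  qed
  have "(LINT v|lborel. fejer v * measure M {b + v/T..a + v/T}) = (LINT v|lborel. (LINT x|M. ?g v x))"
    by simp
  also have "\<dots> = (LINT x|M. (LINT v|lborel. ?g v x))"
    by (rule P.Fubini_integral[OF int, symmetric])
  also have "\<dots> = (LINT x|M. T * Re (LINT t|lborel. tent t *\<^sub>R (iexp (t * T * x) * J t)))"
    by (simp add: subst inner)
  also have "\<dots> = T * Re (LINT x|M. LINT t|lborel. tent t *\<^sub>R (iexp (t * T * x) * J t))"
    using integral_Re[OF intR] by simp
  also have "(LINT x|M. LINT t|lborel. tent t *\<^sub>R (iexp (t * T * x) * J t)) = (LINT t|lborel. LINT x|M. tent t *\<^sub>R (iexp (t * T * x) * J t))"
    by (rule P.Fubini_integral[OF intR2])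
  also have "\<dots> = (LINT t|lborel. tent t *\<^sub>R (char M (t * T) * J t))"
  proof (intro Bochner_Integration.integral_cong refl)
    fix t
    show "(LINT x|M. tent t *\<^sub>R (iexp (t * T * x) * J t)) = tent t *\<^sub>R (char M (t * T) * J t)"
      unfolding char_def by (simp add: scaleR_conv_of_real mult.assoc)
  qed
  finally show "(LINT v|lborel. fejer v * measure M {b + v/T..a + v/T}) = T * Re (LINT t|lborel. tent t *\<^sub>R (char M (t * T) * J t))" .
qed

text \<open>Unlike the trivial bound a - b, this one does not see the length of the interval, which
  later allows b to tend to minus infinity.\<close>

lemma norm_integral_iexp_interval:
  fixes a b w :: real
  assumes "b \<le> a" "w \<noteq> 0"
  shows "norm (LINT s|lborel. indicator {b..a} s *\<^sub>R iexp (-(w * s))) \<le> 2 / \<bar>w\<bar>"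
proof -
  let ?F = "\<lambda>s::real. iexp (-(w * s)) * (\<i> / w)"
  have "(LINT s|lborel. indicator {b..a} s *\<^sub>R iexp (-(w * s))) = ?F a - ?F b"
  proof (rule integral_FTC_Icc)
    show "(?F has_vector_derivative iexp (-(w * x))) (at x within {b..a})" for x
      using assms by (auto intro!: derivative_eq_intros has_vector_derivative_real_field simp: field_simps)
    show "continuous_on {b..a} (\<lambda>x. iexp (- (w * x)))" by (intro continuous_intros)
  qed fact
  also have "norm \<dots> \<le> norm (?F a) + norm (?F b)" by (rule norm_triangle_ineq4)
  also have "\<dots> = 2 / \<bar>w\<bar>" by (simp add: norm_mult norm_divide del: of_real_minus of_real_mult)
  finally show ?thesis .
qed

text \<open>What remains of |t|^3 exp (- t^2 / 4) once the transform of an interval, of size at most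
  2 / |t|, has removed one power of t.\<close>

definition gauss_const :: real where
  "gauss_const = (LINT t|lborel. t\<^sup>2 * exp (- t\<^sup>2 / 4))"

lemma integrable_gauss_const: "integrable lborel (\<lambda>t::real. t\<^sup>2 * exp (- t\<^sup>2 / 4))"
proof -
  have "integrable lborel (\<lambda>x. normal_density 0 (sqrt 2) x * (x - 0) ^ 2)"
    by (rule integrable_normal_moment) simp
  then have "integrable lborel (\<lambda>x::real. sqrt (4 * pi) * (normal_density 0 (sqrt 2) x * x ^ 2))" by simp
  moreover have "sqrt (4 * pi) * (normal_density 0 (sqrt 2) x * x ^ 2) = x\<^sup>2 * exp (- x\<^sup>2 / 4)" for x :: real
    by (simp add: normal_density_def field_simps)
  ultimately show ?thesis by simp
qed

lemma (in real_distribution) measurable_cdf: "cdf M \<in> borel_measurable borel"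
  by (rule borel_measurable_mono) (auto simp: mono_def cdf_nondecreasing)

lemma (in real_distribution) measurable_measure_moving_interval:
  "(\<lambda>v. measure M {b + v/T..a + v/T}) \<in> borel_measurable borel"
proof -
    have "(\<lambda>v. measure M {b + v/T..a + v/T}) = (\<lambda>v. (LINT x|M. (if b + v/T \<le> x \<and> x \<le> a + v/T then 1 else 0)))"
    proof
      fix v
      have "(LINT x|M. (if b + v/T \<le> x \<and> x \<le> a + v/T then 1 else 0)) = (LINT x|M. indicat_real {b + v/T..a + v/T} x)"
        by (intro Bochner_Integration.integral_cong) (auto simp: indicator_def)
      then show "measure M {b + v/T..a + v/T} = (LINT x|M. (if b + v/T \<le> x \<and> x \<le> a + v/T then 1 else 0))"
        by simp
    qed
  then show ?thesis by simp
qed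

text \<open>On finite intervals Parseval compares the two laws through the difference of their
  characteristic functions, and the resulting bound is free of T and of the left endpoint. Dominated
  convergence then sends that endpoint to minus infinity.\<close>

lemma smoothed_cdf_diff_le:
  assumes M: "real_distribution M" and T: "0 < T" and B: "0 \<le> B"
    and char: "\<And>t. \<bar>t\<bar> \<le> T \<Longrightarrow> norm (char M t - char std_normal_distribution t) \<le> B * \<bar>t\<bar> ^ 3 * exp (- t\<^sup>2 / 4)"
  shows "\<bar>LINT v|lborel. fejer v * (cdf M (a + v/T) - Phi (a + v/T))\<bar> \<le> 2 * B * gauss_const"
proof -
  let ?N = std_normal_distribution
  interpret M: real_distribution M by fact
  interpret N: real_distribution ?N by (rule real_dist_normal_dist)
  define J where "J b t = (LINT s|lborel. indicator {b..a} s *\<^sub>R iexp (-(t * T * s)))" for b t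
  let ?D = "\<lambda>t. char M t - char ?N t"
  have fin: "\<bar>LINT v|lborel. fejer v * (measure M {b + v/T..a + v/T} - measure ?N {b + v/T..a + v/T})\<bar> \<le> 2 * B * gauss_const"
    if ba: "b \<le> a" for b
  proof -
    note S = smoothed_distribution_eq[OF M T ba, folded J_def]
    note SN = smoothed_distribution_eq[OF real_dist_normal_dist T ba, folded J_def]
    have [measurable]: "J b \<in> borel_measurable borel" by (rule S(3))
    have I: "integrable lborel (\<lambda>t. tent t *\<^sub>R (char L (t * T) * J b t))" if "real_distribution L" for L
    proof (rule integrable_tent_mult)
      interpret L: real_distribution L by fact
      show "(\<lambda>t. char L (t * T) * J b t) \<in> borel_measurable borel" by measurable
      show "norm (char L (t * T) * J b t) \<le> 1 * (a - b)" for t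
        unfolding norm_mult by (intro mult_mono L.cmod_char_le_1 S(2)) (use ba in auto)
    qed
    have meas: "(\<lambda>v. fejer v * measure L {b + v/T..a + v/T}) \<in> borel_measurable borel"
      "integrable lborel (\<lambda>v. fejer v * measure L {b + v/T..a + v/T})" if "real_distribution L" for L
    proof -
      interpret L: real_distribution L by fact
      note [measurable] = L.measurable_measure_moving_interval
      show m: "(\<lambda>v. fejer v * measure L {b + v/T..a + v/T}) \<in> borel_measurable borel" by measurable
      show "integrable lborel (\<lambda>v. fejer v * measure L {b + v/T..a + v/T})"
        by (rule Bochner_Integration.integrable_bound[OF integrable_fejer])
          (use m in \<open>auto simp: fejer_nonneg abs_mult intro!: mult_left_le\<close>)
    qed
    have "(LINT v|lborel. fejer v * (measure M {b + v/T..a + v/T} - measure ?N {b + v/T..a + v/T}))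
       = (LINT v|lborel. fejer v * measure M {b + v/T..a + v/T}) - (LINT v|lborel. fejer v * measure ?N {b + v/T..a + v/T})"
      unfolding right_diff_distrib
      by (intro Bochner_Integration.integral_diff meas M real_dist_normal_dist)
    also have "\<dots> = T * Re ((LINT t|lborel. tent t *\<^sub>R (char M (t * T) * J b t)) - (LINT t|lborel. tent t *\<^sub>R (char ?N (t * T) * J b t)))"
      unfolding S(1) SN(1) by (simp add: right_diff_distrib)
    also have "(LINT t|lborel. tent t *\<^sub>R (char M (t * T) * J b t)) - (LINT t|lborel. tent t *\<^sub>R (char ?N (t * T) * J b t))
        = (LINT t|lborel. tent t *\<^sub>R (?D (t * T) * J b t))"
      by (subst Bochner_Integration.integral_diff[OF I[OF M] I[OF real_dist_normal_dist], symmetric])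
         (simp add: algebra_simps)
    finally have eq: "(LINT v|lborel. fejer v * (measure M {b + v/T..a + v/T} - measure ?N {b + v/T..a + v/T}))
      = T * Re (LINT t|lborel. tent t *\<^sub>R (?D (t * T) * J b t))" .
    have "norm (LINT t|lborel. tent t *\<^sub>R (?D (t * T) * J b t)) \<le> (LINT t|lborel. 2 * B * ((0 + T * t)\<^sup>2 * exp (- (0 + T * t)\<^sup>2 / 4)))"
    proof (rule Bochner_Integration.integral_norm_bound_integral)
      have "integrable lborel (\<lambda>t. tent t *\<^sub>R (char M (t * T) * J b t) - tent t *\<^sub>R (char ?N (t * T) * J b t))"
        by (intro Bochner_Integration.integrable_diff I M real_dist_normal_dist)
      then show "integrable lborel (\<lambda>t. tent t *\<^sub>R (?D (t * T) * J b t))" by (simp add: algebra_simps)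
      show "integrable lborel (\<lambda>t. 2 * B * ((0 + T * t)\<^sup>2 * exp (- (0 + T * t)\<^sup>2 / 4)))"
        by (intro integrable_mult_right lborel_integrable_real_affine[OF integrable_gauss_const]) (use T in simp)
      fix t :: real
      show "norm (tent t *\<^sub>R (?D (t * T) * J b t)) \<le> 2 * B * ((0 + T * t)\<^sup>2 * exp (- (0 + T * t)\<^sup>2 / 4))"
      proof (cases "\<bar>t\<bar> \<le> 1 \<and> t \<noteq> 0")
        case True
        then have tT: "\<bar>t * T\<bar> \<le> T" using T by (simp add: abs_mult)
        have w: "t * T \<noteq> 0" using True T by simp
        have "norm (tent t *\<^sub>R (?D (t * T) * J b t)) \<le> 1 * (norm (?D (t * T)) * norm (J b t))"
          unfolding norm_scaleR norm_mult by (intro mult_right_mono) (auto simp: tent_def)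
        also have "\<dots> \<le> 1 * ((B * \<bar>t * T\<bar> ^ 3 * exp (- (t * T)\<^sup>2 / 4)) * (2 / \<bar>t * T\<bar>))"
          using char[OF tT] norm_integral_iexp_interval[OF ba w] B
          by (intro mult_left_mono mult_mono) (auto simp: J_def)
        also have "\<dots> = 2 * B * ((0 + T * t)\<^sup>2 * exp (- (0 + T * t)\<^sup>2 / 4))"
          using w by (simp add: power2_eq_square power3_eq_cube field_simps abs_mult)
        finally show ?thesis .
      next
        \<comment> \<open>Outside [-1,1] the triangle vanishes, and at t = 0 both characteristic
          functions are 1; the quotient by |t| is formed only where it makes sense.\<close>
        case False
        moreover have "?D 0 = 0" by (simp add: M.char_zero N.char_zero)
        ultimately have "tent t *\<^sub>R (?D (t * T) * J b t) = 0" by (auto simp: tent_def)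
        then show ?thesis using B by (simp only: norm_zero) simp
      qed
    qed
    also have "\<dots> = 2 * B * (gauss_const / T)"
    proof -
      have "gauss_const = \<bar>T\<bar> *\<^sub>R (LINT t|lborel. ((0 + T * t)\<^sup>2 * exp (- (0 + T * t)\<^sup>2 / 4)))"
        unfolding gauss_const_def by (rule lborel_integral_real_affine) (use T in simp)
      then show ?thesis using T by (simp add: field_simps)
    qed
    finally have "T * norm (LINT t|lborel. tent t *\<^sub>R (?D (t * T) * J b t)) \<le> 2 * B * gauss_const"
      using T by (simp add: field_simps)
    moreover have "\<bar>T * Re (LINT t|lborel. tent t *\<^sub>R (?D (t * T) * J b t))\<bar> \<le> T * norm (LINT t|lborel. tent t *\<^sub>R (?D (t * T) * J b t))"
      using T by (simp add: abs_mult abs_Re_le_cmod)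
    ultimately show ?thesis unfolding eq by linarith
  qed
  have conv: "(\<lambda>n. measure L {- real n + x..y}) \<longlonglongrightarrow> cdf L y" if "real_distribution L" for L x y
  proof -
    interpret L: real_distribution L by fact
    have "(\<lambda>n. measure L {- real n + x..y}) \<longlonglongrightarrow> measure L (\<Union>n. {- real n + x..y})"
      by (rule L.finite_Lim_measure_incseq) (auto simp: incseq_def)
    also have "(\<Union>n. {- real n + x..y}) = {..y}"
    proof -
      have "\<exists>n. - real n + x \<le> z" for z
        using real_arch_simple[of "x - z"] by (auto simp: algebra_simps)
      then show ?thesis by auto
    qed
    finally show ?thesis by (simp add: cdf_def)
  qed
  have lim: "(\<lambda>n. LINT v|lborel. fejer v * (measure M {- real n + v/T..a + v/T} - measure ?N {- real n + v/T..a + v/T}))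
     \<longlonglongrightarrow> (LINT v|lborel. fejer v * (cdf M (a + v/T) - cdf ?N (a + v/T)))"
  proof (rule integral_dominated_convergence)
    show "integrable lborel (\<lambda>v. fejer v * 1)" using integrable_fejer by simp
    note [measurable] = M.measurable_measure_moving_interval N.measurable_measure_moving_interval
      M.measurable_cdf N.measurable_cdf
    show "(\<lambda>v. fejer v * (cdf M (a + v/T) - cdf ?N (a + v/T))) \<in> borel_measurable lborel"
      by measurable
    show "(\<lambda>v. fejer v * (measure M {- real n + v/T..a + v/T} - measure ?N {- real n + v/T..a + v/T})) \<in> borel_measurable lborel" for n
      by measurable
    show "AE v in lborel. (\<lambda>n. fejer v * (measure M {- real n + v/T..a + v/T} - measure ?N {- real n + v/T..a + v/T}))
       \<longlonglongrightarrow> fejer v * (cdf M (a + v/T) - cdf ?N (a + v/T))"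
      by (intro AE_I2 tendsto_intros conv M real_dist_normal_dist)
    show "AE v in lborel. norm (fejer v * (measure M {- real n + v/T..a + v/T} - measure ?N {- real n + v/T..a + v/T})) \<le> fejer v * 1" for n
    proof (rule AE_I2)
      fix v
      have "\<bar>measure M {- real n + v/T..a + v/T} - measure ?N {- real n + v/T..a + v/T}\<bar> \<le> 1"
        using M.prob_le_1[of "{- real n + v/T..a + v/T}"] N.prob_le_1[of "{- real n + v/T..a + v/T}"]
         measure_nonneg[of M "{- real n + v/T..a + v/T}"] measure_nonneg[of ?N "{- real n + v/T..a + v/T}"] by argo
      then show "norm (fejer v * (measure M {- real n + v/T..a + v/T} - measure ?N {- real n + v/T..a + v/T})) \<le> fejer v * 1"
        using fejer_nonneg[of v] by (simp add: abs_mult mult_left_le)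
    qed
  qed
  have ev: "eventually (\<lambda>n. - real n \<le> a) sequentially"
    by real_asymp
  have "\<bar>LINT v|lborel. fejer v * (cdf M (a + v/T) - cdf ?N (a + v/T))\<bar> \<le> 2 * B * gauss_const"
    by (rule tendsto_upperbound[OF tendsto_rabs[OF lim] eventually_mono[OF ev]]) (rule fin, simp_all)
  then show ?thesis by (simp add: Phi_def)
qed

text \<open>The density is at most 1 / sqrt (2 pi) < 1, so 1 serves as a Lipschitz constant.\<close>

lemma Phi_increment_le: "Phi (x + h) - Phi x \<le> h" if "0 \<le> h"
proof -
  interpret N: real_distribution std_normal_distribution by (rule real_dist_normal_dist)
  have "Phi (x + h) - Phi x = measure std_normal_distribution {x<..x + h}"
    unfolding Phi_def using N.cdf_diff_eq[of x "x + h"] that by (cases "h = 0") auto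
  also have "\<dots> \<le> measure lborel {x<..x + h}"
  proof -
    have d: "std_normal_density y \<le> 1" for y
    proof -
      have "1 \<le> sqrt (2 * pi)" using pi_gt3 by simp
      then show ?thesis by (auto simp: std_normal_density_def field_simps intro: order_trans[of _ 1])
    qed
    have "emeasure std_normal_distribution {x<..x + h} = (\<integral>\<^sup>+ y. ennreal (std_normal_density y) * indicator {x<..x + h} y \<partial>lborel)"
      by (rule emeasure_density) auto
    also have "\<dots> \<le> (\<integral>\<^sup>+ y. indicator {x<..x + h} y \<partial>lborel)"
      by (rule nn_integral_mono) (auto simp: indicator_def d)
    also have "\<dots> = ennreal h" using that by simp
    finally show ?thesis using that by (simp add: measure_def enn2real_leI)
  qed
  finally show ?thesis using that by simp
qed

text \<open>A large deviation at one point persists on one side of it over a window of length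
  proportional to 1/T, since one distribution function is monotone and the other Lipschitz. With the
  kernel centred in that window, most of its mass sees the deviation, while the remaining mass is
  weighted by the supremum itself and can be absorbed.\<close>

lemma Esseen_smoothing:
  "\<exists>C0>0. \<forall>M T B x. real_distribution M \<longrightarrow> 0 < T \<longrightarrow> 0 \<le> B \<longrightarrow>
    (\<forall>t. \<bar>t\<bar> \<le> T \<longrightarrow> norm (char M t - char std_normal_distribution t) \<le> B * \<bar>t\<bar> ^ 3 * exp (- t\<^sup>2 / 4)) \<longrightarrow>
    \<bar>cdf M x - Phi x\<bar> \<le> C0 * (B + 1 / T)"
proof -
  define c where "c = (LINT v|lborel. fejer v)"
  have c: "0 < c" unfolding c_def by (rule fejer_mass)
  have "(\<lambda>n. LINT v|lborel. fejer v * indicator {- real n..real n} v) \<longlonglongrightarrow> (LINT v|lborel. fejer v)"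
  proof (rule integral_dominated_convergence[OF _ _ integrable_fejer])
    show "AE v in lborel. (\<lambda>n. fejer v * indicator {- real n..real n} v) \<longlonglongrightarrow> fejer v"
    proof (rule AE_I2)
      fix v :: real
      have "eventually (\<lambda>n. \<bar>v\<bar> \<le> real n) sequentially" by real_asymp
      then have "eventually (\<lambda>n. fejer v * indicator {- real n..real n} v = fejer v) sequentially"
        by eventually_elim (auto simp: indicator_def abs_le_iff)
      then show "(\<lambda>n. fejer v * indicator {- real n..real n} v) \<longlonglongrightarrow> fejer v"
        by (rule tendsto_eventually)
    qed
  qed (auto simp: fejer_nonneg indicator_def abs_mult)
  \<comment> \<open>Any fraction above 1/2 would do; 3/4 leaves a coefficient
    \<open>2 * cY - c > c / 2\<close> in front of the supremum.\<close>
  then have "eventually (\<lambda>n. (LINT v|lborel. fejer v * indicator {- real n..real n} v) > 3/4 * c) sequentially"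
    by (rule order_tendstoD) (use c in \<open>simp add: c_def\<close>)
  then obtain n where n: "(LINT v|lborel. fejer v * indicator {- real n..real n} v) > 3/4 * c"
    by (auto simp: eventually_sequentially)
  define Y where "Y = real n"
  define cY where "cY = (LINT v|lborel. fejer v * indicator {- Y..Y} v)"
  have cY: "3/4 * c < cY" using n by (simp add: cY_def Y_def)
  have iY: "integrable lborel (\<lambda>v. fejer v * indicator {- Y..Y} v)"
    by (rule Bochner_Integration.integrable_bound[OF integrable_fejer]) (auto simp: indicator_def)
  have cYc: "cY \<le> c" unfolding cY_def c_def
    by (rule Bochner_Integration.integral_mono[OF iY integrable_fejer]) (auto simp: indicator_def fejer_nonneg)
  have Y0: "0 \<le> Y" by (simp add: Y_def)
  have g0: "0 \<le> gauss_const" unfolding gauss_const_def by (rule Bochner_Integration.integral_nonneg) simp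
  \<comment> \<open>Solving the final inequality for \<open>S\<close> gives
    \<open>4 / c * gauss_const\<close> in front of B and \<open>4 * Y\<close> in front of 1/T; the
    summand 1 makes the constant positive.\<close>
  define C0 where "C0 = 4 / c * gauss_const + 4 * Y + 1"
  have "C0 > 0" using c g0 Y0 by (auto simp: C0_def intro!: add_nonneg_pos add_nonneg_nonneg)
  moreover have "\<bar>cdf M x - Phi x\<bar> \<le> C0 * (B + 1 / T)"
    if M: "real_distribution M" and T: "0 < T" and B: "0 \<le> B"
      and char: "\<And>t. \<bar>t\<bar> \<le> T \<Longrightarrow> norm (char M t - char std_normal_distribution t) \<le> B * \<bar>t\<bar> ^ 3 * exp (- t\<^sup>2 / 4)"
    for M T B x
  proof -
    interpret M: real_distribution M by fact
    interpret N: real_distribution std_normal_distribution by (rule real_dist_normal_dist)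
    define G where "G x = cdf M x - Phi x" for x
    have G1: "\<bar>G x\<bar> \<le> 1" for x
      using M.cdf_bounded_prob[of x] N.cdf_bounded_prob[of x] M.cdf_nonneg[of x] N.cdf_nonneg[of x]
      by (auto simp: G_def Phi_def)
    define S where "S = (SUP x. \<bar>G x\<bar>)"
    have bdd: "bdd_above (range (\<lambda>x. \<bar>G x\<bar>))" using G1 by (auto intro!: bdd_aboveI[of _ 1])
    have GS: "\<bar>G x\<bar> \<le> S" for x unfolding S_def by (rule cSUP_upper[OF _ bdd]) simp
    note [measurable] = M.measurable_cdf N.measurable_cdf
    have Gm[measurable]: "G \<in> borel_measurable borel"
      unfolding G_def[abs_def] Phi_def[abs_def] by measurable
    have main: "\<bar>LINT v|lborel. fejer v * G (a + v/T)\<bar> \<le> 2 * B * gauss_const" for a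
      unfolding G_def by (rule smoothed_cdf_diff_le[OF M T B char])
    have iG: "integrable lborel (\<lambda>v. fejer v * G (a + v/T))" for a
      by (rule Bochner_Integration.integrable_bound[OF integrable_fejer])
         (use G1 in \<open>auto simp: fejer_nonneg abs_mult intro!: mult_left_le\<close>)
    have step: "\<bar>G x\<bar> * cY \<le> 2 * B * gauss_const + 2 * Y / T * cY + (c - cY) * S" for x
    proof -
      have one: "sg * G x * cY \<le> 2 * B * gauss_const + 2 * Y / T * cY + (c - cY) * S" if sg: "sg = 1 \<or> sg = -1" for sg :: real
      proof -
        \<comment> \<open>The window lies to the right of x for a positive deviation and to the left
          for a negative one, the direction in which monotonicity of \<open>cdf M\<close>
          helps.\<close>
        let ?a = "x + sg * (Y / T)"
        have low: "fejer v * indicator {-Y..Y} v * (sg * G x - 2 * Y / T) + (fejer v - fejer v * indicator {-Y..Y} v) * (- S) \<le> sg * (fejer v * G (?a + v/T))" for v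
        proof (cases "v \<in> {-Y..Y}")
          case True
          have r: "- (Y/T) \<le> v/T" "v/T \<le> Y/T" using True T divide_right_mono[of "-Y" v T] divide_right_mono[of v Y T] by simp_all
          have "sg * G x - 2 * Y / T \<le> sg * G (?a + v/T)"
          proof (cases "sg = 1")
            case s: True
            have "cdf M x \<le> cdf M (x + (Y/T + v/T))" using r by (intro M.cdf_nondecreasing) simp
            moreover have "Phi (x + (Y/T + v/T)) - Phi x \<le> Y/T + v/T" using r by (intro Phi_increment_le) simp
            ultimately show ?thesis using s r by (simp add: G_def add.assoc)
          next
            case s: False
            then have s: "sg = -1" using sg by simp
            have "cdf M (x - (Y/T - v/T)) \<le> cdf M x" using r by (intro M.cdf_nondecreasing) simp
            moreover have "Phi ((x - (Y/T - v/T)) + (Y/T - v/T)) - Phi (x - (Y/T - v/T)) \<le> Y/T - v/T"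
              using r by (intro Phi_increment_le) simp
            moreover have "?a + v/T = x - (Y/T - v/T)" using s by simp
            ultimately show ?thesis using s r unfolding G_def by (simp add: algebra_simps)
          qed
          from mult_left_mono[OF this fejer_nonneg[of v]] show ?thesis using True by (simp add: algebra_simps)
        next
          case False
          have "- S \<le> sg * G (?a + v/T)" using GS[of "?a + v/T"] sg by (auto simp: abs_le_iff)
          from mult_left_mono[OF this fejer_nonneg[of v]] show ?thesis using False by (simp add: algebra_simps)
        qed
        have "cY * (sg * G x - 2 * Y / T) + (c - cY) * (- S)
           = (LINT v|lborel. fejer v * indicator {-Y..Y} v * (sg * G x - 2 * Y / T) + (fejer v - fejer v * indicator {-Y..Y} v) * (- S))"
          using iY integrable_fejer
          by (subst Bochner_Integration.integral_add) (auto simp: c_def cY_def Bochner_Integration.integral_diff)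
        also have "\<dots> \<le> (LINT v|lborel. sg * (fejer v * G (?a + v/T)))"
        proof (rule Bochner_Integration.integral_mono)
          show "integrable lborel (\<lambda>v. fejer v * indicator {-Y..Y} v * (sg * G x - 2 * Y / T) + (fejer v - fejer v * indicator {-Y..Y} v) * (- S))"
            using iY integrable_fejer by (intro Bochner_Integration.integrable_add integrable_mult_left Bochner_Integration.integrable_diff)
          show "integrable lborel (\<lambda>v. sg * (fejer v * G (?a + v/T)))" using iG by (intro integrable_mult_right)
        qed (rule low)
        also have "\<dots> = sg * (LINT v|lborel. fejer v * G (?a + v/T))" by simp
        also have "\<dots> \<le> 2 * B * gauss_const" using main[of ?a] sg by auto
        finally show ?thesis by (simp add: algebra_simps)
      qed
      from one[of 1] one[of "-1"] show ?thesis by (cases "G x \<ge> 0") auto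
    qed
    have cY0: "0 < cY" using c cY by simp
    have S0: "0 \<le> S" using GS[of 0] by linarith
    have "\<bar>G x\<bar> \<le> (2 * B * gauss_const + 2 * Y / T * cY + (c - cY) * S) / cY" for x
      using step[of x] cY0 by (simp add: field_simps)
    then have "S \<le> (2 * B * gauss_const + 2 * Y / T * cY + (c - cY) * S) / cY"
      unfolding S_def by (intro cSUP_least) auto
    then have "S * cY \<le> 2 * B * gauss_const + 2 * Y / T * cY + (c - cY) * S"
      using cY0 by (simp add: field_simps)
    \<comment> \<open>Here the tail contribution \<open>(c - cY) * S\<close> moves to the left
      side.\<close>
    then have "S * (2 * cY - c) \<le> 2 * B * gauss_const + 2 * Y / T * cY" by (simp add: algebra_simps)
    moreover have "S * (c / 2) \<le> S * (2 * cY - c)" using cY S0 by (intro mult_left_mono) auto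
    moreover have "2 * Y / T * cY \<le> 2 * Y / T * c" using cYc Y0 T by (intro mult_left_mono) auto
    ultimately have "S * (c / 2) \<le> 2 * B * gauss_const + 2 * Y / T * c" by linarith
    then have "S \<le> 4 / c * gauss_const * B + 4 * Y * (1 / T)" using c by (simp add: field_simps)
    also have "\<dots> \<le> C0 * B + C0 * (1 / T)"
      using B T c g0 Y0 by (intro add_mono mult_right_mono) (auto simp: C0_def)
    finally show ?thesis using GS[of x] by (simp add: G_def distrib_left)
  qed
  ultimately show ?thesis by blast
qed

section \<open>Berry--Esseen bounds from zero-free moment generating functions\<close>

text \<open>Borel--Caratheodory on half the radius: f / (2A - f) takes the half plane Re < A into
  the unit disc and fixes 0, so Schwarz's lemma bounds it by 1/2 for |z| \<le> r/2; inverting the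
  map gives 2A.\<close>

lemma norm_le_of_Re_less:
  assumes hol: "f holomorphic_on ball 0 r" and f0: "f 0 = 0" and r: "0 < r"
    and Re: "\<And>z. norm z < r \<Longrightarrow> Re (f z) < A" and z: "norm z \<le> r / 2"
  shows "norm (f z) \<le> 2 * A"
proof -
  have A: "0 < A" using Re[of 0] r f0 by simp
  define g where "g w = f (of_real r * w) / (of_real (2 * A) - f (of_real r * w))" for w
  have in_ball: "norm (of_real r * w) < r" if "norm w < 1" for w :: complex
    using that r by (simp add: norm_mult)
  have nz: "of_real (2 * A) - f (of_real r * w) \<noteq> 0" if "norm w < 1" for w
  proof
    assume "of_real (2 * A) - f (of_real r * w) = 0"
    then have "Re (f (of_real r * w)) = 2 * A" by (metis Re_complex_of_real eq_iff_diff_eq_0)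
    with Re[OF in_ball[OF that]] A show False by simp
  qed
  have less: "norm (f (of_real r * w)) < norm (of_real (2 * A) - f (of_real r * w))" if "norm w < 1" for w
  proof -
    let ?u = "f (of_real r * w)"
    have "(norm ?u)\<^sup>2 < (norm (of_real (2 * A) - ?u))\<^sup>2"
    proof -
      have "A * Re ?u < A * A" using Re[OF in_ball[OF that]] A by simp
      then show ?thesis unfolding cmod_power2 by (simp add: power2_eq_square algebra_simps)
    qed
    then show ?thesis by (rule power2_less_imp_less) simp
  qed
  have holg: "g holomorphic_on ball 0 1"
    unfolding g_def
  proof (intro holomorphic_intros)
    have "(\<lambda>w. f (of_real r * w)) = f \<circ> (\<lambda>w. of_real r * w)" by (simp add: fun_eq_iff)
    moreover have "(f \<circ> (\<lambda>w. of_real r * w)) holomorphic_on ball 0 1"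
      by (rule holomorphic_on_compose_gen[OF _ hol]) (use in_ball in \<open>auto intro!: holomorphic_intros\<close>)
    ultimately show "(\<lambda>w. f (of_real r * w)) holomorphic_on ball 0 1" "(\<lambda>w. f (of_real r * w)) holomorphic_on ball 0 1" by simp_all
  qed (use nz in auto)
  define w where "w = z / of_real r"
  have zw: "z = of_real r * w" using r by (simp add: w_def)
  have w: "norm w \<le> 1/2" using z r by (simp add: w_def norm_divide field_simps)
  have "norm (g w) \<le> norm w"
    using Schwarz_Lemma(1)[OF holg, of w] less nz w f0 by (auto simp: g_def norm_divide)
  with w have g: "norm (g w) \<le> 1/2" by simp
  have eq: "f z * (1 + g w) = of_real (2 * A) * g w"
    using nz[of w] w by (simp add: g_def zw field_simps)
  have "norm (f z) * (1 / 2) \<le> norm (f z) * norm (1 + g w)"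
  proof (intro mult_left_mono)
    have "1 \<le> norm (1 + g w) + norm (g w)" using norm_triangle_ineq4[of "1 + g w" "g w"] by simp
    then show "1/2 \<le> norm (1 + g w)" using g by simp
  qed simp
  also have "\<dots> = 2 * A * norm (g w)" using arg_cong[OF eq, of norm] A by (simp add: norm_mult)
  also have "\<dots> \<le> 2 * A * (1/2)" using g A by (intro mult_left_mono) auto
  finally show ?thesis by simp
qed

text \<open>Cauchy's inequality bounds the n-th Taylor coefficient by M / \<rho>^n; the tail from
  order three is dominated by a geometric series of ratio at most 1/2, whence the factor 2.\<close>

lemma third_order_remainder:
  assumes hol: "f holomorphic_on ball 0 r" and \<rho>: "0 < \<rho>" "\<rho> < r"
    and M: "\<And>z. norm z \<le> \<rho> \<Longrightarrow> norm (f z) \<le> M" and z: "norm z \<le> \<rho> / 2"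
  shows "norm (f z - (f 0 + deriv f 0 * z + (deriv ^^ 2) f 0 / 2 * z\<^sup>2)) \<le> 2 * M * (norm z / \<rho>) ^ 3"
proof -
  have M0: "0 \<le> M" using M[of 0] \<rho> order_trans[OF norm_ge_zero, of "f 0" M] by simp
  let ?c = "\<lambda>n. (deriv ^^ n) f 0 / fact n"
  let ?q = "norm z / \<rho>"
  have q: "0 \<le> ?q" "?q \<le> 1/2" "norm ?q < 1" "?q < 1" using z \<rho> by (auto simp: field_simps)
  have sums: "(\<lambda>n. ?c n * z ^ n) sums f z"
    using holomorphic_power_series[OF hol, of z] z \<rho> by simp
  have coeff: "norm (?c n) \<le> M / \<rho> ^ n" for n
  proof -
    have "norm ((deriv ^^ n) f 0) \<le> fact n * M / \<rho> ^ n"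
    proof (rule Cauchy_inequality)
      show "f holomorphic_on ball 0 \<rho>" using hol by (rule holomorphic_on_subset) (use \<rho> in auto)
      show "continuous_on (cball 0 \<rho>) f"
        using holomorphic_on_imp_continuous_on[OF hol] by (rule continuous_on_subset) (use \<rho> in auto)
    qed (use \<rho> M in auto)
    then show ?thesis by (simp add: norm_divide field_simps)
  qed
  have b: "norm (?c (n + 3) * z ^ (n + 3)) \<le> M * ?q ^ 3 * ?q ^ n" for n
  proof -
    have "norm (?c (n + 3) * z ^ (n + 3)) \<le> M / \<rho> ^ (n + 3) * norm z ^ (n + 3)"
      unfolding norm_mult norm_power by (intro mult_right_mono coeff) simp
    also have "\<dots> = M * ?q ^ 3 * ?q ^ n" by (simp add: power_divide power_add field_simps)
    finally show ?thesis .
  qed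
  have "(\<lambda>n. ?c (n + 3) * z ^ (n + 3)) sums (f z - (\<Sum>i<3. ?c i * z ^ i))"
    using sums_split_initial_segment[OF sums, of 3] .
  then have eq: "(\<Sum>n. ?c (n + 3) * z ^ (n + 3)) = f z - (f 0 + deriv f 0 * z + (deriv ^^ 2) f 0 / 2 * z\<^sup>2)"
    by (simp add: sums_iff eval_nat_numeral)
  have "norm (\<Sum>n. ?c (n + 3) * z ^ (n + 3)) \<le> (\<Sum>n. M * ?q ^ 3 * ?q ^ n)"
    by (rule norm_suminf_le[OF b]) (intro summable_mult summable_geometric q)
  also have "\<dots> = M * ?q ^ 3 * (1 / (1 - ?q))"
    by (simp only: suminf_mult[OF summable_geometric[OF q(3)]] suminf_geometric[OF q(3)])
  also have "\<dots> \<le> M * ?q ^ 3 * 2"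
  proof (intro mult_left_mono)
    have "1 / (1 - ?q) \<le> 1 / (1 / 2)" using q(2,4) by (intro divide_left_mono) auto
    then show "1 / (1 - ?q) \<le> 2" by simp
  qed (use q M0 in simp)
  finally show ?thesis unfolding eq by simp
qed

text \<open>Boundedness of \<open>S\<close> makes the error of the first-order expansion of exp
  quadratic in h, uniformly in x, so differentiation under the integral is a direct estimate. The
  weight \<open>g\<close> allows a second application: weight 1 yields F', weight \<open>S\<close>
  yields F''.\<close>

lemma (in prob_space) has_field_derivative_mgf:
  fixes S g :: "'a \<Rightarrow> real"
  assumes [measurable]: "S \<in> borel_measurable M" "g \<in> borel_measurable M"
    and Sb: "\<And>x. x \<in> space M \<Longrightarrow> \<bar>S x\<bar> \<le> b" and gb: "\<And>x. x \<in> space M \<Longrightarrow> \<bar>g x\<bar> \<le> c"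
  shows "((\<lambda>z. CLINT x|M. of_real (g x) * exp (z * of_real (S x))) has_field_derivative
      (CLINT x|M. of_real (g x * S x) * exp (z * of_real (S x)))) (at z)"
proof -
  obtain x0 where x0: "x0 \<in> space M" using not_empty by auto
  have b0: "0 \<le> b" using Sb[OF x0] abs_ge_zero[of "S x0"] by linarith
  have c0: "0 \<le> c" using gb[OF x0] abs_ge_zero[of "g x0"] by linarith
  let ?F = "\<lambda>z. CLINT x|M. of_real (g x) * exp (z * of_real (S x))"
  let ?D = "CLINT x|M. of_real (g x * S x) * exp (z * of_real (S x))"
  have Re_le: "\<bar>Re (w * of_real (S x))\<bar> \<le> norm w * b" if "x \<in> space M" for w :: complex and x
  proof -
    have "\<bar>Re (w * of_real (S x))\<bar> \<le> norm (w * of_real (S x))" by (rule abs_Re_le_cmod)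
    also have "\<dots> \<le> norm w * b" unfolding norm_mult using Sb[OF that] by (intro mult_left_mono) auto
    finally show ?thesis .
  qed
  have exp_le: "norm (exp (w * of_real (S x))) \<le> exp (norm w * b)" if "x \<in> space M" for w :: complex and x
    using Re_le[OF that, of w] by simp
  have int: "integrable M (\<lambda>x. of_real (h x) * exp (w * of_real (S x)))"
    if [measurable]: "h \<in> borel_measurable M" and h: "\<And>x. x \<in> space M \<Longrightarrow> \<bar>h x\<bar> \<le> d" for h and w :: complex and d :: real
  proof (rule integrable_const_bound)
    have "norm (of_real (h x) * exp (w * of_real (S x))) \<le> d * exp (norm w * b)" if "x \<in> space M" for x
      unfolding norm_mult using h[OF that] exp_le[OF that, of w] by (intro mult_mono) auto
    then show "AE x in M. norm (of_real (h x) * exp (w * of_real (S x))) \<le> d * exp (norm w * b)" by simp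
  qed measurable
  have gS: "\<bar>g x * S x\<bar> \<le> c * b" if "x \<in> space M" for x
    unfolding abs_mult using gb[OF that] Sb[OF that] c0 by (intro mult_mono) auto
  define K where "K = c * exp (norm z * b) * (exp b * b\<^sup>2)"
  have quad: "norm (?F (z + h) - ?F z - h * ?D) \<le> K * (norm h)\<^sup>2" if h: "norm h \<le> 1" for h :: complex
  proof -
    have "?F (z + h) - ?F z - h * ?D = (CLINT x|M. of_real (g x) * exp ((z + h) * of_real (S x))
        - of_real (g x) * exp (z * of_real (S x)) - h * (of_real (g x * S x) * exp (z * of_real (S x))))"
      using int[OF _ gb] int[OF _ gS]
      by (subst Bochner_Integration.integral_diff) (auto simp: Bochner_Integration.integral_diff)
    also have "\<dots> = (CLINT x|M. of_real (g x) * exp (z * of_real (S x)) * (exp (h * of_real (S x)) - (1 + h * of_real (S x))))"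
      by (intro Bochner_Integration.integral_cong) (simp_all add: algebra_simps exp_add)
    also have "norm \<dots> \<le> (LINT x|M. K * (norm h)\<^sup>2)"
    proof (rule order_trans[OF integral_norm_bound Bochner_Integration.integral_mono])
      fix x assume x: "x \<in> space M"
      have "norm (exp (h * of_real (S x)) - (\<Sum>k\<le>1. (h * of_real (S x)) ^ k / fact k))
          \<le> exp \<bar>Re (h * of_real (S x))\<bar> * norm (h * of_real (S x)) ^ Suc 1 / fact 1"
        by (rule Taylor_exp)
      also have "\<dots> \<le> exp b * (norm h * b)\<^sup>2"
      proof -
        have "exp \<bar>Re (h * of_real (S x))\<bar> \<le> exp b"
          using Re_le[OF x, of h] mult_right_mono[OF h b0] by simp
        moreover have "norm (h * of_real (S x)) ^ 2 \<le> (norm h * b)\<^sup>2"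
          unfolding norm_mult using Sb[OF x] by (intro power_mono mult_left_mono) auto
        ultimately show ?thesis by (simp add: mult_mono numeral_2_eq_2)
      qed
      finally have e: "norm (exp (h * of_real (S x)) - (1 + h * of_real (S x))) \<le> exp b * (norm h * b)\<^sup>2"
        by simp
      have "norm (of_real (g x) * exp (z * of_real (S x)) * (exp (h * of_real (S x)) - (1 + h * of_real (S x))))
         \<le> c * exp (norm z * b) * (exp b * (norm h * b)\<^sup>2)"
        unfolding norm_mult[of _ "exp (h * of_real (S x)) - (1 + h * of_real (S x))"] norm_mult[of "of_real (g x)"]
        using gb[OF x] exp_le[OF x, of z] e c0 by (intro mult_mono) auto
      then show "norm (of_real (g x) * exp (z * of_real (S x)) * (exp (h * of_real (S x)) - (1 + h * of_real (S x)))) \<le> K * (norm h)\<^sup>2"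
        by (simp add: K_def power_mult_distrib mult_ac)
    next
      have "integrable M (\<lambda>x. of_real (g x) * exp ((z + h) * of_real (S x))
        - of_real (g x) * exp (z * of_real (S x)) - h * (of_real (g x * S x) * exp (z * of_real (S x))))"
        using int[OF _ gb] int[OF _ gS] by auto
      then have "integrable M (\<lambda>x. of_real (g x) * exp (z * of_real (S x)) * (exp (h * of_real (S x)) - (1 + h * of_real (S x))))"
        by (rule Bochner_Integration.integrable_cong[THEN iffD1, rotated 2]) (simp_all add: algebra_simps exp_add)
      then show "integrable M (\<lambda>x. norm (of_real (g x) * exp (z * of_real (S x)) * (exp (h * of_real (S x)) - (1 + h * of_real (S x)))))"
        by (rule integrable_norm)
    qed simp
    also have "\<dots> = K * (norm h)\<^sup>2" by (simp add: prob_space)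
    finally show ?thesis .
  qed
  show ?thesis unfolding DERIV_def
  proof (rule LIM_zero_cancel, rule tendsto_norm_zero_cancel, rule Lim_null_comparison)
    show "\<forall>\<^sub>F h in at 0. norm (norm ((?F (z + h) - ?F z) / h - ?D)) \<le> K * norm h"
    proof -
      have "\<forall>\<^sub>F h in at (0::complex). norm h < 1 \<and> h \<noteq> 0"
        by (auto simp: eventually_at intro!: exI[of _ 1])
      then show ?thesis
      proof eventually_elim
        case (elim h)
        have "(?F (z + h) - ?F z) / h - ?D = (?F (z + h) - ?F z - h * ?D) / h"
          using elim by (simp add: field_simps)
        then have "norm ((?F (z + h) - ?F z) / h - ?D) = norm (?F (z + h) - ?F z - h * ?D) / norm h"
          by (simp add: norm_divide)
        also have "\<dots> \<le> K * (norm h)\<^sup>2 / norm h" using quad[of h] elim by (intro divide_right_mono) auto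
        also have "\<dots> = K * norm h" using elim by (simp add: power2_eq_square)
        finally show ?case by simp
      qed
    qed
    show "((\<lambda>h. K * norm h) \<longlongrightarrow> 0) (at 0)" by (auto intro!: tendsto_eq_intros)
  qed
qed

text \<open>On a zero-free disc F has a holomorphic logarithm f whose real part ln |F| stays below
  A, so f is bounded by 2A on half the radius. Its Taylor data at 0 are 0, the mean and the
  variance. The constant is 32 = 2 * 2 * 2^3, the cube coming from the radius r/2.\<close>

lemma (in prob_space) log_mgf_expansion:
  fixes S :: "'a \<Rightarrow> real"
  assumes S[measurable]: "S \<in> borel_measurable M" and Sb: "\<And>x. x \<in> space M \<Longrightarrow> \<bar>S x\<bar> \<le> b"
    and mean: "expectation S = 0" and r: "0 < r"
    and nz: "\<And>z. norm z < r \<Longrightarrow> (CLINT x|M. exp (z * of_real (S x))) \<noteq> 0"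
    and bd: "\<And>z. norm z < r \<Longrightarrow> norm (CLINT x|M. exp (z * of_real (S x))) < exp A"
    and z: "norm z \<le> r / 4"
  shows "\<exists>R. (CLINT x|M. exp (z * of_real (S x))) = exp (of_real (expectation (\<lambda>x. (S x)\<^sup>2)) * z\<^sup>2 / 2 + R)
      \<and> norm R \<le> 32 * A * (norm z / r) ^ 3"
proof -
  define F where "F z = (CLINT x|M. exp (z * of_real (S x)))" for z
  define F1 where "F1 z = (CLINT x|M. of_real (S x) * exp (z * of_real (S x)))" for z
  define v where "v = expectation (\<lambda>x. (S x)\<^sup>2)"
  have dF: "(F has_field_derivative F1 z) (at z)" for z
    using has_field_derivative_mgf[OF S _ Sb, of "\<lambda>_. 1" 1 z] by (simp add: F_def[abs_def] F1_def)
  have dF1: "(F1 has_field_derivative (CLINT x|M. of_real (S x * S x) * exp (z * of_real (S x)))) (at z)" for z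
    using has_field_derivative_mgf[OF S S Sb Sb, of z] by (simp add: F1_def[abs_def])
  have F0: "F 0 = 1" by (simp add: F_def prob_space)
  have F10: "F1 0 = 0" using mean by (simp add: F1_def)
  have dF10: "(F1 has_field_derivative of_real v) (at 0)"
    using dF1[of 0] by (simp add: v_def power2_eq_square flip: integral_complex_of_real)
  have holF: "F holomorphic_on ball 0 r"
    using dF by (auto simp: holomorphic_on_def field_differentiable_def intro: has_field_derivative_at_within)
  obtain g where g: "g holomorphic_on ball 0 r" "\<And>x. x \<in> ball 0 r \<Longrightarrow> exp (g x) = F x"
    using holomorphic_logarithm_exists[OF convex_ball open_ball holF, of 0] nz r by (auto simp: F_def)
  \<comment> \<open>A logarithm is determined up to a multiple of 2 pi i; subtracting the value at 0
    gives f 0 = 0 and keeps the exponential.\<close>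
  define f where "f z = g z - g 0" for z
  have eg0: "exp (g 0) = 1" using g(2)[of 0] r F0 by simp
  have holf: "f holomorphic_on ball 0 r" unfolding f_def by (intro holomorphic_intros g)
  have f0: "f 0 = 0" by (simp add: f_def)
  have ef: "exp (f x) = F x" if "x \<in> ball 0 r" for x
    using g(2)[OF that] eg0 by (simp add: f_def exp_diff)
  have Re: "Re (f z) < A" if "norm z < r" for z
  proof -
    have "exp (Re (f z)) = norm (F z)" using ef[of z] that by (metis norm_exp_eq_Re mem_ball_0)
    also have "\<dots> < exp A" using bd[OF that] by (simp add: F_def)
    finally show ?thesis by simp
  qed
  have fM: "norm (f z) \<le> 2 * A" if "norm z \<le> r/2" for z
    by (rule norm_le_of_Re_less[OF holf f0 r Re that])
  have df: "(f has_field_derivative deriv f z) (at z)" if "z \<in> ball 0 r" for z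
    by (rule holomorphic_derivI[OF holf _ that]) simp
  have F1f: "F1 z = F z * deriv f z" if z: "z \<in> ball 0 r" for z
  proof -
    have "((\<lambda>z. exp (f z)) has_field_derivative exp (f z) * deriv f z) (at z)"
      using df[OF z] by (auto intro!: derivative_eq_intros)
    moreover have "((\<lambda>z. exp (f z)) has_field_derivative F1 z) (at z)"
      by (rule has_field_derivative_transform_within_open[OF dF, of "ball 0 r"]) (use z ef in auto)
    ultimately show ?thesis using ef[OF z] DERIV_unique by metis
  qed
  have f1: "deriv f 0 = 0" using F1f[of 0] r F0 F10 by simp
  have "(deriv f has_field_derivative deriv (deriv f) 0) (at 0)"
    by (rule holomorphic_derivI[where S="ball 0 r"]) (use holf r in \<open>auto intro: holomorphic_deriv\<close>)
  \<comment> \<open>Differentiating F' = F f' at 0, where F = 1 and both first derivatives vanish,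
    identifies f''(0) with F''(0).\<close>
  then have "((\<lambda>z. F z * deriv f z) has_field_derivative deriv (deriv f) 0) (at 0)"
    using DERIV_mult[OF dF[of 0], of "deriv f" "deriv (deriv f) 0"] F0 f1 F10 by simp
  then have "(F1 has_field_derivative deriv (deriv f) 0) (at 0)"
    by (rule has_field_derivative_transform_within_open[where S="ball 0 r"]) (use F1f r in auto)
  then have f2: "(deriv ^^ 2) f 0 = of_real v" using dF10 DERIV_unique by (auto simp: numeral_2_eq_2)
  define R where "R = f z - of_real v / 2 * z\<^sup>2"
  have "norm (f z - (f 0 + deriv f 0 * z + (deriv ^^ 2) f 0 / 2 * z\<^sup>2)) \<le> 2 * (2 * A) * (norm z / (r/2)) ^ 3"
    by (rule third_order_remainder[OF holf]) (use r z fM in auto)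
  then have "norm R \<le> 32 * A * (norm z / r) ^ 3"
    by (simp add: R_def f0 f1 f2 power_divide field_simps)
  moreover have "F z = exp (of_real v * z\<^sup>2 / 2 + R)"
    using ef[of z] z r by (simp add: R_def)
  ultimately show ?thesis unfolding F_def v_def by blast
qed

text \<open>At z = i t / s the quadratic term of the logarithm is exactly - t^2 / 2 and the
  remainder is cubic in t, which is the input form of the smoothing inequality. The constant is
  quantified before all data, hence uniform in the measure, in n and in t.\<close>

lemma Berry_Esseen_zero_free_mgf:
  "\<exists>C0>0. \<forall>(M :: 'a measure) S b r A t. prob_space M \<longrightarrow> S \<in> borel_measurable M \<longrightarrow> (\<forall>x\<in>space M. \<bar>S x\<bar> \<le> b) \<longrightarrow>
    integral\<^sup>L M S = 0 \<longrightarrow> 0 < r \<longrightarrow> 0 < integral\<^sup>L M (\<lambda>x. (S x)\<^sup>2) \<longrightarrow>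
    (\<forall>z. norm z < r \<longrightarrow> (CLINT x|M. exp (z * of_real (S x))) \<noteq> 0 \<and> norm (CLINT x|M. exp (z * of_real (S x))) < exp A) \<longrightarrow>
    \<bar>measure M {x \<in> space M. S x \<le> t * sqrt (integral\<^sup>L M (\<lambda>x. (S x)\<^sup>2))} - Phi t\<bar>
      \<le> C0 * (1 / (r * sqrt (integral\<^sup>L M (\<lambda>x. (S x)\<^sup>2))) + A / (r * sqrt (integral\<^sup>L M (\<lambda>x. (S x)\<^sup>2))) ^ 3)"
proof -
  obtain C1 where C1: "C1 > 0" and E: "\<And>M T B x. real_distribution M \<Longrightarrow> 0 < T \<Longrightarrow> 0 \<le> B \<Longrightarrow>
    (\<And>t. \<bar>t\<bar> \<le> T \<Longrightarrow> norm (char M t - char std_normal_distribution t) \<le> B * \<bar>t\<bar> ^ 3 * exp (- t\<^sup>2 / 4)) \<Longrightarrow>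
    \<bar>cdf M x - Phi x\<bar> \<le> C1 * (B + 1 / T)"
    using Esseen_smoothing by blast
  have "\<bar>measure M {x \<in> space M. S x \<le> t * sqrt (integral\<^sup>L M (\<lambda>x. (S x)\<^sup>2))} - Phi t\<bar>
      \<le> C1 * 160 * (1 / (r * sqrt (integral\<^sup>L M (\<lambda>x. (S x)\<^sup>2))) + A / (r * sqrt (integral\<^sup>L M (\<lambda>x. (S x)\<^sup>2))) ^ 3)"
    if M: "prob_space M" and S[measurable]: "S \<in> borel_measurable M" and Sb: "\<And>x. x \<in> space M \<Longrightarrow> \<bar>S x\<bar> \<le> b"
      and mean: "integral\<^sup>L M S = 0" and r: "0 < r" and v: "0 < integral\<^sup>L M (\<lambda>x. (S x)\<^sup>2)"
      and nz: "\<And>z. norm z < r \<Longrightarrow> (CLINT x|M. exp (z * of_real (S x))) \<noteq> 0"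
      and bd: "\<And>z. norm z < r \<Longrightarrow> norm (CLINT x|M. exp (z * of_real (S x))) < exp A"
    for M :: "'a measure" and S b r A t
  proof -
    interpret prob_space M by fact
    define s where "s = sqrt (integral\<^sup>L M (\<lambda>x. (S x)\<^sup>2))"
    have s: "0 < s" and s2: "s\<^sup>2 = expectation (\<lambda>x. (S x)\<^sup>2)" using v by (auto simp: s_def)
    have A: "0 < A" using bd[of 0] r by (simp add: prob_space)
    define N where "N = distr M borel (\<lambda>x. S x / s)"
    have N: "real_distribution N" unfolding N_def by (rule real_distribution_distr) measurable
    define B where "B = 32 * A / (r * s) ^ 3"
    have B: "0 < B" using A r s by (simp add: B_def)
    \<comment> \<open>The first entry keeps |z| \<le> r/4, where the expansion holds; the second
      forces |R| \<le> t^2 / 4, so that exp |R| spends only half of the Gaussian factor exp (- t^2 /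
      2).\<close>
    define T where "T = min (r * s / 4) (1 / (4 * B))"
    have T: "0 < T" using r s B by (simp add: T_def)
    have char: "norm (char N t - char std_normal_distribution t) \<le> B * \<bar>t\<bar> ^ 3 * exp (- t\<^sup>2 / 4)" if t: "\<bar>t\<bar> \<le> T" for t
    proof -
      define z where "z = \<i> * of_real (t / s)"
      have nz': "norm z = \<bar>t\<bar> / s" using s by (simp add: z_def norm_mult norm_divide)
      have z: "norm z \<le> r / 4" using t s by (simp add: nz' T_def field_simps)
      obtain R where R: "(CLINT x|M. exp (z * of_real (S x))) = exp (of_real (s\<^sup>2) * z\<^sup>2 / 2 + R)"
        "norm R \<le> 32 * A * (norm z / r) ^ 3"
        using log_mgf_expansion[OF S Sb mean r nz bd z] unfolding s2 by blast
      have "char N t = (CLINT x|M. iexp (t * (S x / s)))"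
        unfolding char_def N_def by (rule integral_distr) auto
      also have "\<dots> = (CLINT x|M. exp (z * of_real (S x)))"
        by (intro Bochner_Integration.integral_cong) (simp_all add: z_def mult_ac)
      also have "\<dots> = exp (of_real (- t\<^sup>2 / 2)) * exp R"
      proof -
        have "of_real (s\<^sup>2) * z\<^sup>2 / 2 = of_real (- t\<^sup>2 / 2)" using s by (simp add: z_def power_mult_distrib power_divide)
        then show ?thesis unfolding R(1) by (simp only: exp_add)
      qed
      finally have cN: "char N t = of_real (exp (- t\<^sup>2 / 2)) * exp R" by (simp add: exp_of_real[symmetric])
      have R2: "norm R \<le> B * \<bar>t\<bar> ^ 3"
        using R(2) s r by (simp add: nz' B_def power_divide power_mult_distrib field_simps)
      have R3: "norm R \<le> t\<^sup>2 / 4"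
      proof -
        have "B * \<bar>t\<bar> \<le> B * (1 / (4 * B))" using t B by (intro mult_left_mono) (auto simp: T_def)
        also have "\<dots> = 1/4" using B by simp
        finally have "B * \<bar>t\<bar> * t\<^sup>2 \<le> 1/4 * t\<^sup>2" by (rule mult_right_mono) simp
        moreover have "B * \<bar>t\<bar> ^ 3 = B * \<bar>t\<bar> * t\<^sup>2" by (simp add: power3_eq_cube power2_eq_square)
        ultimately show ?thesis using R2 by linarith
      qed
      have "norm (exp R - 1) \<le> norm R * exp (norm R)"
      proof -
        have "norm (exp R - (\<Sum>k\<le>0. R ^ k / fact k)) \<le> exp \<bar>Re R\<bar> * norm R ^ Suc 0 / fact 0" by (rule Taylor_exp)
        also have "\<dots> \<le> exp (norm R) * norm R" using abs_Re_le_cmod[of R] by (simp add: mult_right_mono)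
        finally show ?thesis by (simp add: mult.commute)
      qed
      also have "\<dots> \<le> (B * \<bar>t\<bar> ^ 3) * exp (t\<^sup>2 / 4)" using R2 R3 B by (intro mult_mono) auto
      finally have eR: "norm (exp R - 1) \<le> B * \<bar>t\<bar> ^ 3 * exp (t\<^sup>2 / 4)" .
      have "char N t - char std_normal_distribution t = of_real (exp (- t\<^sup>2 / 2)) * (exp R - 1)"
        unfolding cN char_std_normal_distribution by (simp add: algebra_simps)
      then have "norm (char N t - char std_normal_distribution t) = exp (- t\<^sup>2 / 2) * norm (exp R - 1)"
        by (simp add: norm_mult)
      also have "\<dots> \<le> exp (- t\<^sup>2 / 2) * (B * \<bar>t\<bar> ^ 3 * exp (t\<^sup>2 / 4))" using eR by (intro mult_left_mono) auto
      also have "\<dots> = B * \<bar>t\<bar> ^ 3 * exp (- t\<^sup>2 / 4)" by (simp add: mult_exp_exp)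
      finally show ?thesis .
    qed
    have "\<bar>cdf N t - Phi t\<bar> \<le> C1 * (B + 1 / T)" by (rule E[OF N T _ char]) (use B in auto)
    also have "cdf N t = measure M {x \<in> space M. S x \<le> t * s}"
      unfolding cdf_def N_def using s
      by (subst measure_distr) (auto intro!: arg_cong[where f="measure M"] simp: field_simps)
    finally have le: "\<bar>measure M {x \<in> space M. S x \<le> t * s} - Phi t\<bar> \<le> C1 * (B + 1 / T)" .
    \<comment> \<open>The reciprocal of a minimum is at most the sum of the reciprocals. Together
      with B this makes \<open>5 * B\<close>, and 5 * 32 = 160.\<close>
    have "1 / T \<le> 4 / (r * s) + 4 * B"
      unfolding T_def using r s B by (auto simp: min_def)
    moreover have "4 / (r * s) + 5 * B \<le> 160 * (1 / (r * s) + A / (r * s) ^ 3)"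
      using r s divide_right_mono[of 4 160 "r * s"] by (simp add: B_def)
    ultimately have "B + 1 / T \<le> 160 * (1 / (r * s) + A / (r * s) ^ 3)" by linarith
    then have "C1 * (B + 1 / T) \<le> C1 * (160 * (1 / (r * s) + A / (r * s) ^ 3))" using C1 by (intro mult_left_mono) auto
    with le show ?thesis unfolding s_def[symmetric] mult.assoc by linarith
  qed
  moreover have "C1 * 160 > 0" using C1 by simp
  ultimately show ?thesis by blast
qed

section \<open>Cones cut out by finite point functionals\<close>

text \<open>A functional lists the coefficients and base points of a finite real combination of point
  evaluations, so that it can be applied to real and to complex functions alike.\<close>

type_synonym 'x functional = "(real \<times> 'x) list"

definition feval :: "'x functional \<Rightarrow> ('x \<Rightarrow> 'b::real_vector) \<Rightarrow> 'b" where
  "feval l g = (\<Sum>(a, x)\<leftarrow>l. a *\<^sub>R g x)"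

lemma feval_Nil [simp]: "feval [] g = 0"
  and feval_Cons [simp]: "feval (ax # l) g = fst ax *\<^sub>R g (snd ax) + feval l g"
  by (simp_all add: feval_def split_beta)

lemma feval_cong: "(\<And>x. x \<in> snd ` set l \<Longrightarrow> f x = g x) \<Longrightarrow> feval l f = feval l g"
  by (induction l) auto

lemma feval_add: "feval l (\<lambda>x. f x + g x) = feval l f + feval l g"
  by (induction l) (auto simp: scaleR_add_right)

lemma feval_diff: "feval l (\<lambda>x. f x - g x) = feval l f - feval l g"
  by (induction l) (auto simp: scaleR_diff_right)

lemma feval_mult: "feval l (\<lambda>x. c * f x) = c * feval l f" for c :: "'a::real_algebra"
  by (induction l) (auto simp: distrib_left)

lemma feval_of_real: "feval l (\<lambda>x. of_real (f x)) = (of_real (feval l f) :: 'a::real_algebra_1)"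
  by (induction l) (auto simp: scaleR_conv_of_real)

lemma Re_feval: "Re (feval l f) = feval l (\<lambda>x. Re (f x))"
  by (induction l) auto

lemma Im_feval: "Im (feval l f) = feval l (\<lambda>x. Im (f x))"
  by (induction l) auto

lemma tendsto_feval:
  fixes f :: "'i \<Rightarrow> 'x \<Rightarrow> 'b::real_normed_vector"
  shows "(\<And>x. x \<in> snd ` set l \<Longrightarrow> ((\<lambda>n. f n x) \<longlongrightarrow> g x) F) \<Longrightarrow> ((\<lambda>n. feval l (f n)) \<longlongrightarrow> feval l g) F"
  by (induction l) (auto intro!: tendsto_intros)

definition fcone :: "'x functional set \<Rightarrow> ('x \<Rightarrow> real) set" where
  "fcone S = {g. \<forall>l\<in>S. 0 \<le> feval l g}"

lemma fconeD: "p \<in> fcone S \<Longrightarrow> l \<in> S \<Longrightarrow> 0 \<le> feval l p"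
  by (simp add: fcone_def)

lemma fcone_scale: "p \<in> fcone S \<Longrightarrow> 0 \<le> c \<Longrightarrow> (\<lambda>x. c * p x) \<in> fcone S"
  by (simp add: fcone_def feval_mult)

lemma diff_mult_mem_fcone: "(\<lambda>x. p x - c * q x) \<in> fcone S \<longleftrightarrow> (\<forall>l\<in>S. c * feval l q \<le> feval l p)"
  and mult_diff_mem_fcone: "(\<lambda>x. c * q x - p x) \<in> fcone S \<longleftrightarrow> (\<forall>l\<in>S. feval l p \<le> c * feval l q)"
  by (simp_all add: fcone_def feval_diff feval_mult)

lemma abs_sin_le_cos: "\<bar>sin t\<bar> \<le> cos t" if "\<bar>t\<bar> \<le> pi / 4" for t :: real
proof -
  have t: "- (pi/4) \<le> t" "t \<le> pi/4" using that by auto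
  have c: "0 \<le> cos t" by (rule cos_ge_zero) (use t pi_gt_zero in linarith)+
  have "0 \<le> cos (2 * t)" by (rule cos_ge_zero) (use t in linarith)+
  then have "(sin t)\<^sup>2 \<le> (cos t)\<^sup>2" by (simp add: cos_double)
  then have "\<bar>sin t\<bar> \<le> \<bar>cos t\<bar>" by (simp add: abs_le_square_iff)
  with c show ?thesis by simp
qed

text \<open>Pairwise angles of at most pi/2 force all arguments, measured from one element, into an
  interval of length at most pi/2; turning by its midpoint leaves every argument within pi/4 of the
  positive axis.\<close>

lemma rotate_into_sector:
  fixes Z :: "complex set"
  assumes Z: "\<And>z w. z \<in> Z \<Longrightarrow> w \<in> Z \<Longrightarrow> 0 \<le> Re (cnj z * w)"
  shows "\<exists>u. u \<noteq> 0 \<and> (\<forall>z\<in>Z. \<bar>Im (u * z)\<bar> \<le> Re (u * z))"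
proof (cases "Z \<subseteq> {0}")
  case True
  then show ?thesis by (intro exI[of _ 1]) auto
next
  case False
  then obtain z0 where z0: "z0 \<in> Z" "z0 \<noteq> 0" by auto
  \<comment> \<open>Arguments relative to z0 stay in [-pi/2, pi/2], so their differences never wrap
    around.\<close>
  define A where "A = (\<lambda>z. Arg (cnj z0 * z)) ` (Z - {0})"
  have polar: "cnj z0 * z = of_real (norm (cnj z0 * z)) * cis (Arg (cnj z0 * z))" if "z \<noteq> 0" for z
    using cis_Arg[of "cnj z0 * z"] that z0 by (simp add: sgn_eq norm_mult)
  have A_bound: "\<bar>a\<bar> \<le> pi / 2" if "a \<in> A" for a
  proof -
    obtain z where z: "z \<in> Z" "z \<noteq> 0" "a = Arg (cnj z0 * z)" using \<open>a \<in> A\<close> by (auto simp: A_def)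
    have "0 \<le> Re (cnj z0 * z)" using Z z0 z by simp
    then show ?thesis unfolding z(3) by (simp only: Arg_Re_nonneg)
  qed
  have diff: "\<bar>a - b\<bar> \<le> pi / 2" if ab: "a \<in> A" "b \<in> A" for a b
  proof (rule ccontr)
    assume n: "\<not> ?thesis"
    obtain z where z: "z \<in> Z" "z \<noteq> 0" "a = Arg (cnj z0 * z)" using ab by (auto simp: A_def)
    obtain w where w: "w \<in> Z" "w \<noteq> 0" "b = Arg (cnj z0 * w)" using ab by (auto simp: A_def)
    have "cnj (cnj z0 * z) * (cnj z0 * w) = of_real (norm (cnj z0 * z) * norm (cnj z0 * w)) * cis (b - a)"
      unfolding z(3) w(3) using z(2) w(2)
      by (subst (1 2) polar) (simp_all add: cis_cnj cis_mult)
    also have "cnj (cnj z0 * z) * (cnj z0 * w) = of_real ((norm z0)\<^sup>2) * (cnj z * w)"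
      by (simp only: complex_norm_square complex_cnj_mult complex_cnj_cnj mult_ac)
    finally have eq: "of_real ((norm z0)\<^sup>2) * (cnj z * w) = of_real (norm (cnj z0 * z) * norm (cnj z0 * w)) * cis (b - a)"
      by (simp only:)
    have "(norm z0)\<^sup>2 * Re (cnj z * w) = norm (cnj z0 * z) * norm (cnj z0 * w) * cos (b - a)"
      using arg_cong[OF eq, of Re] by simp
    moreover have "0 \<le> (norm z0)\<^sup>2 * Re (cnj z * w)" using Z z w by simp
    moreover have "0 < norm (cnj z0 * z) * norm (cnj z0 * w)" using z0 z w by simp
    ultimately have "0 \<le> cos (b - a)" by (metis zero_le_mult_iff not_le)
    then have "0 \<le> cos \<bar>b - a\<bar>" by simp
    moreover have "cos \<bar>b - a\<bar> < cos (pi / 2)"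
      by (rule cos_monotone_0_pi) (use n A_bound[OF ab(1)] A_bound[OF ab(2)] pi_gt_zero in linarith)+
    ultimately show False by simp
  qed
  have ne: "A \<noteq> {}" using z0 by (auto simp: A_def)
  have bdd: "bdd_above A" "bdd_below A"
    using abs_le_D1[OF A_bound] abs_le_D2[OF A_bound]
    by (auto intro!: bdd_aboveI[of _ "pi/2"] bdd_belowI[of _ "-(pi/2)"] simp: minus_le_iff)
  define c where "c = (Sup A + Inf A) / 2"
  have "Sup A - pi/2 \<le> Inf A"
  proof (rule cInf_greatest[OF ne])
    fix b assume b: "b \<in> A"
    have "a \<le> b + pi/2" if "a \<in> A" for a using abs_le_D1[OF diff[OF that b]] by linarith
    then have "Sup A \<le> b + pi/2" by (rule cSup_least[OF ne])
    then show "Sup A - pi/2 \<le> b" by simp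
  qed
  then have close: "\<bar>a - c\<bar> \<le> pi / 4" if "a \<in> A" for a
    using cSup_upper[OF that bdd(1)] cInf_lower[OF that bdd(2)] unfolding c_def abs_le_iff by argo
  have "\<bar>Im (cis (- c) * cnj z0 * z)\<bar> \<le> Re (cis (- c) * cnj z0 * z)" if z: "z \<in> Z" for z
  proof (cases "z = 0")
    case False
    let ?t = "Arg (cnj z0 * z) - c"
    have "cis (- c) * cnj z0 * z = cis (- c) * (cnj z0 * z)" by simp
    also have "\<dots> = of_real (norm (cnj z0 * z)) * cis ?t"
      by (subst polar[OF False]) (simp add: cis_mult)
    finally have eq: "cis (- c) * cnj z0 * z = of_real (norm (cnj z0 * z)) * cis ?t" .
    have "\<bar>sin ?t\<bar> \<le> cos ?t" by (rule abs_sin_le_cos, rule close) (use z False in \<open>auto simp: A_def\<close>)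
    then show ?thesis unfolding eq by (simp add: abs_mult mult_left_mono)
  qed simp
  moreover have "cis (- c) * cnj z0 \<noteq> 0" using z0 by simp
  ultimately show ?thesis by (intro exI[of _ "cis (- c) * cnj z0"]) auto
qed

text \<open>The numbers 1 + i and 1 - i span the edges of the sector |Im| \<le> Re. After the
  rotation from \<open>rotate_into_sector\<close>, Re + Im and Re - Im of every functional value are
  nonnegative, which says that the corresponding real functions lie in the real cone.\<close>

lemma complex_cone_decomposition:
  assumes "\<And>l m. l \<in> S \<Longrightarrow> m \<in> S \<Longrightarrow> 0 \<le> Re (cnj (feval l g) * feval m g)"
  obtains c p q where "c \<noteq> 0" "p \<in> fcone S" "q \<in> fcone S"
    "\<And>x. g x = c * ((1 + \<i>) * of_real (p x) + (1 - \<i>) * of_real (q x))"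
proof -
  obtain u where u: "u \<noteq> 0" "\<And>l. l \<in> S \<Longrightarrow> \<bar>Im (u * feval l g)\<bar> \<le> Re (u * feval l g)"
    using rotate_into_sector[of "(\<lambda>l. feval l g) ` S"] assms by blast
  define p where "p x = Re (u * g x) + Im (u * g x)" for x
  define q where "q x = Re (u * g x) - Im (u * g x)" for x
  have evu: "Re (u * feval l g) = feval l (\<lambda>x. Re (u * g x))" "Im (u * feval l g) = feval l (\<lambda>x. Im (u * g x))" for l
    by (simp_all only: feval_mult[symmetric] Re_feval Im_feval)
  have "p \<in> fcone S \<and> q \<in> fcone S"
    using u(2)[unfolded evu, THEN abs_le_D1] u(2)[unfolded evu, THEN abs_le_D2]
    unfolding fcone_def p_def q_def mem_Collect_eq feval_add feval_diff by fastforce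
  moreover have "g x = 1 / (2 * u) * ((1 + \<i>) * of_real (p x) + (1 - \<i>) * of_real (q x))" for x
  proof -
    have "(1 + \<i>) * of_real (p x) + (1 - \<i>) * of_real (q x) = 2 * (u * g x)"
      by (simp add: p_def q_def complex_eq_iff)
    then show ?thesis using u(1) by (simp del: Re_complex_of_real)
  qed
  ultimately show thesis using u(1) by (intro that[of "1 / (2 * u)" p q]) (blast | simp)+
qed

lemma perturbed_product_close:
  fixes A B :: complex and a b e :: real
  assumes "0 \<le> a" "0 \<le> b" "0 \<le> e" "norm (A - of_real a) \<le> e * a" "norm (B - of_real b) \<le> e * b"
  shows "norm (cnj A * B - of_real (a * b)) \<le> (2 * e + e\<^sup>2) * (a * b)"
proof -
  have "cnj A * B - of_real (a * b) = cnj (A - of_real a) * (B - of_real b) + of_real a * (B - of_real b) + cnj (A - of_real a) * of_real b"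
    by (simp add: algebra_simps)
  also have "norm \<dots> \<le> norm (cnj (A - of_real a) * (B - of_real b)) + norm (of_real a * (B - of_real b)) + norm (cnj (A - of_real a) * of_real b)"
    by (intro order_trans[OF norm_triangle_ineq] add_mono norm_triangle_ineq order_refl)
  also have "\<dots> \<le> (e * a) * (e * b) + a * (e * b) + (e * a) * b"
    unfolding norm_mult complex_mod_cnj using assms by (intro add_mono mult_mono) auto
  finally show ?thesis by (simp add: power2_eq_square algebra_simps)
qed

text \<open>For exact data the real part is 2 (aa' + bb'), the mixed products contributing to the
  imaginary part. A perturbation makes them leak into the real part with weight of order 1/\<Gamma>,
  and the cross-ratio bound keeps each mixed product below \<Gamma> times the mean of the diagonal
  ones.\<close>

lemma complex_cone_stable:
  fixes A B A' B' :: complex and a b a' b' \<Gamma> :: real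
  assumes nn: "0 \<le> a" "0 \<le> b" "0 \<le> a'" "0 \<le> b'" and \<Gamma>: "1 \<le> \<Gamma>"
    and cr: "a * b' \<le> \<Gamma>\<^sup>2 * (b * a')" "b * a' \<le> \<Gamma>\<^sup>2 * (a * b')"
    and A: "norm (A - of_real a) \<le> a / (6 * \<Gamma>)" and B: "norm (B - of_real b) \<le> b / (6 * \<Gamma>)"
    and A': "norm (A' - of_real a') \<le> a' / (6 * \<Gamma>)" and B': "norm (B' - of_real b') \<le> b' / (6 * \<Gamma>)"
  shows "0 \<le> Re (cnj ((1 + \<i>) * A + (1 - \<i>) * B) * ((1 + \<i>) * A' + (1 - \<i>) * B'))"
proof -
  define e where "e = 1 / (6 * \<Gamma>)"
  have e: "0 \<le> e" using \<Gamma> by (simp add: e_def)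
  define k where "k = 2 * e + e\<^sup>2"
  have k0: "0 \<le> k" using e by (simp add: k_def)
  have P: "norm (cnj A * A' - of_real (a * a')) \<le> k * (a * a')" "norm (cnj B * B' - of_real (b * b')) \<le> k * (b * b')"
    "norm (cnj A * B' - of_real (a * b')) \<le> k * (a * b')" "norm (cnj B * A' - of_real (b * a')) \<le> k * (b * a')"
    unfolding k_def using nn e A B A' B' by (intro perturbed_product_close; simp add: e_def)+
  have eq: "cnj ((1 + \<i>) * A + (1 - \<i>) * B) * ((1 + \<i>) * A' + (1 - \<i>) * B')
     = 2 * (cnj A * A' + cnj B * B') + 2 * \<i> * (cnj B * A' - cnj A * B')"
    by (simp add: algebra_simps)
  have R: "\<bar>Re (cnj A * A') - a * a'\<bar> \<le> k * (a * a')" "\<bar>Re (cnj B * B') - b * b'\<bar> \<le> k * (b * b')"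
    "\<bar>Im (cnj A * B')\<bar> \<le> k * (a * b')" "\<bar>Im (cnj B * A')\<bar> \<le> k * (b * a')"
    using P[THEN order_trans[OF abs_Re_le_cmod]] P[THEN order_trans[OF abs_Im_le_cmod]] by simp_all
  have "Re (cnj ((1 + \<i>) * A + (1 - \<i>) * B) * ((1 + \<i>) * A' + (1 - \<i>) * B'))
     = 2 * (Re (cnj A * A') + Re (cnj B * B')) - 2 * (Im (cnj B * A') - Im (cnj A * B'))"
    unfolding eq by simp
  also have "\<dots> \<ge> 2 * (a * a' + b * b') - 2 * k * (a * a' + b * b' + (a * b' + b * a'))"
  proof -
    have *: "2 * (r1 + r2) - 2 * (i2 - i1) \<ge> 2 * (x1 + x2) - 2 * k * (x1 + x2 + (y1 + y2))"
      if "\<bar>r1 - x1\<bar> \<le> k * x1" "\<bar>r2 - x2\<bar> \<le> k * x2" "\<bar>i1\<bar> \<le> k * y1" "\<bar>i2\<bar> \<le> k * y2" for r1 r2 i1 i2 x1 x2 y1 y2 :: real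
      using that by (simp add: distrib_left abs_le_iff)
    show ?thesis by (rule *[OF R])
  qed
  finally have low: "2 * (a * a' + b * b') - 2 * k * (a * a' + b * b' + (a * b' + b * a'))
     \<le> Re (cnj ((1 + \<i>) * A + (1 - \<i>) * B) * ((1 + \<i>) * A' + (1 - \<i>) * B'))" .
  \<comment> \<open>Arithmetic-geometric mean: x^2 \<le> \<Gamma>^2 x y, and x y is the product of
    the two diagonal terms.\<close>
  have half: "x \<le> \<Gamma> * (a * a' + b * b') / 2" if "0 \<le> x" "0 \<le> y" "x \<le> \<Gamma>\<^sup>2 * y" "x * y = (a * a') * (b * b')" for x y
  proof -
    have "x\<^sup>2 \<le> x * (\<Gamma>\<^sup>2 * y)" using that by (simp add: power2_eq_square mult_left_mono)
    also have "\<dots> = \<Gamma>\<^sup>2 * ((a * a') * (b * b'))" using that(4) by (simp add: mult_ac)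
    also have "\<dots> \<le> \<Gamma>\<^sup>2 * ((a * a' + b * b') / 2)\<^sup>2"
      using zero_le_square[of "a * a' - b * b'"] by (intro mult_left_mono) (simp_all add: power2_eq_square algebra_simps)
    also have "\<dots> = (\<Gamma> * (a * a' + b * b') / 2)\<^sup>2" by (simp add: power2_eq_square)
    finally show ?thesis using nn \<Gamma> by (intro power2_le_imp_le[of x]) auto
  qed
  have "a * b' + b * a' \<le> \<Gamma> * (a * a' + b * b')"
    using half[of "a * b'" "b * a'"] half[of "b * a'" "a * b'"] cr nn by (auto simp: mult_ac)
  then have "k * (a * a' + b * b' + (a * b' + b * a')) \<le> k * ((1 + \<Gamma>) * (a * a' + b * b'))"
    using k0 by (intro mult_left_mono) (auto simp: algebra_simps)
  also have "\<dots> = (k * (1 + \<Gamma>)) * (a * a' + b * b')" by simp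
  also have "\<dots> \<le> 1 * (a * a' + b * b')"
  proof (rule mult_right_mono)
    have "k * (1 + \<Gamma>) \<le> k * (2 * \<Gamma>)" using k0 \<Gamma> by (intro mult_left_mono) auto
    \<comment> \<open>This is what the tolerance 1 / (6 \<Gamma>) is made for: 2/3 + 1/18 <
      1.\<close>
    also have "\<dots> = 2 / 3 + 1 / (18 * \<Gamma>)" using \<Gamma> by (simp add: k_def e_def power2_eq_square field_simps)
    also have "\<dots> \<le> 2 / 3 + 1 / 18" using \<Gamma> by (intro add_left_mono divide_left_mono) auto
    finally show "k * (1 + \<Gamma>) \<le> 1" by simp
  qed (use nn in simp)
  finally show ?thesis using low by linarith
qed

text \<open>The two edges of the sector are orthogonal, so nonnegative coefficients never
  cancel.\<close>

lemma norm_sector_combination: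
  fixes a b :: real
  assumes "0 \<le> a" "0 \<le> b"
  shows "a + b \<le> norm ((1 + \<i>) * of_real a + (1 - \<i>) * of_real b)"
    "norm ((1 + \<i>) * of_real a + (1 - \<i>) * of_real b) \<le> sqrt 2 * (a + b)"
proof -
  have n: "norm ((1 + \<i>) * of_real a + (1 - \<i>) * of_real b) = sqrt ((a + b)\<^sup>2 + (a - b)\<^sup>2)"
    by (simp add: cmod_def)
  show "a + b \<le> norm ((1 + \<i>) * of_real a + (1 - \<i>) * of_real b)"
    unfolding n by (rule real_le_rsqrt) simp
  have "(a + b)\<^sup>2 + (a - b)\<^sup>2 \<le> 2 * (a + b)\<^sup>2"
    using assms by (simp add: power2_eq_square algebra_simps)
  then have "sqrt ((a + b)\<^sup>2 + (a - b)\<^sup>2) \<le> sqrt (2 * (a + b)\<^sup>2)" by (rule real_sqrt_le_mono)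
  also have "\<dots> = sqrt 2 * (a + b)" using assms by (simp add: real_sqrt_mult)
  finally show "norm ((1 + \<i>) * of_real a + (1 - \<i>) * of_real b) \<le> sqrt 2 * (a + b)"
    unfolding n .
qed

text \<open>The cross-ratio condition bounds the projective diameter of the image of the cone by \<open>2 ln \<Gamma>\<close>.\<close>

definition cone_step :: "'x functional set \<Rightarrow> 'x functional set \<Rightarrow> (('x \<Rightarrow> real) \<Rightarrow> 'x \<Rightarrow> real) \<Rightarrow> real \<Rightarrow> bool" where
  "cone_step S S' L \<Gamma> \<longleftrightarrow> 1 \<le> \<Gamma> \<and> (\<forall>p\<in>fcone S. L p \<in> fcone S') \<and>
     (\<forall>p\<in>fcone S. \<forall>q\<in>fcone S. \<forall>l\<in>S'. \<forall>m\<in>S'. feval l (L p) * feval m (L q) \<le> \<Gamma>\<^sup>2 * (feval l (L q) * feval m (L p)))"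

text \<open>Birkhoff contraction without the projective metric. Either every functional sees a fixed
  share of the gap in the image of p - a q, and the lower coefficient rises; or one functional sees
  little of it, and the cross-ratio bound transports this smallness to all others, so the upper
  coefficient falls.\<close>

lemma cone_step_contracts:
  assumes step: "cone_step S S' L \<Gamma>"
    and lin: "\<And>c d l. l \<in> S' \<Longrightarrow> feval l (L (\<lambda>x. c * p x + d * q x)) = c * feval l (L p) + d * feval l (L q)"
    and low: "(\<lambda>x. p x - a * q x) \<in> fcone S" and up: "(\<lambda>x. b * q x - p x) \<in> fcone S"
    and q: "q \<in> fcone S" and ab: "a \<le> b"
  shows "\<exists>a' b'. a \<le> a' \<and> a' \<le> b' \<and> b' \<le> b \<and> b' - a' \<le> (1 - 1 / (1 + \<Gamma>)) * (b - a) \<and>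
    (\<lambda>x. L p x - a' * L q x) \<in> fcone S' \<and> (\<lambda>x. b' * L q x - L p x) \<in> fcone S'"
proof -
  \<comment> \<open>The share 1 / (1 + \<Gamma>) is balanced:
    \<open>1 - \<delta> = \<Gamma> * \<delta>\<close> makes both alternatives gain the same
    amount.\<close>
  define \<delta> where "\<delta> = 1 / (1 + \<Gamma>)"
  have \<Gamma>: "1 \<le> \<Gamma>" using step by (simp add: cone_step_def)
  have \<delta>: "0 < \<delta>" "\<delta> \<le> 1/2" using \<Gamma> by (auto simp: \<delta>_def field_simps)
  let ?P = "L (\<lambda>x. p x - a * q x)" and ?Q = "L (\<lambda>x. b * q x - p x)"
  have evP: "feval l ?P = feval l (L p) - a * feval l (L q)" and evQ: "feval l ?Q = b * feval l (L q) - feval l (L p)" if "l \<in> S'" for l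
    using lin[OF that, of 1 "- a"] lin[OF that, of "-1" b] by (simp_all add: algebra_simps)
  have P0: "0 \<le> feval l ?P" and Q0: "0 \<le> feval l ?Q" and G0: "0 \<le> feval l (L q)" if "l \<in> S'" for l
    using step low up q that by (auto simp: cone_step_def intro: fconeD)
  have bd: "\<delta> * (b - a) \<le> b - a" "0 \<le> \<delta> * (b - a)" using mult_right_mono[of \<delta> 1 "b - a"] \<delta> ab by auto
  show ?thesis
  proof (cases "\<forall>m\<in>S'. \<delta> * (b - a) * feval m (L q) \<le> feval m ?P")
    case True
    have "(\<lambda>x. L p x - (a + \<delta> * (b - a)) * L q x) \<in> fcone S'"
      unfolding diff_mult_mem_fcone using True by (simp add: evP algebra_simps)
    moreover have "(\<lambda>x. b * L q x - L p x) \<in> fcone S'"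
      using Q0 by (auto simp: mult_diff_mem_fcone evQ)
    ultimately show ?thesis
      by (intro exI[of _ "a + \<delta> * (b - a)"] exI[of _ b]) (use bd in \<open>auto simp: \<delta>_def algebra_simps\<close>)
  next
    case False
    then obtain m where m: "m \<in> S'" "feval m ?P < \<delta> * (b - a) * feval m (L q)" by (auto simp: not_le)
    define G where "G = (b - a) * feval m (L q)"
    have "0 < \<delta> * G" using m P0[OF m(1)] by (simp add: G_def mult.assoc)
    then have G: "0 < G" using \<delta> by (simp add: zero_less_mult_iff)
    \<comment> \<open>The images of p - a q and b q - p add up to the gap at every functional, so m,
      which sees little of the first, sees most of the second.\<close>
    have Qm: "(1 - \<delta>) * G \<le> feval m ?Q" using m unfolding evP[OF m(1)] evQ[OF m(1)] G_def by (simp add: algebra_simps)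
    have bound: "feval l ?P \<le> (1 - \<delta>) * (b - a) * feval l (L q)" if l: "l \<in> S'" for l
    proof -
      have "feval l ?P * ((1 - \<delta>) * G) \<le> feval l ?P * feval m ?Q" using Qm P0[OF l] by (rule mult_left_mono)
      also have "\<dots> \<le> \<Gamma>\<^sup>2 * (feval l ?Q * feval m ?P)"
        using step low up l m by (auto simp: cone_step_def)
      also have "\<dots> \<le> \<Gamma>\<^sup>2 * (feval l ?Q * (\<delta> * G))"
        using m Q0[OF l] by (intro mult_left_mono) (auto simp: G_def mult.assoc)
      finally have "feval l ?P * (1 - \<delta>) * G \<le> \<Gamma>\<^sup>2 * feval l ?Q * \<delta> * G" by (simp add: mult_ac)
      then have "feval l ?P * (1 - \<delta>) \<le> \<Gamma>\<^sup>2 * feval l ?Q * \<delta>" using G by simp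
      moreover have "1 - \<delta> = \<Gamma> * \<delta>" using \<Gamma> by (simp add: \<delta>_def field_simps)
      ultimately have "feval l ?P * \<Gamma> * \<delta> \<le> \<Gamma> * feval l ?Q * \<Gamma> * \<delta>" by (simp add: power2_eq_square mult_ac)
      then have "feval l ?P \<le> \<Gamma> * feval l ?Q" using \<delta> \<Gamma> by (simp add: mult_ac)
      then have "feval l ?P * (1 + \<Gamma>) \<le> \<Gamma> * (feval l ?P + feval l ?Q)" by (simp add: algebra_simps)
      also have "feval l ?P + feval l ?Q = (b - a) * feval l (L q)" unfolding evP[OF l] evQ[OF l] by (simp add: algebra_simps)
      finally have "feval l ?P * (1 + \<Gamma>) * \<delta> \<le> \<Gamma> * ((b - a) * feval l (L q)) * \<delta>" using \<delta> by (intro mult_right_mono) auto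
      moreover have "(1 + \<Gamma>) * \<delta> = 1" using \<Gamma> by (simp add: \<delta>_def)
      ultimately have "feval l ?P * 1 \<le> \<Gamma> * ((b - a) * feval l (L q)) * \<delta>" by (metis mult.assoc)
      then show ?thesis using \<open>1 - \<delta> = \<Gamma> * \<delta>\<close> by (simp add: mult_ac)
    qed
    let ?b = "a + (1 - \<delta>) * (b - a)"
    have "(\<lambda>x. ?b * L q x - L p x) \<in> fcone S'"
      unfolding mult_diff_mem_fcone using bound by (simp add: evP algebra_simps)
    moreover have "(\<lambda>x. L p x - a * L q x) \<in> fcone S'"
      using P0 by (auto simp: diff_mult_mem_fcone evP)
    ultimately show ?thesis
      by (intro exI[of _ a] exI[of _ ?b]) (use bd in \<open>auto simp: \<delta>_def[symmetric] algebra_simps\<close>)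
  qed
qed

section \<open>Transfer operators of branched maps\<close>

text \<open>Closed sets form an intersection-stable generator. The indicator of a closed A is the
  limit of max (0, 1 - n dist (x, A)); these functions are Lipschitz, hence \<alpha>-Hoelder because
  distances and \<alpha> are at most 1.\<close>

lemma finite_measures_eqI_Holder:
  fixes X :: "'x::metric_space set"
  assumes X: "closed X" and diam: "\<And>x x'. x \<in> X \<Longrightarrow> x' \<in> X \<Longrightarrow> dist x x' \<le> 1" and \<alpha>: "0 < \<alpha>" "\<alpha> \<le> 1"
    and fin: "finite_measure M" "finite_measure N"
    and sets: "sets M = sets (restrict_space borel X)" "sets N = sets (restrict_space borel X)"
    and eq: "\<And>g. holder_space \<alpha> X g \<Longrightarrow> (\<And>x. 0 \<le> g x) \<Longrightarrow> integral\<^sup>L M g = integral\<^sup>L N g"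
  shows "M = N"
proof (rule measure_eqI_generator_eq)
  interpret M: finite_measure M by fact
  interpret N: finite_measure N by fact
  let ?E = "(\<inter>) X ` Collect closed"
  have spM: "space M = X" and spN: "space N = X"
    using sets[THEN sets_eq_imp_space_eq] by (simp_all add: space_restrict_space)
  have gen: "sets (restrict_space borel X) = sigma_sets X ?E"
  proof -
    have "sets (restrict_space borel X) = (\<inter>) X ` sets borel" by (rule sets_restrict_space)
    also have "sets (borel :: 'x measure) = sigma_sets UNIV (Collect closed)"
      unfolding borel_eq_closed by (rule sets_measure_of) simp
    also have "(\<inter>) X ` sigma_sets UNIV (Collect closed) = sigma_sets X ((\<inter>) X ` Collect closed)"
      by (rule sigma_sets_Int) (use X in auto)
    finally show ?thesis .
  qed
  show "sets M = sigma_sets X ?E" "sets N = sigma_sets X ?E" using sets gen by auto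
  show "Int_stable ?E"
  proof (rule Int_stableI)
    fix a b assume "a \<in> ?E" "b \<in> ?E"
    then obtain F G where "closed F" "a = X \<inter> F" "closed G" "b = X \<inter> G" by auto
    then have "a \<inter> b = X \<inter> (F \<inter> G)" "closed (F \<inter> G)" by auto
    then show "a \<inter> b \<in> ?E" by blast
  qed
  show "?E \<subseteq> Pow X" by auto
  show "range (\<lambda>_::nat. X) \<subseteq> ?E" by (auto intro!: image_eqI[of _ _ UNIV])
  show "(\<Union>i::nat. X) = X" by simp
  show "emeasure M X \<noteq> \<infinity>" for i :: nat using M.emeasure_finite by simp
  fix A assume "A \<in> ?E"
  then obtain F0 where "closed F0" "A = X \<inter> F0" by auto
  then have A: "closed A" "A \<subseteq> X" using X by auto
  show "emeasure M A = emeasure N A"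
  \<comment> \<open>\<open>infdist\<close> to the empty set is 0 by convention, so the approximating
    functions would be constantly 1; this case is kept apart.\<close>
  proof (cases "A = {}")
    case False
    define g where "g n x = max 0 (1 - real n * infdist x A)" for n x
    have lip: "\<bar>g n x - g n z\<bar> \<le> real n * dist x z" for n x z
    proof -
      have "\<bar>g n x - g n z\<bar> \<le> \<bar>real n * infdist x A - real n * infdist z A\<bar>" by (auto simp: g_def)
      also have "\<dots> = real n * \<bar>infdist x A - infdist z A\<bar>"
        unfolding right_diff_distrib[symmetric] abs_mult by simp
      also have "\<dots> \<le> real n * dist x z" by (intro mult_left_mono infdist_triangle_abs) simp
      finally show ?thesis .
    qed
    have hol: "holder_space \<alpha> X (g n)" for n
      unfolding holder_space_def
    proof
      have "norm (g n x) \<le> 1" for x by (auto simp: g_def infdist_nonneg)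
      then show "bounded (g n ` X)" by (auto simp: bounded_iff)
      have "\<bar>g n x - g n z\<bar> \<le> real n * dist x z powr \<alpha>" if "x \<in> X" "z \<in> X" for x z
      proof -
        have "dist x z powr 1 \<le> dist x z powr \<alpha>"
          using diam[OF that] \<alpha> by (intro powr_mono') auto
        then show ?thesis using order_trans[OF lip[of n x z] mult_left_mono[of "dist x z" "dist x z powr \<alpha>" "real n"]] by simp
      qed
      then show "\<exists>C. \<forall>x\<in>X. \<forall>x'\<in>X. \<bar>g n x - g n x'\<bar> \<le> C * dist x x' powr \<alpha>" by blast
    qed
    have gm: "g n \<in> borel_measurable L" if "sets L = sets (restrict_space borel X)" for n L
    proof -
      have "g n \<in> borel_measurable borel" unfolding g_def[abs_def]
        by (intro borel_measurable_max borel_measurable_const borel_measurable_diff borel_measurable_times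
           borel_measurable_continuous_onI continuous_intros)
      then have "g n \<in> borel_measurable (restrict_space borel X)" by (rule measurable_restrict_space1)
      then show ?thesis using that measurable_cong_sets by blast
    qed
    have lim: "(\<lambda>n. integral\<^sup>L L (g n)) \<longlonglongrightarrow> measure L A"
      if L: "finite_measure L" and s: "sets L = sets (restrict_space borel X)" for L
    proof -
      interpret L: finite_measure L by fact
      have As: "A \<in> sets L" using s A \<open>closed A\<close> by (auto simp: sets_restrict_space intro!: image_eqI[of _ _ A])
      have "(\<lambda>n. integral\<^sup>L L (g n)) \<longlonglongrightarrow> integral\<^sup>L L (indicator A)"
      proof (rule integral_dominated_convergence)
        show "integrable L (\<lambda>_. 1::real)" by simp
        show "AE x in L. (\<lambda>n. g n x) \<longlonglongrightarrow> indicator A x"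
        proof (rule AE_I2)
          fix x
          show "(\<lambda>n. g n x) \<longlonglongrightarrow> indicator A x"
          proof (cases "x \<in> A")
            case True
            then show ?thesis by (simp add: g_def)
          next
            case n: False
            then have pos: "0 < infdist x A" using in_closed_iff_infdist_zero[OF A(1) False] infdist_nonneg[of x A]
              by (metis less_eq_real_def)
            then have "eventually (\<lambda>n. 1 - real n * infdist x A \<le> 0) sequentially"
              by real_asymp
            then have "eventually (\<lambda>n. g n x = indicator A x) sequentially"
              by eventually_elim (use n in \<open>auto simp: g_def\<close>)
            then show ?thesis by (rule tendsto_eventually)
          qed
        qed
        show "AE x in L. norm (g n x) \<le> 1" for n by (rule AE_I2) (auto simp: g_def infdist_nonneg)
        show "g n \<in> borel_measurable L" for n by (rule gm[OF s])
        show "indicat_real A \<in> borel_measurable L" using As by simp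
      qed
      moreover have "integral\<^sup>L L (indicat_real A) = measure L A" using As by simp
      ultimately show ?thesis by simp
    qed
    have "integral\<^sup>L M (g n) = integral\<^sup>L N (g n)" for n by (rule eq[OF hol]) (simp add: g_def)
    with lim[OF fin(1) sets(1)] lim[OF fin(2) sets(2)] have "measure M A = measure N A"
      using LIMSEQ_unique by fastforce
    then show ?thesis by (simp add: M.emeasure_eq_measure N.emeasure_eq_measure)
  qed simp
qed

lemma continuous_on_Holder:
  fixes f :: "'a::metric_space \<Rightarrow> 'b::metric_space"
  assumes "0 < \<alpha>" and f: "\<And>x x'. x \<in> X \<Longrightarrow> x' \<in> X \<Longrightarrow> dist (f x) (f x') \<le> C * dist x x' powr \<alpha>"
  shows "continuous_on X f"
  unfolding continuous_on_def tendsto_dist_iff[of f]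
proof
  fix x assume x: "x \<in> X"
  have "((\<lambda>z. C * dist z x powr \<alpha>) \<longlongrightarrow> C * dist x x powr \<alpha>) (at x within X)"
    using \<open>0 < \<alpha>\<close> by (intro tendsto_intros) auto
  then have "((\<lambda>z. C * dist z x powr \<alpha>) \<longlongrightarrow> 0) (at x within X)" by simp
  then show "((\<lambda>z. dist (f z) (f x)) \<longlongrightarrow> 0) (at x within X)"
    by (rule Lim_null_comparison[rotated]) (use f x in \<open>auto simp: eventually_at_filter\<close>)
qed

lemma holder_space_bounded: "holder_space \<alpha> X g \<Longrightarrow> \<exists>b. \<forall>z\<in>X. \<bar>g z\<bar> \<le> b"
  by (auto simp: holder_space_def bounded_iff)

lemma holder_space_measurable:
  assumes "0 < \<alpha>" "holder_space \<alpha> X g"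
  shows "g \<in> borel_measurable (restrict_space borel X)"
proof -
  obtain C where "\<And>x x'. x \<in> X \<Longrightarrow> x' \<in> X \<Longrightarrow> \<bar>g x - g x'\<bar> \<le> C * dist x x' powr \<alpha>"
    using assms(2) by (auto simp: holder_space_def)
  then show ?thesis
    by (intro borel_measurable_continuous_on_restrict continuous_on_Holder[OF assms(1), of X g C]) (simp add: dist_real_def)
qed

section \<open>The transfer operator of a single fibre map\<close>

definition transfer :: "'x set \<Rightarrow> ('x \<Rightarrow> 'x) \<Rightarrow> ('x \<Rightarrow> real) \<Rightarrow> ('x \<Rightarrow> real) \<Rightarrow> 'x \<Rightarrow> real" where
  "transfer X T \<phi> g x = (\<Sum>\<^sub>\<infinity>z\<in>{z \<in> X. T z = x}. exp (\<phi> z) * g z)"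

lemma Lop_eq_transfer: "Lop E T \<phi> \<omega> = transfer (fib E \<omega>) (T \<omega>) (\<phi> \<omega>)"
  by (simp add: fun_eq_iff Lop_def transfer_def)

lemma transfer_cong: "(\<And>z. z \<in> X \<Longrightarrow> f z = g z) \<Longrightarrow> transfer X T \<phi> f x = transfer X T \<phi> g x"
  unfolding transfer_def by (intro infsum_cong) auto

text \<open>One fibre map with its inverse branches, as both settings see it. The index set may be
  infinite, hence the summability clause and the bound \<open>Db\<close>; continuity of the branches
  and of \<phi> along them supplies measurability.\<close>

locale branched_map =
  fixes X X' :: "'x::metric_space set" and T :: "'x \<Rightarrow> 'x" and \<phi> :: "'x \<Rightarrow> real"
    and I :: "nat set" and y :: "nat \<Rightarrow> 'x \<Rightarrow> 'x" and Db :: real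
  assumes compact: "compact X" "compact X'" and nonempty: "X' \<noteq> {}"
    and T_measurable: "T \<in> measurable (restrict_space borel X) (restrict_space borel X')"
    and branches: "\<And>x. x \<in> X' \<Longrightarrow> bij_betw (\<lambda>i. y i x) I {z \<in> X. T z = x}"
    and cont_y: "\<And>i. i \<in> I \<Longrightarrow> continuous_on X' (y i)"
    and cont_\<phi>: "\<And>i. i \<in> I \<Longrightarrow> continuous_on X' (\<lambda>x. \<phi> (y i x))"
    and summable: "\<And>x. x \<in> X' \<Longrightarrow> (\<lambda>z. exp (\<phi> z)) summable_on {z \<in> X. T z = x}"
    and sum_le: "\<And>x. x \<in> X' \<Longrightarrow> (\<Sum>\<^sub>\<infinity>z\<in>{z \<in> X. T z = x}. exp (\<phi> z)) \<le> Db"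
begin

abbreviation L where "L \<equiv> transfer X T \<phi>"

lemma y_mem: "x \<in> X' \<Longrightarrow> i \<in> I \<Longrightarrow> y i x \<in> X"
  using branches[of x] by (auto simp: bij_betw_def)

lemma T_mem: "x \<in> X \<Longrightarrow> T x \<in> X'"
  using measurable_space[OF T_measurable, of x] by (simp add: space_restrict_space)

lemma transfer_eq: "x \<in> X' \<Longrightarrow> L g x = (\<Sum>\<^sub>\<infinity>i\<in>I. exp (\<phi> (y i x)) * g (y i x))"
  unfolding transfer_def using infsum_reindex_bij_betw[OF branches, of x "\<lambda>z. exp (\<phi> z) * g z"] by simp

lemma summable_weights: "x \<in> X' \<Longrightarrow> (\<lambda>i. exp (\<phi> (y i x))) summable_on I"
  using summable_on_reindex_bij_betw[OF branches, of x "\<lambda>z. exp (\<phi> z)"] summable by simp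

lemma summable_weighted:
  assumes "x \<in> X'" "\<And>z. z \<in> X \<Longrightarrow> \<bar>g z\<bar> \<le> b"
  shows "(\<lambda>i. norm (exp (\<phi> (y i x)) * g (y i x))) summable_on I" "(\<lambda>i. exp (\<phi> (y i x)) * g (y i x)) summable_on I"
proof -
  show "(\<lambda>i. norm (exp (\<phi> (y i x)) * g (y i x))) summable_on I"
  proof (rule Infinite_Sum.abs_summable_on_comparison_test)
    show "(\<lambda>i. norm (exp (\<phi> (y i x)) * b)) summable_on I"
      using summable_on_cmult_left[OF summable_weights[OF assms(1)], of "\<bar>b\<bar>"] by (simp add: abs_mult)
    show "norm (exp (\<phi> (y i x)) * g (y i x)) \<le> norm (exp (\<phi> (y i x)) * b)" if "i \<in> I" for i
      using assms(2)[OF y_mem[OF assms(1) that]] by (simp add: abs_mult)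
  qed
  then show "(\<lambda>i. exp (\<phi> (y i x)) * g (y i x)) summable_on I" by (rule abs_summable_summable)
qed

lemma transfer_linear:
  assumes "x \<in> X'" "\<And>z. z \<in> X \<Longrightarrow> \<bar>f z\<bar> \<le> b" "\<And>z. z \<in> X \<Longrightarrow> \<bar>g z\<bar> \<le> b'"
  shows "L (\<lambda>z. c * f z + d * g z) x = c * L f x + d * L g x"
proof -
  have "L (\<lambda>z. c * f z + d * g z) x = (\<Sum>\<^sub>\<infinity>i\<in>I. c * (exp (\<phi> (y i x)) * f (y i x)) + d * (exp (\<phi> (y i x)) * g (y i x)))"
    unfolding transfer_eq[OF assms(1)] by (intro infsum_cong) (simp add: algebra_simps)
  also have "\<dots> = c * L f x + d * L g x"
    unfolding transfer_eq[OF assms(1)]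
    by (subst infsum_add) (auto intro!: summable_on_cmult_right summable_weighted[OF assms(1)] assms simp: infsum_cmult_right')
  finally show ?thesis .
qed

lemma transfer_mono:
  assumes "x \<in> X'" "\<And>z. z \<in> X \<Longrightarrow> \<bar>f z\<bar> \<le> b" "\<And>z. z \<in> X \<Longrightarrow> \<bar>g z\<bar> \<le> b'" "\<And>z. z \<in> X \<Longrightarrow> f z \<le> g z"
  shows "L f x \<le> L g x"
  unfolding transfer_eq[OF assms(1)]
  using assms y_mem by (intro infsum_mono summable_weighted[OF assms(1)]) auto

lemma transfer_nonneg: "x \<in> X' \<Longrightarrow> (\<And>z. z \<in> X \<Longrightarrow> 0 \<le> g z) \<Longrightarrow> 0 \<le> L g x"
  unfolding transfer_def by (intro infsum_nonneg) auto

lemma transfer_one_le: "x \<in> X' \<Longrightarrow> L (\<lambda>_. 1) x \<le> Db"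
  using sum_le by (simp add: transfer_def)

lemma transfer_scale: "L (\<lambda>z. c * g z) x = c * L g x"
proof -
  have "L (\<lambda>z. c * g z) x = (\<Sum>\<^sub>\<infinity>z\<in>{z \<in> X. T z = x}. c * (exp (\<phi> z) * g z))"
    unfolding transfer_def by (intro infsum_cong) auto
  then show ?thesis unfolding transfer_def infsum_cmult_right' .
qed

lemma abs_transfer_le:
  assumes "x \<in> X'" "\<And>z. z \<in> X \<Longrightarrow> \<bar>g z\<bar> \<le> b"
  shows "\<bar>L g x\<bar> \<le> b * L (\<lambda>_. 1) x"
proof -
  have g: "g z \<le> b" "- b \<le> g z" if "z \<in> X" for z using assms(2)[OF that] by auto
  have "L g x \<le> L (\<lambda>_. b * 1) x"
    by (rule transfer_mono[OF assms, where b'="\<bar>b\<bar>"]) (use g in auto)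
  moreover have "L (\<lambda>_. (- b) * 1) x \<le> L g x"
    by (rule transfer_mono[OF assms(1) _ assms(2), where b="\<bar>b\<bar>"]) (use g in auto)
  ultimately show ?thesis unfolding transfer_scale by auto
qed

lemma transfer_pos:
  assumes "x \<in> X'" "I \<noteq> {}" "\<And>z. z \<in> X \<Longrightarrow> \<bar>g z\<bar> \<le> b" "\<And>z. z \<in> X \<Longrightarrow> 0 < g z"
  shows "0 < L g x"
proof -
  obtain i where i: "i \<in> I" using assms(2) by auto
  have "0 < exp (\<phi> (y i x)) * g (y i x)" using assms(4)[OF y_mem[OF assms(1) i]] by simp
  also have "\<dots> = (\<Sum>\<^sub>\<infinity>j\<in>{i}. exp (\<phi> (y j x)) * g (y j x))" by simp
  also have "\<dots> \<le> (\<Sum>\<^sub>\<infinity>j\<in>I. exp (\<phi> (y j x)) * g (y j x))"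
  proof (rule infsum_mono2)
    show "(\<lambda>j. exp (\<phi> (y j x)) * g (y j x)) summable_on I" by (rule summable_weighted(2)[OF assms(1,3)])
    show "0 \<le> exp (\<phi> (y j x)) * g (y j x)" if "j \<in> I - {i}" for j
      using assms(4)[OF y_mem[OF assms(1)], of j] that by simp
  qed (use i in auto)
  finally show ?thesis unfolding transfer_eq[OF assms(1)] .
qed

lemma measurable_branch: "i \<in> I \<Longrightarrow> y i \<in> measurable (restrict_space borel X') (restrict_space borel X)"
  by (intro measurable_restrict_space2 borel_measurable_continuous_on_restrict cont_y)
     (auto simp: space_restrict_space y_mem)

lemma measurable_weight: "i \<in> I \<Longrightarrow> (\<lambda>x. exp (\<phi> (y i x))) \<in> borel_measurable (restrict_space borel X')"
  by (intro borel_measurable_continuous_on_restrict continuous_intros cont_\<phi>)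

text \<open>Bridge from \<open>infsum\<close> to a nonnegative integral over counting measure, where
  Tonelli and measurability in a parameter are available.\<close>

lemma ennreal_transfer_eq:
  assumes "x \<in> X'" "\<And>z. z \<in> X \<Longrightarrow> 0 \<le> g z" "\<And>z. z \<in> X \<Longrightarrow> g z \<le> b"
  shows "ennreal (L g x) = (\<integral>\<^sup>+ i. ennreal (exp (\<phi> (y i x)) * g (y i x)) \<partial>count_space I)"
proof -
  have ab: "\<bar>g z\<bar> \<le> b" if "z \<in> X" for z using assms that by auto
  have s: "(\<lambda>i. norm (exp (\<phi> (y i x)) * g (y i x))) summable_on I" by (rule summable_weighted(1)[OF assms(1) ab])
  have s': "integrable (count_space I) (\<lambda>i. exp (\<phi> (y i x)) * g (y i x))"
    using abs_summable_equivalent[THEN iffD1, OF s] unfolding abs_summable_on_def .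
  have "(\<integral>\<^sup>+ i. ennreal (exp (\<phi> (y i x)) * g (y i x)) \<partial>count_space I)
      = ennreal (integral\<^sup>L (count_space I) (\<lambda>i. exp (\<phi> (y i x)) * g (y i x)))"
    by (rule nn_integral_eq_integral[OF s']) (use assms y_mem in \<open>auto simp: AE_count_space\<close>)
  also have "integral\<^sup>L (count_space I) (\<lambda>i. exp (\<phi> (y i x)) * g (y i x)) = L g x"
    unfolding transfer_eq[OF assms(1)] using infsetsum_infsum[OF abs_summable_equivalent[THEN iffD1, OF s]] by (simp add: infsetsum_def)
  finally show ?thesis by simp
qed

lemma measurable_weighted_pair:
  assumes "sets \<nu>' = sets (restrict_space borel X')" "g \<in> borel_measurable (restrict_space borel X)"
  shows "(\<lambda>(i, x). ennreal (exp (\<phi> (y i x)) * g (y i x))) \<in> borel_measurable (count_space I \<Otimes>\<^sub>M \<nu>')"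
proof (rule measurable_pair_measure_countable1)
  fix i assume i: "i \<in> I"
  have "(\<lambda>x. exp (\<phi> (y i x)) * g (y i x)) \<in> borel_measurable (restrict_space borel X')"
    by (intro borel_measurable_times measurable_weight[OF i] measurable_compose[OF measurable_branch[OF i] assms(2)])
  then show "(\<lambda>x. case (i, x) of (i, x) \<Rightarrow> ennreal (exp (\<phi> (y i x)) * g (y i x))) \<in> borel_measurable \<nu>'"
    using measurable_compose[OF _ measurable_ennreal] by (simp add: measurable_cong_sets[OF assms(1) refl])
qed simp

lemma measurable_transfer_nonneg:
  assumes g: "g \<in> borel_measurable (restrict_space borel X)" "\<And>z. z \<in> X \<Longrightarrow> 0 \<le> g z" "\<And>z. z \<in> X \<Longrightarrow> g z \<le> b"
  shows "L g \<in> borel_measurable (restrict_space borel X')"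
proof -
  interpret C: sigma_finite_measure "count_space I" by (rule sigma_finite_measure_count_space_countable) simp
  have "(\<lambda>(i, x). ennreal (exp (\<phi> (y i x)) * g (y i x))) \<in> borel_measurable (count_space I \<Otimes>\<^sub>M restrict_space borel X')"
    by (rule measurable_weighted_pair[OF refl g(1)])
  then have "(\<lambda>(x, i). ennreal (exp (\<phi> (y i x)) * g (y i x))) \<in> borel_measurable (restrict_space borel X' \<Otimes>\<^sub>M count_space I)"
    by (subst measurable_pair_swap_iff) (simp add: split_beta')
  then have "(\<lambda>x. enn2real (\<integral>\<^sup>+ i. ennreal (exp (\<phi> (y i x)) * g (y i x)) \<partial>count_space I)) \<in> borel_measurable (restrict_space borel X')"
    by (intro borel_measurable_enn2real C.borel_measurable_nn_integral)
  moreover have "L g x = enn2real (\<integral>\<^sup>+ i. ennreal (exp (\<phi> (y i x)) * g (y i x)) \<partial>count_space I)" if "x \<in> X'" for x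
    using ennreal_transfer_eq[of x g b, symmetric] transfer_nonneg[OF that, of g] g(2,3) that by simp
  ultimately show ?thesis
    by (subst measurable_cong[where g="\<lambda>x. enn2real (\<integral>\<^sup>+ i. ennreal (exp (\<phi> (y i x)) * g (y i x)) \<partial>count_space I)"])
       (auto simp: space_restrict_space)
qed

text \<open>Reduces bounded functions to nonnegative ones, to which the extended-real formula
  applies.\<close>

lemma transfer_shift:
  assumes "x \<in> X'" "\<And>z. z \<in> X \<Longrightarrow> \<bar>g z\<bar> \<le> b"
  shows "L g x = L (\<lambda>z. g z + b) x - b * L (\<lambda>_. 1) x"
proof -
  have "L (\<lambda>z. 1 * g z + b * 1) x = 1 * L g x + b * L (\<lambda>_. 1) x"
    by (rule transfer_linear[OF assms, where b'=1]) auto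
  then show ?thesis by simp
qed

lemma measurable_transfer:
  assumes g: "g \<in> borel_measurable (restrict_space borel X)" "\<And>z. z \<in> X \<Longrightarrow> \<bar>g z\<bar> \<le> b"
  shows "L g \<in> borel_measurable (restrict_space borel X')"
proof -
  have 1: "L (\<lambda>z. g z + b) \<in> borel_measurable (restrict_space borel X')"
    using g by (intro measurable_transfer_nonneg[where b="2 * b"]) (force simp: abs_le_iff)+
  have 2: "L (\<lambda>_. 1) \<in> borel_measurable (restrict_space borel X')"
    by (intro measurable_transfer_nonneg[where b=1]) auto
  have "(\<lambda>x. L (\<lambda>z. g z + b) x - b * L (\<lambda>_. 1) x) \<in> borel_measurable (restrict_space borel X')"
    using 1 2 by simp
  moreover have "L g x = L (\<lambda>z. g z + b) x - b * L (\<lambda>_. 1) x" if "x \<in> space (restrict_space borel X')" for x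
    using that g(2) by (intro transfer_shift) (auto simp: space_restrict_space)
  ultimately show ?thesis by (simp cong: measurable_cong)
qed

end

text \<open>The eigenmeasure relation \<open>\<integral> L g d\<nu>' = c \<integral> g d\<nu>\<close> passes from Hoelder functions to bounded
  measurable ones because \<open>g \<mapsto> \<integral> L g d\<nu>'\<close> is itself integration against a finite measure.\<close>

locale conformal_map = branched_map +
  fixes \<nu> \<nu>' :: "'a measure" and c \<alpha> :: real
  assumes \<nu>: "prob_space \<nu>" "sets \<nu> = sets (restrict_space borel X)"
    and \<nu>': "prob_space \<nu>'" "sets \<nu>' = sets (restrict_space borel X')"
    and diam: "\<And>x x'. x \<in> X \<Longrightarrow> x' \<in> X \<Longrightarrow> dist x x' \<le> 1" and \<alpha>: "0 < \<alpha>" "\<alpha> \<le> 1" and c: "0 \<le> c"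
    and conformal_Holder: "\<And>g. holder_space \<alpha> X g \<Longrightarrow> integral\<^sup>L \<nu>' (L g) = c * integral\<^sup>L \<nu> g"
begin

lemma space_\<nu>: "space \<nu> = X" and space_\<nu>': "space \<nu>' = X'"
  using \<nu>(2) \<nu>'(2) by (auto dest!: sets_eq_imp_space_eq simp: space_restrict_space)

lemma measurable_\<nu>: "borel_measurable \<nu> = borel_measurable (restrict_space borel X)"
  and measurable_\<nu>': "borel_measurable \<nu>' = borel_measurable (restrict_space borel X')"
  using \<nu>(2) \<nu>'(2) measurable_cong_sets by blast+

lemma integrable_transfer:
  assumes g: "g \<in> borel_measurable (restrict_space borel X)" "\<And>z. z \<in> X \<Longrightarrow> \<bar>g z\<bar> \<le> b"
  shows "integrable \<nu>' (L g)"
proof -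
  interpret \<nu>': prob_space \<nu>' by (rule \<nu>')
  obtain x0 where x0: "x0 \<in> X'" using nonempty by auto
  have b: "0 \<le> b" if "X \<noteq> {}" using that g(2) by (meson abs_ge_zero ex_in_conv order_trans)
  have "\<bar>L g x\<bar> \<le> \<bar>b\<bar> * Db" if "x \<in> X'" for x
  proof -
    have "\<bar>L g x\<bar> \<le> \<bar>b\<bar> * L (\<lambda>_. 1) x"
      by (rule abs_transfer_le[OF that]) (use g(2) in force)
    also have "\<dots> \<le> \<bar>b\<bar> * Db" by (intro mult_left_mono transfer_one_le that) auto
    finally show ?thesis .
  qed
  then show ?thesis
    by (intro \<nu>'.integrable_const_bound[where B="\<bar>b\<bar> * Db"])
       (use measurable_transfer[OF g] in \<open>auto simp: measurable_\<nu>' space_\<nu>'\<close>)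
qed

text \<open>The dual measure is realised concretely: weight the product of counting measure and
  \<nu>' by exp \<phi> and push it forward along the branches. Tonelli identifies integration
  against it with the \<nu>'-integral of L g; agreement with c \<nu> on Hoelder functions makes the
  two measures equal.\<close>

lemma nn_conformal:
  assumes g: "g \<in> borel_measurable (restrict_space borel X)" "\<And>z. z \<in> X \<Longrightarrow> 0 \<le> g z" "\<And>z. z \<in> X \<Longrightarrow> g z \<le> b"
  shows "(\<integral>\<^sup>+x. ennreal (L g x) \<partial>\<nu>') = ennreal c * (\<integral>\<^sup>+x. ennreal (g x) \<partial>\<nu>)"
proof -
  interpret \<nu>: prob_space \<nu> by (rule \<nu>)
  interpret \<nu>': prob_space \<nu>' by (rule \<nu>')
  interpret C: sigma_finite_measure "count_space I" by (rule sigma_finite_measure_count_space_countable) simp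
  interpret P: pair_sigma_finite "count_space I" \<nu>' ..
  \<comment> \<open>The factor 1 matches the shape of \<open>measurable_weighted_pair\<close> for a
    constant function.\<close>
  define w where "w = (\<lambda>(i, x). ennreal (exp (\<phi> (y i x)) * 1))"
  have wm[measurable]: "w \<in> borel_measurable (count_space I \<Otimes>\<^sub>M \<nu>')"
    unfolding w_def by (rule measurable_weighted_pair[OF \<nu>'(2)]) simp
  have ym[measurable]: "(\<lambda>(i, x). y i x) \<in> measurable (count_space I \<Otimes>\<^sub>M \<nu>') (restrict_space borel X)"
    by (rule measurable_pair_measure_countable1)
       (use measurable_branch measurable_cong_sets[OF \<nu>'(2) refl] in auto)
  define m where "m = distr (density (count_space I \<Otimes>\<^sub>M \<nu>') w) (restrict_space borel X) (\<lambda>(i, x). y i x)"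
  have m_eq: "(\<integral>\<^sup>+z. ennreal (f z) \<partial>m) = (\<integral>\<^sup>+x. ennreal (L f x) \<partial>\<nu>')"
    if f[measurable]: "f \<in> borel_measurable (restrict_space borel X)" and f0: "\<And>z. z \<in> X \<Longrightarrow> 0 \<le> f z" and fb: "\<And>z. z \<in> X \<Longrightarrow> f z \<le> d" for f d
  proof -
    have "(\<integral>\<^sup>+z. ennreal (f z) \<partial>m) = (\<integral>\<^sup>+p. ennreal (f (case p of (i, x) \<Rightarrow> y i x)) \<partial>density (count_space I \<Otimes>\<^sub>M \<nu>') w)"
      unfolding m_def by (rule nn_integral_distr) simp_all
    also have "\<dots> = (\<integral>\<^sup>+p. w p * ennreal (f (case p of (i, x) \<Rightarrow> y i x)) \<partial>(count_space I \<Otimes>\<^sub>M \<nu>'))"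
      by (rule nn_integral_density) simp_all
    also have "\<dots> = (\<integral>\<^sup>+p. (case p of (i, x) \<Rightarrow> ennreal (exp (\<phi> (y i x)) * f (y i x))) \<partial>(count_space I \<Otimes>\<^sub>M \<nu>'))"
      by (intro nn_integral_cong) (auto simp: w_def space_pair_measure space_\<nu>' ennreal_mult'' f0 y_mem)
    also have "\<dots> = (\<integral>\<^sup>+x. (\<integral>\<^sup>+i. ennreal (exp (\<phi> (y i x)) * f (y i x)) \<partial>count_space I) \<partial>\<nu>')"
      using P.nn_integral_snd[OF measurable_weighted_pair[OF \<nu>'(2) f]] by simp
    also have "\<dots> = (\<integral>\<^sup>+x. ennreal (L f x) \<partial>\<nu>')"
      by (intro nn_integral_cong ennreal_transfer_eq[OF _ f0 fb, symmetric]) (auto simp: space_\<nu>')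
    finally show ?thesis .
  qed
  define m' where "m' = scale_measure (ennreal c) \<nu>"
  have setsm: "sets m = sets (restrict_space borel X)" "sets m' = sets (restrict_space borel X)"
    using \<nu>(2) by (simp_all add: m_def m'_def)
  have mX: "space m = X" "space m' = X" using setsm[THEN sets_eq_imp_space_eq] by (auto simp: space_restrict_space)
  have "emeasure m (space m) = (\<integral>\<^sup>+z. ennreal 1 \<partial>m)" by simp
  also have "\<dots> = (\<integral>\<^sup>+x. ennreal (L (\<lambda>_. 1) x) \<partial>\<nu>')" by (rule m_eq[of "\<lambda>_. 1" 1]) auto
  also have "\<dots> \<le> (\<integral>\<^sup>+x. ennreal Db \<partial>\<nu>')"
    by (intro nn_integral_mono) (auto simp: space_\<nu>' transfer_one_le ennreal_leI)
  also have "\<dots> < \<infinity>" by (simp add: \<nu>'.emeasure_space_1)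
  finally have finm: "finite_measure m" by (intro finite_measureI) auto
  have finm': "finite_measure m'"
    by (intro finite_measureI) (simp add: m'_def emeasure_scale_measure \<nu>.emeasure_space_1 space_scale_measure)
  have "m = m'"
  proof (rule finite_measures_eqI_Holder[OF compact_imp_closed[OF compact(1)] diam \<alpha> finm finm' setsm])
    fix f assume f: "holder_space \<alpha> X f" and f0: "\<And>x. 0 \<le> f x"
    note fm = holder_space_measurable[OF \<alpha>(1) f]
    obtain d where d: "\<And>z. z \<in> X \<Longrightarrow> \<bar>f z\<bar> \<le> d" using holder_space_bounded[OF f] by blast
    have fm': "f \<in> borel_measurable m" "f \<in> borel_measurable m'"
      using fm setsm measurable_cong_sets by blast+
    have "(\<integral>\<^sup>+z. ennreal (f z) \<partial>m) = (\<integral>\<^sup>+x. ennreal (L f x) \<partial>\<nu>')"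
      using f0 d by (intro m_eq[OF fm]) (force simp: abs_le_iff)+
    also have "\<dots> = ennreal (integral\<^sup>L \<nu>' (L f))"
      by (rule nn_integral_eq_integral[OF integrable_transfer[OF fm d]]) (auto simp: space_\<nu>' f0 intro!: AE_I2 transfer_nonneg)
    also have "\<dots> = ennreal c * ennreal (integral\<^sup>L \<nu> f)"
      unfolding conformal_Holder[OF f] using c f0 by (intro ennreal_mult) auto
    also have "ennreal (integral\<^sup>L \<nu> f) = (\<integral>\<^sup>+x. ennreal (f x) \<partial>\<nu>)"
      using f0 d fm by (intro nn_integral_eq_integral[symmetric] \<nu>.integrable_const_bound[where B=d])
        (auto simp: measurable_\<nu> space_\<nu> intro!: AE_I2)
    also have "ennreal c * (\<integral>\<^sup>+x. ennreal (f x) \<partial>\<nu>) = (\<integral>\<^sup>+x. ennreal (f x) \<partial>m')"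
      unfolding m'_def by (rule nn_integral_scale_measure[symmetric]) (use fm in \<open>simp add: measurable_\<nu>\<close>)
    finally show "integral\<^sup>L m f = integral\<^sup>L m' f"
      using fm' f0 by (subst (1 2) integral_eq_nn_integral) auto
  qed
  then have "(\<integral>\<^sup>+x. ennreal (L g x) \<partial>\<nu>') = (\<integral>\<^sup>+x. ennreal (g x) \<partial>m')"
    using m_eq[OF g] by simp
  also have "\<dots> = ennreal c * (\<integral>\<^sup>+x. ennreal (g x) \<partial>\<nu>)"
    unfolding m'_def by (rule nn_integral_scale_measure) (use g in \<open>simp add: measurable_\<nu>\<close>)
  finally show ?thesis .
qed

lemma conformal_nonneg:
  assumes g: "g \<in> borel_measurable (restrict_space borel X)" "\<And>z. z \<in> X \<Longrightarrow> 0 \<le> g z" "\<And>z. z \<in> X \<Longrightarrow> g z \<le> b"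
  shows "integral\<^sup>L \<nu>' (L g) = c * integral\<^sup>L \<nu> g"
proof -
  have gb: "\<bar>g z\<bar> \<le> b" if "z \<in> X" for z using g that by auto
  have "integral\<^sup>L \<nu>' (L g) = enn2real (\<integral>\<^sup>+x. ennreal (L g x) \<partial>\<nu>')"
    by (rule integral_eq_nn_integral)
       (use measurable_transfer[OF g(1) gb] in \<open>auto simp: measurable_\<nu>' space_\<nu>' g intro!: AE_I2 transfer_nonneg\<close>)
  also have "\<dots> = c * enn2real (\<integral>\<^sup>+x. ennreal (g x) \<partial>\<nu>)"
    using c by (simp add: nn_conformal[OF g] enn2real_mult)
  also have "enn2real (\<integral>\<^sup>+x. ennreal (g x) \<partial>\<nu>) = integral\<^sup>L \<nu> g"
    by (rule integral_eq_nn_integral[symmetric]) (use g in \<open>auto simp: measurable_\<nu> space_\<nu> intro!: AE_I2\<close>)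
  finally show ?thesis .
qed

lemma conformal:
  assumes g: "g \<in> borel_measurable (restrict_space borel X)" "\<And>z. z \<in> X \<Longrightarrow> \<bar>g z\<bar> \<le> b"
  shows "integral\<^sup>L \<nu>' (L g) = c * integral\<^sup>L \<nu> g"
proof -
  interpret \<nu>: prob_space \<nu> by (rule \<nu>)
  interpret \<nu>': prob_space \<nu>' by (rule \<nu>')
  have gb: "0 \<le> g z + b" "g z + b \<le> 2 * b" "\<bar>g z + b\<bar> \<le> 2 * b" if "z \<in> X" for z
    using g(2)[OF that] by auto
  have gm: "(\<lambda>z. g z + b) \<in> borel_measurable (restrict_space borel X)" using g by simp
  have "integral\<^sup>L \<nu>' (L g) = integral\<^sup>L \<nu>' (\<lambda>x. L (\<lambda>z. g z + b) x - b * L (\<lambda>_. 1) x)"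
    by (intro Bochner_Integration.integral_cong refl transfer_shift) (auto simp: space_\<nu>' g)
  also have "\<dots> = integral\<^sup>L \<nu>' (L (\<lambda>z. g z + b)) - b * integral\<^sup>L \<nu>' (L (\<lambda>_. 1))"
    using integrable_transfer[OF gm gb(3)] integrable_transfer[of "\<lambda>_. 1" 1] by simp
  also have "\<dots> = c * integral\<^sup>L \<nu> (\<lambda>z. g z + b) - b * (c * integral\<^sup>L \<nu> (\<lambda>_. 1))"
    using conformal_nonneg[OF gm gb(1,2)] conformal_nonneg[of "\<lambda>_. 1" 1] by simp
  also have "\<dots> = c * integral\<^sup>L \<nu> g"
  proof -
    have "integrable \<nu> g"
      by (rule \<nu>.integrable_const_bound[where B=b]) (use g in \<open>auto simp: measurable_\<nu> space_\<nu>\<close>)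
    then show ?thesis by (simp add: \<nu>.prob_space algebra_simps)
  qed
  finally show ?thesis .
qed

end

section \<open>Equivariant densities of a random transfer operator\<close>

text \<open>The interface through which the general theory sees a cone, shared by both settings:
  point evaluations belong to the functionals, values are comparable with constant K, elements are
  Hoelder, and there are enough of them, since every Hoelder function enters after adding a
  constant.\<close>

definition good_cone :: "'x::metric_space functional set \<Rightarrow> 'x set \<Rightarrow> real \<Rightarrow> real \<Rightarrow> bool" where
  "good_cone S X K \<alpha> \<longleftrightarrow>
     (\<forall>x\<in>X. [(1, x)] \<in> S) \<and> (\<forall>l\<in>S. snd ` set l \<subseteq> X) \<and>
     (\<forall>p\<in>fcone S. holder_space \<alpha> X p \<and> (\<forall>x\<in>X. \<forall>x'\<in>X. p x \<le> K * p x')) \<and>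
     (\<lambda>_. 1) \<in> fcone S \<and> (\<forall>g. holder_space \<alpha> X g \<longrightarrow> (\<exists>c. (\<lambda>x. g x + c) \<in> fcone S))"

lemma holder_space_cong: "(\<And>x. x \<in> X \<Longrightarrow> f x = g x) \<Longrightarrow> holder_space \<alpha> X f \<Longrightarrow> holder_space \<alpha> X g"
  unfolding holder_space_def by (auto simp: bounded_iff)

lemma holder_space_diff_scale:
  assumes "holder_space \<alpha> X f" "holder_space \<alpha> X g"
  shows "holder_space \<alpha> X (\<lambda>x. f x - c * g x)"
proof -
  obtain b b' where b: "\<And>z. z \<in> X \<Longrightarrow> \<bar>f z\<bar> \<le> b" "\<And>z. z \<in> X \<Longrightarrow> \<bar>g z\<bar> \<le> b'"
    using assms holder_space_bounded by metis
  obtain C C' where C: "\<And>x x'. x \<in> X \<Longrightarrow> x' \<in> X \<Longrightarrow> \<bar>f x - f x'\<bar> \<le> C * dist x x' powr \<alpha>"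
      "\<And>x x'. x \<in> X \<Longrightarrow> x' \<in> X \<Longrightarrow> \<bar>g x - g x'\<bar> \<le> C' * dist x x' powr \<alpha>"
    using assms unfolding holder_space_def by metis
  have "\<bar>f z - c * g z\<bar> \<le> b + \<bar>c\<bar> * b'" if "z \<in> X" for z
  proof -
    have "\<bar>f z - c * g z\<bar> \<le> \<bar>f z\<bar> + \<bar>c\<bar> * \<bar>g z\<bar>" unfolding abs_mult[symmetric] by (rule abs_triangle_ineq4)
    also have "\<dots> \<le> b + \<bar>c\<bar> * b'" using b[OF that] by (intro add_mono mult_left_mono) auto
    finally show ?thesis .
  qed
  moreover have "\<bar>(f x - c * g x) - (f x' - c * g x')\<bar> \<le> (C + \<bar>c\<bar> * C') * dist x x' powr \<alpha>" if "x \<in> X" "x' \<in> X" for x x'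
  proof -
    have "\<bar>(f x - c * g x) - (f x' - c * g x')\<bar> = \<bar>(f x - f x') - c * (g x - g x')\<bar>" by (simp add: algebra_simps)
    also have "\<dots> \<le> \<bar>f x - f x'\<bar> + \<bar>c\<bar> * \<bar>g x - g x'\<bar>" unfolding abs_mult[symmetric] by (rule abs_triangle_ineq4)
    also have "\<dots> \<le> C * dist x x' powr \<alpha> + \<bar>c\<bar> * (C' * dist x x' powr \<alpha>)"
      using C[OF that] by (intro add_mono mult_left_mono) auto
    finally show ?thesis by (simp add: algebra_simps)
  qed
  ultimately show ?thesis unfolding holder_space_def by (auto simp: bounded_iff)
qed

lemma good_coneD:
  assumes "good_cone S X K \<alpha>"
  shows "x \<in> X \<Longrightarrow> [(1, x)] \<in> S" "l \<in> S \<Longrightarrow> z \<in> snd ` set l \<Longrightarrow> z \<in> X"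
    "p \<in> fcone S \<Longrightarrow> holder_space \<alpha> X p" "p \<in> fcone S \<Longrightarrow> x \<in> X \<Longrightarrow> x' \<in> X \<Longrightarrow> p x \<le> K * p x'"
    "(\<lambda>_. 1) \<in> fcone S" "holder_space \<alpha> X g \<Longrightarrow> \<exists>c. (\<lambda>x. g x + c) \<in> fcone S"
  using assms unfolding good_cone_def by auto

lemma good_cone_nonneg: "good_cone S X K \<alpha> \<Longrightarrow> p \<in> fcone S \<Longrightarrow> x \<in> X \<Longrightarrow> 0 \<le> p x"
  using good_coneD(1)[of S X K \<alpha> x] fconeD[of p S "[(1, x)]"] by simp

lemma good_cone_pos:
  assumes "good_cone S X K \<alpha>" "p \<in> fcone S" "x0 \<in> X" "0 < p x0" "x \<in> X"
  shows "0 < p x"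
proof (rule ccontr)
  assume "\<not> 0 < p x"
  then have "p x = 0" using good_cone_nonneg[OF assms(1,2,5)] by simp
  then show False using good_coneD(4)[OF assms(1,2,3,5)] assms(4) by simp
qed

lemma good_cone_holder_const: "good_cone S X K \<alpha> \<Longrightarrow> holder_space \<alpha> X (\<lambda>_. c)"
  by (auto simp: holder_space_def intro!: exI[of _ 0] boundedI)

lemma feval_linear: "(\<And>x. x \<in> snd ` set l \<Longrightarrow> f x = c * g x + d * h x) \<Longrightarrow> feval l f = c * feval l g + d * feval l h"
  for c d :: real
  by (subst feval_cong[where g="\<lambda>x. c * g x + d * h x"]) (auto simp: feval_add feval_mult)

text \<open>\<open>N\<close> is a set of base points invariant in both time directions on which all
  almost-sure hypotheses hold everywhere, so the arguments are pointwise in \<omega>.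
  \<open>recurrent\<close> asks for infinitely many past times with \<Gamma> below a bound that may
  depend on \<omega>.\<close>

locale skew_product =
  fixes N :: "'w set" and \<theta> \<tau> :: "'w \<Rightarrow> 'w" and E :: "('w \<times> 'x::metric_space) set"
    and T :: "'w \<Rightarrow> 'x \<Rightarrow> 'x" and \<phi> :: "'w \<Rightarrow> 'x \<Rightarrow> real" and \<alpha> :: real
    and I :: "'w \<Rightarrow> nat set" and y :: "'w \<Rightarrow> nat \<Rightarrow> 'x \<Rightarrow> 'x" and Db :: "'w \<Rightarrow> real"
    and S :: "'w \<Rightarrow> 'x functional set" and K \<Gamma> :: "'w \<Rightarrow> real" and \<nu> :: "'w \<Rightarrow> 'x measure"
  assumes \<theta>: "\<omega> \<in> N \<Longrightarrow> \<theta> \<omega> \<in> N" and \<tau>: "\<omega> \<in> N \<Longrightarrow> \<tau> \<omega> \<in> N"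
    and \<theta>_\<tau>: "\<omega> \<in> N \<Longrightarrow> \<theta> (\<tau> \<omega>) = \<omega>" and \<tau>_\<theta>: "\<omega> \<in> N \<Longrightarrow> \<tau> (\<theta> \<omega>) = \<omega>"
    and branched: "\<omega> \<in> N \<Longrightarrow> branched_map (fib E \<omega>) (fib E (\<theta> \<omega>)) (T \<omega>) (\<phi> \<omega>) (I \<omega>) (y \<omega>) (Db \<omega>)"
    and cone: "\<omega> \<in> N \<Longrightarrow> good_cone (S \<omega>) (fib E \<omega>) (K \<omega>) \<alpha>"
    and step: "\<omega> \<in> N \<Longrightarrow> cone_step (S \<omega>) (S (\<theta> \<omega>)) (Lop E T \<phi> \<omega>) (\<Gamma> \<omega>)"
    and \<nu>: "\<omega> \<in> N \<Longrightarrow> prob_space (\<nu> \<omega>)" "\<omega> \<in> N \<Longrightarrow> sets (\<nu> \<omega>) = sets (restrict_space borel (fib E \<omega>))"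
    and \<nu>_limit: "\<omega> \<in> N \<Longrightarrow> holder_space \<alpha> (fib E \<omega>) g \<Longrightarrow> (\<And>n. xs n \<in> fib E ((\<theta> ^^ n) \<omega>)) \<Longrightarrow>
      (\<lambda>n. Lit E T \<phi> \<theta> n \<omega> g (xs n) / Lit E T \<phi> \<theta> n \<omega> (\<lambda>_. 1) (xs n)) \<longlonglongrightarrow> integral\<^sup>L (\<nu> \<omega>) g"
    and diam: "\<omega> \<in> N \<Longrightarrow> x \<in> fib E \<omega> \<Longrightarrow> x' \<in> fib E \<omega> \<Longrightarrow> dist x x' \<le> 1"
    and \<alpha>: "0 < \<alpha>" "\<alpha> \<le> 1"
    and recurrent: "\<omega> \<in> N \<Longrightarrow> \<exists>G. infinite {n. \<Gamma> ((\<tau> ^^ n) \<omega>) \<le> G}"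
begin

abbreviation "L \<equiv> Lop E T \<phi>"
abbreviation "Lk \<equiv> Lit E T \<phi> \<theta>"
abbreviation "lam \<equiv> glam \<nu> E T \<phi> \<theta>"

lemma \<theta>n: "\<omega> \<in> N \<Longrightarrow> (\<theta> ^^ n) \<omega> \<in> N" and \<tau>n: "\<omega> \<in> N \<Longrightarrow> (\<tau> ^^ n) \<omega> \<in> N"
  by (induction n) (auto intro: \<theta> \<tau>)

lemma \<theta>n_\<tau>n: "\<omega> \<in> N \<Longrightarrow> (\<theta> ^^ n) ((\<tau> ^^ n) \<omega>) = \<omega>"
proof (induction n)
  case (Suc n)
  have "(\<theta> ^^ Suc n) ((\<tau> ^^ Suc n) \<omega>) = (\<theta> ^^ n) (\<theta> (\<tau> ((\<tau> ^^ n) \<omega>)))"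
    by (simp add: funpow_Suc_right del: funpow.simps(2)) (simp add: funpow_swap1)
  then show ?case using Suc \<theta>_\<tau>[OF \<tau>n] by simp
qed simp

lemma \<theta>n_\<tau>n_le: "\<omega> \<in> N \<Longrightarrow> j \<le> n \<Longrightarrow> (\<theta> ^^ j) ((\<tau> ^^ n) \<omega>) = (\<tau> ^^ (n - j)) \<omega>"
  using \<theta>n_\<tau>n[OF \<tau>n, of \<omega> j "n - j"] funpow_add[of j "n - j" \<tau>] by (simp add: comp_def)

lemma fib_nonempty: "\<omega> \<in> N \<Longrightarrow> fib E \<omega> \<noteq> {}"
  using branched_map.nonempty[OF branched[OF \<tau>]] \<theta>_\<tau> by metis

lemma space_\<nu>: "\<omega> \<in> N \<Longrightarrow> space (\<nu> \<omega>) = fib E \<omega>"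
  using sets_eq_imp_space_eq[OF \<nu>(2)] by (simp add: space_restrict_space)

lemma Lk_add: "Lk (m + n) \<omega> g = Lk m ((\<theta> ^^ n) \<omega>) (Lk n \<omega> g)"
  by (induction m) (simp_all add: funpow_add)

lemma L_cone: "\<omega> \<in> N \<Longrightarrow> p \<in> fcone (S \<omega>) \<Longrightarrow> L \<omega> p \<in> fcone (S (\<theta> \<omega>))"
  using step by (simp add: cone_step_def)

lemma Lk_cone: "\<omega> \<in> N \<Longrightarrow> p \<in> fcone (S \<omega>) \<Longrightarrow> Lk n \<omega> p \<in> fcone (S ((\<theta> ^^ n) \<omega>))"
  by (induction n) (auto intro: L_cone \<theta>n)

lemma cone_bounded: "\<omega> \<in> N \<Longrightarrow> p \<in> fcone (S \<omega>) \<Longrightarrow> \<exists>b. \<forall>z\<in>fib E \<omega>. \<bar>p z\<bar> \<le> b"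
  using holder_space_bounded good_coneD(3)[OF cone] by blast

lemma L_linear:
  assumes "\<omega> \<in> N" "x \<in> fib E (\<theta> \<omega>)" "holder_space \<alpha> (fib E \<omega>) f" "holder_space \<alpha> (fib E \<omega>) g"
  shows "L \<omega> (\<lambda>z. c * f z + d * g z) x = c * L \<omega> f x + d * L \<omega> g x"
proof -
  obtain b b' where "\<And>z. z \<in> fib E \<omega> \<Longrightarrow> \<bar>f z\<bar> \<le> b" "\<And>z. z \<in> fib E \<omega> \<Longrightarrow> \<bar>g z\<bar> \<le> b'"
    using assms holder_space_bounded by metis
  then show ?thesis unfolding Lop_eq_transfer by (rule branched_map.transfer_linear[OF branched[OF assms(1)] assms(2)])
qed

lemma feval_L_linear:
  assumes "\<omega> \<in> N" "l \<in> S (\<theta> \<omega>)" "p \<in> fcone (S \<omega>)" "q \<in> fcone (S \<omega>)"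
  shows "feval l (L \<omega> (\<lambda>x. c * p x + d * q x)) = c * feval l (L \<omega> p) + d * feval l (L \<omega> q)"
  using assms good_coneD(2)[OF cone[OF \<theta>]] good_coneD(3)[OF cone]
  by (intro feval_linear L_linear) auto

text \<open>The cone hypotheses concern images of cone elements; a general Hoelder function is
  written as (g + c) - c * 1 with both terms in the cone.\<close>

lemma L_holder:
  assumes \<omega>: "\<omega> \<in> N" and g: "holder_space \<alpha> (fib E \<omega>) g"
  shows "holder_space \<alpha> (fib E (\<theta> \<omega>)) (L \<omega> g)"
proof -
  obtain c where c: "(\<lambda>x. g x + c) \<in> fcone (S \<omega>)" using good_coneD(6)[OF cone[OF \<omega>] g] by auto
  have 1: "(\<lambda>_. 1) \<in> fcone (S \<omega>)" by (rule good_coneD(5)[OF cone[OF \<omega>]])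
  have eq: "L \<omega> (\<lambda>x. g x + c) x - c * L \<omega> (\<lambda>_. 1) x = L \<omega> g x" if "x \<in> fib E (\<theta> \<omega>)" for x
    using L_linear[OF \<omega> that g good_cone_holder_const[OF cone[OF \<omega>]], of 1 c 1] by simp
  show ?thesis
    by (rule holder_space_cong[OF eq])
      (assumption, intro holder_space_diff_scale good_coneD(3)[OF cone[OF \<theta>[OF \<omega>]]] L_cone[OF \<omega>] c 1)
qed

text \<open>Without branches the operator is 0, so from the first step on the quotients in
  \<open>\<nu>_limit\<close> for g = 1 read 0 / 0 = 0; they would converge to 0 although \<nu> has
  mass 1.\<close>

lemma branch_nonempty:
  assumes \<omega>: "\<omega> \<in> N"
  shows "I \<omega> \<noteq> {}"
proof
  assume I: "I \<omega> = {}"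
  interpret B: branched_map "fib E \<omega>" "fib E (\<theta> \<omega>)" "T \<omega>" "\<phi> \<omega>" "I \<omega>" "y \<omega>" "Db \<omega>" by (rule branched[OF \<omega>])
  have L0: "L \<omega> (\<lambda>_. 1) x = 0" if "x \<in> fib E (\<theta> \<omega>)" for x
    unfolding Lop_eq_transfer B.transfer_eq[OF that] I by simp
  have zero: "Lk (Suc n) \<omega> (\<lambda>_. 1) x = 0" if "x \<in> fib E ((\<theta> ^^ Suc n) \<omega>)" for n x
    using that
  proof (induction n arbitrary: x)
    case 0
    then show ?case using L0 by simp
  next
    case (Suc n)
    let ?\<omega> = "(\<theta> ^^ Suc n) \<omega>"
    have "Lk (Suc (Suc n)) \<omega> (\<lambda>_. 1) x = L ?\<omega> (Lk (Suc n) \<omega> (\<lambda>_. 1)) x" by simp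
    also have "\<dots> = L ?\<omega> (\<lambda>z. 0 * 1) x"
      unfolding Lop_eq_transfer by (intro transfer_cong) (use Suc.IH in simp)
    also have "\<dots> = 0 * L ?\<omega> (\<lambda>_. 1) x"
      unfolding Lop_eq_transfer by (rule branched_map.transfer_scale[OF branched[OF \<theta>n[OF \<omega>]]])
    finally show ?case by simp
  qed
  have "\<exists>xs. \<forall>n. xs n \<in> fib E ((\<theta> ^^ n) \<omega>)" using fib_nonempty[OF \<theta>n[OF \<omega>]] by (intro choice allI) blast
  then obtain xs where xs: "\<And>n. xs n \<in> fib E ((\<theta> ^^ n) \<omega>)" by auto
  have "(\<lambda>n. Lk (Suc n) \<omega> (\<lambda>_. 1) (xs (Suc n)) / Lk (Suc n) \<omega> (\<lambda>_. 1) (xs (Suc n))) \<longlonglongrightarrow> integral\<^sup>L (\<nu> \<omega>) (\<lambda>_. 1)"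
    using \<nu>_limit[OF \<omega> good_cone_holder_const[OF cone[OF \<omega>]], of xs 1] xs by (intro LIMSEQ_Suc) auto
  moreover have "(\<lambda>n. Lk (Suc n) \<omega> (\<lambda>_. 1) (xs (Suc n)) / Lk (Suc n) \<omega> (\<lambda>_. 1) (xs (Suc n))) = (\<lambda>_. 0)"
    by (intro ext) (subst zero[OF xs], simp)
  ultimately have "integral\<^sup>L (\<nu> \<omega>) (\<lambda>_. 1) = (0::real)" using LIMSEQ_unique tendsto_const by metis
  then show False using prob_space.prob_space[OF \<nu>(1)[OF \<omega>]] by simp
qed

lemma L_pos:
  assumes \<omega>: "\<omega> \<in> N" and p: "p \<in> fcone (S \<omega>)" "x0 \<in> fib E \<omega>" "0 < p x0" and x: "x \<in> fib E (\<theta> \<omega>)"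
  shows "0 < L \<omega> p x"
proof -
  obtain b where b: "\<And>z. z \<in> fib E \<omega> \<Longrightarrow> \<bar>p z\<bar> \<le> b" using cone_bounded[OF \<omega> p(1)] by auto
  show ?thesis unfolding Lop_eq_transfer
    by (rule branched_map.transfer_pos[OF branched[OF \<omega>] x branch_nonempty[OF \<omega>] b])
      (use good_cone_pos[OF cone[OF \<omega>] p] in auto)
qed

lemma Lk_pos:
  assumes \<omega>: "\<omega> \<in> N" and p: "p \<in> fcone (S \<omega>)" "\<And>z. z \<in> fib E \<omega> \<Longrightarrow> 0 < p z" and x: "x \<in> fib E ((\<theta> ^^ n) \<omega>)"
  shows "0 < Lk n \<omega> p x"
  using x
proof (induction n arbitrary: x)
  case (Suc n)
  obtain x0 where x0: "x0 \<in> fib E ((\<theta> ^^ n) \<omega>)" using fib_nonempty[OF \<theta>n[OF \<omega>]] by auto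
  show ?case using L_pos[OF \<theta>n[OF \<omega>] Lk_cone[OF \<omega> p(1)] x0 Suc.IH[OF x0], of x] Suc.prems by simp
qed (use p in simp)

lemma integrable_holder:
  assumes \<omega>: "\<omega> \<in> N" and g: "holder_space \<alpha> (fib E \<omega>) g"
  shows "g \<in> borel_measurable (\<nu> \<omega>)" "integrable (\<nu> \<omega>) g"
proof -
  interpret \<nu>: prob_space "\<nu> \<omega>" by (rule \<nu>(1)[OF \<omega>])
  obtain b where b: "\<And>z. z \<in> fib E \<omega> \<Longrightarrow> \<bar>g z\<bar> \<le> b" using holder_space_bounded[OF g] by auto
  have "g \<in> borel_measurable (restrict_space borel (fib E \<omega>))" by (rule holder_space_measurable[OF \<alpha>(1) g])
  then show m: "g \<in> borel_measurable (\<nu> \<omega>)" using measurable_cong_sets[OF \<nu>(2)[OF \<omega>] refl] by blast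
  then show "integrable (\<nu> \<omega>) g"
    by (rule \<nu>.integrable_const_bound[rotated]) (use b in \<open>auto simp: space_\<nu>[OF \<omega>] intro!: AE_I2\<close>)
qed

text \<open>The quotient for L g at \<open>\<theta> \<omega>\<close> factors into the quotient for L
  1 at \<open>\<theta> \<omega>\<close> times the quotient for g at \<omega>, one step longer; all
  three converge.\<close>

lemma conformal_holder:
  assumes \<omega>: "\<omega> \<in> N" and g: "holder_space \<alpha> (fib E \<omega>) g"
  shows "integral\<^sup>L (\<nu> (\<theta> \<omega>)) (L \<omega> g) = lam \<omega> * integral\<^sup>L (\<nu> \<omega>) g"
proof -
  have "\<exists>xs. \<forall>n. xs n \<in> fib E ((\<theta> ^^ n) \<omega>)" using fib_nonempty[OF \<theta>n[OF \<omega>]] by (intro choice allI) blast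
  then obtain xs where xs: "\<And>n. xs n \<in> fib E ((\<theta> ^^ n) \<omega>)" by auto
  have xs': "xs (Suc n) \<in> fib E ((\<theta> ^^ n) (\<theta> \<omega>))" for n using xs[of "Suc n"] by (simp add: funpow_swap1)
  have Suc: "Lk (Suc n) \<omega> f = Lk n (\<theta> \<omega>) (L \<omega> f)" for n f using Lk_add[of n 1 \<omega> f] by simp
  define C where "C n = Lk n (\<theta> \<omega>) (\<lambda>_. 1) (xs (Suc n))" for n
  note one = good_cone_holder_const[OF cone[OF \<omega>], of 1]
  have C: "0 < C n" for n
    unfolding C_def by (rule Lk_pos[OF \<theta>[OF \<omega>] good_coneD(5)[OF cone[OF \<theta>[OF \<omega>]]] _ xs']) simp
  have a: "(\<lambda>n. Lk n (\<theta> \<omega>) (L \<omega> f) (xs (Suc n)) / C n) \<longlonglongrightarrow> integral\<^sup>L (\<nu> (\<theta> \<omega>)) (L \<omega> f)"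
    if "holder_space \<alpha> (fib E \<omega>) f" for f
    unfolding C_def by (rule \<nu>_limit[OF \<theta>[OF \<omega>] L_holder[OF \<omega> that], of "\<lambda>n. xs (Suc n)"]) (rule xs')
  have r: "(\<lambda>n. Lk (Suc n) \<omega> g (xs (Suc n)) / Lk (Suc n) \<omega> (\<lambda>_. 1) (xs (Suc n))) \<longlonglongrightarrow> integral\<^sup>L (\<nu> \<omega>) g"
    using \<nu>_limit[OF \<omega> g, of xs] xs by (intro LIMSEQ_Suc) auto
  have "(\<lambda>n. Lk n (\<theta> \<omega>) (L \<omega> (\<lambda>_. 1)) (xs (Suc n)) / C n * (Lk (Suc n) \<omega> g (xs (Suc n)) / Lk (Suc n) \<omega> (\<lambda>_. 1) (xs (Suc n))))
     \<longlonglongrightarrow> lam \<omega> * integral\<^sup>L (\<nu> \<omega>) g"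
    unfolding glam_def by (intro tendsto_mult a[OF one] r)
  moreover have "Lk n (\<theta> \<omega>) (L \<omega> (\<lambda>_. 1)) (xs (Suc n)) / C n * (Lk (Suc n) \<omega> g (xs (Suc n)) / Lk (Suc n) \<omega> (\<lambda>_. 1) (xs (Suc n)))
     = Lk n (\<theta> \<omega>) (L \<omega> g) (xs (Suc n)) / C n" for n
    using Lk_pos[OF \<omega> good_coneD(5)[OF cone[OF \<omega>]] _ xs, of "Suc n"] unfolding Suc by simp
  ultimately show ?thesis using a[OF g] LIMSEQ_unique by force
qed

lemma lam_pos:
  assumes \<omega>: "\<omega> \<in> N"
  shows "0 < lam \<omega>"
proof -
  interpret \<nu>': prob_space "\<nu> (\<theta> \<omega>)" by (rule \<nu>(1)[OF \<theta>[OF \<omega>]])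
  have 1: "(\<lambda>_. 1) \<in> fcone (S \<omega>)" by (rule good_coneD(5)[OF cone[OF \<omega>]])
  obtain x0 x1 where x: "x0 \<in> fib E \<omega>" "x1 \<in> fib E (\<theta> \<omega>)" using fib_nonempty[OF \<omega>] fib_nonempty[OF \<theta>[OF \<omega>]] by auto
  have pos: "0 < L \<omega> (\<lambda>_. 1) x" if "x \<in> fib E (\<theta> \<omega>)" for x
    using L_pos[OF \<omega> 1 x(1) _ that] by simp
  have int: "integrable (\<nu> (\<theta> \<omega>)) (L \<omega> (\<lambda>_. 1))"
    by (intro integrable_holder(2) \<theta> \<omega> L_holder good_cone_holder_const[OF cone])
  have "integral\<^sup>L (\<nu> (\<theta> \<omega>)) (L \<omega> (\<lambda>_. 1)) \<noteq> 0"
  proof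
    assume "integral\<^sup>L (\<nu> (\<theta> \<omega>)) (L \<omega> (\<lambda>_. 1)) = 0"
    moreover have "AE x in \<nu> (\<theta> \<omega>). 0 \<le> L \<omega> (\<lambda>_. 1) x"
      by (rule AE_I2) (use pos in \<open>simp add: space_\<nu>[OF \<theta>[OF \<omega>]] less_imp_le\<close>)
    ultimately have "AE x in \<nu> (\<theta> \<omega>). L \<omega> (\<lambda>_. 1) x = 0"
      using integral_nonneg_eq_0_iff_AE[OF int] by blast
    then have "AE x in \<nu> (\<theta> \<omega>). False"
      using AE_space by eventually_elim (use pos in \<open>force simp: space_\<nu>[OF \<theta>[OF \<omega>]]\<close>)
    then show False by simp
  qed
  moreover have "0 \<le> integral\<^sup>L (\<nu> (\<theta> \<omega>)) (L \<omega> (\<lambda>_. 1))"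
    by (rule Bochner_Integration.integral_nonneg) (auto simp: space_\<nu>[OF \<theta>[OF \<omega>]] less_imp_le pos)
  ultimately show ?thesis unfolding glam_def by simp
qed

lemma conformal_map:
  "\<omega> \<in> N \<Longrightarrow> conformal_map (fib E \<omega>) (fib E (\<theta> \<omega>)) (T \<omega>) (\<phi> \<omega>) (I \<omega>) (y \<omega>) (Db \<omega>) (\<nu> \<omega>) (\<nu> (\<theta> \<omega>)) (lam \<omega>) \<alpha>"
  unfolding conformal_map_def conformal_map_axioms_def
  using branched \<nu> \<theta> diam \<alpha> lam_pos conformal_holder[unfolded Lop_eq_transfer] by (auto simp: less_imp_le)

section \<open>Normalising factors and contraction along an orbit\<close>

abbreviation "lamn \<equiv> glamn \<nu> E T \<phi> \<theta>"

lemma lamn_pos: "\<omega> \<in> N \<Longrightarrow> 0 < lamn \<omega> n"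
  unfolding glamn_def by (intro prod_pos ballI lam_pos \<theta>n)

lemma lamn_Suc: "lamn \<omega> (Suc n) = lamn \<omega> n * lam ((\<theta> ^^ n) \<omega>)"
  by (simp add: glamn_def)

lemma integral_Lk:
  assumes \<omega>: "\<omega> \<in> N" and p: "p \<in> fcone (S \<omega>)"
  shows "integral\<^sup>L (\<nu> ((\<theta> ^^ n) \<omega>)) (Lk n \<omega> p) = lamn \<omega> n * integral\<^sup>L (\<nu> \<omega>) p"
proof (induction n)
  case (Suc n)
  show ?case
    using conformal_holder[OF \<theta>n[OF \<omega>] good_coneD(3)[OF cone[OF \<theta>n[OF \<omega>]] Lk_cone[OF \<omega> p]], of n] Suc
    by (simp add: lamn_Suc)
qed (simp add: glamn_def)

text \<open>No rate of convergence is needed: the first step bounds the ratio of two iterates, and this product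
  of the later contraction factors tends to \<open>0\<close> because a value of \<open>\<Gamma>\<close> recurs.\<close>

definition contr :: "'w \<Rightarrow> nat \<Rightarrow> real" where
  "contr \<omega> k = (\<Prod>j\<in>{1..k}. 1 - 1 / (1 + \<Gamma> ((\<theta> ^^ j) \<omega>)))"

lemma \<Gamma>_ge_1: "\<omega> \<in> N \<Longrightarrow> 1 \<le> \<Gamma> \<omega>"
  using step by (simp add: cone_step_def)

lemma contraction_factor: "\<omega> \<in> N \<Longrightarrow> 0 \<le> 1 - 1 / (1 + \<Gamma> \<omega>)" "\<omega> \<in> N \<Longrightarrow> 1 - 1 / (1 + \<Gamma> \<omega>) \<le> 1"
  using \<Gamma>_ge_1[of \<omega>] by (simp_all add: field_simps)

lemma contr_nonneg: "\<omega> \<in> N \<Longrightarrow> 0 \<le> contr \<omega> k"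
  unfolding contr_def by (intro prod_nonneg ballI contraction_factor \<theta>n)

text \<open>One step makes the images comparable: the cross-ratio bound against evaluation at a
  single point z gives the coefficients t / \<Gamma>^2 and \<Gamma>^2 t. From then on each step
  shrinks the gap between the coefficients by its own contraction factor.\<close>

lemma iterate_sandwich:
  assumes \<omega>: "\<omega> \<in> N" and p: "p \<in> fcone (S \<omega>)" "x0 \<in> fib E \<omega>" "0 < p x0"
    and q: "q \<in> fcone (S \<omega>)" "x1 \<in> fib E \<omega>" "0 < q x1"
  shows "\<exists>t a b. 0 < t \<and> t / (\<Gamma> \<omega>)\<^sup>2 \<le> a \<and> a \<le> b \<and> b - a \<le> contr \<omega> k * ((\<Gamma> \<omega>)\<^sup>2 * t - t / (\<Gamma> \<omega>)\<^sup>2) \<and>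
    (\<lambda>x. Lk (Suc k) \<omega> p x - a * Lk (Suc k) \<omega> q x) \<in> fcone (S ((\<theta> ^^ Suc k) \<omega>)) \<and>
    (\<lambda>x. b * Lk (Suc k) \<omega> q x - Lk (Suc k) \<omega> p x) \<in> fcone (S ((\<theta> ^^ Suc k) \<omega>))"
proof -
  define c where "c = (\<Gamma> \<omega>)\<^sup>2"
  have c: "1 \<le> c" using \<Gamma>_ge_1[OF \<omega>] by (simp add: c_def)
  obtain z where z: "z \<in> fib E (\<theta> \<omega>)" using fib_nonempty[OF \<theta>[OF \<omega>]] by auto
  have Lz: "0 < L \<omega> p z" "0 < L \<omega> q z" using L_pos[OF \<omega> p z] L_pos[OF \<omega> q z] by auto
  define t where "t = L \<omega> p z / L \<omega> q z"
  have t: "0 < t" using Lz by (simp add: t_def)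
  have "\<exists>a b. t / c \<le> a \<and> a \<le> b \<and> b - a \<le> contr \<omega> k * (c * t - t / c) \<and>
    (\<lambda>x. Lk (Suc k) \<omega> p x - a * Lk (Suc k) \<omega> q x) \<in> fcone (S ((\<theta> ^^ Suc k) \<omega>)) \<and>
    (\<lambda>x. b * Lk (Suc k) \<omega> q x - Lk (Suc k) \<omega> p x) \<in> fcone (S ((\<theta> ^^ Suc k) \<omega>))"
  proof (induction k)
    case 0
    have zS: "[(1, z)] \<in> S (\<theta> \<omega>)" by (rule good_coneD(1)[OF cone[OF \<theta>[OF \<omega>]] z])
    have cr: "feval l (L \<omega> p') * feval m (L \<omega> q') \<le> c * (feval l (L \<omega> q') * feval m (L \<omega> p'))"
      if "l \<in> S (\<theta> \<omega>)" "m \<in> S (\<theta> \<omega>)" "p' \<in> fcone (S \<omega>)" "q' \<in> fcone (S \<omega>)" for l m p' q'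
      using step[OF \<omega>] that by (simp add: cone_step_def c_def)
    have "feval l (L \<omega> p) \<le> c * t * feval l (L \<omega> q)" if l: "l \<in> S (\<theta> \<omega>)" for l
      using cr[OF l zS p(1) q(1)] Lz by (simp add: t_def field_simps)
    then have up: "(\<lambda>x. c * t * L \<omega> q x - L \<omega> p x) \<in> fcone (S (\<theta> \<omega>))"
      unfolding mult_diff_mem_fcone by blast
    have "t / c * feval l (L \<omega> q) \<le> feval l (L \<omega> p)" if l: "l \<in> S (\<theta> \<omega>)" for l
      using cr[OF l zS q(1) p(1)] Lz c by (simp add: t_def field_simps)
    then have low: "(\<lambda>x. L \<omega> p x - t / c * L \<omega> q x) \<in> fcone (S (\<theta> \<omega>))"
      unfolding diff_mult_mem_fcone by blast
    have "t / c \<le> t" "t \<le> c * t" using t c by (auto simp: field_simps)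
    then have "t / c \<le> c * t" by (rule order_trans)
    then show ?case using up low by (intro exI[of _ "t / c"] exI[of _ "c * t"]) (auto simp: contr_def)
  next
    case (Suc k)
    then obtain a b where ab: "t / c \<le> a" "a \<le> b" "b - a \<le> contr \<omega> k * (c * t - t / c)"
      "(\<lambda>x. Lk (Suc k) \<omega> p x - a * Lk (Suc k) \<omega> q x) \<in> fcone (S ((\<theta> ^^ Suc k) \<omega>))"
      "(\<lambda>x. b * Lk (Suc k) \<omega> q x - Lk (Suc k) \<omega> p x) \<in> fcone (S ((\<theta> ^^ Suc k) \<omega>))" by auto
    let ?\<omega> = "(\<theta> ^^ Suc k) \<omega>" and ?P = "Lk (Suc k) \<omega> p" and ?Q = "Lk (Suc k) \<omega> q"
    have P: "?P \<in> fcone (S ?\<omega>)" "?Q \<in> fcone (S ?\<omega>)" by (rule Lk_cone[OF \<omega> p(1)] Lk_cone[OF \<omega> q(1)])+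
    have lin: "feval l (L ?\<omega> (\<lambda>x. c * ?P x + d * ?Q x)) = c * feval l (L ?\<omega> ?P) + d * feval l (L ?\<omega> ?Q)"
      if "l \<in> S (\<theta> ?\<omega>)" for c d l by (rule feval_L_linear[OF \<theta>n[OF \<omega>] that P])
    have "\<exists>a' b'. a \<le> a' \<and> a' \<le> b' \<and> b' \<le> b \<and> b' - a' \<le> (1 - 1 / (1 + \<Gamma> ?\<omega>)) * (b - a) \<and>
      (\<lambda>x. L ?\<omega> ?P x - a' * L ?\<omega> ?Q x) \<in> fcone (S (\<theta> ?\<omega>)) \<and> (\<lambda>x. b' * L ?\<omega> ?Q x - L ?\<omega> ?P x) \<in> fcone (S (\<theta> ?\<omega>))"
      by (rule cone_step_contracts[OF step[OF \<theta>n[OF \<omega>]] lin ab(4,5) P(2) ab(2)])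
    then obtain a' b' where ab': "a \<le> a'" "a' \<le> b'" "b' \<le> b" "b' - a' \<le> (1 - 1 / (1 + \<Gamma> ?\<omega>)) * (b - a)"
      "(\<lambda>x. L ?\<omega> ?P x - a' * L ?\<omega> ?Q x) \<in> fcone (S (\<theta> ?\<omega>))" "(\<lambda>x. b' * L ?\<omega> ?Q x - L ?\<omega> ?P x) \<in> fcone (S (\<theta> ?\<omega>))"
      by (elim exE conjE)
    have f: "0 \<le> 1 - 1 / (1 + \<Gamma> ?\<omega>)" by (rule contraction_factor(1)[OF \<theta>n[OF \<omega>]])
    have "b' - a' \<le> (1 - 1 / (1 + \<Gamma> ?\<omega>)) * (contr \<omega> k * (c * t - t / c))"
      using ab'(4) mult_left_mono[OF ab(3) f] by linarith
    also have "\<dots> = contr \<omega> (Suc k) * (c * t - t / c)" by (simp add: contr_def)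
    finally have ba: "b' - a' \<le> contr \<omega> (Suc k) * (c * t - t / c)" .
    have "(\<lambda>x. Lk (Suc (Suc k)) \<omega> p x - a' * Lk (Suc (Suc k)) \<omega> q x) \<in> fcone (S ((\<theta> ^^ Suc (Suc k)) \<omega>))"
      "(\<lambda>x. b' * Lk (Suc (Suc k)) \<omega> q x - Lk (Suc (Suc k)) \<omega> p x) \<in> fcone (S ((\<theta> ^^ Suc (Suc k)) \<omega>))"
      using ab'(5,6) by simp_all
    then show ?case using order_trans[OF ab(1) ab'(1)] ab'(2) ba by blast
  qed
  then show ?thesis using t unfolding c_def by blast
qed

text \<open>Integrate the comparison of p x with p z over z.\<close>

lemma cone_le_K:
  assumes \<omega>: "\<omega> \<in> N" and p: "p \<in> fcone (S \<omega>)" and x: "x \<in> fib E \<omega>"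
  shows "p x \<le> K \<omega> * integral\<^sup>L (\<nu> \<omega>) p"
proof -
  interpret \<nu>: prob_space "\<nu> \<omega>" by (rule \<nu>(1)[OF \<omega>])
  have int: "integrable (\<nu> \<omega>) p" by (rule integrable_holder(2)[OF \<omega> good_coneD(3)[OF cone[OF \<omega>] p]])
  have "integral\<^sup>L (\<nu> \<omega>) (\<lambda>_. p x) \<le> integral\<^sup>L (\<nu> \<omega>) (\<lambda>z. K \<omega> * p z)"
    by (rule Bochner_Integration.integral_mono) (use int good_coneD(4)[OF cone[OF \<omega>] p x] in \<open>auto simp: space_\<nu>[OF \<omega>]\<close>)
  then show ?thesis by (simp add: \<nu>.prob_space)
qed

text \<open>Integrating the sandwich between functions of equal integral forces a \<le> 1 \<le> b,
  so the pointwise distance is at most (b - a) times an iterate that K bounds.\<close>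

lemma normalised_iterates_close:
  assumes \<omega>: "\<omega> \<in> N" and p: "p \<in> fcone (S \<omega>)" and q: "q \<in> fcone (S \<omega>)"
    and normp: "integral\<^sup>L (\<nu> ((\<theta> ^^ Suc k) \<omega>)) (Lk (Suc k) \<omega> p) = 1"
    and normq: "integral\<^sup>L (\<nu> ((\<theta> ^^ Suc k) \<omega>)) (Lk (Suc k) \<omega> q) = 1"
    and x: "x \<in> fib E ((\<theta> ^^ Suc k) \<omega>)"
  shows "\<bar>Lk (Suc k) \<omega> p x - Lk (Suc k) \<omega> q x\<bar> \<le> (\<Gamma> \<omega>) ^ 4 * contr \<omega> k * K ((\<theta> ^^ Suc k) \<omega>)"
proof -
  let ?\<omega> = "(\<theta> ^^ Suc k) \<omega>" and ?P = "Lk (Suc k) \<omega> p" and ?Q = "Lk (Suc k) \<omega> q"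
  have \<omega>': "?\<omega> \<in> N" by (rule \<theta>n[OF \<omega>])
  have PQ: "?P \<in> fcone (S ?\<omega>)" "?Q \<in> fcone (S ?\<omega>)" by (rule Lk_cone[OF \<omega> p] Lk_cone[OF \<omega> q])+
  have ex: "\<exists>z\<in>fib E \<omega>. 0 < r z" if r: "r \<in> fcone (S \<omega>)" "integral\<^sup>L (\<nu> ?\<omega>) (Lk (Suc k) \<omega> r) = 1" for r
  proof (rule ccontr)
    assume "\<not> ?thesis"
    then have "r z = 0" if "z \<in> fib E \<omega>" for z using good_cone_nonneg[OF cone[OF \<omega>] r(1) that] that by force
    then have "integral\<^sup>L (\<nu> \<omega>) r = integral\<^sup>L (\<nu> \<omega>) (\<lambda>_. 0)"
      by (intro Bochner_Integration.integral_cong) (auto simp: space_\<nu>[OF \<omega>])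
    then show False using integral_Lk[OF \<omega> r(1), of "Suc k"] r(2) by simp
  qed
  obtain z0 z1 where z: "z0 \<in> fib E \<omega>" "0 < p z0" "z1 \<in> fib E \<omega>" "0 < q z1"
    using ex[OF p normp] ex[OF q normq] by blast
  obtain t a b where t: "0 < t" "t / (\<Gamma> \<omega>)\<^sup>2 \<le> a" "a \<le> b" "b - a \<le> contr \<omega> k * ((\<Gamma> \<omega>)\<^sup>2 * t - t / (\<Gamma> \<omega>)\<^sup>2)"
    "(\<lambda>x. ?P x - a * ?Q x) \<in> fcone (S ?\<omega>)" "(\<lambda>x. b * ?Q x - ?P x) \<in> fcone (S ?\<omega>)"
    using iterate_sandwich[OF \<omega> p z(1,2) q z(3,4), of k] by blast
  note int = integrable_holder(2)[OF \<omega>' good_coneD(3)[OF cone[OF \<omega>'] PQ(1)]] integrable_holder(2)[OF \<omega>' good_coneD(3)[OF cone[OF \<omega>'] PQ(2)]]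
  note nn = good_cone_nonneg[OF cone[OF \<omega>']]
  have "0 \<le> integral\<^sup>L (\<nu> ?\<omega>) (\<lambda>x. ?P x - a * ?Q x)"
    by (rule Bochner_Integration.integral_nonneg) (use nn[OF t(5)] space_\<nu>[OF \<omega>'] in \<open>auto simp del: funpow.simps Lit.simps\<close>)
  then have a1: "a \<le> 1" using int normp normq by simp
  have "0 \<le> integral\<^sup>L (\<nu> ?\<omega>) (\<lambda>x. b * ?Q x - ?P x)"
    by (rule Bochner_Integration.integral_nonneg) (use nn[OF t(6)] space_\<nu>[OF \<omega>'] in \<open>auto simp del: funpow.simps Lit.simps\<close>)
  then have b1: "1 \<le> b" using int normp normq by simp
  have G: "1 \<le> \<Gamma> \<omega>" by (rule \<Gamma>_ge_1[OF \<omega>])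
  \<comment> \<open>From t / \<Gamma>^2 \<le> a \<le> 1. With the factor \<Gamma>^2 of the initial
    upper coefficient this produces the fourth power.\<close>
  have "t \<le> (\<Gamma> \<omega>)\<^sup>2" using order_trans[OF t(2) a1] G by (simp add: field_simps)
  then have "(\<Gamma> \<omega>)\<^sup>2 * t - t / (\<Gamma> \<omega>)\<^sup>2 \<le> (\<Gamma> \<omega>)\<^sup>2 * (\<Gamma> \<omega>)\<^sup>2 - 0"
    using t(1) by (intro diff_mono mult_left_mono) auto
  then have ba: "b - a \<le> contr \<omega> k * (\<Gamma> \<omega>) ^ 4"
    using t(4) mult_left_mono[OF _ contr_nonneg[OF \<omega>], of _ _ k] by (simp add: power4_eq_xxxx power2_eq_square mult.assoc) (meson order_trans)
  have Q0: "0 \<le> ?Q x" by (rule nn[OF PQ(2) x])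
  have "?Q x \<le> K ?\<omega>" using cone_le_K[OF \<omega>' PQ(2) x] normq by simp
  have "a * ?Q x \<le> ?P x" "?P x \<le> b * ?Q x" using nn[OF t(5) x] nn[OF t(6) x] by auto
  moreover have "a * ?Q x \<le> 1 * ?Q x" "1 * ?Q x \<le> b * ?Q x" using a1 b1 Q0 by (intro mult_right_mono; simp)+
  ultimately have "\<bar>?P x - ?Q x\<bar> \<le> (b - a) * ?Q x" by (simp add: left_diff_distrib abs_le_iff)
  also have "\<dots> \<le> (contr \<omega> k * (\<Gamma> \<omega>) ^ 4) * K ?\<omega>"
    using ba Q0 \<open>?Q x \<le> K ?\<omega>\<close> contr_nonneg[OF \<omega>] G by (intro mult_mono) auto
  finally show ?thesis by (simp add: mult_ac)
qed

text \<open>Among the fibres strictly between the starting point in the past and \<omega>, k visits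
  to small \<Gamma> contribute k factors at most r < 1, and all others are at most 1. The starting
  point is itself chosen with small \<Gamma>, because the constant of the first step is evaluated
  there.\<close>

lemma contr_tendsto_0:
  assumes \<omega>: "\<omega> \<in> N" and inf: "infinite {n. \<Gamma> ((\<tau> ^^ n) \<omega>) \<le> G}" and \<epsilon>: "0 < \<epsilon>"
  shows "\<exists>m. \<Gamma> ((\<tau> ^^ Suc m) \<omega>) \<le> G \<and> contr ((\<tau> ^^ Suc m) \<omega>) m < \<epsilon>"
proof -
  have G: "1 \<le> G"
  proof -
    obtain n where "\<Gamma> ((\<tau> ^^ n) \<omega>) \<le> G" using infinite_imp_nonempty[OF inf] by auto
    then show ?thesis using \<Gamma>_ge_1[OF \<tau>n[OF \<omega>], of n] by linarith
  qed
  define r where "r = 1 - 1 / (1 + G)"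
  have r: "0 \<le> r" "r < 1" using G by (auto simp: r_def field_simps)
  obtain k where k: "r ^ k < \<epsilon>" using real_arch_pow_inv[OF \<epsilon> r(2)] by auto
  have inf': "infinite ({n. \<Gamma> ((\<tau> ^^ n) \<omega>) \<le> G} - {0})" using inf by simp
  obtain B where B: "finite B" "card B = k" "B \<subseteq> {n. \<Gamma> ((\<tau> ^^ n) \<omega>) \<le> G} - {0}"
    using infinite_arbitrarily_large[OF inf'] by blast
  define M where "M = Max (insert 0 B)"
  have "infinite ({n. \<Gamma> ((\<tau> ^^ n) \<omega>) \<le> G} - {.. M})" using inf by simp
  then have "{n. \<Gamma> ((\<tau> ^^ n) \<omega>) \<le> G} - {.. M} \<noteq> {}" by (rule infinite_imp_nonempty)
  then obtain n where "n \<in> {n. \<Gamma> ((\<tau> ^^ n) \<omega>) \<le> G} - {.. M}" by blast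
  then have n: "\<Gamma> ((\<tau> ^^ n) \<omega>) \<le> G" "M < n" by auto
  then obtain m where m: "n = Suc m" by (cases n) auto
  have Bm: "B \<subseteq> {1..m}"
  proof
    fix i assume i: "i \<in> B"
    then have "i \<le> M" using B(1) unfolding M_def by (intro Max_ge) auto
    then show "i \<in> {1..m}" using n m i B(3) by auto
  qed
  have f: "0 \<le> 1 - 1 / (1 + \<Gamma> ((\<tau> ^^ i) \<omega>))" "1 - 1 / (1 + \<Gamma> ((\<tau> ^^ i) \<omega>)) \<le> 1" for i
    using contraction_factor[OF \<tau>n[OF \<omega>], of i] by auto
  have "contr ((\<tau> ^^ Suc m) \<omega>) m = (\<Prod>j\<in>{1..m}. 1 - 1 / (1 + \<Gamma> ((\<tau> ^^ (Suc m - j)) \<omega>)))"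
    unfolding contr_def by (intro prod.cong refl) (simp add: \<theta>n_\<tau>n_le[OF \<omega>] del: funpow.simps)
  \<comment> \<open>Reversing the product turns forward steps from the starting point into the
    backward times 1, ..., m of \<omega>.\<close>
  also have "\<dots> = (\<Prod>i\<in>{1..m}. 1 - 1 / (1 + \<Gamma> ((\<tau> ^^ i) \<omega>)))"
    by (rule prod.reindex_bij_witness[of _ "\<lambda>i. Suc m - i" "\<lambda>i. Suc m - i"]) auto
  also have "\<dots> = (\<Prod>i\<in>B. 1 - 1 / (1 + \<Gamma> ((\<tau> ^^ i) \<omega>))) * (\<Prod>i\<in>{1..m} - B. 1 - 1 / (1 + \<Gamma> ((\<tau> ^^ i) \<omega>)))"
    using prod.subset_diff[OF Bm] by (simp add: mult.commute)
  also have "\<dots> \<le> (\<Prod>i\<in>B. r) * 1"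
  proof (rule mult_mono)
    show "(\<Prod>i\<in>B. 1 - 1 / (1 + \<Gamma> ((\<tau> ^^ i) \<omega>))) \<le> (\<Prod>i\<in>B. r)"
    proof (rule prod_mono)
      fix i assume "i \<in> B"
      then have "\<Gamma> ((\<tau> ^^ i) \<omega>) \<le> G" using B(3) by auto
      then have "1 / (1 + G) \<le> 1 / (1 + \<Gamma> ((\<tau> ^^ i) \<omega>))"
        using \<Gamma>_ge_1[OF \<tau>n[OF \<omega>], of i] by (intro divide_left_mono) auto
      then show "0 \<le> 1 - 1 / (1 + \<Gamma> ((\<tau> ^^ i) \<omega>)) \<and> 1 - 1 / (1 + \<Gamma> ((\<tau> ^^ i) \<omega>)) \<le> r"
        using f by (simp add: r_def)
    qed
    show "(\<Prod>i\<in>{1..m} - B. 1 - 1 / (1 + \<Gamma> ((\<tau> ^^ i) \<omega>))) \<le> 1" by (rule prod_le_1) (use f in blast)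
    show "0 \<le> (\<Prod>i\<in>B. r)" by (rule prod_nonneg) (use r in blast)
    show "0 \<le> (\<Prod>i\<in>{1..m} - B. 1 - 1 / (1 + \<Gamma> ((\<tau> ^^ i) \<omega>)))" by (rule prod_nonneg) (use f in blast)
  qed
  also have "\<dots> = r ^ k" using B by simp
  finally show ?thesis using k n m by (intro exI[of _ m]) (auto intro: le_less_trans)
qed

section \<open>The density as a limit of pulled-back iterates\<close>

definition hn :: "'w \<Rightarrow> nat \<Rightarrow> 'x \<Rightarrow> real" where
  "hn \<omega> n x = Lk n ((\<tau> ^^ n) \<omega>) (\<lambda>_. 1) x / lamn ((\<tau> ^^ n) \<omega>) n"

definition hlim :: "'w \<Rightarrow> 'x \<Rightarrow> real" where
  "hlim \<omega> x = lim (\<lambda>n. hn \<omega> n x)"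

lemma hn_cone:
  assumes \<omega>: "\<omega> \<in> N"
  shows "hn \<omega> n \<in> fcone (S \<omega>)" "integral\<^sup>L (\<nu> \<omega>) (hn \<omega> n) = 1"
proof -
  let ?\<omega> = "(\<tau> ^^ n) \<omega>"
  have \<omega>': "?\<omega> \<in> N" by (rule \<tau>n[OF \<omega>])
  have 1: "(\<lambda>_. 1) \<in> fcone (S ?\<omega>)" by (rule good_coneD(5)[OF cone[OF \<omega>']])
  have pos: "0 < lamn ?\<omega> n" by (rule lamn_pos[OF \<omega>'])
  have "Lk n ?\<omega> (\<lambda>_. 1) \<in> fcone (S \<omega>)" using Lk_cone[OF \<omega>' 1, of n] by (simp add: \<theta>n_\<tau>n[OF \<omega>])
  from fcone_scale[OF this, of "1 / lamn ?\<omega> n"] show "hn \<omega> n \<in> fcone (S \<omega>)"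
    using pos by (simp add: hn_def[abs_def])
  have "integral\<^sup>L (\<nu> \<omega>) (Lk n ?\<omega> (\<lambda>_. 1)) = lamn ?\<omega> n"
    using integral_Lk[OF \<omega>' 1, of n] prob_space.prob_space[OF \<nu>(1)[OF \<omega>']] by (simp add: \<theta>n_\<tau>n[OF \<omega>])
  then show "integral\<^sup>L (\<nu> \<omega>) (hn \<omega> n) = 1" using pos by (simp add: hn_def[abs_def])
qed

lemma Lk_scale:
  assumes \<omega>: "\<omega> \<in> N" and x: "x \<in> fib E ((\<theta> ^^ n) \<omega>)"
  shows "Lk n \<omega> (\<lambda>z. c * p z) x = c * Lk n \<omega> p x"
  using x
proof (induction n arbitrary: x)
  case (Suc n)
  have "L ((\<theta> ^^ n) \<omega>) (Lk n \<omega> (\<lambda>z. c * p z)) x = L ((\<theta> ^^ n) \<omega>) (\<lambda>z. c * Lk n \<omega> p z) x"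
    unfolding Lop_eq_transfer by (intro transfer_cong Suc.IH)
  also have "\<dots> = c * L ((\<theta> ^^ n) \<omega>) (Lk n \<omega> p) x"
    unfolding Lop_eq_transfer by (rule branched_map.transfer_scale[OF branched[OF \<theta>n[OF \<omega>]]])
  finally show ?case by simp
qed simp

text \<open>All approximants of index at least m + 1 are images, under the same last m + 1 steps, of
  cone elements, and all have integral 1; their distance is therefore governed by those last steps
  alone.\<close>

lemma hn_close:
  assumes \<omega>: "\<omega> \<in> N" and \<epsilon>: "0 < \<epsilon>"
  shows "\<exists>m. \<forall>n\<ge>m. \<forall>n'\<ge>m. \<forall>x\<in>fib E \<omega>. \<bar>hn \<omega> n x - hn \<omega> n' x\<bar> \<le> \<epsilon>"
proof -
  obtain G where G: "infinite {n. \<Gamma> ((\<tau> ^^ n) \<omega>) \<le> G}" using recurrent[OF \<omega>] by auto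
  have K1: "1 \<le> K \<omega>"
  proof -
    obtain x where "x \<in> fib E \<omega>" using fib_nonempty[OF \<omega>] by auto
    then show ?thesis using good_coneD(4)[OF cone[OF \<omega>] good_coneD(5)[OF cone[OF \<omega>]], of x x] by simp
  qed
  have G1: "1 \<le> G"
  proof -
    obtain n where "\<Gamma> ((\<tau> ^^ n) \<omega>) \<le> G" using infinite_imp_nonempty[OF G] by auto
    then show ?thesis using \<Gamma>_ge_1[OF \<tau>n[OF \<omega>], of n] by linarith
  qed
  have pos: "0 < \<epsilon> / (G ^ 4 * K \<omega>)" using \<epsilon> G1 K1 by simp
  obtain m where m: "\<Gamma> ((\<tau> ^^ Suc m) \<omega>) \<le> G" "contr ((\<tau> ^^ Suc m) \<omega>) m < \<epsilon> / (G ^ 4 * K \<omega>)"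
    using contr_tendsto_0[OF \<omega> G pos] by auto
  let ?\<omega> = "(\<tau> ^^ Suc m) \<omega>"
  have \<omega>': "?\<omega> \<in> N" by (rule \<tau>n[OF \<omega>])
  have split: "\<exists>p\<in>fcone (S ?\<omega>). \<forall>x\<in>fib E \<omega>. hn \<omega> n x = Lk (Suc m) ?\<omega> p x" if n: "Suc m \<le> n" for n
  proof -
    let ?v = "(\<tau> ^^ n) \<omega>"
    have v: "?v \<in> N" by (rule \<tau>n[OF \<omega>])
    have vm: "(\<theta> ^^ (n - Suc m)) ?v = ?\<omega>" using \<theta>n_\<tau>n_le[OF \<omega>, of "n - Suc m" n] n by simp
    let ?p = "\<lambda>z. 1 / lamn ?v n * Lk (n - Suc m) ?v (\<lambda>_. 1) z"
    have "Lk (n - Suc m) ?v (\<lambda>_. 1) \<in> fcone (S ?\<omega>)"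
      using Lk_cone[OF v good_coneD(5)[OF cone[OF v]], of "n - Suc m"] vm by simp
    then have p: "?p \<in> fcone (S ?\<omega>)" using lamn_pos[OF v, of n] by (intro fcone_scale) auto
    have "hn \<omega> n x = Lk (Suc m) ?\<omega> ?p x" if x: "x \<in> fib E \<omega>" for x
    proof -
      have "Lk n ?v (\<lambda>_. 1) = Lk (Suc m) ?\<omega> (Lk (n - Suc m) ?v (\<lambda>_. 1))"
        using Lk_add[of "Suc m" "n - Suc m" ?v "\<lambda>_. 1"] n vm by (simp del: Lit.simps)
      moreover have "Lk (Suc m) ?\<omega> ?p x = 1 / lamn ?v n * Lk (Suc m) ?\<omega> (Lk (n - Suc m) ?v (\<lambda>_. 1)) x"
        by (rule Lk_scale[OF \<omega>']) (use x in \<open>simp add: \<theta>n_\<tau>n[OF \<omega>] del: funpow.simps\<close>)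
      ultimately show ?thesis by (simp add: hn_def)
    qed
    with p show ?thesis by blast
  qed
  have eq: "(\<theta> ^^ Suc m) ?\<omega> = \<omega>" by (rule \<theta>n_\<tau>n[OF \<omega>])
  have "\<bar>hn \<omega> n x - hn \<omega> n' x\<bar> \<le> \<epsilon>" if n: "Suc m \<le> n" "Suc m \<le> n'" and x: "x \<in> fib E \<omega>" for n n' x
  proof -
    obtain p q where p: "p \<in> fcone (S ?\<omega>)" "\<And>x. x \<in> fib E \<omega> \<Longrightarrow> hn \<omega> n x = Lk (Suc m) ?\<omega> p x"
      and q: "q \<in> fcone (S ?\<omega>)" "\<And>x. x \<in> fib E \<omega> \<Longrightarrow> hn \<omega> n' x = Lk (Suc m) ?\<omega> q x"
      using split n by metis
    have "integral\<^sup>L (\<nu> \<omega>) (Lk (Suc m) ?\<omega> p) = integral\<^sup>L (\<nu> \<omega>) (hn \<omega> n)"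
      by (intro Bochner_Integration.integral_cong) (auto simp: p(2) space_\<nu>[OF \<omega>])
    moreover have "integral\<^sup>L (\<nu> \<omega>) (Lk (Suc m) ?\<omega> q) = integral\<^sup>L (\<nu> \<omega>) (hn \<omega> n')"
      by (intro Bochner_Integration.integral_cong) (auto simp: q(2) space_\<nu>[OF \<omega>])
    ultimately have "\<bar>Lk (Suc m) ?\<omega> p x - Lk (Suc m) ?\<omega> q x\<bar> \<le> (\<Gamma> ?\<omega>) ^ 4 * contr ?\<omega> m * K \<omega>"
      using normalised_iterates_close[OF \<omega>' p(1) q(1), of m x] x hn_cone(2)[OF \<omega>] unfolding eq by simp
    also have "\<dots> \<le> G ^ 4 * (\<epsilon> / (G ^ 4 * K \<omega>)) * K \<omega>"
      using m \<Gamma>_ge_1[OF \<omega>'] contr_nonneg[OF \<omega>'] K1 \<epsilon> by (intro mult_mono power_mono) auto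
    also have "\<dots> = \<epsilon>" using G1 K1 by simp
    finally show ?thesis using p(2)[OF x] q(2)[OF x] by simp
  qed
  then show ?thesis by blast
qed

lemma hn_tendsto:
  assumes \<omega>: "\<omega> \<in> N" and x: "x \<in> fib E \<omega>"
  shows "(\<lambda>n. hn \<omega> n x) \<longlonglongrightarrow> hlim \<omega> x"
proof -
  have "Cauchy (\<lambda>n. hn \<omega> n x)"
  proof (rule metric_CauchyI)
    fix e :: real assume "0 < e"
    then obtain m where "\<forall>n\<ge>m. \<forall>n'\<ge>m. \<forall>x\<in>fib E \<omega>. \<bar>hn \<omega> n x - hn \<omega> n' x\<bar> \<le> e / 2"
      using hn_close[OF \<omega>, of "e/2"] by auto
    then have "\<forall>n\<ge>m. \<forall>n'\<ge>m. dist (hn \<omega> n x) (hn \<omega> n' x) < e"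
      using x \<open>0 < e\<close> by (fastforce simp: dist_real_def)
    then show "\<exists>M. \<forall>m\<ge>M. \<forall>n\<ge>M. dist (hn \<omega> m x) (hn \<omega> n x) < e" by blast
  qed
  then show ?thesis unfolding hlim_def by (simp add: Cauchy_convergent_iff convergent_LIMSEQ_iff)
qed

lemma hn_uniform:
  assumes \<omega>: "\<omega> \<in> N" and \<epsilon>: "0 < \<epsilon>"
  shows "\<exists>m. \<forall>n\<ge>m. \<forall>x\<in>fib E \<omega>. \<bar>hn \<omega> n x - hlim \<omega> x\<bar> \<le> \<epsilon>"
proof -
  obtain m where m: "\<forall>n\<ge>m. \<forall>n'\<ge>m. \<forall>x\<in>fib E \<omega>. \<bar>hn \<omega> n x - hn \<omega> n' x\<bar> \<le> \<epsilon>" using hn_close[OF assms] by auto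
  have "\<bar>hn \<omega> n x - hlim \<omega> x\<bar> \<le> \<epsilon>" if "m \<le> n" "x \<in> fib E \<omega>" for n x
  proof (rule tendsto_upperbound)
    show "(\<lambda>n'. \<bar>hn \<omega> n x - hn \<omega> n' x\<bar>) \<longlonglongrightarrow> \<bar>hn \<omega> n x - hlim \<omega> x\<bar>"
      by (intro tendsto_intros hn_tendsto[OF \<omega> that(2)])
    show "\<forall>\<^sub>F i in sequentially. \<bar>hn \<omega> n x - hn \<omega> i x\<bar> \<le> \<epsilon>"
      using m that by (auto simp: eventually_sequentially)
  qed simp
  then show ?thesis by blast
qed

text \<open>Each functional involves finitely many points, so the cone is closed under pointwise
  limits.\<close>

lemma hlim_cone:
  assumes \<omega>: "\<omega> \<in> N"
  shows "hlim \<omega> \<in> fcone (S \<omega>)"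
  unfolding fcone_def mem_Collect_eq
proof
  fix l assume l: "l \<in> S \<omega>"
  have "(\<lambda>n. feval l (hn \<omega> n)) \<longlonglongrightarrow> feval l (hlim \<omega>)"
    by (intro tendsto_feval hn_tendsto[OF \<omega>] good_coneD(2)[OF cone[OF \<omega>] l])
  then show "0 \<le> feval l (hlim \<omega>)"
    by (rule tendsto_lowerbound) (use fconeD[OF hn_cone(1)[OF \<omega>] l] in auto)
qed

text \<open>Cone elements of integral 1 are bounded by K, which serves as the dominating
  constant.\<close>

lemma integral_hlim:
  assumes \<omega>: "\<omega> \<in> N"
  shows "integral\<^sup>L (\<nu> \<omega>) (hlim \<omega>) = 1"
proof -
  interpret \<nu>: prob_space "\<nu> \<omega>" by (rule \<nu>(1)[OF \<omega>])
  have "(\<lambda>n. integral\<^sup>L (\<nu> \<omega>) (hn \<omega> n)) \<longlonglongrightarrow> integral\<^sup>L (\<nu> \<omega>) (hlim \<omega>)"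
  proof (rule integral_dominated_convergence)
    show "integrable (\<nu> \<omega>) (\<lambda>_. K \<omega>)" by simp
    show "AE x in \<nu> \<omega>. (\<lambda>n. hn \<omega> n x) \<longlonglongrightarrow> hlim \<omega> x"
      using hn_tendsto[OF \<omega>] by (auto simp: space_\<nu>[OF \<omega>] intro!: AE_I2)
    show "AE x in \<nu> \<omega>. norm (hn \<omega> n x) \<le> K \<omega>" for n
    proof (rule AE_I2)
      fix x assume "x \<in> space (\<nu> \<omega>)"
      then have x: "x \<in> fib E \<omega>" by (simp add: space_\<nu>[OF \<omega>])
      show "norm (hn \<omega> n x) \<le> K \<omega>"
        using cone_le_K[OF \<omega> hn_cone(1)[OF \<omega>] x, of n] hn_cone(2)[OF \<omega>, of n]
          good_cone_nonneg[OF cone[OF \<omega>] hn_cone(1)[OF \<omega>] x, of n] by simp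
    qed
    show "hlim \<omega> \<in> borel_measurable (\<nu> \<omega>)" "hn \<omega> n \<in> borel_measurable (\<nu> \<omega>)" for n
      by (rule integrable_holder(1)[OF \<omega> good_coneD(3)[OF cone[OF \<omega>]]], rule hn_cone(1)[OF \<omega>] hlim_cone[OF \<omega>])+
  qed
  then have "(\<lambda>n::nat. 1) \<longlonglongrightarrow> integral\<^sup>L (\<nu> \<omega>) (hlim \<omega>)" unfolding hn_cone(2)[OF \<omega>] .
  then show ?thesis by (rule LIMSEQ_unique[OF _ tendsto_const])
qed

text \<open>L takes the n-th approximant at \<omega> to \<open>lam \<omega>\<close> times the
  (n+1)-st at \<open>\<theta> \<omega>\<close>. Passing to the limit inside L, possibly an infinite
  sum, uses uniform convergence on the fibre.\<close>

lemma L_hlim: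
  assumes \<omega>: "\<omega> \<in> N" and x: "x \<in> fib E (\<theta> \<omega>)"
  shows "L \<omega> (hlim \<omega>) x = lam \<omega> * hlim (\<theta> \<omega>) x"
proof -
  interpret B: branched_map "fib E \<omega>" "fib E (\<theta> \<omega>)" "T \<omega>" "\<phi> \<omega>" "I \<omega>" "y \<omega>" "Db \<omega>" by (rule branched[OF \<omega>])
  have hold: "holder_space \<alpha> (fib E \<omega>) (hn \<omega> n)" "holder_space \<alpha> (fib E \<omega>) (hlim \<omega>)" for n
    by (rule good_coneD(3)[OF cone[OF \<omega>]], rule hn_cone(1)[OF \<omega>] hlim_cone[OF \<omega>])+
  have lim: "(\<lambda>n. L \<omega> (hn \<omega> n) x) \<longlonglongrightarrow> L \<omega> (hlim \<omega>) x"
  proof (rule metric_LIMSEQ_I)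
    fix e :: real assume e: "0 < e"
    let ?c = "L \<omega> (\<lambda>_. 1) x"
    have c: "0 \<le> ?c" unfolding Lop_eq_transfer by (rule B.transfer_nonneg[OF x]) simp
    \<comment> \<open>Dividing by 1 + L 1 rather than L 1 avoids a zero denominator and keeps the
      final inequality strict.\<close>
    obtain m where m: "\<forall>n\<ge>m. \<forall>x\<in>fib E \<omega>. \<bar>hn \<omega> n x - hlim \<omega> x\<bar> \<le> e / (1 + ?c)"
      using hn_uniform[OF \<omega> divide_pos_pos[OF e add_pos_nonneg[OF zero_less_one c]]] by blast
    have "dist (L \<omega> (hn \<omega> n) x) (L \<omega> (hlim \<omega>) x) < e" if "m \<le> n" for n
    proof -
      have "L \<omega> (hn \<omega> n) x - L \<omega> (hlim \<omega>) x = L \<omega> (\<lambda>z. hn \<omega> n z - hlim \<omega> z) x"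
        using L_linear[OF \<omega> x hold, of 1 n "-1"] by simp
      also have "\<bar>\<dots>\<bar> \<le> e / (1 + ?c) * ?c"
        unfolding Lop_eq_transfer by (rule B.abs_transfer_le[OF x]) (use m that in \<open>auto simp: Lop_eq_transfer\<close>)
      also have "\<dots> < e" using e c by (simp add: field_simps)
      finally show ?thesis by (simp add: dist_real_def)
    qed
    then show "\<exists>no. \<forall>n\<ge>no. dist (L \<omega> (hn \<omega> n) x) (L \<omega> (hlim \<omega>) x) < e" by blast
  qed
  have eq: "L \<omega> (hn \<omega> n) x = lam \<omega> * hn (\<theta> \<omega>) (Suc n) x" for n
  proof -
    let ?v = "(\<tau> ^^ n) \<omega>"
    have v: "?v \<in> N" by (rule \<tau>n[OF \<omega>])
    have vS: "(\<tau> ^^ Suc n) (\<theta> \<omega>) = ?v" using \<tau>_\<theta>[OF \<omega>] by (simp add: funpow_swap1)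
    have v_eq: "(\<theta> ^^ n) ?v = \<omega>" by (rule \<theta>n_\<tau>n[OF \<omega>])
    have "L \<omega> (hn \<omega> n) x = L \<omega> (\<lambda>z. 1 / lamn ?v n * Lk n ?v (\<lambda>_. 1) z) x"
      by (simp add: hn_def[abs_def])
    also have "\<dots> = 1 / lamn ?v n * L \<omega> (Lk n ?v (\<lambda>_. 1)) x"
      unfolding Lop_eq_transfer[of E T \<phi> \<omega>] by (rule B.transfer_scale)
    also have "L \<omega> (Lk n ?v (\<lambda>_. 1)) x = Lk (Suc n) ?v (\<lambda>_. 1) x" by (simp add: v_eq)
    also have "1 / lamn ?v n * \<dots> = lam \<omega> * hn (\<theta> \<omega>) (Suc n) x"
      unfolding hn_def vS lamn_Suc v_eq using lam_pos[OF \<omega>] lamn_pos[OF v, of n] by (simp add: field_simps)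
    finally show ?thesis .
  qed
  have "(\<lambda>n. lam \<omega> * hn (\<theta> \<omega>) (Suc n) x) \<longlonglongrightarrow> lam \<omega> * hlim (\<theta> \<omega>) x"
    by (intro tendsto_mult tendsto_const LIMSEQ_Suc hn_tendsto[OF \<theta>[OF \<omega>] x])
  then have "(\<lambda>n. L \<omega> (hn \<omega> n) x) \<longlonglongrightarrow> lam \<omega> * hlim (\<theta> \<omega>) x" by (simp only: eq)
  with lim show ?thesis by (rule LIMSEQ_unique)
qed

end

section \<open>Complex perturbations\<close>

lemma exp_half_le_2: "exp (1 / 2 :: real) \<le> 2"
proof -
  have "(exp (1 / 2 :: real))\<^sup>2 = exp 1" by (simp add: power2_eq_square mult_exp_exp)
  also have "\<dots> \<le> 2\<^sup>2" using exp_le by simp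
  finally show ?thesis by (rule power2_le_imp_le) simp
qed

text \<open>Mean value inequality on the disc of radius 1/2, where |exp| is at most exp (1/2) \<le>
  2.\<close>

lemma norm_exp_diff_le: "norm (exp a - exp b) \<le> 2 * norm (a - b)" if "norm a \<le> 1/2" "norm b \<le> 1/2" for a b :: complex
proof (rule field_differentiable_bound[of "cball 0 (1/2)" exp exp 2])
  show "norm (exp z) \<le> 2" if "z \<in> cball 0 (1/2)" for z :: complex
  proof -
    have "Re z \<le> 1/2" using complex_Re_le_cmod[of z] that by simp
    then have "exp (Re z) \<le> exp (1/2)" by simp
    from order_trans[OF this exp_half_le_2] show ?thesis by simp
  qed
  show "(exp has_field_derivative exp z) (at z within cball 0 (1/2))" for z :: complex
    by (auto intro!: derivative_eq_intros)
qed (use that in auto)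

section \<open>Complex transfer operators and the complexified cone\<close>

context skew_product
begin

text \<open>Composition with T need not preserve Hoelder continuity. This class is closed under the
  products, exponentials and compositions below, and the conformal relation still applies to it; it
  is polymorphic because real and complex functions both occur.\<close>

definition bmeas :: "'w \<Rightarrow> ('x \<Rightarrow> 'b::{real_normed_vector, second_countable_topology}) \<Rightarrow> bool" where
  "bmeas \<omega> f \<longleftrightarrow> f \<in> borel_measurable (restrict_space borel (fib E \<omega>)) \<and> (\<exists>b. \<forall>x\<in>fib E \<omega>. norm (f x) \<le> b)"

lemma measurable_\<nu>: "\<omega> \<in> N \<Longrightarrow> borel_measurable (\<nu> \<omega>) = borel_measurable (restrict_space borel (fib E \<omega>))"
  using measurable_cong_sets[OF \<nu>(2) refl] by blast

lemma bmeas_holder: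
  assumes "\<omega> \<in> N" "holder_space \<alpha> (fib E \<omega>) g"
  shows "bmeas \<omega> g"
  unfolding bmeas_def measurable_\<nu>[OF assms(1), symmetric]
  using integrable_holder(1)[OF assms] holder_space_bounded[OF assms(2)] by simp

lemma bmeas_integrable:
  fixes f :: "'x \<Rightarrow> 'b::{banach, second_countable_topology}"
  assumes \<omega>: "\<omega> \<in> N" and f: "bmeas \<omega> f"
  shows "integrable (\<nu> \<omega>) f"
proof -
  interpret \<nu>: prob_space "\<nu> \<omega>" by (rule \<nu>(1)[OF \<omega>])
  obtain b where "\<And>x. x \<in> fib E \<omega> \<Longrightarrow> norm (f x) \<le> b" using f by (auto simp: bmeas_def)
  then show ?thesis
    by (intro \<nu>.integrable_const_bound[where B=b]) (use f in \<open>auto simp: bmeas_def measurable_\<nu>[OF \<omega>] space_\<nu>[OF \<omega>] intro!: AE_I2\<close>)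
qed

lemma bmeas_mult:
  fixes f g :: "'x \<Rightarrow> 'b::{real_normed_field, second_countable_topology}"
  assumes f: "bmeas \<omega> f" and g: "bmeas \<omega> g"
  shows "bmeas \<omega> (\<lambda>x. f x * g x)"
proof -
  obtain b b' where b: "\<And>x. x \<in> fib E \<omega> \<Longrightarrow> norm (f x) \<le> b" "\<And>x. x \<in> fib E \<omega> \<Longrightarrow> norm (g x) \<le> b'"
    using f g by (auto simp: bmeas_def)
  have "norm (f x * g x) \<le> \<bar>b\<bar> * \<bar>b'\<bar>" if "x \<in> fib E \<omega>" for x
    unfolding norm_mult using b[OF that] by (intro mult_mono) auto
  then show ?thesis unfolding bmeas_def using f g by (auto simp: bmeas_def)
qed

lemma bmeas_const: "bmeas \<omega> (\<lambda>_. c)"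
  by (auto simp: bmeas_def)

lemma bmeas_add:
  fixes f g :: "'x \<Rightarrow> 'b::{real_normed_vector, second_countable_topology}"
  assumes f: "bmeas \<omega> f" and g: "bmeas \<omega> g"
  shows "bmeas \<omega> (\<lambda>x. f x + g x)"
proof -
  obtain b b' where b: "\<And>x. x \<in> fib E \<omega> \<Longrightarrow> norm (f x) \<le> b" "\<And>x. x \<in> fib E \<omega> \<Longrightarrow> norm (g x) \<le> b'"
    using f g by (auto simp: bmeas_def)
  have "norm (f x + g x) \<le> b + b'" if "x \<in> fib E \<omega>" for x
    using norm_triangle_ineq[of "f x" "g x"] b[OF that] by linarith
  then show ?thesis unfolding bmeas_def using f g by (auto simp: bmeas_def)
qed

lemma bmeas_of_real: "bmeas \<omega> f \<Longrightarrow> bmeas \<omega> (\<lambda>x. complex_of_real (f x))"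
  by (auto simp: bmeas_def)

lemma bmeas_Re: "bmeas \<omega> f \<Longrightarrow> bmeas \<omega> (\<lambda>x. Re (f x))" and bmeas_Im: "bmeas \<omega> f \<Longrightarrow> bmeas \<omega> (\<lambda>x. Im (f x))"
  unfolding bmeas_def by (auto intro: order_trans[OF abs_Re_le_cmod] order_trans[OF abs_Im_le_cmod])

lemma bmeas_exp:
  assumes "bmeas \<omega> f"
  shows "bmeas \<omega> (\<lambda>x. exp (z * complex_of_real (f x)))"
proof -
  obtain b where b: "\<And>x. x \<in> fib E \<omega> \<Longrightarrow> norm (f x) \<le> b" using assms by (auto simp: bmeas_def)
  have "norm (exp (z * complex_of_real (f x))) \<le> exp (norm z * b)" if "x \<in> fib E \<omega>" for x
  proof -
    have "Re (z * complex_of_real (f x)) \<le> norm (z * complex_of_real (f x))" by (rule complex_Re_le_cmod)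
    also have "\<dots> \<le> norm z * b" unfolding norm_mult using b[OF that] by (intro mult_left_mono) auto
    finally show ?thesis by simp
  qed
  then show ?thesis using assms unfolding bmeas_def by (auto intro!: borel_measurable_exp)
qed

lemma bmeas_comp:
  assumes "g \<in> measurable (restrict_space borel (fib E \<omega>)) (restrict_space borel (fib E \<omega>'))" "bmeas \<omega>' f"
  shows "bmeas \<omega> (\<lambda>x. f (g x))"
proof -
  obtain b where "\<And>x. x \<in> fib E \<omega>' \<Longrightarrow> norm (f x) \<le> b" using assms(2) by (auto simp: bmeas_def)
  then have "\<forall>x\<in>fib E \<omega>. norm (f (g x)) \<le> b" using measurable_space[OF assms(1)] by (simp add: space_restrict_space)
  then show ?thesis using measurable_compose[OF assms(1)] assms(2) unfolding bmeas_def by blast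
qed

lemma bmeas_cong:
  assumes eq: "\<And>x. x \<in> fib E \<omega> \<Longrightarrow> f x = g x" and f: "bmeas \<omega> f"
  shows "bmeas \<omega> g"
proof -
  have "f \<in> borel_measurable (restrict_space borel (fib E \<omega>)) \<longleftrightarrow> g \<in> borel_measurable (restrict_space borel (fib E \<omega>))"
    by (rule measurable_cong) (simp add: space_restrict_space eq)
  then show ?thesis using f eq by (simp add: bmeas_def)
qed

lemma measurable_T: "\<omega> \<in> N \<Longrightarrow> T \<omega> \<in> measurable (restrict_space borel (fib E \<omega>)) (restrict_space borel (fib E (\<theta> \<omega>)))"
  using branched_map.T_measurable[OF branched] .

lemma measurable_iterT:
  "\<omega> \<in> N \<Longrightarrow> iterT \<theta> T n \<omega> \<in> measurable (restrict_space borel (fib E \<omega>)) (restrict_space borel (fib E ((\<theta> ^^ n) \<omega>)))"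
proof (induction n)
  case (Suc n)
  then show ?case using measurable_comp[OF Suc.IH measurable_T[OF \<theta>n]] by (simp add: o_def)
qed (simp add: id_def)

lemma iterT_mem: "\<omega> \<in> N \<Longrightarrow> x \<in> fib E \<omega> \<Longrightarrow> iterT \<theta> T n \<omega> x \<in> fib E ((\<theta> ^^ n) \<omega>)"
  using measurable_space[OF measurable_iterT, of \<omega> x n] by (simp add: space_restrict_space)

lemma L_bmeas_linear:
  assumes "\<omega> \<in> N" "x \<in> fib E (\<theta> \<omega>)" "bmeas \<omega> f" "bmeas \<omega> g"
  shows "L \<omega> (\<lambda>z. c * f z + d * g z) x = c * L \<omega> f x + d * L \<omega> g x"
proof -
  obtain b b' where b: "\<And>x. x \<in> fib E \<omega> \<Longrightarrow> \<bar>f x\<bar> \<le> b" "\<And>x. x \<in> fib E \<omega> \<Longrightarrow> \<bar>g x\<bar> \<le> b'"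
    using assms(3,4) by (auto simp: bmeas_def)
  then show ?thesis unfolding Lop_eq_transfer by (rule branched_map.transfer_linear[OF branched[OF assms(1)] assms(2)])
qed

lemma integral_L:
  assumes "\<omega> \<in> N" "bmeas \<omega> f"
  shows "integrable (\<nu> (\<theta> \<omega>)) (L \<omega> f)" "integral\<^sup>L (\<nu> (\<theta> \<omega>)) (L \<omega> f) = lam \<omega> * integral\<^sup>L (\<nu> \<omega>) f"
proof -
  obtain b where "\<And>x. x \<in> fib E \<omega> \<Longrightarrow> \<bar>f x\<bar> \<le> b" using assms by (auto simp: bmeas_def)
  then show "integrable (\<nu> (\<theta> \<omega>)) (L \<omega> f)" "integral\<^sup>L (\<nu> (\<theta> \<omega>)) (L \<omega> f) = lam \<omega> * integral\<^sup>L (\<nu> \<omega>) f"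
    using conformal_map.integrable_transfer[OF conformal_map[OF assms(1)], of f b]
      conformal_map.conformal[OF conformal_map[OF assms(1)], of f b] assms(2)
    by (auto simp: bmeas_def Lop_eq_transfer)
qed

text \<open>Defined through real and imaginary parts, so that the facts about the real operator
  carry over directly.\<close>

definition LC :: "'w \<Rightarrow> ('x \<Rightarrow> complex) \<Rightarrow> 'x \<Rightarrow> complex" where
  "LC \<omega> G x = Complex (L \<omega> (\<lambda>z. Re (G z)) x) (L \<omega> (\<lambda>z. Im (G z)) x)"

lemma LC_linear:
  assumes \<omega>: "\<omega> \<in> N" "x \<in> fib E (\<theta> \<omega>)" and f: "bmeas \<omega> f" and g: "bmeas \<omega> g"
  shows "LC \<omega> (\<lambda>z. a * f z + b * g z) x = a * LC \<omega> f x + b * LC \<omega> g x"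
proof -
  note B = bmeas_Re[OF f] bmeas_Im[OF f] bmeas_Re[OF g] bmeas_Im[OF g]
  have lin: "L \<omega> (\<lambda>z. (c1 * Re (f z) + c2 * Im (f z)) + (d1 * Re (g z) + d2 * Im (g z))) x
      = (c1 * L \<omega> (\<lambda>z. Re (f z)) x + c2 * L \<omega> (\<lambda>z. Im (f z)) x) + (d1 * L \<omega> (\<lambda>z. Re (g z)) x + d2 * L \<omega> (\<lambda>z. Im (g z)) x)"
    for c1 c2 d1 d2 :: real
  proof -
    have 1: "bmeas \<omega> (\<lambda>z. c1 * Re (f z) + c2 * Im (f z))" "bmeas \<omega> (\<lambda>z. d1 * Re (g z) + d2 * Im (g z))"
      by (intro bmeas_add bmeas_mult bmeas_const B)+
    have "L \<omega> (\<lambda>z. 1 * (c1 * Re (f z) + c2 * Im (f z)) + 1 * (d1 * Re (g z) + d2 * Im (g z))) x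
      = 1 * L \<omega> (\<lambda>z. c1 * Re (f z) + c2 * Im (f z)) x + 1 * L \<omega> (\<lambda>z. d1 * Re (g z) + d2 * Im (g z)) x"
      by (rule L_bmeas_linear[OF \<omega> 1])
    then show ?thesis by (simp add: L_bmeas_linear[OF \<omega> B(1,2)] L_bmeas_linear[OF \<omega> B(3,4)])
  qed
  have re: "(\<lambda>z. Re (a * f z + b * g z)) = (\<lambda>z. (Re a * Re (f z) + (- Im a) * Im (f z)) + (Re b * Re (g z) + (- Im b) * Im (g z)))"
    and im: "(\<lambda>z. Im (a * f z + b * g z)) = (\<lambda>z. (Im a * Re (f z) + Re a * Im (f z)) + (Im b * Re (g z) + Re b * Im (g z)))"
    by (auto simp: fun_eq_iff algebra_simps)
  show ?thesis
    unfolding LC_def re im lin by (simp add: complex_eq_iff algebra_simps)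
qed

text \<open>All preimages z of x share the value f (T z) = f x, which therefore leaves the
  sum.\<close>

lemma LC_mult_comp:
  assumes \<omega>: "\<omega> \<in> N" "x \<in> fib E (\<theta> \<omega>)" and G: "bmeas \<omega> G"
  shows "LC \<omega> (\<lambda>z. f (T \<omega> z) * G z) x = f x * LC \<omega> G x"
proof -
  have eq: "LC \<omega> (\<lambda>z. f (T \<omega> z) * G z) x = LC \<omega> (\<lambda>z. f x * G z + 0 * G z) x"
    unfolding LC_def Lop_eq_transfer transfer_def by (auto intro!: arg_cong2[where f=Complex] infsum_cong)
  show ?thesis unfolding eq LC_linear[OF \<omega> G G] by simp
qed

lemma LC_of_real: "LC \<omega> (\<lambda>z. of_real (f z)) x = of_real (L \<omega> f x)"
proof -
  have "L \<omega> (\<lambda>_. 0) x = 0" unfolding Lop_eq_transfer transfer_def by (simp add: infsum_0)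
  then show ?thesis by (simp add: LC_def complex_eq_iff)
qed

lemma LC_cong: "(\<And>z. z \<in> fib E \<omega> \<Longrightarrow> f z = g z) \<Longrightarrow> LC \<omega> f x = LC \<omega> g x"
  unfolding LC_def Lop_eq_transfer by (intro arg_cong2[where f=Complex] transfer_cong) auto

lemma integral_LC:
  fixes G :: "'x \<Rightarrow> complex"
  assumes \<omega>: "\<omega> \<in> N" and G: "bmeas \<omega> G"
  shows "integral\<^sup>L (\<nu> (\<theta> \<omega>)) (LC \<omega> G) = lam \<omega> * integral\<^sup>L (\<nu> \<omega>) G"
proof -
  note R = integral_L[OF \<omega> bmeas_Re[OF G]] and I = integral_L[OF \<omega> bmeas_Im[OF G]]
  note int = bmeas_integrable[OF \<omega> G]
  have "integral\<^sup>L (\<nu> (\<theta> \<omega>)) (LC \<omega> G) = integral\<^sup>L (\<nu> (\<theta> \<omega>)) (\<lambda>x. of_real (L \<omega> (\<lambda>z. Re (G z)) x) + \<i> * of_real (L \<omega> (\<lambda>z. Im (G z)) x))"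
    by (intro Bochner_Integration.integral_cong) (auto simp: LC_def complex_eq_iff)
  also have "\<dots> = of_real (lam \<omega> * integral\<^sup>L (\<nu> \<omega>) (\<lambda>z. Re (G z))) + \<i> * of_real (lam \<omega> * integral\<^sup>L (\<nu> \<omega>) (\<lambda>z. Im (G z)))"
    using R I by simp
  also have "\<dots> = lam \<omega> * integral\<^sup>L (\<nu> \<omega>) G"
    using integral_Re[OF int] integral_Im[OF int] by (simp add: complex_eq_iff)
  finally show ?thesis .
qed

text \<open>The complexified cone without 0, in the form delivered by
  \<open>complex_cone_decomposition\<close>. The point with p + q > 0 excludes the zero
  function.\<close>

definition ccone :: "'w \<Rightarrow> ('x \<Rightarrow> complex) \<Rightarrow> bool" where
  "ccone \<omega> G \<longleftrightarrow> (\<exists>c p q. c \<noteq> 0 \<and> p \<in> fcone (S \<omega>) \<and> q \<in> fcone (S \<omega>) \<and> (\<exists>x\<in>fib E \<omega>. 0 < p x + q x) \<and>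
     (\<forall>x\<in>fib E \<omega>. G x = c * ((1 + \<i>) * of_real (p x) + (1 - \<i>) * of_real (q x))))"

lemma bmeas_cone: "\<omega> \<in> N \<Longrightarrow> p \<in> fcone (S \<omega>) \<Longrightarrow> bmeas \<omega> p"
  by (rule bmeas_holder) (auto intro: good_coneD(3)[OF cone])

lemma bmeas_ccone:
  assumes \<omega>: "\<omega> \<in> N" and G: "ccone \<omega> G"
  shows "bmeas \<omega> G"
proof -
  obtain c p q where pq: "p \<in> fcone (S \<omega>)" "q \<in> fcone (S \<omega>)"
    and G: "\<And>x. x \<in> fib E \<omega> \<Longrightarrow> G x = c * ((1 + \<i>) * of_real (p x) + (1 - \<i>) * of_real (q x))"
    using G by (auto simp: ccone_def)
  show ?thesis
    by (rule bmeas_cong[OF G[symmetric]], assumption)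
      (intro bmeas_mult bmeas_add bmeas_const bmeas_of_real bmeas_cone[OF \<omega>] pq)
qed

text \<open>Integration preserves the sector form, and inside a sector nothing cancels: the integral
  has modulus at least |c| (P + Q), whereas |G| is at most sqrt 2 |c| (p + q). The first fact yields
  zero-freeness of generating functions, the second, with comparability of cone values, their growth
  bound.\<close>

lemma ccone_bound:
  assumes \<omega>: "\<omega> \<in> N" and G: "ccone \<omega> G"
  shows "integral\<^sup>L (\<nu> \<omega>) G \<noteq> 0" "x \<in> fib E \<omega> \<Longrightarrow> norm (G x) \<le> sqrt 2 * K \<omega> * norm (integral\<^sup>L (\<nu> \<omega>) G)"
proof -
  interpret \<nu>: prob_space "\<nu> \<omega>" by (rule \<nu>(1)[OF \<omega>])
  obtain c p q x0 where c: "c \<noteq> 0" and pq: "p \<in> fcone (S \<omega>)" "q \<in> fcone (S \<omega>)"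
    and x0: "x0 \<in> fib E \<omega>" "0 < p x0 + q x0"
    and G: "\<And>x. x \<in> fib E \<omega> \<Longrightarrow> G x = c * ((1 + \<i>) * of_real (p x) + (1 - \<i>) * of_real (q x))"
    using G by (auto simp: ccone_def)
  let ?P = "integral\<^sup>L (\<nu> \<omega>) p" and ?Q = "integral\<^sup>L (\<nu> \<omega>) q"
  note nn = good_cone_nonneg[OF cone[OF \<omega>]]
  note int = bmeas_integrable[OF \<omega> bmeas_cone[OF \<omega> pq(1)]] bmeas_integrable[OF \<omega> bmeas_cone[OF \<omega> pq(2)]]
  have PQ: "0 \<le> ?P" "0 \<le> ?Q"
    using nn pq by (auto simp: space_\<nu>[OF \<omega>] intro!: Bochner_Integration.integral_nonneg)
  have "integral\<^sup>L (\<nu> \<omega>) G = integral\<^sup>L (\<nu> \<omega>) (\<lambda>x. c * ((1 + \<i>) * of_real (p x) + (1 - \<i>) * of_real (q x)))"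
    by (intro Bochner_Integration.integral_cong) (auto simp: G space_\<nu>[OF \<omega>])
  also have "\<dots> = c * ((1 + \<i>) * of_real ?P + (1 - \<i>) * of_real ?Q)" using int by simp
  finally have I: "integral\<^sup>L (\<nu> \<omega>) G = c * ((1 + \<i>) * of_real ?P + (1 - \<i>) * of_real ?Q)" .
  have lower: "norm c * (?P + ?Q) \<le> norm (integral\<^sup>L (\<nu> \<omega>) G)"
    unfolding I norm_mult by (intro mult_left_mono norm_sector_combination(1) PQ) auto
  have le: "p x + q x \<le> K \<omega> * (?P + ?Q)" if "x \<in> fib E \<omega>" for x
    using cone_le_K[OF \<omega> pq(1) that] cone_le_K[OF \<omega> pq(2) that] by (simp add: distrib_left)
  have "?P + ?Q \<noteq> 0" using le[OF x0(1)] x0(2) by auto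
  then have "0 < ?P + ?Q" using PQ by linarith
  then have "0 < norm c * (?P + ?Q)" using c by simp
  then show "integral\<^sup>L (\<nu> \<omega>) G \<noteq> 0" using lower by auto
  assume x: "x \<in> fib E \<omega>"
  have K0: "0 \<le> K \<omega>" using le[OF x0(1)] x0(2) \<open>0 < ?P + ?Q\<close> by (smt (verit) mult_nonpos_nonneg)
  have "norm (G x) \<le> norm c * (sqrt 2 * (p x + q x))"
    unfolding G[OF x] norm_mult[of c] by (intro mult_left_mono norm_sector_combination(2) nn[OF pq(1) x] nn[OF pq(2) x]) auto
  also have "\<dots> \<le> norm c * (sqrt 2 * (K \<omega> * (?P + ?Q)))" using le[OF x] by (intro mult_left_mono) auto
  also have "\<dots> = sqrt 2 * K \<omega> * (norm c * (?P + ?Q))" by simp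
  also have "\<dots> \<le> sqrt 2 * K \<omega> * norm (integral\<^sup>L (\<nu> \<omega>) G)" using lower K0 by (intro mult_left_mono) auto
  finally show "norm (G x) \<le> sqrt 2 * K \<omega> * norm (integral\<^sup>L (\<nu> \<omega>) G)" .
qed

end

text \<open>The perturbation enters through a real multiplier \<psi>, later the real part of a
  rotated exp (z u) - 1 with |z| = r; the factor 2 is the Lipschitz constant of exp on the disc of
  radius 1/2. A one-sided bound suffices because it also holds for - \<psi>.\<close>

definition perturbation_bound ::
  "'x functional set \<Rightarrow> 'x functional set \<Rightarrow> (('x \<Rightarrow> real) \<Rightarrow> 'x \<Rightarrow> real) \<Rightarrow> real \<Rightarrow> 'x set \<Rightarrow> real \<Rightarrow> real \<Rightarrow> ('x \<Rightarrow> real) \<Rightarrow> bool" where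
  "perturbation_bound S S' L \<Gamma> X U W f \<longleftrightarrow>
     (\<forall>r \<psi> p m. 0 \<le> r \<longrightarrow> r * W \<le> 1/2 \<longrightarrow> (\<forall>x\<in>X. \<bar>\<psi> x\<bar> \<le> 2 * r * U) \<longrightarrow>
       (\<forall>x\<in>X. \<forall>x'\<in>X. \<bar>\<psi> x - \<psi> x'\<bar> \<le> 2 * r * \<bar>f x - f x'\<bar>) \<longrightarrow> p \<in> fcone S \<longrightarrow> m \<in> S' \<longrightarrow>
       6 * \<Gamma> * feval m (L (\<lambda>x. \<psi> x * p x)) \<le> feval m (L p))"

lemma perturbation_boundD:
  assumes "perturbation_bound S S' L \<Gamma> X U W f" "0 \<le> r" "r * W \<le> 1/2" "p \<in> fcone S" "m \<in> S'"
    "\<And>x. x \<in> X \<Longrightarrow> \<bar>\<psi> x\<bar> \<le> 2 * r * U" "\<And>x x'. x \<in> X \<Longrightarrow> x' \<in> X \<Longrightarrow> \<bar>\<psi> x - \<psi> x'\<bar> \<le> 2 * r * \<bar>f x - f x'\<bar>"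
  shows "6 * \<Gamma> * feval m (L (\<lambda>x. \<psi> x * p x)) \<le> feval m (L p)"
  using assms unfolding perturbation_bound_def by blast

text \<open>\<open>W\<close> is a reciprocal radius: for |z| \<le> 1 / (2 W) the perturbed operator
  preserves the complexified cone. \<open>U_le_W\<close> keeps |z u| \<le> 1/2 on that disc.\<close>

locale skew_observable = skew_product +
  fixes ut :: "'a \<Rightarrow> 'b \<Rightarrow> real" and U W :: "'a \<Rightarrow> real"
  assumes ut_holder: "\<omega> \<in> N \<Longrightarrow> holder_space \<alpha> (fib E \<omega>) (ut \<omega>)"
    and ut_le: "\<omega> \<in> N \<Longrightarrow> x \<in> fib E \<omega> \<Longrightarrow> \<bar>ut \<omega> x\<bar> \<le> U \<omega>"
    and U_le_W: "\<omega> \<in> N \<Longrightarrow> U \<omega> \<le> W \<omega>"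
    and perturb: "\<omega> \<in> N \<Longrightarrow> perturbation_bound (S \<omega>) (S (\<theta> \<omega>)) (Lop E T \<phi> \<omega>) (\<Gamma> \<omega>) (fib E \<omega>) (U \<omega>) (W \<omega>) (ut \<omega>)"
begin

lemma U_nonneg: "\<omega> \<in> N \<Longrightarrow> 0 \<le> U \<omega>"
  using ut_le[of \<omega>] fib_nonempty[of \<omega>] by (meson abs_ge_zero ex_in_conv order_trans)

lemma bmeas_ut: "\<omega> \<in> N \<Longrightarrow> bmeas \<omega> (ut \<omega>)"
  by (rule bmeas_holder) (auto intro: ut_holder)

lemma norm_z_ut: "\<omega> \<in> N \<Longrightarrow> norm z * W \<omega> \<le> 1/2 \<Longrightarrow> x \<in> fib E \<omega> \<Longrightarrow> norm (z * complex_of_real (ut \<omega> x)) \<le> 1/2"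
  unfolding norm_mult
  using mult_left_mono[of "\<bar>ut \<omega> x\<bar>" "W \<omega>" "norm z"] order_trans[OF ut_le U_le_W] by fastforce

text \<open>The modulus of a complex number is the largest real part of its rotations, which reduces the
  complex perturbation bound to the real one.\<close>

lemma feval_perturbed:
  assumes \<omega>: "\<omega> \<in> N" and z: "norm z * W \<omega> \<le> 1/2" and p: "p \<in> fcone (S \<omega>)" and m: "m \<in> S (\<theta> \<omega>)"
  shows "norm (feval m (LC \<omega> (\<lambda>x. exp (z * of_real (ut \<omega> x)) * of_real (p x))) - of_real (feval m (L \<omega> p))) \<le> feval m (L \<omega> p) / (6 * \<Gamma> \<omega>)"
proof -
  have mX: "x \<in> fib E (\<theta> \<omega>)" if "x \<in> snd ` set m" for x by (rule good_coneD(2)[OF cone[OF \<theta>[OF \<omega>]] m that])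
  define w where "w x = exp (z * of_real (ut \<omega> x)) - 1" for x
  have bw: "bmeas \<omega> w"
  proof -
    have "bmeas \<omega> (\<lambda>x. exp (z * of_real (ut \<omega> x)) + (- 1))"
      by (intro bmeas_add bmeas_const bmeas_exp bmeas_ut \<omega>)
    then show ?thesis by (simp add: w_def[abs_def])
  qed
  have bp: "bmeas \<omega> (\<lambda>x. complex_of_real (p x))" by (intro bmeas_of_real bmeas_cone \<omega> p)
  have bwp: "bmeas \<omega> (\<lambda>x. w x * of_real (p x))" by (rule bmeas_mult[OF bw bp])
  define D where "D = feval m (LC \<omega> (\<lambda>x. w x * of_real (p x)))"
  have D: "feval m (LC \<omega> (\<lambda>x. exp (z * of_real (ut \<omega> x)) * of_real (p x))) - of_real (feval m (L \<omega> p)) = D"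
  proof -
    have "feval m (LC \<omega> (\<lambda>x. exp (z * of_real (ut \<omega> x)) * of_real (p x)))
      = feval m (\<lambda>x. LC \<omega> (\<lambda>x. w x * of_real (p x)) x + of_real (L \<omega> p x))"
    proof (rule feval_cong)
      fix x assume "x \<in> snd ` set m"
      then have x: "x \<in> fib E (\<theta> \<omega>)" by (rule mX)
      have "LC \<omega> (\<lambda>x. 1 * (w x * of_real (p x)) + 1 * of_real (p x)) x = 1 * LC \<omega> (\<lambda>x. w x * of_real (p x)) x + 1 * LC \<omega> (\<lambda>x. of_real (p x)) x"
        by (rule LC_linear[OF \<omega> x bwp bp])
      then show "LC \<omega> (\<lambda>x. exp (z * of_real (ut \<omega> x)) * of_real (p x)) x = LC \<omega> (\<lambda>x. w x * of_real (p x)) x + of_real (L \<omega> p x)"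
        by (simp add: LC_of_real w_def algebra_simps)
    qed
    then show ?thesis by (simp add: feval_add feval_of_real D_def)
  qed
  \<comment> \<open>\<open>c\<close> turns D onto the positive axis, so that |D| becomes a
    functional of the real multiplier Re (c w).\<close>
  obtain c where c: "norm c = 1" "c * D = of_real (norm D)"
  proof (cases "D = 0")
    case False
    then have 1: "norm (cnj (sgn D)) = 1" by (simp add: norm_sgn)
    have "cnj (sgn D) * D = (D * cnj D) / of_real (norm D)" by (simp add: sgn_eq mult.commute)
    also have "\<dots> = of_real ((norm D)\<^sup>2) / of_real (norm D)" unfolding complex_norm_square ..
    also have "\<dots> = of_real (norm D)" using False by (simp add: power2_eq_square)
    finally show thesis by (rule that[OF 1])
  qed (use that[of 1] in simp)
  define \<psi> where "\<psi> x = Re (c * w x)" for x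
  have \<psi>_diff: "\<bar>Re (c * a)\<bar> \<le> norm a" for a
    using abs_Re_le_cmod[of "c * a"] c(1) by (simp add: norm_mult)
  have "norm D = Re (c * D)" using c(2) by simp
  also have "\<dots> = feval m (\<lambda>x. Re (c * LC \<omega> (\<lambda>x. w x * of_real (p x)) x))"
    unfolding D_def feval_mult[symmetric] Re_feval ..
  also have "\<dots> = feval m (L \<omega> (\<lambda>x. \<psi> x * p x))"
  proof (rule feval_cong)
    fix x assume "x \<in> snd ` set m"
    then have x: "x \<in> fib E (\<theta> \<omega>)" by (rule mX)
    have "c * LC \<omega> (\<lambda>x. w x * of_real (p x)) x = LC \<omega> (\<lambda>x. c * (w x * of_real (p x)) + 0 * (w x * of_real (p x))) x"
      by (subst LC_linear[OF \<omega> x bwp bwp]) simp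
    then have "Re (c * LC \<omega> (\<lambda>x. w x * of_real (p x)) x) = L \<omega> (\<lambda>x. Re (c * (w x * of_real (p x)))) x"
      by (simp only: LC_def complex.sel) simp
    also have "(\<lambda>x. Re (c * (w x * of_real (p x)))) = (\<lambda>x. \<psi> x * p x)"
      by (auto simp: \<psi>_def fun_eq_iff algebra_simps)
    finally show "Re (c * LC \<omega> (\<lambda>x. w x * of_real (p x)) x) = L \<omega> (\<lambda>x. \<psi> x * p x) x" .
  qed
  finally have normD: "norm D = feval m (L \<omega> (\<lambda>x. \<psi> x * p x))" .
  have "6 * \<Gamma> \<omega> * feval m (L \<omega> (\<lambda>x. \<psi> x * p x)) \<le> feval m (L \<omega> p)"
  proof (rule perturbation_boundD[OF perturb[OF \<omega>] norm_ge_zero z p m])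
    fix x assume x: "x \<in> fib E \<omega>"
    have "\<bar>\<psi> x\<bar> \<le> norm (exp (z * of_real (ut \<omega> x)) - exp 0)" unfolding \<psi>_def using \<psi>_diff[of "w x"] by (simp add: w_def)
    also have "\<dots> \<le> 2 * norm (z * of_real (ut \<omega> x) - 0)" by (rule norm_exp_diff_le) (use norm_z_ut[OF \<omega> z x] in auto)
    also have "\<dots> \<le> 2 * (norm z * U \<omega>)" using ut_le[OF \<omega> x] by (simp add: norm_mult mult_left_mono)
    finally show "\<bar>\<psi> x\<bar> \<le> 2 * norm z * U \<omega>" by simp
  next
    fix x x' assume x: "x \<in> fib E \<omega>" "x' \<in> fib E \<omega>"
    have "\<psi> x - \<psi> x' = Re (c * (w x - w x'))" by (simp add: \<psi>_def algebra_simps)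
    then have "\<bar>\<psi> x - \<psi> x'\<bar> \<le> norm (exp (z * of_real (ut \<omega> x)) - exp (z * of_real (ut \<omega> x')))"
      using \<psi>_diff[of "w x - w x'"] by (simp add: w_def)
    also have "\<dots> \<le> 2 * norm (z * of_real (ut \<omega> x) - z * of_real (ut \<omega> x'))"
      by (rule norm_exp_diff_le) (use norm_z_ut[OF \<omega> z] x in auto)
    also have "\<dots> = 2 * norm z * \<bar>ut \<omega> x - ut \<omega> x'\<bar>"
      by (simp add: norm_mult right_diff_distrib[symmetric] of_real_diff[symmetric] del: of_real_diff)
    finally show "\<bar>\<psi> x - \<psi> x'\<bar> \<le> 2 * norm z * \<bar>ut \<omega> x - ut \<omega> x'\<bar>" .
  qed
  then show ?thesis unfolding D normD using \<Gamma>_ge_1[OF \<omega>] by (simp add: field_simps)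
qed

text \<open>On every functional the perturbed images of both real components stay within relative
  error 1 / (6 \<Gamma>) of the unperturbed ones. \<open>complex_cone_stable\<close> therefore
  applies to every pair of functionals, and \<open>complex_cone_decomposition\<close> returns new
  real components.\<close>

lemma ccone_step:
  assumes \<omega>: "\<omega> \<in> N" and z: "norm z * W \<omega> \<le> 1/2" and G: "ccone \<omega> G"
  shows "ccone (\<theta> \<omega>) (LC \<omega> (\<lambda>x. exp (z * of_real (ut \<omega> x)) * G x))"
proof -
  obtain c p q x0 where c: "c \<noteq> 0" and pq: "p \<in> fcone (S \<omega>)" "q \<in> fcone (S \<omega>)"
    and x0: "x0 \<in> fib E \<omega>" "0 < p x0 + q x0"
    and G: "\<And>x. x \<in> fib E \<omega> \<Longrightarrow> G x = c * ((1 + \<i>) * of_real (p x) + (1 - \<i>) * of_real (q x))"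
    using G by (auto simp: ccone_def)
  let ?e = "\<lambda>x. exp (z * complex_of_real (ut \<omega> x))"
  let ?P = "\<lambda>x. ?e x * of_real (p x)" and ?Q = "\<lambda>x. ?e x * of_real (q x)"
  define R where "R x = (1 + \<i>) * LC \<omega> ?P x + (1 - \<i>) * LC \<omega> ?Q x" for x
  have bP: "bmeas \<omega> ?P" "bmeas \<omega> ?Q"
    by (intro bmeas_mult bmeas_exp bmeas_ut bmeas_of_real bmeas_cone \<omega> pq)+
  have LCG: "LC \<omega> (\<lambda>x. ?e x * G x) x = c * R x" if x: "x \<in> fib E (\<theta> \<omega>)" for x
  proof -
    have "LC \<omega> (\<lambda>x. ?e x * G x) x = LC \<omega> (\<lambda>x. (c * (1 + \<i>)) * ?P x + (c * (1 - \<i>)) * ?Q x) x"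
      by (rule LC_cong) (simp add: G algebra_simps)
    also have "\<dots> = (c * (1 + \<i>)) * LC \<omega> ?P x + (c * (1 - \<i>)) * LC \<omega> ?Q x"
      by (rule LC_linear[OF \<omega> x bP])
    finally show ?thesis by (simp add: R_def algebra_simps)
  qed
  have fR: "feval m R = (1 + \<i>) * feval m (LC \<omega> ?P) + (1 - \<i>) * feval m (LC \<omega> ?Q)" for m
    unfolding R_def[abs_def] feval_add feval_mult ..
  have Lpq: "L \<omega> p \<in> fcone (S (\<theta> \<omega>))" "L \<omega> q \<in> fcone (S (\<theta> \<omega>))" by (rule L_cone[OF \<omega>] pq)+
  note nn = fconeD[OF Lpq(1)] fconeD[OF Lpq(2)]
  have cr: "feval l (L \<omega> p') * feval m (L \<omega> q') \<le> (\<Gamma> \<omega>)\<^sup>2 * (feval l (L \<omega> q') * feval m (L \<omega> p'))"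
    if "l \<in> S (\<theta> \<omega>)" "m \<in> S (\<theta> \<omega>)" "p' \<in> fcone (S \<omega>)" "q' \<in> fcone (S \<omega>)" for l m p' q'
    using step[OF \<omega>] that by (simp add: cone_step_def)
  have stable: "0 \<le> Re (cnj (feval l R) * feval m R)" if lm: "l \<in> S (\<theta> \<omega>)" "m \<in> S (\<theta> \<omega>)" for l m
    unfolding fR
    by (rule complex_cone_stable[where a="feval l (L \<omega> p)" and b="feval l (L \<omega> q)" and a'="feval m (L \<omega> p)" and b'="feval m (L \<omega> q)" and \<Gamma>="\<Gamma> \<omega>"])
      (use lm nn \<Gamma>_ge_1[OF \<omega>] cr[OF lm pq] cr[OF lm pq(2,1)] in \<open>simp_all add: feval_perturbed[OF \<omega> z] pq\<close>)
  obtain c' p' q' where d: "c' \<noteq> 0" "p' \<in> fcone (S (\<theta> \<omega>))" "q' \<in> fcone (S (\<theta> \<omega>))"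
    "\<And>x. R x = c' * ((1 + \<i>) * of_real (p' x) + (1 - \<i>) * of_real (q' x))"
    using complex_cone_decomposition[of "S (\<theta> \<omega>)" R] stable by metis
  obtain x1 where x1: "x1 \<in> fib E (\<theta> \<omega>)" using fib_nonempty[OF \<theta>[OF \<omega>]] by auto
  \<comment> \<open>The unperturbed modulus at x1 is at least a + b > 0, while the error is at most
    (a + b) / 3; the image is not the zero function.\<close>
  have "R x1 \<noteq> 0"
  proof
    assume R0: "R x1 = 0"
    have m: "[(1, x1)] \<in> S (\<theta> \<omega>)" by (rule good_coneD(1)[OF cone[OF \<theta>[OF \<omega>]] x1])
    let ?a = "L \<omega> p x1" and ?b = "L \<omega> q x1"
    have a: "0 \<le> ?a" "0 \<le> ?b" using nn[OF m] by auto
    have ab: "0 < ?a + ?b"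
    proof (cases "0 < p x0")
      case True
      then show ?thesis using L_pos[OF \<omega> pq(1) x0(1) _ x1] a by simp
    next
      case False
      then have "0 < q x0" using x0 by simp
      then show ?thesis using L_pos[OF \<omega> pq(2) x0(1) _ x1] a by simp
    qed
    have e: "norm (LC \<omega> ?P x1 - of_real ?a) \<le> ?a / 6" "norm (LC \<omega> ?Q x1 - of_real ?b) \<le> ?b / 6"
    proof -
      have g: "t / (6 * \<Gamma> \<omega>) \<le> t / 6" if "0 \<le> t" for t
        using \<Gamma>_ge_1[OF \<omega>] that by (intro divide_left_mono) auto
      show "norm (LC \<omega> ?P x1 - of_real ?a) \<le> ?a / 6" "norm (LC \<omega> ?Q x1 - of_real ?b) \<le> ?b / 6"
        using feval_perturbed[OF \<omega> z pq(1) m] feval_perturbed[OF \<omega> z pq(2) m] g[OF a(1)] g[OF a(2)] by auto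
    qed
    have "?a + ?b \<le> norm ((1 + \<i>) * of_real ?a + (1 - \<i>) * of_real ?b)"
      by (rule norm_sector_combination(1)[OF a])
    also have "(1 + \<i>) * of_real ?a + (1 - \<i>) * of_real ?b
       = R x1 - ((1 + \<i>) * (LC \<omega> ?P x1 - of_real ?a) + (1 - \<i>) * (LC \<omega> ?Q x1 - of_real ?b))"
      by (simp add: R_def algebra_simps)
    also have "norm \<dots> \<le> norm (1 + \<i>) * (?a / 6) + norm (1 - \<i>) * (?b / 6)"
      unfolding R0 diff_0 norm_minus_cancel
      by (rule order_trans[OF norm_triangle_ineq]) (unfold norm_mult, intro add_mono mult_left_mono e, auto)
    also have "\<dots> \<le> 2 * (?a / 6) + 2 * (?b / 6)"
    proof -
      have "norm (1 + \<i>) \<le> 2" "norm (1 - \<i>) \<le> 2"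
        using norm_triangle_ineq[of 1 \<i>] norm_triangle_ineq4[of 1 \<i>] by simp_all
      then show ?thesis using a by (intro add_mono mult_right_mono) auto
    qed
    finally show False using ab by simp
  qed
  then have "p' x1 \<noteq> 0 \<or> q' x1 \<noteq> 0" using d(4)[of x1] by auto
  then have "0 < p' x1 + q' x1"
    using good_cone_nonneg[OF cone[OF \<theta>[OF \<omega>]] d(2) x1] good_cone_nonneg[OF cone[OF \<theta>[OF \<omega>]] d(3) x1] by auto
  then show ?thesis unfolding ccone_def
    using c d x1 LCG by (intro exI[of _ "c * c'"] exI[of _ p'] exI[of _ q']) auto
qed

text \<open>Unnormalised iterates started from h, so that their \<nu>-integral is the moment
  generating function under the Gibbs measure times \<open>lamn\<close>.\<close>

primrec Gk :: "complex \<Rightarrow> 'a \<Rightarrow> nat \<Rightarrow> 'b \<Rightarrow> complex" where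
  "Gk z \<omega> 0 = (\<lambda>x. of_real (hlim \<omega> x))"
| "Gk z \<omega> (Suc k) = LC ((\<theta> ^^ k) \<omega>) (\<lambda>x. exp (z * of_real (ut ((\<theta> ^^ k) \<omega>) x)) * Gk z \<omega> k x)"

lemma ccone_hlim:
  assumes \<omega>: "\<omega> \<in> N"
  shows "ccone \<omega> (\<lambda>x. of_real (hlim \<omega> x))"
proof -
  have "\<exists>x\<in>fib E \<omega>. 0 < hlim \<omega> x"
  proof (rule ccontr)
    assume "\<not> ?thesis"
    then have "hlim \<omega> x = 0" if "x \<in> fib E \<omega>" for x
      using good_cone_nonneg[OF cone[OF \<omega>] hlim_cone[OF \<omega>] that] that by force
    then have "integral\<^sup>L (\<nu> \<omega>) (hlim \<omega>) = integral\<^sup>L (\<nu> \<omega>) (\<lambda>_. 0)"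
      by (intro Bochner_Integration.integral_cong) (auto simp: space_\<nu>[OF \<omega>])
    then show False using integral_hlim[OF \<omega>] by simp
  qed
  then have "\<exists>x\<in>fib E \<omega>. 0 < hlim \<omega> x + hlim \<omega> x" by (metis add_pos_pos)
  \<comment> \<open>With p = q = h the two sector edges add up to 2 h, whence the constant
    1/2.\<close>
  then show ?thesis unfolding ccone_def
    using hlim_cone[OF \<omega>] by (intro exI[of _ "1/2"] exI[of _ "hlim \<omega>"]) (auto simp: algebra_simps)
qed

lemma ccone_Gk:
  assumes \<omega>: "\<omega> \<in> N" and z: "\<And>j. j < k \<Longrightarrow> norm z * W ((\<theta> ^^ j) \<omega>) \<le> 1/2"
  shows "ccone ((\<theta> ^^ k) \<omega>) (Gk z \<omega> k)"
  using z
proof (induction k)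
  case 0
  then show ?case using ccone_hlim[OF \<omega>] by simp
next
  case (Suc k)
  then show ?case using ccone_step[OF \<theta>n[OF \<omega>], of z k "Gk z \<omega> k"] by simp
qed

lemma bmeas_Ssum: "\<omega> \<in> N \<Longrightarrow> bmeas \<omega> (Ssum \<theta> T ut n \<omega>)"
proof (induction n)
  case (Suc n)
  have "bmeas \<omega> (\<lambda>x. Ssum \<theta> T ut n \<omega> x + ut ((\<theta> ^^ n) \<omega>) (iterT \<theta> T n \<omega> x))"
    by (intro bmeas_add Suc bmeas_comp[OF measurable_iterT] bmeas_ut \<theta>n)
  then show ?case by (simp add: Ssum_def[abs_def] add.commute)
qed (simp add: Ssum_def[abs_def] bmeas_const)

text \<open>Duality against an arbitrary test function: in the induction step f composed with T,
  times exp (z u), becomes the test function one fibre earlier, and the exponentials collect into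
  the Birkhoff sum.\<close>

lemma integral_Gk:
  fixes f :: "'b \<Rightarrow> complex" and z :: complex
  assumes \<omega>: "\<omega> \<in> N" and z: "\<And>j. j < k \<Longrightarrow> norm z * W ((\<theta> ^^ j) \<omega>) \<le> 1/2" and f: "bmeas ((\<theta> ^^ k) \<omega>) f"
  shows "integral\<^sup>L (\<nu> ((\<theta> ^^ k) \<omega>)) (\<lambda>x. f x * Gk z \<omega> k x)
     = lamn \<omega> k * integral\<^sup>L (\<nu> \<omega>) (\<lambda>x. f (iterT \<theta> T k \<omega> x) * (exp (z * of_real (Ssum \<theta> T ut k \<omega> x)) * of_real (hlim \<omega> x)))"
  using z f
proof (induction k arbitrary: f)
  case 0
  then show ?case by (simp add: Ssum_def glamn_def)
next
  case (Suc k)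
  let ?v = "(\<theta> ^^ k) \<omega>"
  have v: "?v \<in> N" by (rule \<theta>n[OF \<omega>])
  let ?e = "\<lambda>x. exp (z * complex_of_real (ut ?v x))"
  have bG: "bmeas ?v (Gk z \<omega> k)" by (rule bmeas_ccone[OF v ccone_Gk[OF \<omega>]]) (use Suc.prems in auto)
  have bf: "bmeas (\<theta> ?v) f" using Suc.prems by simp
  have beG: "bmeas ?v (\<lambda>x. ?e x * Gk z \<omega> k x)" by (intro bmeas_mult bmeas_exp bmeas_ut v bG)
  have bfT: "bmeas ?v (\<lambda>x. f (T ?v x))" by (rule bmeas_comp[OF measurable_T[OF v] bf])
  have "integral\<^sup>L (\<nu> ((\<theta> ^^ Suc k) \<omega>)) (\<lambda>x. f x * Gk z \<omega> (Suc k) x)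
     = integral\<^sup>L (\<nu> (\<theta> ?v)) (LC ?v (\<lambda>x. f (T ?v x) * (?e x * Gk z \<omega> k x)))"
    using LC_mult_comp[OF v _ beG, of _ f] space_\<nu>[OF \<theta>[OF v]] by (intro Bochner_Integration.integral_cong) simp_all
  also have "\<dots> = lam ?v * integral\<^sup>L (\<nu> ?v) (\<lambda>x. f (T ?v x) * (?e x * Gk z \<omega> k x))"
    by (rule integral_LC[OF v]) (intro bmeas_mult[of ?v "\<lambda>x. f (T ?v x)"] bfT beG)
  also have "\<dots> = lam ?v * integral\<^sup>L (\<nu> ?v) (\<lambda>x. (f (T ?v x) * ?e x) * Gk z \<omega> k x)" by (simp add: mult.assoc)
  also have "integral\<^sup>L (\<nu> ?v) (\<lambda>x. (f (T ?v x) * ?e x) * Gk z \<omega> k x)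
     = lamn \<omega> k * integral\<^sup>L (\<nu> \<omega>) (\<lambda>x. (f (T ?v (iterT \<theta> T k \<omega> x)) * ?e (iterT \<theta> T k \<omega> x)) * (exp (z * of_real (Ssum \<theta> T ut k \<omega> x)) * of_real (hlim \<omega> x)))"
    by (rule Suc.IH) (use Suc.prems in \<open>auto intro!: bmeas_mult bfT bmeas_exp bmeas_ut v\<close>)
  also have "(\<lambda>x. (f (T ?v (iterT \<theta> T k \<omega> x)) * ?e (iterT \<theta> T k \<omega> x)) * (exp (z * of_real (Ssum \<theta> T ut k \<omega> x)) * of_real (hlim \<omega> x)))
     = (\<lambda>x. f (iterT \<theta> T (Suc k) \<omega> x) * (exp (z * of_real (Ssum \<theta> T ut (Suc k) \<omega> x)) * of_real (hlim \<omega> x)))"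
    by (auto simp: Ssum_def fun_eq_iff exp_add algebra_simps)
  finally show ?case by (simp add: lamn_Suc)
qed

section \<open>The moment generating function along an orbit\<close>

definition Fk :: "complex \<Rightarrow> 'a \<Rightarrow> nat \<Rightarrow> complex" where
  "Fk z \<omega> k = integral\<^sup>L (\<nu> \<omega>) (\<lambda>x. exp (z * of_real (Ssum \<theta> T ut k \<omega> x)) * of_real (hlim \<omega> x))"

lemma Fk_eq:
  assumes \<omega>: "\<omega> \<in> N" and z: "\<And>j. j < k \<Longrightarrow> norm z * W ((\<theta> ^^ j) \<omega>) \<le> 1/2"
  shows "integral\<^sup>L (\<nu> ((\<theta> ^^ k) \<omega>)) (Gk z \<omega> k) = lamn \<omega> k * Fk z \<omega> k"
  using integral_Gk[OF \<omega> z bmeas_const[of _ 1]] by (simp add: Fk_def)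

lemma Fk_nonzero:
  assumes \<omega>: "\<omega> \<in> N" and z: "\<And>j. j < k \<Longrightarrow> norm z * W ((\<theta> ^^ j) \<omega>) \<le> 1/2"
  shows "Fk z \<omega> k \<noteq> 0"
  using ccone_bound(1)[OF \<theta>n[OF \<omega>] ccone_Gk[OF \<omega> z], of k] Fk_eq[OF \<omega> z] by auto

lemma K_nonneg: "\<omega> \<in> N \<Longrightarrow> 1 \<le> K \<omega>"
  using good_coneD(4)[OF cone good_coneD(5)[OF cone]] fib_nonempty by fastforce

text \<open>On the admissible disc |exp (z u)| \<le> 2, \<open>ccone_bound\<close> contributes sqrt
  2 * K, and 2 sqrt 2 \<le> 3.\<close>

lemma Fk_Suc_le:
  assumes \<omega>: "\<omega> \<in> N" and z: "\<And>j. j < Suc k \<Longrightarrow> norm z * W ((\<theta> ^^ j) \<omega>) \<le> 1/2"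
  shows "norm (Fk z \<omega> (Suc k)) \<le> 3 * K ((\<theta> ^^ k) \<omega>) * norm (Fk z \<omega> k)"
proof -
  let ?v = "(\<theta> ^^ k) \<omega>"
  have v: "?v \<in> N" by (rule \<theta>n[OF \<omega>])
  interpret \<nu>: prob_space "\<nu> ?v" by (rule \<nu>(1)[OF v])
  let ?e = "\<lambda>x. exp (z * complex_of_real (ut ?v x))"
  have zk: "norm z * W ((\<theta> ^^ j) \<omega>) \<le> 1/2" if "j < k" for j using z that by simp
  have G: "ccone ?v (Gk z \<omega> k)" by (rule ccone_Gk[OF \<omega> zk])
  let ?I = "integral\<^sup>L (\<nu> ?v) (Gk z \<omega> k)"
  have beG: "bmeas ?v (\<lambda>x. ?e x * Gk z \<omega> k x)" by (intro bmeas_mult bmeas_exp bmeas_ut v bmeas_ccone[OF v G])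
  have pos: "0 < lam ?v" "0 < lamn \<omega> k" using lam_pos[OF v] lamn_pos[OF \<omega>] by auto
  have "of_real (lamn \<omega> k * lam ?v) * Fk z \<omega> (Suc k) = integral\<^sup>L (\<nu> (\<theta> ?v)) (LC ?v (\<lambda>x. ?e x * Gk z \<omega> k x))"
    using Fk_eq[OF \<omega> z, of "Suc k"] by (simp add: lamn_Suc)
  also have "\<dots> = lam ?v * integral\<^sup>L (\<nu> ?v) (\<lambda>x. ?e x * Gk z \<omega> k x)" by (rule integral_LC[OF v beG])
  finally have eq: "lamn \<omega> k * Fk z \<omega> (Suc k) = integral\<^sup>L (\<nu> ?v) (\<lambda>x. ?e x * Gk z \<omega> k x)" using pos by simp
  have "norm (integral\<^sup>L (\<nu> ?v) (\<lambda>x. ?e x * Gk z \<omega> k x)) \<le> integral\<^sup>L (\<nu> ?v) (\<lambda>x. 3 * K ?v * norm ?I)"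
  proof (rule order_trans[OF integral_norm_bound Bochner_Integration.integral_mono])
    show "integrable (\<nu> ?v) (\<lambda>x. norm (?e x * Gk z \<omega> k x))" by (intro integrable_norm bmeas_integrable v beG)
    fix x assume "x \<in> space (\<nu> ?v)"
    then have x: "x \<in> fib E ?v" by (simp add: space_\<nu>[OF v])
    have "Re (z * of_real (ut ?v x)) \<le> 1/2"
      using complex_Re_le_cmod[of "z * of_real (ut ?v x)"] norm_z_ut[OF v z x] by (meson lessI order_trans)
    then have e: "norm (?e x) \<le> 2" using exp_half_le_2 by (simp add: order_trans[of _ "exp (1/2)"])
    have s: "2 * sqrt 2 \<le> (3::real)" by (rule power2_le_imp_le) (simp_all add: power_mult_distrib)
    have "norm (?e x * Gk z \<omega> k x) \<le> 2 * (sqrt 2 * K ?v * norm ?I)"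
      unfolding norm_mult by (intro mult_mono e ccone_bound(2)[OF v G x]) auto
    also have "\<dots> = (2 * sqrt 2) * (K ?v * norm ?I)" by simp
    also have "\<dots> \<le> 3 * (K ?v * norm ?I)" using K_nonneg[OF v] s by (intro mult_right_mono) auto
    finally show "norm (?e x * Gk z \<omega> k x) \<le> 3 * K ?v * norm ?I" by simp
  qed simp
  also have "\<dots> = 3 * K ?v * norm ?I" by (simp add: \<nu>.prob_space)
  also have "norm ?I = lamn \<omega> k * norm (Fk z \<omega> k)" using Fk_eq[OF \<omega> zk] pos by (simp add: norm_mult)
  finally have "lamn \<omega> k * norm (Fk z \<omega> (Suc k)) \<le> lamn \<omega> k * (3 * K ?v * norm (Fk z \<omega> k))"
    using arg_cong[OF eq, of norm] pos by (simp add: norm_mult mult_ac)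
  then show ?thesis using pos by simp
qed

lemma Fk_le:
  assumes \<omega>: "\<omega> \<in> N" and z: "\<And>j. j < k \<Longrightarrow> norm z * W ((\<theta> ^^ j) \<omega>) \<le> 1/2"
  shows "norm (Fk z \<omega> k) \<le> (\<Prod>j<k. 3 * K ((\<theta> ^^ j) \<omega>))"
  using z
proof (induction k)
  case 0
  have "integral\<^sup>L (\<nu> \<omega>) (\<lambda>x. complex_of_real (hlim \<omega> x)) = of_real 1" using integral_hlim[OF \<omega>] by simp
  then show ?case by (simp add: Fk_def Ssum_def)
next
  case (Suc k)
  have "norm (Fk z \<omega> (Suc k)) \<le> 3 * K ((\<theta> ^^ k) \<omega>) * norm (Fk z \<omega> k)" by (rule Fk_Suc_le[OF \<omega> Suc.prems])
  also have "\<dots> \<le> 3 * K ((\<theta> ^^ k) \<omega>) * (\<Prod>j<k. 3 * K ((\<theta> ^^ j) \<omega>))"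
    using Suc K_nonneg[OF \<theta>n[OF \<omega>], of k] by (intro mult_left_mono) auto
  finally show ?case by (simp add: mult.commute)
qed

section \<open>The Gibbs measure: normalisation and invariance\<close>

definition mu :: "'a \<Rightarrow> 'b measure" where
  "mu \<omega> = density (\<nu> \<omega>) (\<lambda>x. ennreal (hlim \<omega> x))"

lemma hlim_nonneg: "\<omega> \<in> N \<Longrightarrow> x \<in> fib E \<omega> \<Longrightarrow> 0 \<le> hlim \<omega> x"
  by (rule good_cone_nonneg[OF cone hlim_cone])

lemma measurable_hlim: "\<omega> \<in> N \<Longrightarrow> hlim \<omega> \<in> borel_measurable (\<nu> \<omega>)"
  by (rule integrable_holder(1)[OF _ good_coneD(3)[OF cone hlim_cone]])

lemma space_mu: "\<omega> \<in> N \<Longrightarrow> space (mu \<omega>) = fib E \<omega>" and sets_mu: "\<omega> \<in> N \<Longrightarrow> sets (mu \<omega>) = sets (restrict_space borel (fib E \<omega>))"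
  by (simp_all add: mu_def space_\<nu> \<nu>(2))

lemma prob_space_mu:
  assumes \<omega>: "\<omega> \<in> N"
  shows "prob_space (mu \<omega>)"
proof (rule prob_spaceI)
  have "emeasure (mu \<omega>) (space (mu \<omega>)) = (\<integral>\<^sup>+x. ennreal (hlim \<omega> x) * indicator (space (\<nu> \<omega>)) x \<partial>\<nu> \<omega>)"
    unfolding mu_def using measurable_hlim[OF \<omega>] by (subst emeasure_density) auto
  also have "\<dots> = (\<integral>\<^sup>+x. ennreal (hlim \<omega> x) \<partial>\<nu> \<omega>)" by (intro nn_integral_cong) simp
  also have "\<dots> = ennreal (integral\<^sup>L (\<nu> \<omega>) (hlim \<omega>))"
    by (rule nn_integral_eq_integral[OF bmeas_integrable[OF \<omega> bmeas_cone[OF \<omega> hlim_cone[OF \<omega>]]]])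
      (use hlim_nonneg[OF \<omega>] in \<open>auto simp: space_\<nu>[OF \<omega>] intro!: AE_I2\<close>)
  finally show "emeasure (mu \<omega>) (space (mu \<omega>)) = 1" using integral_hlim[OF \<omega>] by simp
qed

lemma integral_mu:
  fixes f :: "'b \<Rightarrow> 'c::{banach, second_countable_topology}"
  assumes \<omega>: "\<omega> \<in> N" and f: "bmeas \<omega> f"
  shows "integral\<^sup>L (mu \<omega>) f = integral\<^sup>L (\<nu> \<omega>) (\<lambda>x. hlim \<omega> x *\<^sub>R f x)"
  unfolding mu_def
  by (rule integral_density) (use f measurable_hlim[OF \<omega>] hlim_nonneg[OF \<omega>] measurable_\<nu>[OF \<omega>] in \<open>auto simp: bmeas_def space_\<nu>[OF \<omega>] intro!: AE_I2\<close>)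

lemma bmeas_integrable_mu:
  fixes f :: "'b \<Rightarrow> 'c::{banach, second_countable_topology}"
  assumes \<omega>: "\<omega> \<in> N" and f: "bmeas \<omega> f"
  shows "integrable (mu \<omega>) f"
proof -
  interpret prob_space "mu \<omega>" by (rule prob_space_mu[OF \<omega>])
  obtain b where b: "\<And>x. x \<in> fib E \<omega> \<Longrightarrow> norm (f x) \<le> b" using f by (auto simp: bmeas_def)
  have "f \<in> borel_measurable (mu \<omega>)" using f measurable_cong_sets[OF sets_mu[OF \<omega>] refl] by (auto simp: bmeas_def)
  then show ?thesis
    by (intro integrable_const_bound[where B=b]) (use b in \<open>auto simp: space_mu[OF \<omega>] intro!: AE_I2\<close>)
qed

lemma mgf_mu:
  assumes \<omega>: "\<omega> \<in> N"
  shows "(CLINT x|mu \<omega>. exp (z * of_real (Ssum \<theta> T ut k \<omega> x))) = Fk z \<omega> k"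
  unfolding Fk_def by (subst integral_mu[OF \<omega> bmeas_exp[OF bmeas_Ssum[OF \<omega>]]]) (simp add: scaleR_conv_of_real mult.commute)

text \<open>At z = 0 the operators are unperturbed and the equation for h iterates.\<close>

lemma Gk_0:
  assumes \<omega>: "\<omega> \<in> N" and x: "x \<in> fib E ((\<theta> ^^ k) \<omega>)"
  shows "Gk 0 \<omega> k x = of_real (lamn \<omega> k * hlim ((\<theta> ^^ k) \<omega>) x)"
  using x
proof (induction k arbitrary: x)
  case (Suc k)
  let ?v = "(\<theta> ^^ k) \<omega>"
  have "Gk 0 \<omega> (Suc k) x = LC ?v (\<lambda>x. of_real (lamn \<omega> k * hlim ?v x)) x"
    using Suc.IH by (auto intro: LC_cong)
  also have "\<dots> = of_real (L ?v (\<lambda>x. lamn \<omega> k * hlim ?v x) x)" by (rule LC_of_real)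
  also have "L ?v (\<lambda>x. lamn \<omega> k * hlim ?v x) x = lamn \<omega> k * L ?v (hlim ?v) x"
    unfolding Lop_eq_transfer by (rule branched_map.transfer_scale[OF branched[OF \<theta>n[OF \<omega>]]])
  also have "L ?v (hlim ?v) x = lam ?v * hlim (\<theta> ?v) x"
    by (rule L_hlim[OF \<theta>n[OF \<omega>]]) (use Suc.prems in simp)
  finally show ?case by (simp add: lamn_Suc)
qed (simp add: glamn_def)

text \<open>Invariance is the duality \<open>integral_Gk\<close> at z = 0; the factor
  \<open>lamn\<close> appears on both sides and cancels.\<close>

lemma integral_mu_iterT:
  fixes f :: "'b \<Rightarrow> real"
  assumes \<omega>: "\<omega> \<in> N" and f: "bmeas ((\<theta> ^^ k) \<omega>) f"
  shows "integral\<^sup>L (mu \<omega>) (\<lambda>x. f (iterT \<theta> T k \<omega> x)) = integral\<^sup>L (mu ((\<theta> ^^ k) \<omega>)) f"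
proof -
  let ?v = "(\<theta> ^^ k) \<omega>"
  have v: "?v \<in> N" by (rule \<theta>n[OF \<omega>])
  have pos: "lamn \<omega> k \<noteq> 0" using lamn_pos[OF \<omega>, of k] by simp
  have "integral\<^sup>L (\<nu> ?v) (\<lambda>x. complex_of_real (f x) * Gk 0 \<omega> k x)
    = lamn \<omega> k * integral\<^sup>L (\<nu> \<omega>) (\<lambda>x. complex_of_real (f (iterT \<theta> T k \<omega> x)) * (exp (0 * of_real (Ssum \<theta> T ut k \<omega> x)) * of_real (hlim \<omega> x)))"
    by (rule integral_Gk[OF \<omega> _ bmeas_of_real[OF f]]) simp
  also have "integral\<^sup>L (\<nu> ?v) (\<lambda>x. complex_of_real (f x) * Gk 0 \<omega> k x)
     = integral\<^sup>L (\<nu> ?v) (\<lambda>x. of_real (lamn \<omega> k * (hlim ?v x * f x)))"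
    by (intro Bochner_Integration.integral_cong refl) (simp add: Gk_0[OF \<omega>] space_\<nu>[OF v])
  also have "integral\<^sup>L (\<nu> \<omega>) (\<lambda>x. of_real (f (iterT \<theta> T k \<omega> x)) * (exp (0 * of_real (Ssum \<theta> T ut k \<omega> x)) * complex_of_real (hlim \<omega> x)))
     = integral\<^sup>L (\<nu> \<omega>) (\<lambda>x. of_real (hlim \<omega> x * f (iterT \<theta> T k \<omega> x)))"
    by (intro Bochner_Integration.integral_cong refl) simp
  finally have "integral\<^sup>L (\<nu> ?v) (\<lambda>x. lamn \<omega> k * (hlim ?v x * f x)) = lamn \<omega> k * integral\<^sup>L (\<nu> \<omega>) (\<lambda>x. hlim \<omega> x * f (iterT \<theta> T k \<omega> x))"
    by (simp only: integral_complex_of_real of_real_mult[symmetric] of_real_eq_iff)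
  then have "integral\<^sup>L (\<nu> ?v) (\<lambda>x. hlim ?v x * f x) = integral\<^sup>L (\<nu> \<omega>) (\<lambda>x. hlim \<omega> x * f (iterT \<theta> T k \<omega> x))"
    using pos by simp
  then show ?thesis
    using integral_mu[OF v f] integral_mu[OF \<omega> bmeas_comp[OF measurable_iterT[OF \<omega>] f]] by simp
qed

lemma mgf_bounds:
  assumes \<omega>: "\<omega> \<in> N" and W: "\<And>j. j < n \<Longrightarrow> r * W ((\<theta> ^^ j) \<omega>) \<le> 1/2" and z: "norm z < r"
  shows "(CLINT x|mu \<omega>. exp (z * of_real (Ssum \<theta> T ut n \<omega> x))) \<noteq> 0"
    "norm (CLINT x|mu \<omega>. exp (z * of_real (Ssum \<theta> T ut n \<omega> x))) < exp (1 + (\<Sum>j<n. ln (3 * K ((\<theta> ^^ j) \<omega>))))"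
proof -
  have zW: "norm z * W ((\<theta> ^^ j) \<omega>) \<le> 1/2" if "j < n" for j
    using W[OF that] mult_right_mono[of "norm z" r "W ((\<theta> ^^ j) \<omega>)"] z
      order_trans[OF U_nonneg[OF \<theta>n[OF \<omega>]] U_le_W[OF \<theta>n[OF \<omega>]], of j] by linarith
  show "(CLINT x|mu \<omega>. exp (z * of_real (Ssum \<theta> T ut n \<omega> x))) \<noteq> 0"
    unfolding mgf_mu[OF \<omega>] by (rule Fk_nonzero[OF \<omega> zW])
  have pos: "0 < 3 * K ((\<theta> ^^ j) \<omega>)" for j using K_nonneg[OF \<theta>n[OF \<omega>], of j] by simp
  have "norm (Fk z \<omega> n) \<le> (\<Prod>j<n. 3 * K ((\<theta> ^^ j) \<omega>))" by (rule Fk_le[OF \<omega> zW])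
  also have "\<dots> = exp (\<Sum>j<n. ln (3 * K ((\<theta> ^^ j) \<omega>)))" using pos by (simp add: exp_sum)
  \<comment> \<open>The summand 1 makes the inequality strict, as the Berry--Esseen lemma
    requires.\<close>
  also have "\<dots> < exp (1 + (\<Sum>j<n. ln (3 * K ((\<theta> ^^ j) \<omega>))))" by simp
  finally show "norm (CLINT x|mu \<omega>. exp (z * of_real (Ssum \<theta> T ut n \<omega> x))) < exp (1 + (\<Sum>j<n. ln (3 * K ((\<theta> ^^ j) \<omega>))))"
    unfolding mgf_mu[OF \<omega>] .
qed

lemma measurable_Ssum: "\<omega> \<in> N \<Longrightarrow> Ssum \<theta> T ut n \<omega> \<in> borel_measurable (mu \<omega>)"
  using bmeas_Ssum[of \<omega> n] measurable_cong_sets[OF sets_mu refl, of \<omega>] by (auto simp: bmeas_def)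

text \<open>Invariance moves each summand to its own fibre, where the observable is centred.\<close>

lemma mean_Ssum:
  assumes \<omega>: "\<omega> \<in> N" and centred: "\<And>\<omega>. \<omega> \<in> N \<Longrightarrow> integral\<^sup>L (mu \<omega>) (ut \<omega>) = 0"
  shows "integral\<^sup>L (mu \<omega>) (Ssum \<theta> T ut n \<omega>) = 0"
proof -
  have "integral\<^sup>L (mu \<omega>) (Ssum \<theta> T ut n \<omega>) = (\<Sum>j<n. integral\<^sup>L (mu \<omega>) (\<lambda>x. ut ((\<theta> ^^ j) \<omega>) (iterT \<theta> T j \<omega> x)))"
    unfolding Ssum_def[abs_def]
    by (rule Bochner_Integration.integral_sum)
      (intro bmeas_integrable_mu[OF \<omega>] bmeas_comp[OF measurable_iterT[OF \<omega>]] bmeas_ut \<theta>n \<omega>)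
  also have "\<dots> = 0"
    by (intro sum.neutral ballI) (simp add: integral_mu_iterT[OF \<omega> bmeas_ut[OF \<theta>n[OF \<omega>]]] centred \<theta>n \<omega>)
  finally show ?thesis .
qed

end

section \<open>The cones of Settings A and B\<close>

lemma hvar_le:
  assumes "holder_space \<alpha> X g" "x \<in> X" "x' \<in> X"
  shows "\<bar>g x - g x'\<bar> \<le> hvar \<alpha> X g * dist x x' powr \<alpha>" "0 \<le> hvar \<alpha> X g"
proof -
  let ?A = "insert 0 {\<bar>g x - g x'\<bar> / dist x x' powr \<alpha> | x x'. x \<in> X \<and> x' \<in> X \<and> x \<noteq> x'}"
  obtain C where C: "\<And>x x'. x \<in> X \<Longrightarrow> x' \<in> X \<Longrightarrow> \<bar>g x - g x'\<bar> \<le> C * dist x x' powr \<alpha>"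
    using assms(1) unfolding holder_space_def by blast
  have "\<bar>g x - g x'\<bar> / dist x x' powr \<alpha> \<le> \<bar>C\<bar>" if "x \<in> X" "x' \<in> X" "x \<noteq> x'" for x x'
  proof -
    have "\<bar>g x - g x'\<bar> \<le> \<bar>C\<bar> * dist x x' powr \<alpha>"
      by (rule order_trans[OF C[OF that(1,2)]]) (intro mult_right_mono, auto)
    then show ?thesis using that by (simp add: divide_le_eq)
  qed
  then have bdd: "bdd_above ?A" by (intro bdd_aboveI[of _ "\<bar>C\<bar>"]) auto
  show "0 \<le> hvar \<alpha> X g" unfolding hvar_def by (rule cSup_upper[OF _ bdd]) simp
  show "\<bar>g x - g x'\<bar> \<le> hvar \<alpha> X g * dist x x' powr \<alpha>"
  proof (cases "x = x'")
    case False
    have "\<bar>g x - g x'\<bar> / dist x x' powr \<alpha> \<le> hvar \<alpha> X g"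
      unfolding hvar_def by (rule cSup_upper[OF _ bdd]) (use assms False in auto)
    then show ?thesis using False by (simp add: divide_le_eq)
  qed simp
qed

lemma supabs_ge:
  assumes "bounded (g ` X)"
  shows "x \<in> X \<Longrightarrow> \<bar>g x\<bar> \<le> supabs X g" "0 \<le> supabs X g"
proof -
  obtain b where "\<And>x. x \<in> X \<Longrightarrow> \<bar>g x\<bar> \<le> b" using assms by (auto simp: bounded_iff)
  then have bdd: "bdd_above (insert 0 ((\<lambda>x. \<bar>g x\<bar>) ` X))" by (auto intro!: bdd_aboveI[of _ "\<bar>b\<bar>"] intro: order_trans[OF _ abs_ge_self])
  show "x \<in> X \<Longrightarrow> \<bar>g x\<bar> \<le> supabs X g" "0 \<le> supabs X g"
    unfolding supabs_def by (rule cSup_upper[OF _ bdd], simp)+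
qed

text \<open>On images, every functional is squeezed between c and R c times evaluation at one base
  point, and values at two points differ by at most a factor \<kappa>. Exchanging f and g costs R
  for each functional and \<kappa> for each of the two functions, so the cross-ratio constant is R
  \<kappa>.\<close>

lemma cross_ratio_from_base_points:
  fixes F :: "('x \<Rightarrow> real) set"
  assumes base: "\<And>l. l \<in> S \<Longrightarrow> \<exists>b\<in>X. \<exists>c\<ge>0. \<forall>f\<in>F. c * f b \<le> feval l f \<and> feval l f \<le> R * c * f b"
    and nn: "\<And>f x. f \<in> F \<Longrightarrow> x \<in> X \<Longrightarrow> 0 \<le> f x" and \<kappa>: "\<And>f x x'. f \<in> F \<Longrightarrow> x \<in> X \<Longrightarrow> x' \<in> X \<Longrightarrow> f x \<le> \<kappa> * f x'"
    and R: "0 \<le> R" and fg: "f \<in> F" "g \<in> F" and lm: "l \<in> S" "m \<in> S"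
  shows "feval l f * feval m g \<le> (R * \<kappa>)\<^sup>2 * (feval l g * feval m f)"
proof -
  obtain b c where b: "b \<in> X" "0 \<le> c" and l: "\<And>f. f \<in> F \<Longrightarrow> c * f b \<le> feval l f" "\<And>f. f \<in> F \<Longrightarrow> feval l f \<le> R * c * f b"
    using base[OF lm(1)] by blast
  obtain b' c' where b': "b' \<in> X" "0 \<le> c'" and m: "\<And>f. f \<in> F \<Longrightarrow> c' * f b' \<le> feval m f" "\<And>f. f \<in> F \<Longrightarrow> feval m f \<le> R * c' * f b'"
    using base[OF lm(2)] by blast
  note nnf = nn[OF fg(1) b(1)] nn[OF fg(1) b'(1)] nn[OF fg(2) b(1)] nn[OF fg(2) b'(1)]
  have "0 \<le> feval m g" using m(1)[OF fg(2)] b' nnf by (meson mult_nonneg_nonneg order_trans)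
  then have "feval l f * feval m g \<le> (R * c * f b) * (R * c' * g b')"
    using l(2)[OF fg(1)] m(2)[OF fg(2)] R b nnf by (intro mult_mono) auto
  also have "\<dots> = R * R * (c * c') * (f b * g b')" by (simp add: mult_ac)
  also have "\<dots> \<le> R * R * (c * c') * ((\<kappa> * f b') * (\<kappa> * g b))"
    using \<kappa>[OF fg(1) b(1) b'(1)] \<kappa>[OF fg(2) b'(1) b(1)] R b b' nnf
    by (intro mult_left_mono mult_mono) (auto intro: order_trans)
  also have "\<dots> = (R * \<kappa>)\<^sup>2 * ((c * g b) * (c' * f b'))" by (simp add: power2_eq_square mult_ac)
  also have "\<dots> \<le> (R * \<kappa>)\<^sup>2 * (feval l g * feval m f)"
    using l(1)[OF fg(2)] m(1)[OF fg(1)] b b' nnf by (intro mult_left_mono mult_mono) (auto intro: order_trans[OF mult_nonneg_nonneg])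
  finally show ?thesis .
qed

text \<open>The positivity and regularity conditions defining \<open>C\<^sub>\<omega>\<close>, one functional each.  In Setting B
  the inequality \<open>v(g) \<le> inf g / s\<close> becomes a family indexed by three points; the closed cone
  (\<open>g \<ge> 0\<close> instead of \<open>g > 0\<close>) serves equally well.\<close>

definition SA :: "real \<Rightarrow> 'x::metric_space set \<Rightarrow> real \<Rightarrow> 'x functional set" where
  "SA Q X \<alpha> = (\<lambda>x. [(1, x)]) ` X \<union> (\<lambda>(x, x'). [(exp (Q * dist x x' powr \<alpha>), x'), (-1, x)]) ` (X \<times> X)"

definition SB :: "real \<Rightarrow> 'x::metric_space set \<Rightarrow> real \<Rightarrow> 'x functional set" where
  "SB s X \<alpha> = (\<lambda>x. [(1, x)]) ` X \<union>
     (\<lambda>(x0, x, x'). [(1 / s, x0), (- (1 / dist x x' powr \<alpha>), x), (1 / dist x x' powr \<alpha>, x')]) `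
       {(x0, x, x'). x0 \<in> X \<and> x \<in> X \<and> x' \<in> X \<and> x \<noteq> x'}"

lemma mem_fcone_SA:
  "p \<in> fcone (SA Q X \<alpha>) \<longleftrightarrow> (\<forall>x\<in>X. 0 \<le> p x) \<and> (\<forall>x\<in>X. \<forall>x'\<in>X. p x \<le> exp (Q * dist x x' powr \<alpha>) * p x')"
  by (auto simp: fcone_def SA_def ball_Un)

text \<open>The functionals carry the quotient by a power of the distance and omit x = x';
  multiplied out, the inequality there follows from nonnegativity at once.\<close>

lemma mem_fcone_SB:
  "p \<in> fcone (SB s X \<alpha>) \<longleftrightarrow> (\<forall>x\<in>X. 0 \<le> p x) \<and> (\<forall>x0\<in>X. \<forall>x\<in>X. \<forall>x'\<in>X. p x - p x' \<le> dist x x' powr \<alpha> * (p x0 / s))" (is "?L \<longleftrightarrow> ?R")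
proof -
  have *: "p x - p x' \<le> dist x x' powr \<alpha> * (p x0 / s) \<longleftrightarrow> 0 \<le> p x0 / s - p x / dist x x' powr \<alpha> + p x' / dist x x' powr \<alpha>"
    if "x \<noteq> x'" for x0 x x'
  proof -
    have "0 < dist x x' powr \<alpha>" using that by simp
    then show ?thesis by (simp add: field_simps)
  qed
  have "?L \<longleftrightarrow> (\<forall>x\<in>X. 0 \<le> p x) \<and> (\<forall>x0\<in>X. \<forall>x\<in>X. \<forall>x'\<in>X. x \<noteq> x' \<longrightarrow> 0 \<le> p x0 / s - p x / dist x x' powr \<alpha> + p x' / dist x x' powr \<alpha>)"
    by (auto simp: fcone_def SB_def ball_Un algebra_simps)
  also have "\<dots> \<longleftrightarrow> ?R"
  proof -
    have "p x - p x' \<le> dist x x' powr \<alpha> * (p x0 / s) \<longleftrightarrow> (x \<noteq> x' \<longrightarrow> 0 \<le> p x0 / s - p x / dist x x' powr \<alpha> + p x' / dist x x' powr \<alpha>)"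
      for x0 x x'
    proof (cases "x = x'")
      case False
      then show ?thesis using *[OF False] by blast
    qed simp
    then show ?thesis by simp
  qed
  finally show ?thesis .
qed

lemma exp_minus_one_le: "exp s - 1 \<le> s * exp s" for s :: real
proof -
  have "1 - s \<le> exp (- s)" using exp_ge_add_one_self[of "- s"] by simp
  then have "(1 - s) * exp s \<le> exp (- s) * exp s" by (rule mult_right_mono) simp
  then show ?thesis by (simp add: algebra_simps mult_exp_exp)
qed

lemma good_cone_SA:
  assumes Q: "0 < Q" and K: "exp Q \<le> K" and \<alpha>: "0 < \<alpha>" and X: "X \<noteq> {}"
    and diam: "\<And>x x'. x \<in> X \<Longrightarrow> x' \<in> X \<Longrightarrow> dist x x' \<le> 1"
  shows "good_cone (SA Q X \<alpha>) X K \<alpha>"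
  unfolding good_cone_def
proof (intro conjI)
  have d1: "dist x x' powr \<alpha> \<le> 1" if "x \<in> X" "x' \<in> X" for x x'
    using powr_mono2[of \<alpha> "dist x x'" 1] diam[OF that] \<alpha> by simp
  show "\<forall>x\<in>X. [(1, x)] \<in> SA Q X \<alpha>" by (auto simp: SA_def)
  show "\<forall>l\<in>SA Q X \<alpha>. snd ` set l \<subseteq> X" by (auto simp: SA_def)
  show "(\<lambda>_. 1) \<in> fcone (SA Q X \<alpha>)" using Q by (simp add: mem_fcone_SA)
  show "\<forall>p\<in>fcone (SA Q X \<alpha>). holder_space \<alpha> X p \<and> (\<forall>x\<in>X. \<forall>x'\<in>X. p x \<le> K * p x')"
  proof
    fix p assume "p \<in> fcone (SA Q X \<alpha>)"
    then have p0: "\<And>x. x \<in> X \<Longrightarrow> 0 \<le> p x" and p: "\<And>x x'. x \<in> X \<Longrightarrow> x' \<in> X \<Longrightarrow> p x \<le> exp (Q * dist x x' powr \<alpha>) * p x'"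
      by (auto simp: mem_fcone_SA)
    have pQ: "p x \<le> exp Q * p x'" if "x \<in> X" "x' \<in> X" for x x'
    proof -
      have "exp (Q * dist x x' powr \<alpha>) * p x' \<le> exp Q * p x'"
        using d1[OF that] Q p0[OF that(2)] by (intro mult_right_mono) auto
      then show ?thesis using p[OF that] by linarith
    qed
    have pK: "p x \<le> K * p x'" if "x \<in> X" "x' \<in> X" for x x'
      using pQ[OF that] mult_right_mono[OF K p0[OF that(2)]] by linarith
    obtain x0 where x0: "x0 \<in> X" using X by auto
    have lip: "p x - p x' \<le> Q * exp Q * (exp Q * p x0) * dist x x' powr \<alpha>" if xx: "x \<in> X" "x' \<in> X" for x x'
    proof -
      let ?s = "Q * dist x x' powr \<alpha>"
      have s: "0 \<le> ?s" "?s \<le> Q" using Q mult_left_mono[OF d1[OF xx], of Q] by auto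
      have "exp ?s - 1 \<le> ?s * exp Q"
        using exp_minus_one_le[of ?s] mult_left_mono[of "exp ?s" "exp Q" ?s] s by auto
      have "p x - p x' \<le> (exp ?s - 1) * p x'" using p[OF xx] by (simp add: algebra_simps)
      also have "\<dots> \<le> (?s * exp Q) * (exp Q * p x0)"
        using \<open>exp ?s - 1 \<le> ?s * exp Q\<close> pQ[OF xx(2) x0] p0[OF xx(2)] s by (intro mult_mono) auto
      finally show ?thesis by (simp add: mult_ac)
    qed
    have "holder_space \<alpha> X p" unfolding holder_space_def
    proof
      show "bounded (p ` X)" using pQ[OF _ x0] p0 by (auto simp: bounded_iff intro!: exI[of _ "exp Q * p x0"])
      have "\<bar>p x - p x'\<bar> \<le> Q * exp Q * (exp Q * p x0) * dist x x' powr \<alpha>" if "x \<in> X" "x' \<in> X" for x x'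
        using lip[OF that] lip[OF that(2,1)] by (simp add: abs_le_iff dist_commute)
      then show "\<exists>C. \<forall>x\<in>X. \<forall>x'\<in>X. \<bar>p x - p x'\<bar> \<le> C * dist x x' powr \<alpha>" by blast
    qed
    with pK show "holder_space \<alpha> X p \<and> (\<forall>x\<in>X. \<forall>x'\<in>X. p x \<le> K * p x')" by blast
  qed
  show "\<forall>g. holder_space \<alpha> X g \<longrightarrow> (\<exists>c. (\<lambda>x. g x + c) \<in> fcone (SA Q X \<alpha>))"
  proof (intro allI impI)
    fix g assume g: "holder_space \<alpha> X g"
    obtain b where b: "\<And>x. x \<in> X \<Longrightarrow> \<bar>g x\<bar> \<le> b" using holder_space_bounded[OF g] by auto
    define C where "C = hvar \<alpha> X g"
    obtain x0 where x0: "x0 \<in> X" using X by auto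
    have C0: "0 \<le> C" unfolding C_def by (rule hvar_le(2)[OF g x0 x0])
    \<comment> \<open>This makes g + c at least C / Q, so Hoelder increments are at most Q t (g +
      c), and 1 + Q t \<le> exp (Q t) finishes.\<close>
    let ?c = "b + C / Q"
    have "(\<lambda>x. g x + ?c) \<in> fcone (SA Q X \<alpha>)"
      unfolding mem_fcone_SA
    proof (intro conjI ballI)
      have CQ: "0 \<le> C / Q" using C0 Q by simp
      fix x assume x: "x \<in> X"
      show "0 \<le> g x + ?c" using b[OF x] CQ by (simp add: abs_le_iff)
      fix x' assume x': "x' \<in> X"
      let ?t = "dist x x' powr \<alpha>"
      have gc: "C / Q \<le> g x' + ?c" using b[OF x'] by (simp add: abs_le_iff)
      have "g x - g x' \<le> C * ?t" using hvar_le(1)[OF g x x'] by (simp add: C_def)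
      also have "\<dots> = (Q * ?t) * (C / Q)" using Q by simp
      also have "\<dots> \<le> (Q * ?t) * (g x' + ?c)" using gc Q by (intro mult_left_mono) auto
      finally have "g x + ?c \<le> (1 + Q * ?t) * (g x' + ?c)" by (simp add: algebra_simps)
      also have "\<dots> \<le> exp (Q * ?t) * (g x' + ?c)"
        using gc CQ by (intro mult_right_mono exp_ge_add_one_self) auto
      finally show "g x + ?c \<le> exp (Q * ?t) * (g x' + ?c)" .
    qed
    then show "\<exists>c. (\<lambda>x. g x + c) \<in> fcone (SA Q X \<alpha>)" by blast
  qed
qed

lemma good_cone_SB:
  assumes s: "0 < s" and K: "1 + 1 / s \<le> K" and \<alpha>: "0 < \<alpha>" and X: "X \<noteq> {}"
    and diam: "\<And>x x'. x \<in> X \<Longrightarrow> x' \<in> X \<Longrightarrow> dist x x' \<le> 1"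
  shows "good_cone (SB s X \<alpha>) X K \<alpha>"
  unfolding good_cone_def
proof (intro conjI)
  have d1: "dist x x' powr \<alpha> \<le> 1" if "x \<in> X" "x' \<in> X" for x x'
    using powr_mono2[of \<alpha> "dist x x'" 1] diam[OF that] \<alpha> by simp
  show "\<forall>x\<in>X. [(1, x)] \<in> SB s X \<alpha>" by (auto simp: SB_def)
  show "\<forall>l\<in>SB s X \<alpha>. snd ` set l \<subseteq> X" by (auto simp: SB_def)
  show "(\<lambda>_. 1) \<in> fcone (SB s X \<alpha>)" using s by (simp add: mem_fcone_SB)
  show "\<forall>p\<in>fcone (SB s X \<alpha>). holder_space \<alpha> X p \<and> (\<forall>x\<in>X. \<forall>x'\<in>X. p x \<le> K * p x')"
  proof
    fix p assume "p \<in> fcone (SB s X \<alpha>)"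
    then have p0: "\<And>x. x \<in> X \<Longrightarrow> 0 \<le> p x"
      and p: "\<And>x0 x x'. x0 \<in> X \<Longrightarrow> x \<in> X \<Longrightarrow> x' \<in> X \<Longrightarrow> p x - p x' \<le> dist x x' powr \<alpha> * (p x0 / s)"
      by (auto simp: mem_fcone_SB)
    have pK: "p x \<le> K * p x'" if "x \<in> X" "x' \<in> X" for x x'
    proof -
      have "dist x x' powr \<alpha> * (p x' / s) \<le> 1 * (p x' / s)"
        using d1[OF that] p0[OF that(2)] s by (intro mult_right_mono) auto
      then have "p x \<le> (1 + 1 / s) * p x'" using p[OF that(2) that] by (simp add: algebra_simps)
      also have "\<dots> \<le> K * p x'" using K p0[OF that(2)] by (intro mult_right_mono)
      finally show ?thesis .
    qed
    obtain x0 where x0: "x0 \<in> X" using X by auto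
    have "holder_space \<alpha> X p" unfolding holder_space_def
    proof
      show "bounded (p ` X)" using pK[OF _ x0] p0 by (auto simp: bounded_iff intro!: exI[of _ "K * p x0"])
      have "\<bar>p x - p x'\<bar> \<le> p x0 / s * dist x x' powr \<alpha>" if "x \<in> X" "x' \<in> X" for x x'
        using p[OF x0 that] p[OF x0 that(2,1)] by (simp add: abs_le_iff dist_commute mult.commute)
      then show "\<exists>C. \<forall>x\<in>X. \<forall>x'\<in>X. \<bar>p x - p x'\<bar> \<le> C * dist x x' powr \<alpha>" by blast
    qed
    with pK show "holder_space \<alpha> X p \<and> (\<forall>x\<in>X. \<forall>x'\<in>X. p x \<le> K * p x')" by blast
  qed
  show "\<forall>g. holder_space \<alpha> X g \<longrightarrow> (\<exists>c. (\<lambda>x. g x + c) \<in> fcone (SB s X \<alpha>))"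
  proof (intro allI impI)
    fix g assume g: "holder_space \<alpha> X g"
    obtain b where b: "\<And>x. x \<in> X \<Longrightarrow> \<bar>g x\<bar> \<le> b" using holder_space_bounded[OF g] by auto
    define C where "C = hvar \<alpha> X g"
    obtain x0 where x0: "x0 \<in> X" using X by auto
    have C0: "0 \<le> C" unfolding C_def by (rule hvar_le(2)[OF g x0 x0])
    \<comment> \<open>This makes g + c at least s C, the size at which C becomes an admissible
      Hoelder constant.\<close>
    let ?c = "b + s * C"
    have "(\<lambda>x. g x + ?c) \<in> fcone (SB s X \<alpha>)"
      unfolding mem_fcone_SB
    proof (intro conjI ballI)
      have sC: "0 \<le> s * C" using C0 s by simp
      show "0 \<le> g x + ?c" if x: "x \<in> X" for x using b[OF x] sC by (simp add: abs_le_iff)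
      fix x0 x x' assume x: "x0 \<in> X" "x \<in> X" "x' \<in> X"
      have gc: "s * C \<le> g x0 + ?c" using b[OF x(1)] by (simp add: abs_le_iff)
      have "g x - g x' \<le> dist x x' powr \<alpha> * C" using hvar_le(1)[OF g x(2,3)] by (simp add: C_def mult.commute)
      also have "\<dots> \<le> dist x x' powr \<alpha> * ((g x0 + ?c) / s)"
        using gc s by (intro mult_left_mono) (auto simp: field_simps)
      finally show "g x + ?c - (g x' + ?c) \<le> dist x x' powr \<alpha> * ((g x0 + ?c) / s)" by simp
    qed
    then show "\<exists>c. (\<lambda>x. g x + c) \<in> fcone (SB s X \<alpha>)" by blast
  qed
qed

text \<open>The factor (1 + q) / (1 - q) is the limit of the quotient of the two differences as t
  tends to 0. Cleared of denominators, the right side minus the left side vanishes at 0 and has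
  nonnegative derivative.\<close>

lemma exp_quotient_le:
  fixes q t :: real
  assumes q: "0 \<le> q" "q < 1" and t: "0 \<le> t"
  shows "exp t - exp (- (q * t)) \<le> (1 + q) / (1 - q) * (exp t - exp (q * t))"
proof -
  define F where "F t = (1 + q) * (exp t - exp (q * t)) - (1 - q) * (exp t - exp (- (q * t)))" for t :: real
  have "F 0 \<le> F t"
  proof (rule DERIV_nonneg_imp_nondecreasing[OF t])
    fix x :: real assume x: "0 \<le> x"
    have "(F has_real_derivative ((1 + q) * (exp x - q * exp (q * x)) - (1 - q) * (exp x + q * exp (- (q * x))))) (at x)"
      unfolding F_def by (auto intro!: derivative_eq_intros simp: algebra_simps)
    moreover have "0 \<le> (1 + q) * (exp x - q * exp (q * x)) - (1 - q) * (exp x + q * exp (- (q * x)))"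
    proof -
      have 1: "exp (q * x) \<le> exp x" using q x by (simp add: mult_left_le_one_le)
      have 2: "exp (- (q * x)) \<le> exp x" using q x by (simp add: order_trans[of _ 0])
      have "q * ((1 + q) * exp (q * x)) + q * ((1 - q) * exp (- (q * x))) \<le> q * ((1 + q) * exp x) + q * ((1 - q) * exp x)"
        using q 1 2 by (intro add_mono mult_left_mono) auto
      then show ?thesis by (simp add: algebra_simps)
    qed
    ultimately show "\<exists>y. (F has_real_derivative y) (at x) \<and> 0 \<le> y" by blast
  qed
  then have "(1 - q) * (exp t - exp (- (q * t))) \<le> (1 + q) * (exp t - exp (q * t))" by (simp add: F_def)
  then show ?thesis using q by (simp add: field_simps)
qed

lemma summable_on_diff_real:
  fixes f g :: "'i \<Rightarrow> real"
  assumes "f summable_on I" "g summable_on I"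
  shows "(\<lambda>i. f i - g i) summable_on I"
  using summable_on_add[OF assms(1) summable_on_uminus[THEN iffD2, OF assms(2)]] by simp

lemma infsum_diff_real:
  fixes f g :: "'i \<Rightarrow> real"
  assumes "f summable_on I" "g summable_on I"
  shows "(\<Sum>\<^sub>\<infinity>i\<in>I. f i - g i) = infsum f I - infsum g I"
  using infsum_add[OF assms(1) summable_on_uminus[THEN iffD2, OF assms(2)]] by (simp add: infsum_uminus)

text \<open>Contraction of a branch reduces the exponent \<gamma>^\<alpha> to 1 and the oscillation
  of \<phi> adds H, so images satisfy the cone inequality with H + 1 = q * Q', strictly below Q'.
  The ratio q gives the factor (1 + q) / (1 - q), and exp (H + 1) compares values at two
  points.\<close>

lemma (in branched_map) SA_cone_step:
  fixes \<gamma> \<gamma>' H q \<alpha> :: real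
  defines "Q \<equiv> \<gamma> powr \<alpha>" and "Q' \<equiv> \<gamma>' powr \<alpha>"
  assumes \<gamma>: "1 < \<gamma>" "1 < \<gamma>'" and \<alpha>: "0 < \<alpha>" and H: "0 \<le> H"
    and contr: "\<And>x x' i. x \<in> X' \<Longrightarrow> x' \<in> X' \<Longrightarrow> i \<in> I \<Longrightarrow> dist (y i x) (y i x') \<le> dist x x' / \<gamma>"
    and osc: "\<And>x x' i. x \<in> X' \<Longrightarrow> x' \<in> X' \<Longrightarrow> i \<in> I \<Longrightarrow> \<bar>\<phi> (y i x) - \<phi> (y i x')\<bar> \<le> H * dist x x' powr \<alpha>"
    and q: "q * Q' = H + 1" "q < 1" and X: "X \<noteq> {}"
    and diamX: "\<And>x x'. x \<in> X \<Longrightarrow> x' \<in> X \<Longrightarrow> dist x x' \<le> 1"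
    and diamX': "\<And>x x'. x \<in> X' \<Longrightarrow> x' \<in> X' \<Longrightarrow> dist x x' \<le> 1"
  shows "cone_step (SA Q X \<alpha>) (SA Q' X' \<alpha>) L ((1 + q) / (1 - q) * exp (H + 1))"
    and "\<And>\<psi> p m A B. (\<And>x. x \<in> X \<Longrightarrow> \<bar>\<psi> x\<bar> \<le> A) \<Longrightarrow> 0 \<le> B \<Longrightarrow>
      (\<And>x x'. x \<in> X \<Longrightarrow> x' \<in> X \<Longrightarrow> \<bar>\<psi> x - \<psi> x'\<bar> \<le> B * dist x x' powr \<alpha>) \<Longrightarrow>
      p \<in> fcone (SA Q X \<alpha>) \<Longrightarrow> m \<in> SA Q' X' \<alpha> \<Longrightarrow>
      feval m (L (\<lambda>x. \<psi> x * p x)) \<le> (A + \<gamma> powr (- \<alpha>) * B / (Q' - 1 - H)) * feval m (L p)"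
proof -
  have Q: "0 < Q" and Q': "0 < Q'" using \<gamma> by (auto simp: Q_def Q'_def)
  have q0: "0 \<le> q" using q(1) Q' H by (smt (verit) mult_nonpos_nonneg)
  have HQ: "H + 1 < Q'" using q Q' mult_strict_right_mono[of q 1 Q'] by simp
  note gc = good_cone_SA[OF Q order_refl \<alpha> X diamX]
  have d1: "dist x x' powr \<alpha> \<le> 1" if "x \<in> X'" "x' \<in> X'" for x x'
    using powr_mono2[of \<alpha> "dist x x'" 1] diamX'[OF that] \<alpha> by simp
  have contr_powr: "dist (y i x) (y i x') powr \<alpha> \<le> dist x x' powr \<alpha> / Q" if "x \<in> X'" "x' \<in> X'" "i \<in> I" for x x' i
  proof -
    have "dist (y i x) (y i x') powr \<alpha> \<le> (dist x x' / \<gamma>) powr \<alpha>"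
      using contr[OF that] \<alpha> by (intro powr_mono2) auto
    then show ?thesis using \<gamma> by (simp add: powr_divide Q_def)
  qed
  define w where "w p i x = exp (\<phi> (y i x)) * p (y i x)" for p i x
  have w0: "0 \<le> w p i x" if "p \<in> fcone (SA Q X \<alpha>)" "i \<in> I" "x \<in> X'" for p i x
    using that y_mem[OF that(3,2)] by (auto simp: w_def mem_fcone_SA)
  have w_le: "w p i x \<le> exp ((H + 1) * dist x x' powr \<alpha>) * w p i x'"
    if p: "p \<in> fcone (SA Q X \<alpha>)" and x: "x \<in> X'" "x' \<in> X'" and i: "i \<in> I" for p i x x'
  proof -
    let ?t = "dist x x' powr \<alpha>"
    have "exp (\<phi> (y i x)) \<le> exp (H * ?t + \<phi> (y i x'))" using osc[OF x i] by simp
    then have 1: "exp (\<phi> (y i x)) \<le> exp (H * ?t) * exp (\<phi> (y i x'))" by (simp add: exp_add)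
    have "p (y i x) \<le> exp (Q * dist (y i x) (y i x') powr \<alpha>) * p (y i x')"
      using p y_mem[OF x(1) i] y_mem[OF x(2) i] by (auto simp: mem_fcone_SA)
    also have "\<dots> \<le> exp ?t * p (y i x')"
    proof (rule mult_right_mono)
      have "Q * dist (y i x) (y i x') powr \<alpha> \<le> ?t" using contr_powr[OF x i] Q by (simp add: field_simps)
      then show "exp (Q * dist (y i x) (y i x') powr \<alpha>) \<le> exp ?t" by simp
      show "0 \<le> p (y i x')" using p y_mem[OF x(2) i] by (auto simp: mem_fcone_SA)
    qed
    finally have 2: "p (y i x) \<le> exp ?t * p (y i x')" .
    have "w p i x \<le> (exp (H * ?t) * exp (\<phi> (y i x'))) * (exp ?t * p (y i x'))"
      unfolding w_def using 1 2 p y_mem[OF x(1) i] by (intro mult_mono) (auto simp: mem_fcone_SA)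
    also have "\<dots> = exp ((H + 1) * ?t) * w p i x'" by (simp add: w_def distrib_right exp_add)
    finally show ?thesis .
  qed
  have bnd: "\<exists>b. \<forall>z\<in>X. \<bar>p z\<bar> \<le> b" if "p \<in> fcone (SA Q X \<alpha>)" for p
    by (rule holder_space_bounded[OF good_coneD(3)[OF gc that]])
  have sw: "(\<lambda>i. w p i x) summable_on I" and Lw: "L p x = (\<Sum>\<^sub>\<infinity>i\<in>I. w p i x)"
    if p: "p \<in> fcone (SA Q X \<alpha>)" and x: "x \<in> X'" for p x
  proof -
    obtain b where "\<And>z. z \<in> X \<Longrightarrow> \<bar>p z\<bar> \<le> b" using bnd[OF p] by auto
    from summable_weighted(2)[OF x this] show "(\<lambda>i. w p i x) summable_on I" by (simp add: w_def)
    show "L p x = (\<Sum>\<^sub>\<infinity>i\<in>I. w p i x)" unfolding transfer_eq[OF x] by (simp add: w_def)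
  qed
  have L_le: "L p x \<le> exp ((H + 1) * dist x x' powr \<alpha>) * L p x'"
    if p: "p \<in> fcone (SA Q X \<alpha>)" and x: "x \<in> X'" "x' \<in> X'" for p x x'
    unfolding Lw[OF p x(1)] Lw[OF p x(2)] infsum_cmult_right'[symmetric]
    by (intro infsum_mono sw summable_on_cmult_right p x w_le)
  have L0: "0 \<le> L p x" if p: "p \<in> fcone (SA Q X \<alpha>)" and x: "x \<in> X'" for p x
    unfolding Lw[OF p x] by (intro infsum_nonneg w0 p x)
  have invariant: "L p \<in> fcone (SA Q' X' \<alpha>)" if p: "p \<in> fcone (SA Q X \<alpha>)" for p
    unfolding mem_fcone_SA
  proof (intro conjI ballI L0 p)
    fix x x' assume x: "x \<in> X'" "x' \<in> X'"
    have "exp ((H + 1) * dist x x' powr \<alpha>) * L p x' \<le> exp (Q' * dist x x' powr \<alpha>) * L p x'"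
      using HQ L0[OF p x(2)] by (intro mult_right_mono) (auto intro: mult_right_mono)
    then show "L p x \<le> exp (Q' * dist x x' powr \<alpha>) * L p x'" using L_le[OF p x] by linarith
  qed
  let ?R = "(1 + q) / (1 - q)"
  have R1: "1 \<le> ?R" using q0 q(2) by (simp add: field_simps)
  have base: "\<exists>b\<in>X'. \<exists>c\<ge>0. \<forall>f\<in>L ` fcone (SA Q X \<alpha>). c * f b \<le> feval l f \<and> feval l f \<le> ?R * c * f b" if l: "l \<in> SA Q' X' \<alpha>" for l
  proof -
    consider x where "x \<in> X'" "l = [(1, x)]" | x x' where "x \<in> X'" "x' \<in> X'" "l = [(exp (Q' * dist x x' powr \<alpha>), x'), (-1, x)]"
      using l by (auto simp: SA_def)
    then show ?thesis
    proof cases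
      case 1
      have "1 * f x \<le> feval l f \<and> feval l f \<le> ?R * 1 * f x" if "f \<in> L ` fcone (SA Q X \<alpha>)" for f
      proof -
        have "0 \<le> f x" using that L0 1(1) by auto
        then show ?thesis using mult_right_mono[OF R1, of "f x"] by (simp add: 1(2))
      qed
      then show ?thesis using 1(1) zero_le_one by blast
    next
      case 2
      let ?t = "dist x x' powr \<alpha>"
      \<comment> \<open>Relative to the base value f x', the functional is at least this on images,
        and at most exp (Q' t) - exp (- (H + 1) t).\<close>
      let ?c = "exp (Q' * ?t) - exp ((H + 1) * ?t)"
      have t: "0 \<le> ?t" by simp
      have c: "0 \<le> ?c" using HQ t by (simp add: mult_right_mono)
      have hi: "exp (Q' * ?t) - exp (- ((H + 1) * ?t)) \<le> ?R * ?c"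
        using exp_quotient_le[OF q0 q(2), of "Q' * ?t"] Q' t q(1) by (simp add: mult.assoc[symmetric])
      have "?c * f x' \<le> feval l f \<and> feval l f \<le> ?R * ?c * f x'" if fL: "f \<in> L ` fcone (SA Q X \<alpha>)" for f
      proof -
        obtain p where p: "p \<in> fcone (SA Q X \<alpha>)" "f = L p" using fL by auto
        have f0: "0 \<le> f x'" using L0[OF p(1) 2(2)] p(2) by simp
        have up: "f x \<le> exp ((H + 1) * ?t) * f x'" using L_le[OF p(1) 2(1,2)] p(2) by simp
        have fx': "f x' \<le> exp ((H + 1) * ?t) * f x" using L_le[OF p(1) 2(2,1)] p(2) by (simp add: dist_commute)
        have lo: "exp (- ((H + 1) * ?t)) * f x' \<le> f x"
          using mult_left_mono[OF fx', of "exp (- ((H + 1) * ?t))"] by (simp add: mult.assoc[symmetric] mult_exp_exp)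
        have "feval l f = exp (Q' * ?t) * f x' - f x" by (simp add: 2(3))
        moreover have "(exp (Q' * ?t) - exp (- ((H + 1) * ?t))) * f x' \<le> ?R * ?c * f x'"
          using hi f0 by (rule mult_right_mono)
        ultimately show ?thesis using up lo by (simp add: left_diff_distrib)
      qed
      then show ?thesis using c 2(2) by blast
    qed
  qed
  have \<kappa>: "f x \<le> exp (H + 1) * f x'" if fL: "f \<in> L ` fcone (SA Q X \<alpha>)" and x: "x \<in> X'" "x' \<in> X'" for f x x'
  proof -
    obtain p where p: "p \<in> fcone (SA Q X \<alpha>)" "f = L p" using fL by auto
    have "exp ((H + 1) * dist x x' powr \<alpha>) * L p x' \<le> exp (H + 1) * L p x'"
      using d1[OF x] H L0[OF p(1) x(2)] by (intro mult_right_mono) (auto simp: mult_left_le)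
    then show ?thesis unfolding p(2) by (rule order_trans[OF L_le[OF p(1) x]])
  qed
  show "cone_step (SA Q X \<alpha>) (SA Q' X' \<alpha>) L ((1 + q) / (1 - q) * exp (H + 1))"
    unfolding cone_step_def
  proof (intro conjI ballI invariant)
    have "1 * 1 \<le> ?R * exp (H + 1)" by (rule mult_mono) (use R1 H in auto)
    then show "1 \<le> ?R * exp (H + 1)" by simp
    fix p q l m assume "p \<in> fcone (SA Q X \<alpha>)" "q \<in> fcone (SA Q X \<alpha>)" "l \<in> SA Q' X' \<alpha>" "m \<in> SA Q' X' \<alpha>"
    then show "feval l (L p) * feval m (L q) \<le> (?R * exp (H + 1))\<^sup>2 * (feval l (L q) * feval m (L p))"
      using R1 L0 by (intro cross_ratio_from_base_points[where F="L ` fcone (SA Q X \<alpha>)" and X=X', OF base _ \<kappa>]) auto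
  qed
  fix \<psi> p m A B
  assume A: "\<And>x. x \<in> X \<Longrightarrow> \<bar>\<psi> x\<bar> \<le> A" and B0: "0 \<le> B"
    and B: "\<And>x x'. x \<in> X \<Longrightarrow> x' \<in> X \<Longrightarrow> \<bar>\<psi> x - \<psi> x'\<bar> \<le> B * dist x x' powr \<alpha>"
    and p: "p \<in> fcone (SA Q X \<alpha>)" and m: "m \<in> SA Q' X' \<alpha>"
  obtain b where b: "\<And>z. z \<in> X \<Longrightarrow> \<bar>p z\<bar> \<le> b" using bnd[OF p] by auto
  have \<psi>p: "\<bar>\<psi> z * p z\<bar> \<le> \<bar>A\<bar> * \<bar>b\<bar>" if "z \<in> X" for z
    unfolding abs_mult using A[OF that] b[OF that] by (intro mult_mono) auto
  let ?k = "\<gamma> powr (- \<alpha>) * B / (Q' - 1 - H)"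
  have k0: "0 \<le> ?k" using B0 HQ by simp
  have sp: "(\<lambda>i. \<psi> (y i x) * w p i x) summable_on I" and Lp: "L (\<lambda>x. \<psi> x * p x) x = (\<Sum>\<^sub>\<infinity>i\<in>I. \<psi> (y i x) * w p i x)" if x: "x \<in> X'" for x
  proof -
    show "(\<lambda>i. \<psi> (y i x) * w p i x) summable_on I"
      using summable_weighted(2)[OF x, of "\<lambda>z. \<psi> z * p z", OF \<psi>p] by (simp add: w_def mult_ac)
    show "L (\<lambda>x. \<psi> x * p x) x = (\<Sum>\<^sub>\<infinity>i\<in>I. \<psi> (y i x) * w p i x)" unfolding transfer_eq[OF x] by (simp add: w_def mult_ac)
  qed
  have eval: "L (\<lambda>x. \<psi> x * p x) x \<le> A * L p x" if x: "x \<in> X'" for x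
    unfolding Lp[OF x] Lw[OF p x] infsum_cmult_right'[symmetric]
    by (intro infsum_mono sp[OF x] summable_on_cmult_right sw p x mult_right_mono w0)
      (use A y_mem[OF x] in \<open>auto simp: abs_le_iff\<close>)
  consider x where "x \<in> X'" "m = [(1, x)]" | x x' where "x \<in> X'" "x' \<in> X'" "m = [(exp (Q' * dist x x' powr \<alpha>), x'), (-1, x)]"
    using m by (auto simp: SA_def)
  then show "feval m (L (\<lambda>x. \<psi> x * p x)) \<le> (A + ?k) * feval m (L p)"
  proof cases
    case 1
    have "A * L p x \<le> (A + ?k) * L p x" using k0 L0[OF p 1(1)] by (intro mult_right_mono) auto
    then show ?thesis using eval[OF 1(1)] by (simp add: 1(2))
  next
    case 2
    let ?t = "dist x x' powr \<alpha>" and ?E = "exp (Q' * dist x x' powr \<alpha>)"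
    \<comment> \<open>The estimate is made branch by branch, because points over x and x' are known
      to be close only along the same branch.\<close>
    have term_le: "?E * (\<psi> (y i x') * w p i x') - \<psi> (y i x) * w p i x \<le> (A + ?k) * (?E * w p i x' - w p i x)" if i: "i \<in> I" for i
    proof -
      let ?d = "?E * w p i x' - w p i x"
      have wx: "0 \<le> w p i x" by (rule w0[OF p i 2(1)])
      \<comment> \<open>The slack Q' - 1 - H of the exponent becomes a gain linear in t, which pays
        for the oscillation of \<psi>.\<close>
      have "(Q' - 1 - H) * ?t * w p i x \<le> ?d"
      proof -
        have "exp ((H + 1) * ?t) * ((1 + (Q' - 1 - H) * ?t) * w p i x') \<le> exp ((H + 1) * ?t) * (exp ((Q' - 1 - H) * ?t) * w p i x')"
          by (intro mult_left_mono mult_right_mono exp_ge_add_one_self w0[OF p i 2(2)]) simp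
        also have "\<dots> = ?E * w p i x'" by (simp add: mult.assoc[symmetric] mult_exp_exp algebra_simps)
        finally have "(1 + (Q' - 1 - H) * ?t) * (exp ((H + 1) * ?t) * w p i x') \<le> ?E * w p i x'" by (simp add: mult_ac)
        moreover have "(1 + (Q' - 1 - H) * ?t) * w p i x \<le> (1 + (Q' - 1 - H) * ?t) * (exp ((H + 1) * ?t) * w p i x')"
          using HQ w_le[OF p 2(1,2) i] by (intro mult_left_mono) (auto intro!: add_nonneg_nonneg mult_nonneg_nonneg)
        ultimately show ?thesis by (simp add: algebra_simps)
      qed
      then have tw: "?t * w p i x \<le> ?d / (Q' - 1 - H)" using HQ by (simp add: field_simps)
      have d0: "0 \<le> ?d" using order_trans[OF _ \<open>(Q' - 1 - H) * ?t * w p i x \<le> ?d\<close>, of 0] HQ wx by simp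
      have "\<psi> (y i x') - \<psi> (y i x) \<le> B * (?t / Q)"
        using B[OF y_mem[OF 2(2) i] y_mem[OF 2(1) i]] mult_left_mono[OF contr_powr[OF 2(2,1) i] B0] by (simp add: dist_commute)
      then have "(\<psi> (y i x') - \<psi> (y i x)) * w p i x \<le> B * (?t / Q) * w p i x" using wx by (rule mult_right_mono)
      also have "\<dots> = B / Q * (?t * w p i x)" by simp
      also have "\<dots> \<le> B / Q * (?d / (Q' - 1 - H))" using tw B0 Q by (intro mult_left_mono) auto
      also have "\<dots> = ?k * ?d" by (simp add: Q_def powr_minus field_simps)
      finally have 1: "(\<psi> (y i x') - \<psi> (y i x)) * w p i x \<le> ?k * ?d" .
      have "\<psi> (y i x') * ?d \<le> A * ?d" using A[OF y_mem[OF 2(2) i]] d0 by (intro mult_right_mono) auto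
      with 1 show ?thesis by (simp add: algebra_simps)
    qed
    have "feval m (L (\<lambda>x. \<psi> x * p x)) = ?E * (\<Sum>\<^sub>\<infinity>i\<in>I. \<psi> (y i x') * w p i x') - (\<Sum>\<^sub>\<infinity>i\<in>I. \<psi> (y i x) * w p i x)"
      by (simp add: 2(3) Lp[OF 2(1)] Lp[OF 2(2)])
    also have "\<dots> = (\<Sum>\<^sub>\<infinity>i\<in>I. ?E * (\<psi> (y i x') * w p i x') - \<psi> (y i x) * w p i x)"
      unfolding infsum_cmult_right'[symmetric]
      by (rule infsum_diff_real[symmetric]) (intro summable_on_cmult_right sp 2)+
    also have "\<dots> \<le> (\<Sum>\<^sub>\<infinity>i\<in>I. (A + ?k) * (?E * w p i x' - w p i x))"
      by (intro infsum_mono summable_on_diff_real summable_on_cmult_right sp sw p 2 term_le)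
    also have "\<dots> = (A + ?k) * (\<Sum>\<^sub>\<infinity>i\<in>I. ?E * w p i x' - w p i x)" by (rule infsum_cmult_right')
    also have "(\<Sum>\<^sub>\<infinity>i\<in>I. ?E * w p i x' - w p i x) = feval m (L p)"
    proof -
      have "(\<Sum>\<^sub>\<infinity>i\<in>I. ?E * w p i x' - w p i x) = (\<Sum>\<^sub>\<infinity>i\<in>I. ?E * w p i x') - (\<Sum>\<^sub>\<infinity>i\<in>I. w p i x)"
        by (rule infsum_diff_real) (intro summable_on_cmult_right sw p 2)+
      then show ?thesis by (simp add: 2(3) Lw[OF p 2(1)] Lw[OF p 2(2)] infsum_cmult_right')
    qed
    finally show ?thesis .
  qed
qed

lemma abs_exp_diff_le:
  fixes a b :: real
  assumes "exp a \<le> M" "exp b \<le> M"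
  shows "\<bar>exp a - exp b\<bar> \<le> \<bar>a - b\<bar> * M"
proof -
  have *: "exp a - exp b \<le> \<bar>a - b\<bar> * M" if "exp a \<le> M" for a b :: real
  proof -
    have "exp a - exp b = exp b * (exp (a - b) - 1)" by (simp add: algebra_simps mult_exp_exp)
    also have "\<dots> \<le> exp b * ((a - b) * exp (a - b))" by (intro mult_left_mono exp_minus_one_le) simp
    also have "\<dots> = (a - b) * exp a" by (simp add: mult_exp_exp mult_ac)
    also have "\<dots> \<le> \<bar>a - b\<bar> * M" using that by (intro mult_mono) auto
    finally show ?thesis .
  qed
  show ?thesis using *[OF assms(1), of b] *[OF assms(2), of a] by (simp add: abs_le_iff abs_minus_commute)
qed

text \<open>Individual branches may expand, so contraction appears only on average: the oscillation
  over one branch is compared with the weighted value on any other branch at the price exp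
  \<epsilon>, and averaging over the second branch brings in the mean of \<delta>, hence s. This
  produces the constant \<zeta> / s'.\<close>

lemma (in branched_map) SB_cone_step:
  fixes \<delta> :: "nat \<Rightarrow> real"
  assumes I: "I = {1..d}" and d: "0 < d" and s: "0 < s" "s \<le> 1" and s': "0 < s'" "s' \<le> 1" and H: "0 \<le> H"
    and contr: "\<And>x x' i. x \<in> X' \<Longrightarrow> x' \<in> X' \<Longrightarrow> i \<in> I \<Longrightarrow> dist (y i x) (y i x') powr \<alpha> \<le> \<delta> i * dist x x' powr \<alpha>"
    and osc: "\<And>x x' i. x \<in> X' \<Longrightarrow> x' \<in> X' \<Longrightarrow> i \<in> I \<Longrightarrow> \<bar>\<phi> (y i x) - \<phi> (y i x')\<bar> \<le> H * dist x x' powr \<alpha>"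
    and eps: "\<And>z z'. z \<in> X \<Longrightarrow> z' \<in> X \<Longrightarrow> \<phi> z \<le> \<epsilon> + \<phi> z'"
    and sum_\<delta>: "exp \<epsilon> * (\<Sum>i\<in>I. \<delta> i) \<le> real d * s"
    and \<zeta>: "\<zeta> = s' * (1 + (1 + 1 / s) * exp \<epsilon> * H)" "\<zeta> < 1"
    and \<alpha>: "0 < \<alpha>"
    and diamX: "\<And>x x'. x \<in> X \<Longrightarrow> x' \<in> X \<Longrightarrow> dist x x' \<le> 1" and diamX': "\<And>x x'. x \<in> X' \<Longrightarrow> x' \<in> X' \<Longrightarrow> dist x x' \<le> 1"
  shows "cone_step (SB s X \<alpha>) (SB s' X' \<alpha>) L ((1 + \<zeta>) / (1 - \<zeta>) * (1 + \<zeta> / s'))"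
    and "\<And>\<psi> p m a b. (\<And>x. x \<in> X \<Longrightarrow> \<bar>\<psi> x\<bar> \<le> a) \<Longrightarrow> 0 \<le> b \<Longrightarrow>
      (\<And>x x'. x \<in> X \<Longrightarrow> x' \<in> X \<Longrightarrow> \<bar>\<psi> x - \<psi> x'\<bar> \<le> b * dist x x' powr \<alpha>) \<Longrightarrow>
      p \<in> fcone (SB s X \<alpha>) \<Longrightarrow> m \<in> SB s' X' \<alpha> \<Longrightarrow>
      feval m (L (\<lambda>x. \<psi> x * p x)) \<le> 3 * (a + b) / (1 - \<zeta>) * feval m (L p)"
proof -
  have finI: "finite I" and cardI: "card I = d" and I0: "I \<noteq> {}" using I d by auto
  obtain i0 x0 where "i0 \<in> I" "x0 \<in> X'" using I0 nonempty by blast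
  then have X: "X \<noteq> {}" using y_mem by blast
  have \<zeta>s: "\<zeta> / s' = 1 + (1 + 1 / s) * exp \<epsilon> * H" using s' by (simp add: \<zeta>(1))
  have \<zeta>1: "1 \<le> \<zeta> / s'" using \<zeta>(1) s s' H by simp
  have \<zeta>0: "0 \<le> \<zeta>" using \<zeta>1 s' by (simp add: field_simps)
  define w where "w p i x = exp (\<phi> (y i x)) * p (y i x)" for p i x
  have Lw: "L p x = (\<Sum>i\<in>I. w p i x)" if "x \<in> X'" for p x
    unfolding transfer_eq[OF that] w_def using finI by simp
  have p0: "0 \<le> p z" if "p \<in> fcone (SB s X \<alpha>)" "z \<in> X" for p z using that by (auto simp: mem_fcone_SB)
  have pd: "\<bar>p z - p z'\<bar> \<le> dist z z' powr \<alpha> * (p z0 / s)" if "p \<in> fcone (SB s X \<alpha>)" "z \<in> X" "z' \<in> X" "z0 \<in> X" for p z z' z0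
    using that unfolding mem_fcone_SB abs_le_iff by (metis dist_commute minus_diff_eq)
  have w0: "0 \<le> w p i x" if "p \<in> fcone (SB s X \<alpha>)" "i \<in> I" "x \<in> X'" for p i x
    using p0[OF that(1) y_mem[OF that(3,2)]] by (simp add: w_def)
  have L0: "0 \<le> L p x" if p: "p \<in> fcone (SB s X \<alpha>)" and x: "x \<in> X'" for p x
    unfolding Lw[OF x] by (intro sum_nonneg w0 p x)
  have \<phi>_le: "exp (\<phi> z) \<le> exp \<epsilon> * exp (\<phi> z')" if "z \<in> X" "z' \<in> X" for z z'
    using eps[OF that] by (simp add: mult_exp_exp)
  have pK: "p z \<le> (1 + 1 / s) * p z'" if "p \<in> fcone (SB s X \<alpha>)" "z \<in> X" "z' \<in> X" for p z z'
  proof -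
    have "dist z z' powr \<alpha> \<le> 1" using powr_mono2[of \<alpha> "dist z z'" 1] diamX[OF that(2,3)] \<alpha> by simp
    then have "dist z z' powr \<alpha> * (p z' / s) \<le> 1 * (p z' / s)" using p0[OF that(1,3)] s by (intro mult_right_mono) auto
    with pd[OF that that(3)] show ?thesis by (simp add: abs_le_iff algebra_simps)
  qed
  \<comment> \<open>Stated for general G so that it serves twice: with G = p for invariance and the
    cross-ratio, with G = \<psi> p for the perturbation. The reference point x0 is free, as the
    three-point functionals demand.\<close>
  have osc_L: "\<bar>L G x - L G x'\<bar> \<le> (s * B + exp \<epsilon> * H * A) * dist x x' powr \<alpha> * L p x0"
    if p: "p \<in> fcone (SB s X \<alpha>)" and x: "x0 \<in> X'" "x \<in> X'" "x' \<in> X'" and AB: "0 \<le> A" "0 \<le> B"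
      and GA: "\<And>z z'. z \<in> X \<Longrightarrow> z' \<in> X \<Longrightarrow> \<bar>G z\<bar> \<le> A * p z'"
      and GB: "\<And>z z' z0. z \<in> X \<Longrightarrow> z' \<in> X \<Longrightarrow> z0 \<in> X \<Longrightarrow> \<bar>G z - G z'\<bar> \<le> B * dist z z' powr \<alpha> * p z0"
    for p G x0 x x' A B
  proof -
    let ?t = "dist x x' powr \<alpha>"
    have first: "exp (\<phi> (y i x)) * \<bar>G (y i x) - G (y i x')\<bar> \<le> exp \<epsilon> * B * \<delta> i * ?t * w p j x0" if i: "i \<in> I" and j: "j \<in> I" for i j
    proof -
      note m = y_mem[OF x(1) j] y_mem[OF x(2) i] y_mem[OF x(3) i]
      have "\<bar>G (y i x) - G (y i x')\<bar> \<le> B * dist (y i x) (y i x') powr \<alpha> * p (y j x0)" by (rule GB[OF m(2,3,1)])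
      also have "\<dots> \<le> B * (\<delta> i * ?t) * p (y j x0)"
        by (intro mult_right_mono mult_left_mono contr x i AB p0 p m)
      finally have "\<bar>G (y i x) - G (y i x')\<bar> \<le> B * (\<delta> i * ?t) * p (y j x0)" .
      then have "exp (\<phi> (y i x)) * \<bar>G (y i x) - G (y i x')\<bar> \<le> (exp \<epsilon> * exp (\<phi> (y j x0))) * (B * (\<delta> i * ?t) * p (y j x0))"
        by (intro mult_mono \<phi>_le m) auto
      then show ?thesis by (simp add: w_def mult_ac)
    qed
    have second: "\<bar>exp (\<phi> (y i x)) - exp (\<phi> (y i x'))\<bar> * \<bar>G (y i x')\<bar> \<le> exp \<epsilon> * H * A * ?t * w p i x0" if i: "i \<in> I" for i
    proof -
      note m = y_mem[OF x(1) i] y_mem[OF x(2) i] y_mem[OF x(3) i]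
      let ?M = "exp \<epsilon> * exp (\<phi> (y i x0))"
      have "\<bar>exp (\<phi> (y i x)) - exp (\<phi> (y i x'))\<bar> \<le> \<bar>\<phi> (y i x) - \<phi> (y i x')\<bar> * ?M"
        by (intro abs_exp_diff_le \<phi>_le m)
      also have "\<dots> \<le> H * ?t * ?M" by (intro mult_right_mono osc x i) simp
      finally have "\<bar>exp (\<phi> (y i x)) - exp (\<phi> (y i x'))\<bar> * \<bar>G (y i x')\<bar> \<le> (H * ?t * ?M) * (A * p (y i x0))"
        using H by (intro mult_mono GA m) auto
      then show ?thesis by (simp add: w_def mult_ac)
    qed
    have LG: "L G x - L G x' = (\<Sum>i\<in>I. exp (\<phi> (y i x)) * (G (y i x) - G (y i x')) + (exp (\<phi> (y i x)) - exp (\<phi> (y i x'))) * G (y i x'))"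
      unfolding Lw[OF x(2)] Lw[OF x(3)] sum_subtractf[symmetric] w_def by (intro sum.cong) (auto simp: algebra_simps)
    have "\<bar>L G x - L G x'\<bar> \<le> (\<Sum>i\<in>I. exp (\<phi> (y i x)) * \<bar>G (y i x) - G (y i x')\<bar> + \<bar>exp (\<phi> (y i x)) - exp (\<phi> (y i x'))\<bar> * \<bar>G (y i x')\<bar>)"
      unfolding LG by (rule order_trans[OF sum_abs]) (intro sum_mono order_trans[OF abs_triangle_ineq], simp add: abs_mult)
    also have "\<dots> \<le> (\<Sum>i\<in>I. exp (\<phi> (y i x)) * \<bar>G (y i x) - G (y i x')\<bar>) + exp \<epsilon> * H * A * ?t * L p x0"
      unfolding sum.distrib Lw[OF x(1)] sum_distrib_left by (intro add_left_mono sum_mono second)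
    also have "(\<Sum>i\<in>I. exp (\<phi> (y i x)) * \<bar>G (y i x) - G (y i x')\<bar>) \<le> s * B * ?t * L p x0"
    proof -
      have *: "(\<Sum>i\<in>I. exp (\<phi> (y i x)) * \<bar>G (y i x) - G (y i x')\<bar>) \<le> real d * s * (B * ?t * w p j x0)" if j: "j \<in> I" for j
      proof -
        have "(\<Sum>i\<in>I. exp (\<phi> (y i x)) * \<bar>G (y i x) - G (y i x')\<bar>) \<le> (\<Sum>i\<in>I. exp \<epsilon> * B * \<delta> i * ?t * w p j x0)"
          by (intro sum_mono first j)
        also have "\<dots> = exp \<epsilon> * (\<Sum>i\<in>I. \<delta> i) * (B * ?t * w p j x0)" by (simp add: sum_distrib_left sum_distrib_right mult_ac)
        also have "\<dots> \<le> real d * s * (B * ?t * w p j x0)"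
          using sum_\<delta> AB w0[OF p j x(1)] by (intro mult_right_mono) auto
        finally show ?thesis .
      qed
      \<comment> \<open>The bound \<open>*\<close> holds with every branch j on the right; summing
        over j and dividing by d replaces the single weight by the full L p x0.\<close>
      have "real d * (\<Sum>i\<in>I. exp (\<phi> (y i x)) * \<bar>G (y i x) - G (y i x')\<bar>) = (\<Sum>j\<in>I. \<Sum>i\<in>I. exp (\<phi> (y i x)) * \<bar>G (y i x) - G (y i x')\<bar>)"
        using cardI by simp
      also have "\<dots> \<le> (\<Sum>j\<in>I. real d * s * (B * ?t * w p j x0))" by (intro sum_mono *)
      also have "\<dots> = real d * (s * B * ?t * L p x0)" unfolding Lw[OF x(1)] by (simp add: sum_distrib_left mult_ac)
      finally show ?thesis using d by simp
    qed
    finally show ?thesis by (simp add: algebra_simps)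
  qed
  have osc_p: "\<bar>L p x - L p x'\<bar> \<le> \<zeta> / s' * dist x x' powr \<alpha> * L p x0"
    if p: "p \<in> fcone (SB s X \<alpha>)" and x: "x0 \<in> X'" "x \<in> X'" "x' \<in> X'" for p x0 x x'
  proof -
    \<comment> \<open>B = 1 / s and A = 1 + 1 / s are the cone constants of p; with them the bound
      collapses to \<zeta> / s'.\<close>
    have "\<bar>L p x - L p x'\<bar> \<le> (s * (1 / s) + exp \<epsilon> * H * (1 + 1 / s)) * dist x x' powr \<alpha> * L p x0"
    proof (rule osc_L[OF p x])
      show "\<bar>p z\<bar> \<le> (1 + 1 / s) * p z'" if "z \<in> X" "z' \<in> X" for z z'
        using pK[OF p that] p0[OF p that(1)] by simp
      show "\<bar>p z - p z'\<bar> \<le> 1 / s * dist z z' powr \<alpha> * p z0" if "z \<in> X" "z' \<in> X" "z0 \<in> X" for z z' z0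
        using pd[OF p that] by (simp add: mult_ac)
    qed (use s in auto)
    also have "s * (1 / s) + exp \<epsilon> * H * (1 + 1 / s) = \<zeta> / s'" using s s' by (simp add: \<zeta>(1) mult_ac)
    finally show ?thesis .
  qed
  have osc_\<zeta>: "\<bar>(L p x - L p x') / dist x x' powr \<alpha>\<bar> \<le> \<zeta> / s' * L p x0"
    if p: "p \<in> fcone (SB s X \<alpha>)" and x: "x0 \<in> X'" "x \<in> X'" "x' \<in> X'" "x \<noteq> x'" for p x0 x x'
    using osc_p[OF p x(1-3)] x(4) by (simp add: divide_le_eq mult_ac)
  have feval3: "feval [(1 / s', x0), (- (1 / dist x x' powr \<alpha>), x), (1 / dist x x' powr \<alpha>, x')] f =
    f x0 / s' - (f x - f x') / dist x x' powr \<alpha>" for f :: "_ \<Rightarrow> real" and x0 x x' by (simp add: diff_divide_distrib)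
  have invariant: "L p \<in> fcone (SB s' X' \<alpha>)" if p: "p \<in> fcone (SB s X \<alpha>)" for p
    unfolding mem_fcone_SB
  proof (intro conjI ballI L0 p)
    fix x0 x x' assume x: "x0 \<in> X'" "x \<in> X'" "x' \<in> X'"
    have "\<zeta> / s' * dist x x' powr \<alpha> * L p x0 \<le> 1 / s' * dist x x' powr \<alpha> * L p x0"
      using \<zeta> s' L0[OF p x(1)] by (intro mult_right_mono divide_right_mono) auto
    then show "L p x - L p x' \<le> dist x x' powr \<alpha> * (L p x0 / s')" using osc_p[OF p x] by (simp add: mult_ac)
  qed
  let ?R = "(1 + \<zeta>) / (1 - \<zeta>)"
  have R1: "1 \<le> ?R" using \<zeta>0 \<zeta>(2) by (simp add: field_simps)
  \<comment> \<open>The base point contributes 1 / s', and the difference quotient shifts this by at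
    most \<zeta> / s' in either direction.\<close>
  have lo: "(1 - \<zeta>) / s' * L p x0 \<le> feval l (L p) \<and> feval l (L p) \<le> (1 + \<zeta>) / s' * L p x0"
    if l: "l = [(1 / s', x0), (- (1 / dist x x' powr \<alpha>), x), (1 / dist x x' powr \<alpha>, x')]" and x: "x0 \<in> X'" "x \<in> X'" "x' \<in> X'" "x \<noteq> x'"
      and p: "p \<in> fcone (SB s X \<alpha>)" for l x0 x x' p
    using osc_\<zeta>[OF p x] unfolding l feval3 by (simp add: abs_le_iff add_divide_distrib diff_divide_distrib algebra_simps)
  have base: "\<exists>b\<in>X'. \<exists>c\<ge>0. \<forall>f\<in>L ` fcone (SB s X \<alpha>). c * f b \<le> feval l f \<and> feval l f \<le> ?R * c * f b" if l: "l \<in> SB s' X' \<alpha>" for l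
  proof -
    consider x where "x \<in> X'" "l = [(1, x)]" | x0 x x' where "x0 \<in> X'" "x \<in> X'" "x' \<in> X'" "x \<noteq> x'"
        "l = [(1 / s', x0), (- (1 / dist x x' powr \<alpha>), x), (1 / dist x x' powr \<alpha>, x')]"
      using l by (auto simp: SB_def)
    then show ?thesis
    proof cases
      case 1
      have "1 * f x \<le> feval l f \<and> feval l f \<le> ?R * 1 * f x" if "f \<in> L ` fcone (SB s X \<alpha>)" for f
      proof -
        have "0 \<le> f x" using that L0 1(1) by auto
        then show ?thesis using mult_right_mono[OF R1, of "f x"] by (simp add: 1(2))
      qed
      then show ?thesis using 1(1) zero_le_one by blast
    next
      case 2
      have "(1 - \<zeta>) / s' * f x0 \<le> feval l f \<and> feval l f \<le> ?R * ((1 - \<zeta>) / s') * f x0" if "f \<in> L ` fcone (SB s X \<alpha>)" for f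
        using that lo[OF 2(5,1-4)] \<zeta>(2) by auto
      moreover have "0 \<le> (1 - \<zeta>) / s'" using \<zeta>(2) s' by simp
      ultimately show ?thesis using 2(1) by blast
    qed
  qed
  have \<kappa>: "f x \<le> (1 + \<zeta> / s') * f x'" if fL: "f \<in> L ` fcone (SB s X \<alpha>)" and x: "x \<in> X'" "x' \<in> X'" for f x x'
  proof -
    obtain p where p: "p \<in> fcone (SB s X \<alpha>)" "f = L p" using fL by auto
    have "dist x x' powr \<alpha> \<le> 1" using powr_mono2[of \<alpha> "dist x x'" 1] diamX'[OF x] \<alpha> by simp
    then have "\<zeta> / s' * dist x x' powr \<alpha> * L p x' \<le> \<zeta> / s' * 1 * L p x'"
      using \<zeta>0 s' L0[OF p(1) x(2)] by (intro mult_right_mono mult_left_mono) auto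
    then show ?thesis using osc_p[OF p(1) x(2) x] unfolding p(2) by (simp add: abs_le_iff algebra_simps)
  qed
  show "cone_step (SB s X \<alpha>) (SB s' X' \<alpha>) L ((1 + \<zeta>) / (1 - \<zeta>) * (1 + \<zeta> / s'))"
    unfolding cone_step_def
  proof (intro conjI ballI invariant)
    have "1 * 1 \<le> ?R * (1 + \<zeta> / s')" by (rule mult_mono) (use R1 \<zeta>1 in auto)
    then show "1 \<le> ?R * (1 + \<zeta> / s')" by simp
    fix p q l m assume "p \<in> fcone (SB s X \<alpha>)" "q \<in> fcone (SB s X \<alpha>)" "l \<in> SB s' X' \<alpha>" "m \<in> SB s' X' \<alpha>"
    then show "feval l (L p) * feval m (L q) \<le> (?R * (1 + \<zeta> / s'))\<^sup>2 * (feval l (L q) * feval m (L p))"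
      using R1 L0 by (intro cross_ratio_from_base_points[where F="L ` fcone (SB s X \<alpha>)" and X=X', OF base _ \<kappa>]) auto
  qed
  fix \<psi> p m a b
  assume a: "\<And>x. x \<in> X \<Longrightarrow> \<bar>\<psi> x\<bar> \<le> a" and b0: "0 \<le> b"
    and b: "\<And>x x'. x \<in> X \<Longrightarrow> x' \<in> X \<Longrightarrow> \<bar>\<psi> x - \<psi> x'\<bar> \<le> b * dist x x' powr \<alpha>"
    and p: "p \<in> fcone (SB s X \<alpha>)" and m: "m \<in> SB s' X' \<alpha>"
  have a0: "0 \<le> a" using a X by (meson abs_ge_zero ex_in_conv order_trans)
  have le: "L (\<lambda>x. \<psi> x * p x) x \<le> a * L p x" if x: "x \<in> X'" for x
    unfolding Lw[OF x] sum_distrib_left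
  proof (rule sum_mono)
    fix i assume i: "i \<in> I"
    have "\<psi> (y i x) * w p i x \<le> a * w p i x"
      using a[OF y_mem[OF x i]] w0[OF p i x] by (intro mult_right_mono) (auto simp: abs_le_iff)
    then show "w (\<lambda>x. \<psi> x * p x) i x \<le> a * w p i x" by (simp add: w_def mult_ac)
  qed
  consider x where "x \<in> X'" "m = [(1, x)]" | x0 x x' where "x0 \<in> X'" "x \<in> X'" "x' \<in> X'" "x \<noteq> x'"
      "m = [(1 / s', x0), (- (1 / dist x x' powr \<alpha>), x), (1 / dist x x' powr \<alpha>, x')]"
    using m by (auto simp: SB_def)
  then show "feval m (L (\<lambda>x. \<psi> x * p x)) \<le> 3 * (a + b) / (1 - \<zeta>) * feval m (L p)"
  proof cases
    case 1
    have "a * (1 - \<zeta>) \<le> a * 1" using a0 \<zeta>0 by (intro mult_left_mono) auto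
    then have "a \<le> 3 * (a + b) / (1 - \<zeta>)" using \<zeta>(2) a0 b0 by (simp add: le_divide_eq)
    then show ?thesis using le[OF 1(1)] mult_right_mono[OF _ L0[OF p 1(1)]] by (fastforce simp: 1(2))
  next
    case 2
    let ?t = "dist x x' powr \<alpha>"
    have "\<bar>L (\<lambda>x. \<psi> x * p x) x - L (\<lambda>x. \<psi> x * p x) x'\<bar> \<le>
        (s * (a / s + b * (1 + 1 / s)) + exp \<epsilon> * H * (a * (1 + 1 / s))) * ?t * L p x0"
    proof (rule osc_L[OF p 2(1-3)])
      fix z z' assume z: "z \<in> X" "z' \<in> X"
      show "\<bar>\<psi> z * p z\<bar> \<le> a * (1 + 1 / s) * p z'"
        using mult_mono[OF a[OF z(1)] pK[OF p z]] p0[OF p] z a0 by (simp add: abs_mult mult.assoc)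
      fix z0 assume z0: "z0 \<in> X"
      have "\<psi> z * p z - \<psi> z' * p z' = \<psi> z * (p z - p z') + (\<psi> z - \<psi> z') * p z'" by (simp add: algebra_simps)
      also have "\<bar>\<dots>\<bar> \<le> \<bar>\<psi> z\<bar> * \<bar>p z - p z'\<bar> + \<bar>\<psi> z - \<psi> z'\<bar> * \<bar>p z'\<bar>"
        by (rule order_trans[OF abs_triangle_ineq]) (simp add: abs_mult)
      also have "\<dots> \<le> a * (dist z z' powr \<alpha> * (p z0 / s)) + (b * dist z z' powr \<alpha>) * ((1 + 1 / s) * p z0)"
        by (intro add_mono mult_mono a b pd p z z0 a0 b0) (use pK[OF p z(2) z0] p0[OF p z(2)] b0 in auto)
      also have "\<dots> = (a / s + b * (1 + 1 / s)) * dist z z' powr \<alpha> * p z0" by (simp add: algebra_simps)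
      finally show "\<bar>\<psi> z * p z - \<psi> z' * p z'\<bar> \<le> (a / s + b * (1 + 1 / s)) * dist z z' powr \<alpha> * p z0" .
    qed (use s a0 b0 in auto)
    also have "\<dots> \<le> (a + b) * (1 + \<zeta> / s') * ?t * L p x0"
    proof -
      have "s * (a / s + b * (1 + 1 / s)) + exp \<epsilon> * H * (a * (1 + 1 / s)) = a * (\<zeta> / s') + b * (1 + s)"
        using s s' by (simp add: \<zeta>s field_simps)
      also have "\<dots> \<le> a * (1 + \<zeta> / s') + b * (1 + \<zeta> / s')"
        using a0 b0 s \<zeta>1 by (intro add_mono mult_left_mono) auto
      also have "\<dots> = (a + b) * (1 + \<zeta> / s')" by (simp only: distrib_right)
      finally show ?thesis by (intro mult_right_mono L0[OF p 2(1)]) auto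
    qed
    finally have "\<bar>(L (\<lambda>x. \<psi> x * p x) x - L (\<lambda>x. \<psi> x * p x) x') / ?t\<bar> \<le> (a + b) * (1 + \<zeta> / s') * L p x0"
      using 2(4) by (simp add: divide_le_eq mult_ac)
    then have "- ((L (\<lambda>x. \<psi> x * p x) x - L (\<lambda>x. \<psi> x * p x) x') / ?t) \<le> (a + b) * (1 + \<zeta> / s') * L p x0"
      by (rule abs_le_D2)
    moreover have "L (\<lambda>x. \<psi> x * p x) x0 / s' \<le> a * L p x0 / s'"
      using le[OF 2(1)] s' by (intro divide_right_mono) auto
    ultimately have "feval m (L (\<lambda>x. \<psi> x * p x)) \<le> a * L p x0 / s' + (a + b) * (1 + \<zeta> / s') * L p x0"
      unfolding 2(5) feval3 by (simp only: diff_conv_add_uminus)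
    also have "\<dots> = (a + (a + b) * (s' + \<zeta>)) / s' * L p x0" using s' by (simp add: field_simps)
    \<comment> \<open>The 3 arises here: s' \<le> 1 and \<zeta> < 1 bound the bracket by a + 2 (a +
      b).\<close>
    also have "\<dots> \<le> 3 * (a + b) / s' * L p x0"
    proof (intro mult_right_mono divide_right_mono L0 p 2(1))
      have "(a + b) * (s' + \<zeta>) \<le> (a + b) * 2" using a0 b0 s' \<zeta>(2) by (intro mult_left_mono) auto
      then show "a + (a + b) * (s' + \<zeta>) \<le> 3 * (a + b)" using b0 by simp
    qed (use s' in auto)
    also have "\<dots> = 3 * (a + b) / (1 - \<zeta>) * ((1 - \<zeta>) / s' * L p x0)" using \<zeta>(2) by simp
    also have "\<dots> \<le> 3 * (a + b) / (1 - \<zeta>) * feval m (L p)"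
      using lo[OF 2(5,1-4) p] a0 b0 \<zeta>(2) by (intro mult_left_mono) auto
    finally show ?thesis .
  qed
qed

section \<open>The base transformation\<close>

locale invertible_mps = prob_space P for P :: "'w measure" +
  fixes \<theta> :: "'w \<Rightarrow> 'w"
  assumes bij: "bij_betw \<theta> (space P) (space P)" and \<theta>_measurable: "\<theta> \<in> measurable P P"
    and thinv_measurable: "thinv P \<theta> \<in> measurable P P" and preserving: "distr P P \<theta> = P"
begin

abbreviation "\<tau> \<equiv> thinv P \<theta>"

lemma \<theta>_\<tau>: "\<omega> \<in> space P \<Longrightarrow> \<theta> (\<tau> \<omega>) = \<omega>" and \<tau>_\<theta>: "\<omega> \<in> space P \<Longrightarrow> \<tau> (\<theta> \<omega>) = \<omega>"
  using bij by (auto simp: thinv_def bij_betw_def f_the_inv_into_f the_inv_into_f_f)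

lemma \<theta>n_measurable: "(\<theta> ^^ n) \<in> measurable P P"
proof (induction n)
  case (Suc n)
  show ?case unfolding funpow.simps(2) by (rule measurable_comp[OF Suc \<theta>_measurable])
qed (simp add: id_def)

lemma \<tau>n_measurable: "(\<tau> ^^ n) \<in> measurable P P"
proof (induction n)
  case (Suc n)
  show ?case unfolding funpow.simps(2) by (rule measurable_comp[OF Suc thinv_measurable])
qed (simp add: id_def)

lemma distr_\<tau>: "distr P P \<tau> = P"
proof -
  have "distr P P \<tau> = distr (distr P P \<theta>) P \<tau>" by (simp add: preserving)
  also have "\<dots> = distr P P (\<tau> \<circ> \<theta>)" by (rule distr_distr[OF thinv_measurable \<theta>_measurable])
  also have "\<dots> = distr P P (\<lambda>\<omega>. \<omega>)" by (rule distr_cong) (auto simp: \<tau>_\<theta>)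
  finally show ?thesis by (simp add: distr_id2)
qed

lemma distr_\<theta>n: "distr P P (\<theta> ^^ n) = P"
proof (induction n)
  case (Suc n)
  have "distr P P (\<theta> ^^ Suc n) = distr (distr P P (\<theta> ^^ n)) P \<theta>"
    by (simp add: distr_distr[OF \<theta>_measurable \<theta>n_measurable])
  then show ?case by (simp only: Suc preserving)
qed (simp add: distr_id2)

lemma distr_\<tau>n: "distr P P (\<tau> ^^ n) = P"
proof (induction n)
  case (Suc n)
  have "distr P P (\<tau> ^^ Suc n) = distr (distr P P (\<tau> ^^ n)) P \<tau>"
    by (simp add: distr_distr[OF thinv_measurable \<tau>n_measurable])
  then show ?case by (simp only: Suc distr_\<tau>)
qed (simp add: distr_id2)

lemma \<theta>n_space: "\<omega> \<in> space P \<Longrightarrow> (\<theta> ^^ n) \<omega> \<in> space P" and \<tau>n_space: "\<omega> \<in> space P \<Longrightarrow> (\<tau> ^^ n) \<omega> \<in> space P"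
  using measurable_space[OF \<theta>n_measurable] measurable_space[OF \<tau>n_measurable] by auto

lemma AE_orbit:
  assumes "AE \<omega> in P. Q \<omega>"
  shows "AE \<omega> in P. \<forall>n. Q ((\<theta> ^^ n) \<omega>) \<and> Q ((\<tau> ^^ n) \<omega>)"
proof -
  have "AE \<omega> in P. Q ((\<theta> ^^ n) \<omega>)" for n
    by (rule AE_distrD[OF \<theta>n_measurable]) (subst distr_\<theta>n, rule assms)
  moreover have "AE \<omega> in P. Q ((\<tau> ^^ n) \<omega>)" for n
    by (rule AE_distrD[OF \<tau>n_measurable]) (subst distr_\<tau>n, rule assms)
  ultimately show ?thesis by (simp add: AE_all_countable)
qed

lemma AE_shift:
  assumes "AE \<omega> in P. Q \<omega>" shows "AE \<omega> in P. Q \<omega> \<and> Q (\<theta> \<omega>)"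
  using AE_orbit[OF assms]
proof eventually_elim
  case (elim \<omega>)
  then show ?case using elim[rule_format, of 0] elim[rule_format, of 1] by simp
qed

text \<open>Turns an almost-sure property into one valid along whole two-sided orbits: the set is
  invariant under \<theta> and \<tau> and keeps full measure, which is what the locales need as
  \<open>N\<close>.\<close>

definition orbit_set :: "('w \<Rightarrow> bool) \<Rightarrow> 'w set" where
  "orbit_set Q = {\<omega> \<in> space P. \<forall>n. Q ((\<theta> ^^ n) \<omega>) \<and> Q ((\<tau> ^^ n) \<omega>)}"

lemma orbit_setD: "\<omega> \<in> orbit_set Q \<Longrightarrow> Q \<omega>" "\<omega> \<in> orbit_set Q \<Longrightarrow> \<omega> \<in> space P"
  unfolding orbit_set_def by (auto dest: spec[of _ "0::nat"])

lemma orbit_set_\<theta>: assumes "\<omega> \<in> orbit_set Q" shows "\<theta> \<omega> \<in> orbit_set Q"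
proof -
  have sp: "\<omega> \<in> space P" and Q: "Q ((\<theta> ^^ n) \<omega>)" "Q ((\<tau> ^^ n) \<omega>)" for n using assms by (auto simp: orbit_set_def)
  have "Q ((\<theta> ^^ n) (\<theta> \<omega>))" for n using Q(1)[of "Suc n"] by (simp add: funpow_swap1)
  moreover have "Q ((\<tau> ^^ n) (\<theta> \<omega>))" for n
  proof (cases n)
    case 0 then show ?thesis using Q(1)[of 1] by simp
  next
    case (Suc k) then show ?thesis using Q(2)[of k] \<tau>_\<theta>[OF sp] by (simp add: funpow_swap1)
  qed
  ultimately show ?thesis using \<theta>n_space[OF sp, of 1] by (simp add: orbit_set_def)
qed

lemma orbit_set_\<tau>: assumes "\<omega> \<in> orbit_set Q" shows "\<tau> \<omega> \<in> orbit_set Q"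
proof -
  have sp: "\<omega> \<in> space P" and Q: "Q ((\<theta> ^^ n) \<omega>)" "Q ((\<tau> ^^ n) \<omega>)" for n using assms by (auto simp: orbit_set_def)
  have "Q ((\<tau> ^^ n) (\<tau> \<omega>))" for n using Q(2)[of "Suc n"] by (simp add: funpow_swap1)
  moreover have "Q ((\<theta> ^^ n) (\<tau> \<omega>))" for n
  proof (cases n)
    case 0 then show ?thesis using Q(2)[of 1] by simp
  next
    case (Suc k) then show ?thesis using Q(1)[of k] \<theta>_\<tau>[OF sp] by (simp add: funpow_swap1)
  qed
  ultimately show ?thesis using \<tau>n_space[OF sp, of 1] by (simp add: orbit_set_def)
qed

lemma AE_orbit_set:
  assumes "AE \<omega> in P. Q \<omega>" shows "AE \<omega> in P. \<omega> \<in> orbit_set Q"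
  using AE_orbit[OF assms] AE_space by eventually_elim (auto simp: orbit_set_def)

lemma measure_\<tau>n_vimage:
  assumes "A \<in> sets P" shows "measure P ((\<tau> ^^ n) -` A \<inter> space P) = measure P A"
proof -
  have "measure P ((\<tau> ^^ n) -` A \<inter> space P) = measure (distr P P (\<tau> ^^ n)) A"
    by (rule measure_distr[OF \<tau>n_measurable assms, symmetric])
  also have "\<dots> = measure P A" by (simp only: distr_\<tau>n)
  finally show ?thesis .
qed

text \<open>The limsup of the visiting events has measure at least that of A, by continuity from
  above and invariance of the measure. Shifting an orbit shifts its visit times by one, so the
  limsup is \<theta>-invariant and ergodicity makes it full.\<close>

lemma infinitely_many_backward_visits:
  assumes erg: "ergodic P \<theta>" and A: "A \<in> sets P" "measure P A \<noteq> 0"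
  shows "AE \<omega> in P. infinite {n. (\<tau> ^^ n) \<omega> \<in> A}"
proof -
  define V where "V n = (\<tau> ^^ n) -` A \<inter> space P" for n
  define B where "B = (\<Inter>m. \<Union>n\<in>{m..}. V n)"
  have V: "V n \<in> sets P" for n unfolding V_def by (rule measurable_sets[OF \<tau>n_measurable A(1)])
  have U: "(\<Union>n\<in>{m..}. V n) \<in> sets P" for m using V by (intro sets.countable_UN') auto
  have B: "B \<in> sets P" unfolding B_def by (rule sets.countable_INT') (use U in auto)
  have B_iff: "\<omega> \<in> B \<longleftrightarrow> \<omega> \<in> space P \<and> infinite {n. (\<tau> ^^ n) \<omega> \<in> A}" for \<omega>
  proof -
    have "\<omega> \<in> B \<longleftrightarrow> (\<forall>m. \<exists>n\<ge>m. (\<tau> ^^ n) \<omega> \<in> A \<and> \<omega> \<in> space P)" by (auto simp: B_def V_def Bex_def)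
    then show ?thesis unfolding infinite_nat_iff_unbounded_le mem_Collect_eq by blast
  qed
  have "(\<lambda>m. measure P (\<Union>n\<in>{m..}. V n)) \<longlonglongrightarrow> measure P B"
    unfolding B_def
  proof (rule finite_Lim_measure_decseq)
    show "range (\<lambda>m. \<Union>n\<in>{m..}. V n) \<subseteq> sets P" using U by blast
    show "decseq (\<lambda>m. \<Union>n\<in>{m..}. V n)" unfolding decseq_def by (intro allI impI UN_mono) auto
  qed
  moreover have "measure P A \<le> measure P (\<Union>n\<in>{m..}. V n)" for m
  proof -
    have "measure P (V m) \<le> measure P (\<Union>n\<in>{m..}. V n)" by (rule finite_measure_mono[OF _ U]) blast
    then show ?thesis using measure_\<tau>n_vimage[OF A(1), of m] by (simp only: V_def)
  qed
  ultimately have "measure P A \<le> measure P B" by (intro LIMSEQ_le_const) auto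
  then have B0: "measure P B \<noteq> 0" using A(2) measure_nonneg[of P A] by linarith
  have "\<theta> -` B \<inter> space P = B"
  proof (intro set_eqI)
    fix \<omega>
    have "infinite {n. (\<tau> ^^ n) (\<theta> \<omega>) \<in> A} \<longleftrightarrow> infinite {n. (\<tau> ^^ n) \<omega> \<in> A}" if "\<omega> \<in> space P"
    proof -
      have *: "(\<tau> ^^ Suc n) (\<theta> \<omega>) = (\<tau> ^^ n) \<omega>" for n
        using \<tau>_\<theta>[OF that] by (simp add: funpow_swap1)
      \<comment> \<open>Time 0 of the shifted orbit has no counterpart and is dropped; a single
        index does not affect finiteness.\<close>
      have "{n. (\<tau> ^^ n) (\<theta> \<omega>) \<in> A} - {0} = Suc ` {n. (\<tau> ^^ n) \<omega> \<in> A}"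
      proof (intro set_eqI)
        fix n show "n \<in> {n. (\<tau> ^^ n) (\<theta> \<omega>) \<in> A} - {0} \<longleftrightarrow> n \<in> Suc ` {n. (\<tau> ^^ n) \<omega> \<in> A}"
        proof (cases n)
          case (Suc k)
          show ?thesis unfolding Suc using *[of k] by (simp add: image_iff del: funpow.simps)
        qed simp
      qed
      then have "finite {n. (\<tau> ^^ n) (\<theta> \<omega>) \<in> A} \<longleftrightarrow> finite (Suc ` {n. (\<tau> ^^ n) \<omega> \<in> A})"
        by (metis finite_Diff2 finite.emptyI finite.insertI)
      then show ?thesis by (simp add: finite_image_iff)
    qed
    then show "\<omega> \<in> \<theta> -` B \<inter> space P \<longleftrightarrow> \<omega> \<in> B" using \<theta>n_space[of \<omega> 1] by (auto simp: B_iff)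
  qed
  then have "measure P B = 1" using erg B B0 unfolding ergodic_def by blast
  then have "AE \<omega> in P. \<omega> \<in> B" by (rule prob_eq_1[OF B, THEN iffD1])
  then show ?thesis by eventually_elim (simp add: B_iff)
qed

text \<open>Summing |Y|^p along the orbit with weights (j + 1)^(-3/2) gives a function with finite
  integral, hence finite almost surely, and each term is at most the whole sum. Any weight exponent
  above 1 would do; 3/2 leads to growth 3 / (2p).\<close>

lemma AE_growth:
  assumes Y: "Y \<in> borel_measurable P" and int: "integrable P (\<lambda>\<omega>. \<bar>Y \<omega>\<bar> powr p)" and p: "0 < p"
  shows "AE \<omega> in P. \<exists>C\<ge>0. \<forall>j. \<bar>Y ((\<theta> ^^ j) \<omega>)\<bar> \<le> C * real (Suc j) powr (3 / (2 * p))"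
proof -
  define Z where "Z = (\<lambda>\<omega>. \<bar>Y \<omega>\<bar> powr p)"
  have Zm: "Z \<in> borel_measurable P" unfolding Z_def using Y by measurable
  have Z0: "0 \<le> Z \<omega>" for \<omega> by (simp add: Z_def)
  let ?w = "\<lambda>j. real (Suc j) powr (- (3 / 2))"
  have sw: "summable ?w"
    by (rule summable_Suc_iff[of "\<lambda>j. real j powr (- (3 / 2))", THEN iffD2]) (simp add: summable_real_powr_iff)
  have fin: "(\<integral>\<^sup>+\<omega>. ennreal (Z \<omega>) \<partial>P) = ennreal (integral\<^sup>L P Z)"
    using int Z0 by (intro nn_integral_eq_integral) (auto simp: Z_def)
  have shift: "(\<integral>\<^sup>+\<omega>. ennreal (Z ((\<theta> ^^ j) \<omega>)) \<partial>P) = (\<integral>\<^sup>+\<omega>. ennreal (Z \<omega>) \<partial>P)" for j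
  proof -
    have "(\<integral>\<^sup>+\<omega>. ennreal (Z \<omega>) \<partial>distr P P (\<theta> ^^ j)) = (\<integral>\<^sup>+\<omega>. ennreal (Z ((\<theta> ^^ j) \<omega>)) \<partial>P)"
      by (rule nn_integral_distr[OF \<theta>n_measurable]) (use Zm in measurable)
    then show ?thesis by (simp only: distr_\<theta>n)
  qed
  have Zj: "(\<lambda>\<omega>. Z ((\<theta> ^^ j) \<omega>)) \<in> borel_measurable P" for j
    by (rule measurable_compose[OF \<theta>n_measurable Zm])
  have "(\<integral>\<^sup>+\<omega>. (\<Sum>j. ennreal (?w j * Z ((\<theta> ^^ j) \<omega>))) \<partial>P) = (\<Sum>j. \<integral>\<^sup>+\<omega>. ennreal (?w j * Z ((\<theta> ^^ j) \<omega>)) \<partial>P)"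
    using Zj by (intro nn_integral_suminf) auto
  also have "\<dots> = (\<Sum>j. ennreal (?w j * integral\<^sup>L P Z))"
    using Zj by (simp add: ennreal_mult' nn_integral_cmult shift fin)
  also have "\<dots> < \<infinity>"
  proof -
    have "summable (\<lambda>j. ?w j * integral\<^sup>L P Z)" using sw by (rule summable_mult2)
    moreover have "0 \<le> integral\<^sup>L P Z" using Z0 by simp
    ultimately show ?thesis by (simp add: suminf_ennreal2)
  qed
  finally have "AE \<omega> in P. (\<Sum>j. ennreal (?w j * Z ((\<theta> ^^ j) \<omega>))) \<noteq> \<infinity>"
    using Zj by (intro nn_integral_PInf_AE) auto
  then show ?thesis
  proof eventually_elim
    fix \<omega> assume fin: "(\<Sum>j. ennreal (?w j * Z ((\<theta> ^^ j) \<omega>))) \<noteq> \<infinity>"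
    define C where "C = enn2real (\<Sum>j. ennreal (?w j * Z ((\<theta> ^^ j) \<omega>)))"
    have "?w j * Z ((\<theta> ^^ j) \<omega>) \<le> C" for j
    proof -
      have "ennreal (?w j * Z ((\<theta> ^^ j) \<omega>)) \<le> (\<Sum>j. ennreal (?w j * Z ((\<theta> ^^ j) \<omega>)))"
        using sum_le_suminf[OF summableI, of "{j}" "\<lambda>j. ennreal (?w j * Z ((\<theta> ^^ j) \<omega>))"] by simp
      also have "\<dots> = ennreal C" using fin by (simp add: C_def less_top)
      finally show ?thesis by (simp add: C_def)
    qed
    then have C: "Z ((\<theta> ^^ j) \<omega>) \<le> C * real (Suc j) powr (3 / 2)" for j
    proof -
      have "?w j * Z ((\<theta> ^^ j) \<omega>) * real (Suc j) powr (3 / 2) \<le> C * real (Suc j) powr (3 / 2)"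
        by (intro mult_right_mono \<open>?w j * Z ((\<theta> ^^ j) \<omega>) \<le> C\<close>) simp
      moreover have "?w j * real (Suc j) powr (3 / 2) = 1" by (simp add: powr_add[symmetric] del: of_nat_Suc)
      ultimately show ?thesis by (metis mult.commute mult.left_commute mult_1)
    qed
    have C0: "0 \<le> C" by (simp add: C_def)
    have "\<bar>Y ((\<theta> ^^ j) \<omega>)\<bar> \<le> C powr (1 / p) * real (Suc j) powr (3 / (2 * p))" for j
    proof -
      have "\<bar>Y ((\<theta> ^^ j) \<omega>)\<bar> = (\<bar>Y ((\<theta> ^^ j) \<omega>)\<bar> powr p) powr (1 / p)" using p by (simp add: powr_powr)
      also have "\<dots> \<le> (C * real (Suc j) powr (3 / 2)) powr (1 / p)"
        using C[of j] p by (intro powr_mono2) (auto simp: Z_def)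
      also have "\<dots> = C powr (1 / p) * real (Suc j) powr (3 / (2 * p))"
        using C0 by (simp add: powr_mult powr_powr)
      finally show ?thesis .
    qed
    then show "\<exists>C\<ge>0. \<forall>j. \<bar>Y ((\<theta> ^^ j) \<omega>)\<bar> \<le> C * real (Suc j) powr (3 / (2 * p))"
      by (intro exI[of _ "C powr (1 / p)"]) auto
  qed
qed

end

section \<open>Berry--Esseen bounds for random transfer operators\<close>

lemma Phi_bounds: "0 \<le> Phi t" "Phi t \<le> 1"
proof -
  interpret N: prob_space "density lborel std_normal_density" by (rule prob_space_normal_density) simp
  show "0 \<le> Phi t" "Phi t \<le> 1" by (simp_all add: Phi_def cdf_def)
qed

context skew_observable
begin

text \<open>With radius of order n^(-b), radius times standard deviation is at least of order n^(1/2
  - b), and A is at most of order n^(1 + \<delta>). The choice \<delta> = e - 3b gives the cubic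
  term exactly the exponent -(1/2 - e); the linear term is no larger since b \<le> e.\<close>

lemma Berry_Esseen_fibre:
  assumes \<omega>: "\<omega> \<in> N" and centred: "\<And>\<omega>. \<omega> \<in> N \<Longrightarrow> integral\<^sup>L (mu \<omega>) (ut \<omega>) = 0"
    and W: "\<And>j. W ((\<theta> ^^ j) \<omega>) \<le> CW * real (Suc j) powr b" "0 < CW" "0 \<le> b" "3 * b < e"
    and K: "\<And>j. K ((\<theta> ^^ j) \<omega>) \<le> CK * real (Suc j) powr a" "1 \<le> CK" "0 \<le> a"
    and var: "(\<lambda>n. integral\<^sup>L (mu \<omega>) (\<lambda>x. (Ssum \<theta> T ut n \<omega> x)\<^sup>2) / real n) \<longlonglongrightarrow> \<sigma>\<^sup>2" and \<sigma>: "0 < \<sigma>"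
  shows "\<exists>C. \<forall>n\<ge>1. \<forall>t. \<bar>measure (mu \<omega>) {x \<in> space (mu \<omega>). Ssum \<theta> T ut n \<omega> x \<le>
      t * sqrt (integral\<^sup>L (mu \<omega>) (\<lambda>x. (Ssum \<theta> T ut n \<omega> x)\<^sup>2))} - Phi t\<bar> \<le> C * real n powr (- (1/2 - e))"
proof -
  interpret mu: prob_space "mu \<omega>" by (rule prob_space_mu[OF \<omega>])
  obtain C0 where C0: "C0 > 0" and BE: "\<forall>(M :: 'b measure) S b r A t. prob_space M \<longrightarrow> S \<in> borel_measurable M \<longrightarrow> (\<forall>x\<in>space M. \<bar>S x\<bar> \<le> b) \<longrightarrow>
    integral\<^sup>L M S = 0 \<longrightarrow> 0 < r \<longrightarrow> 0 < integral\<^sup>L M (\<lambda>x. (S x)\<^sup>2) \<longrightarrow>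
    (\<forall>z. norm z < r \<longrightarrow> (CLINT x|M. exp (z * of_real (S x))) \<noteq> 0 \<and> norm (CLINT x|M. exp (z * of_real (S x))) < exp A) \<longrightarrow>
    \<bar>measure M {x \<in> space M. S x \<le> t * sqrt (integral\<^sup>L M (\<lambda>x. (S x)\<^sup>2))} - Phi t\<bar>
      \<le> C0 * (1 / (r * sqrt (integral\<^sup>L M (\<lambda>x. (S x)\<^sup>2))) + A / (r * sqrt (integral\<^sup>L M (\<lambda>x. (S x)\<^sup>2))) ^ 3)"
    using Berry_Esseen_zero_free_mgf[where 'a='b] by (elim exE conjE)
  define V where "V n = integral\<^sup>L (mu \<omega>) (\<lambda>x. (Ssum \<theta> T ut n \<omega> x)\<^sup>2)" for n
  define \<Delta> where "\<Delta> n t = \<bar>measure (mu \<omega>) {x \<in> space (mu \<omega>). Ssum \<theta> T ut n \<omega> x \<le> t * sqrt (V n)} - Phi t\<bar>" for n t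
  define \<delta> where "\<delta> = e - 3 * b"
  \<comment> \<open>The factor 1 / (2 CW) comes from the radius and \<sigma> / 2 from the lower
    bound \<sigma>^2 / 4 on the variance per step.\<close>
  define k where "k = \<sigma> / (4 * CW)"
  \<comment> \<open>The summands account for the leading 1 of A, for ln (3 CK), and for a ln n
    through ln n \<le> n^\<delta> / \<delta>.\<close>
  define B where "B = 1 + ln (3 * CK) + a / \<delta>"
  have \<delta>: "0 < \<delta>" using W by (simp add: \<delta>_def)
  have k: "0 < k" using \<sigma> W by (simp add: k_def)
  have "ln (3 * CK) \<ge> 0" using K by (intro ln_ge_zero) auto
  then have B: "0 \<le> B" using K \<delta> by (simp add: B_def)
  have "eventually (\<lambda>n. \<sigma>\<^sup>2 / 4 < V n / real n) sequentially"
    using \<sigma> by (intro order_tendstoD(1)[OF var[folded V_def]]) simp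
  then obtain n0 where n0: "\<And>n. n \<ge> n0 \<Longrightarrow> \<sigma>\<^sup>2 / 4 < V n / real n" by (auto simp: eventually_sequentially)
  have main: "\<Delta> n t \<le> C0 * (1 / k + B / k ^ 3) * real n powr (- (1/2 - e))" if n: "n \<ge> n0" "n \<ge> 1" for n t
  proof -
    let ?n = "real n"
    define r where "r = 1 / (2 * CW * ?n powr b)"
    define A where "A = 1 + (\<Sum>j<n. ln (3 * K ((\<theta> ^^ j) \<omega>)))"
    have n1: "1 \<le> ?n" using n(2) by simp
    have r: "0 < r" using W n1 by (simp add: r_def)
    have Vn: "(\<sigma> / 2)\<^sup>2 * ?n \<le> V n" using n0[OF n(1)] n1 by (simp add: field_simps)
    have V0: "0 < V n" using Vn \<sigma> n1 by (intro less_le_trans[OF _ Vn]) simp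
    have "\<sigma> / 2 * sqrt ?n = sqrt ((\<sigma> / 2)\<^sup>2 * ?n)" using \<sigma> by (simp add: real_sqrt_mult real_sqrt_divide)
    also have "\<dots> \<le> sqrt (V n)" using Vn by simp
    finally have sV: "\<sigma> / 2 * ?n powr (1/2) \<le> sqrt (V n)" using n1 by (simp add: powr_half_sqrt)
    have pw: "?n powr (1/2) = ?n powr b * ?n powr (1/2 - b)" by (simp add: powr_add[symmetric])
    have "k * ?n powr (1/2 - b) = r * (\<sigma> / 2 * ?n powr (1/2))"
      unfolding pw using W n1 by (simp add: k_def r_def)
    also have "\<dots> \<le> r * sqrt (V n)" using sV r by (intro mult_left_mono) auto
    finally have rs: "k * ?n powr (1/2 - b) \<le> r * sqrt (V n)" .
    have kn: "0 < k * ?n powr (1/2 - b)" using k n1 by simp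
    have rW: "r * W ((\<theta> ^^ j) \<omega>) \<le> 1/2" if j: "j < n" for j
    proof -
      have "CW * real (Suc j) powr b \<le> CW * ?n powr b"
        using j W by (intro mult_left_mono powr_mono2) auto
      then have "r * W ((\<theta> ^^ j) \<omega>) \<le> r * (CW * ?n powr b)" using W(1)[of j] r by (intro mult_left_mono) auto
      also have "\<dots> = 1/2" using W n1 by (simp add: r_def)
      finally show ?thesis .
    qed
    have K1: "1 \<le> K ((\<theta> ^^ j) \<omega>)" for j by (rule K_nonneg[OF \<theta>n[OF \<omega>]])
    have K3: "1 \<le> 3 * K ((\<theta> ^^ j) \<omega>)" for j using K1[of j] by linarith
    have A0: "0 \<le> A" unfolding A_def using K3 by (intro add_nonneg_nonneg sum_nonneg ln_ge_zero) auto
    have lnK: "ln (3 * K ((\<theta> ^^ j) \<omega>)) \<le> (B - 1) * ?n powr \<delta>" if j: "j < n" for j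
    proof -
      have "CK * real (Suc j) powr a \<le> CK * ?n powr a" using j K by (intro mult_left_mono powr_mono2) auto
      then have "3 * K ((\<theta> ^^ j) \<omega>) \<le> 3 * CK * ?n powr a" using K(1)[of j] by linarith
      then have "ln (3 * K ((\<theta> ^^ j) \<omega>)) \<le> ln (3 * CK * ?n powr a)"
        using K1[of j] K n1 by (intro ln_mono) auto
      also have "\<dots> = ln (3 * CK) + a * ln ?n" using K n1 by (simp add: ln_mult ln_powr)
      also have "\<dots> \<le> ln (3 * CK) * ?n powr \<delta> + a * (?n powr \<delta> / \<delta>)"
      proof (intro add_mono mult_left_mono ln_powr_bound n1 \<delta> K)
        have "1 \<le> ?n powr \<delta>" using n1 \<delta> by (simp add: ge_one_powr_ge_zero)
        then show "ln (3 * CK) \<le> ln (3 * CK) * ?n powr \<delta>" using \<open>ln (3 * CK) \<ge> 0\<close> by (simp add: mult_le_cancel_left1)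
      qed
      also have "\<dots> = (B - 1) * ?n powr \<delta>" by (simp add: B_def algebra_simps)
      finally show ?thesis .
    qed
    have "A \<le> 1 + real n * ((B - 1) * ?n powr \<delta>)"
      unfolding A_def using sum_bounded_above[of "{..<n}" "\<lambda>j. ln (3 * K ((\<theta> ^^ j) \<omega>))", OF lnK] by simp
    also have "\<dots> \<le> ?n powr (1 + \<delta>) + real n * ((B - 1) * ?n powr \<delta>)"
      using n1 \<delta> by (intro add_right_mono) (simp add: ge_one_powr_ge_zero)
    also have "\<dots> = B * ?n powr (1 + \<delta>)" using n1 by (simp add: powr_add algebra_simps)
    finally have A: "A \<le> B * ?n powr (1 + \<delta>)" .
    have "\<Delta> n t \<le> C0 * (1 / (r * sqrt (V n)) + A / (r * sqrt (V n)) ^ 3)"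
      unfolding \<Delta>_def V_def
    proof (rule BE[rule_format, OF prob_space_mu[OF \<omega>] measurable_Ssum[OF \<omega>] _ mean_Ssum[OF \<omega> centred] r V0[unfolded V_def]])
      show "\<bar>Ssum \<theta> T ut n \<omega> x\<bar> \<le> (\<Sum>j<n. U ((\<theta> ^^ j) \<omega>))" if "x \<in> space (mu \<omega>)" for x
        unfolding Ssum_def using that
        by (intro order_trans[OF sum_abs] sum_mono ut_le \<theta>n \<omega> iterT_mem) (simp add: space_mu[OF \<omega>])
      show "(CLINT x|mu \<omega>. exp (z * of_real (Ssum \<theta> T ut n \<omega> x))) \<noteq> 0 \<and> norm (CLINT x|mu \<omega>. exp (z * of_real (Ssum \<theta> T ut n \<omega> x))) < exp A"
        if z: "norm z < r" for z
        using mgf_bounds[OF \<omega> rW z] by (simp add: A_def)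
    qed
    also have "\<dots> \<le> C0 * (1 / (k * ?n powr (1/2 - b)) + B * ?n powr (1 + \<delta>) / (k * ?n powr (1/2 - b)) ^ 3)"
      using rs kn A A0 C0 by (intro mult_left_mono add_mono divide_left_mono frac_le power_mono) (auto intro!: mult_pos_pos)
    also have "\<dots> \<le> C0 * (1 / k * ?n powr (- (1/2 - e)) + B / k ^ 3 * ?n powr (- (1/2 - e)))"
    proof (intro mult_left_mono add_mono)
      have "1 / (k * ?n powr (1/2 - b)) = 1 / k * ?n powr (- (1/2 - b))" by (simp add: powr_minus field_simps)
      also have "\<dots> \<le> 1 / k * ?n powr (- (1/2 - e))" using k n1 W by (intro mult_left_mono powr_mono) auto
      finally show "1 / (k * ?n powr (1/2 - b)) \<le> 1 / k * ?n powr (- (1/2 - e))" .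
      have "?n powr (1 + \<delta>) / (?n powr (1/2 - b)) ^ 3 = ?n powr (1 + \<delta> - 3 * (1/2 - b))"
      proof -
        have "(?n powr (1/2 - b)) ^ 3 = ?n powr (3 * (1/2 - b))" by (simp add: power3_eq_cube powr_add[symmetric])
        then show ?thesis by (simp only: powr_diff)
      qed
      also have "1 + \<delta> - 3 * (1/2 - b) = - (1/2 - e)" by (simp add: \<delta>_def)
      finally have *: "?n powr (1 + \<delta>) / (?n powr (1/2 - b)) ^ 3 = ?n powr (- (1/2 - e))" .
      have "B * ?n powr (1 + \<delta>) / (k * ?n powr (1/2 - b)) ^ 3 = B / k ^ 3 * (?n powr (1 + \<delta>) / (?n powr (1/2 - b)) ^ 3)"
        unfolding power_mult_distrib by simp
      then show "B * ?n powr (1 + \<delta>) / (k * ?n powr (1/2 - b)) ^ 3 \<le> B / k ^ 3 * ?n powr (- (1/2 - e))"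
        unfolding * by (rule eq_refl)
    qed (use C0 in auto)
    finally show ?thesis by (simp add: algebra_simps)
  qed
  \<comment> \<open>Below n0 the deviation is at most 1 = n * n^(-1), which is at most n0 * n^(-(1/2
    - e)) because e is positive.\<close>
  have small: "\<Delta> n t \<le> real n0 * real n powr (- (1/2 - e))" if n: "n < n0" "n \<ge> 1" for n t
  proof -
    have "\<Delta> n t \<le> 1" unfolding \<Delta>_def
      using Phi_bounds[of t] mu.prob_le_1[of "{x \<in> space (mu \<omega>). Ssum \<theta> T ut n \<omega> x \<le> t * sqrt (V n)}"]
        measure_nonneg[of "mu \<omega>" "{x \<in> space (mu \<omega>). Ssum \<theta> T ut n \<omega> x \<le> t * sqrt (V n)}"] by argo
    also have "1 = real n * real n powr (-1)" using n by (simp add: powr_minus_divide)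
    also have "\<dots> \<le> real n0 * real n powr (- (1/2 - e))"
      using n W by (intro mult_mono powr_mono) auto
    finally show ?thesis .
  qed
  have "\<Delta> n t \<le> (C0 * (1 / k + B / k ^ 3) + real n0) * real n powr (- (1/2 - e))" if "n \<ge> 1" for n t
  proof (cases "n < n0")
    case True
    have "0 \<le> C0 * (1 / k + B / k ^ 3)" using C0 k B by simp
    then have "real n0 * real n powr (- (1/2 - e)) \<le> (C0 * (1 / k + B / k ^ 3) + real n0) * real n powr (- (1/2 - e))"
      by (intro mult_right_mono) auto
    then show ?thesis using small[OF True that, of t] by (rule order_trans[rotated])
  next
    case False
    have "C0 * (1 / k + B / k ^ 3) * real n powr (- (1/2 - e)) \<le> (C0 * (1 / k + B / k ^ 3) + real n0) * real n powr (- (1/2 - e))"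
      by (intro mult_right_mono) auto
    then show ?thesis using main[of n t] False that by (meson leI order_trans)
  qed
  then show ?thesis unfolding \<Delta>_def V_def by blast
qed

end

lemma holder_space_ucent:
  assumes "holder_space \<alpha> X (u \<omega>)" shows "holder_space \<alpha> X (ucent \<mu> u \<omega>)"
proof -
  have "holder_space \<alpha> X (\<lambda>_. 1)" by (auto simp: holder_space_def bounded_iff intro!: exI[of _ 0] exI[of _ 1])
  from holder_space_diff_scale[OF assms this, of "integral\<^sup>L (\<mu> \<omega>) (u \<omega>)"] show ?thesis by (simp add: ucent_def[abs_def])
qed

text \<open>The ingredient of the locale that the hypotheses do not supply directly is recurrence of
  \<Gamma>. It is obtained where the observable is not small, through
  \<open>U * \<Gamma> \<le> W\<close>; everything else is collected along orbits.\<close>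

lemma (in invertible_mps) skew_product_Berry_Esseen:
  fixes E :: "('w \<times> 'x::metric_space) set" and T :: "'w \<Rightarrow> 'x \<Rightarrow> 'x" and \<phi> u ut :: "'w \<Rightarrow> 'x \<Rightarrow> real"
    and S :: "'w \<Rightarrow> 'x functional set" and K \<Gamma> U W :: "'w \<Rightarrow> real" and \<nu> \<mu> :: "'w \<Rightarrow> 'x measure"
  assumes \<mu>: "\<mu> = gibbs P \<nu> E T \<phi> \<theta>" and ut: "ut = ucent \<mu> u" and U: "U = (\<lambda>\<omega>. supabs (fib E \<omega>) (ut \<omega>))"
    and erg: "ergodic P \<theta>" and \<alpha>: "0 < \<alpha>" "\<alpha> \<le> 1"
    and diam: "\<And>\<omega> x x'. \<omega> \<in> space P \<Longrightarrow> x \<in> fib E \<omega> \<Longrightarrow> x' \<in> fib E \<omega> \<Longrightarrow> dist x x' \<le> 1"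
    and conf: "conformal_family P \<theta> E T \<phi> \<alpha> \<nu>"
    and holder: "AE \<omega> in P. holder_space \<alpha> (fib E \<omega>) (u \<omega>)"
    and branched: "AE \<omega> in P. branched_map (fib E \<omega>) (fib E (\<theta> \<omega>)) (T \<omega>) (\<phi> \<omega>) (I \<omega>) (y \<omega>) (Db \<omega>)"
    and cone: "AE \<omega> in P. good_cone (S \<omega>) (fib E \<omega>) (K \<omega>) \<alpha>"
    and step: "AE \<omega> in P. cone_step (S \<omega>) (S (\<theta> \<omega>)) (Lop E T \<phi> \<omega>) (\<Gamma> \<omega>)"
    and UW: "AE \<omega> in P. U \<omega> \<le> W \<omega>" and U\<Gamma>: "AE \<omega> in P. U \<omega> * \<Gamma> \<omega> \<le> W \<omega>"
    and perturb: "AE \<omega> in P. perturbation_bound (S \<omega>) (S (\<theta> \<omega>)) (Lop E T \<phi> \<omega>) (\<Gamma> \<omega>) (fib E \<omega>) (U \<omega>) (W \<omega>) (ut \<omega>)"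
    and Um: "U \<in> borel_measurable P" and Wm: "W \<in> borel_measurable P"
    and W_growth: "AE \<omega> in P. \<exists>C>0. \<forall>j. W ((\<theta> ^^ j) \<omega>) \<le> C * real (Suc j) powr b" "0 \<le> b" "3 * b < e"
    and K_growth: "AE \<omega> in P. \<exists>C\<ge>1. \<forall>j. K ((\<theta> ^^ j) \<omega>) \<le> C * real (Suc j) powr a" "0 \<le> a"
    and \<sigma>: "0 < \<sigma>" "AE \<omega> in P. (\<lambda>n. svar \<mu> \<theta> T u \<omega> n / real n) \<longlonglongrightarrow> \<sigma>\<^sup>2"
  shows "AE \<omega> in P. \<exists>C. \<forall>n\<ge>1. \<forall>t. \<bar>measure (\<mu> \<omega>) {x \<in> fib E \<omega>. Ssum \<theta> T ut n \<omega> x \<le> t * sqrt (svar \<mu> \<theta> T u \<omega> n)} - Phi t\<bar>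
    \<le> C * real n powr (- (1/2 - e))"
proof -
  have holder_ut: "holder_space \<alpha> (fib E \<omega>) (ut \<omega>)" if "holder_space \<alpha> (fib E \<omega>) (u \<omega>)" for \<omega>
    unfolding ut by (rule holder_space_ucent[where u=u and \<omega>=\<omega>, OF that])
  have ut_le: "\<bar>ut \<omega> x\<bar> \<le> U \<omega>" "0 \<le> U \<omega>" if "holder_space \<alpha> (fib E \<omega>) (u \<omega>)" "x \<in> fib E \<omega>" for \<omega> x
    unfolding U using holder_ut[OF that(1)] supabs_ge[of "ut \<omega>" "fib E \<omega>"] that(2) by (auto simp: holder_space_def)
  have \<nu>: "AE \<omega> in P. prob_space (\<nu> \<omega>) \<and> sets (\<nu> \<omega>) = sets (restrict_space borel (fib E \<omega>))"
    using conf unfolding conformal_family_def by eventually_elim blast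
  \<comment> \<open>On \<open>A m\<close> the relation \<open>U * \<Gamma> \<le> W\<close> gives
    \<Gamma> \<le> (m + 1)^2.\<close>
  define A where "A m = {\<omega> \<in> space P. 1 / real (Suc m) \<le> U \<omega> \<and> W \<omega> \<le> real (Suc m)}" for m
  have A: "A m \<in> sets P" for m unfolding A_def using Um Wm by measurable
  \<comment> \<open>Otherwise \<open>u\<close> is almost surely constant on fibres and the variance vanishes.\<close>
  have "\<exists>m. measure P (A m) \<noteq> 0"
  proof (rule ccontr)
    assume "\<not> ?thesis"
    then have "AE \<omega> in P. \<omega> \<notin> A m" for m using A by (intro AE_not_in null_setsI) (auto simp: emeasure_eq_measure)
    then have "AE \<omega> in P. \<forall>m. \<omega> \<notin> A m" by (simp add: AE_all_countable)
    then have "AE \<omega> in P. U \<omega> \<le> 0"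
      using AE_space
    proof eventually_elim
      case (elim \<omega>)
      show ?case
      proof (rule ccontr)
        assume "\<not> U \<omega> \<le> 0"
        then have pos: "0 < U \<omega>" by simp
        obtain m where m: "max (1 / U \<omega>) (W \<omega>) \<le> real m" using real_arch_simple by blast
        then have "1 / U \<omega> \<le> real (Suc m)" by simp
        then have "1 / real (Suc m) \<le> U \<omega>" using pos by (simp add: field_simps)
        then show False using elim(1)[rule_format, of m] elim(2) m by (simp add: A_def)
      qed
    qed
    note U0 = this
    define Q0 where "Q0 \<omega> \<longleftrightarrow> U \<omega> \<le> 0 \<and> holder_space \<alpha> (fib E \<omega>) (u \<omega>) \<and> sets (\<nu> \<omega>) = sets (restrict_space borel (fib E \<omega>)) \<and>
      branched_map (fib E \<omega>) (fib E (\<theta> \<omega>)) (T \<omega>) (\<phi> \<omega>) (I \<omega>) (y \<omega>) (Db \<omega>) \<and> (\<lambda>n. svar \<mu> \<theta> T u \<omega> n / real n) \<longlonglongrightarrow> \<sigma>\<^sup>2" for \<omega>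
    note QD0 = iffD1[OF Q0_def orbit_setD(1)]
    have "AE \<omega> in P. Q0 \<omega>" using U0 holder \<nu> branched \<sigma>(2) unfolding Q0_def by eventually_elim blast
    then have ae: "AE \<omega> in P. \<omega> \<in> orbit_set Q0" by (rule AE_orbit_set)
    have "orbit_set Q0 \<noteq> {}"
    proof
      assume "orbit_set Q0 = {}"
      then have "AE \<omega> in P. False" using ae by simp
      then show False by simp
    qed
    then obtain \<omega> where \<omega>: "\<omega> \<in> orbit_set Q0" by blast
    have orb: "(\<theta> ^^ n) \<omega> \<in> orbit_set Q0" for n by (induction n) (use \<omega> in \<open>auto intro: orbit_set_\<theta>\<close>)
    have sp: "space (\<mu> v) = fib E v" if "v \<in> orbit_set Q0" for v
      using QD0[OF that] sets_eq_imp_space_eq[of "\<nu> v" "restrict_space borel (fib E v)"]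
      by (simp add: \<mu> gibbs_def space_restrict_space)
    define c where "c v = integral\<^sup>L (\<mu> v) (u v)" for v
    have u_eq: "u v x = c v" if "v \<in> orbit_set Q0" "x \<in> fib E v" for v x
    proof -
      have "\<bar>ut v x\<bar> \<le> 0" using ut_le(1)[of v x] QD0[OF that(1)] that(2) by linarith
      then show ?thesis by (simp add: ut ucent_def c_def)
    qed
    have mem: "iterT \<theta> T j v x \<in> fib E ((\<theta> ^^ j) v)" if "v \<in> orbit_set Q0" "x \<in> fib E v" for v x j
    proof -
      have o: "(\<theta> ^^ j) v \<in> orbit_set Q0" for j by (induction j) (use that(1) in \<open>auto intro: orbit_set_\<theta>\<close>)
      show ?thesis
      proof (induction j)
        case (Suc j)
        have "branched_map (fib E ((\<theta> ^^ j) v)) (fib E (\<theta> ((\<theta> ^^ j) v))) (T ((\<theta> ^^ j) v)) (\<phi> ((\<theta> ^^ j) v)) (I ((\<theta> ^^ j) v)) (y ((\<theta> ^^ j) v)) (Db ((\<theta> ^^ j) v))"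
          using QD0[OF o] by blast
        from branched_map.T_mem[OF this Suc] show ?case by simp
      qed (use that(2) in simp)
    qed
    \<comment> \<open>Before recurrence is available the Gibbs measure is not known to have mass 1,
      so its mass is kept as a parameter.\<close>
    have svar_eq: "svar \<mu> \<theta> T u v n = measure (\<mu> v) (fib E v) * ((\<Sum>j<n. c ((\<theta> ^^ j) v)) * (1 - measure (\<mu> v) (fib E v)))\<^sup>2"
      if v: "v \<in> orbit_set Q0" for v n
    proof -
      have o: "(\<theta> ^^ j) v \<in> orbit_set Q0" for j by (induction j) (use v in \<open>auto intro: orbit_set_\<theta>\<close>)
      have S: "Ssum \<theta> T u n v x = (\<Sum>j<n. c ((\<theta> ^^ j) v))" if "x \<in> fib E v" for x
        unfolding Ssum_def by (intro sum.cong refl u_eq o mem v that)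
      have I: "integral\<^sup>L (\<mu> v) (Ssum \<theta> T u n v) = (\<Sum>j<n. c ((\<theta> ^^ j) v)) * measure (\<mu> v) (fib E v)"
        using Bochner_Integration.integral_cong[of "\<mu> v" "\<mu> v" "Ssum \<theta> T u n v" "\<lambda>_. \<Sum>j<n. c ((\<theta> ^^ j) v)"] S
        by (simp add: sp[OF v] mult.commute)
      have "svar \<mu> \<theta> T u v n = integral\<^sup>L (\<mu> v) (\<lambda>_. ((\<Sum>j<n. c ((\<theta> ^^ j) v)) - (\<Sum>j<n. c ((\<theta> ^^ j) v)) * measure (\<mu> v) (fib E v))\<^sup>2)"
        unfolding svar_def I by (intro Bochner_Integration.integral_cong refl) (simp add: sp[OF v] S)
      then show ?thesis by (simp add: sp[OF v] algebra_simps)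
    qed
    have nz: "\<not> (\<forall>n. svar \<mu> \<theta> T u v n = 0)" if "v \<in> orbit_set Q0" for v
    proof
      assume "\<forall>n. svar \<mu> \<theta> T u v n = 0"
      then have "(\<lambda>n. 0) \<longlonglongrightarrow> \<sigma>\<^sup>2" using QD0[OF that] by simp
      then show False using \<sigma>(1) LIMSEQ_const_iff[of 0 "\<sigma>\<^sup>2"] by simp
    qed
    \<comment> \<open>The constant c is its own integral, hence c = c * mass; mass 1 would make the
      variance vanish at once, so c = 0 on every fibre and the variance vanishes after all.\<close>
    have "c v = 0" if v: "v \<in> orbit_set Q0" for v
    proof -
      have "c v = c v * measure (\<mu> v) (fib E v)"
        unfolding c_def[of v] using Bochner_Integration.integral_cong[of "\<mu> v" "\<mu> v" "u v" "\<lambda>_. c v"] u_eq[OF v]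
        by (simp add: sp[OF v] c_def mult.commute)
      moreover have "measure (\<mu> v) (fib E v) \<noteq> 1" using nz[OF v] svar_eq[OF v] by auto
      ultimately show ?thesis by auto
    qed
    then have "svar \<mu> \<theta> T u \<omega> n = 0" for n unfolding svar_eq[OF \<omega>] using orb by simp
    then show False using nz[OF \<omega>] by blast
  qed
  then obtain m where m: "measure P (A m) \<noteq> 0" by blast
  have U\<Gamma>_orbit: "AE \<omega> in P. \<forall>n. (U ((\<theta> ^^ n) \<omega>) * \<Gamma> ((\<theta> ^^ n) \<omega>) \<le> W ((\<theta> ^^ n) \<omega>) \<and> 1 \<le> \<Gamma> ((\<theta> ^^ n) \<omega>)) \<and>
     (U ((\<tau> ^^ n) \<omega>) * \<Gamma> ((\<tau> ^^ n) \<omega>) \<le> W ((\<tau> ^^ n) \<omega>) \<and> 1 \<le> \<Gamma> ((\<tau> ^^ n) \<omega>))"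
    by (rule AE_orbit) (use U\<Gamma> step in \<open>eventually_elim, simp add: cone_step_def\<close>)
  have recurrent: "AE \<omega> in P. \<exists>G. infinite {n. \<Gamma> ((\<tau> ^^ n) \<omega>) \<le> G}"
    using infinitely_many_backward_visits[OF erg A m] U\<Gamma>_orbit
  proof eventually_elim
    case (elim \<omega>)
    have "\<Gamma> ((\<tau> ^^ n) \<omega>) \<le> real (Suc m) * real (Suc m)" if "(\<tau> ^^ n) \<omega> \<in> A m" for n
    proof -
      let ?v = "(\<tau> ^^ n) \<omega>"
      have *: "1 / real (Suc m) \<le> U ?v" "W ?v \<le> real (Suc m)" "U ?v * \<Gamma> ?v \<le> W ?v" "1 \<le> \<Gamma> ?v"
        using that elim(2) by (auto simp: A_def)
      have "1 / real (Suc m) * \<Gamma> ?v \<le> U ?v * \<Gamma> ?v" using * by (intro mult_right_mono) auto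
      then have "1 / real (Suc m) * \<Gamma> ?v \<le> real (Suc m)" using * by linarith
      then show ?thesis by (simp add: field_simps)
    qed
    then have "{n. (\<tau> ^^ n) \<omega> \<in> A m} \<subseteq> {n. \<Gamma> ((\<tau> ^^ n) \<omega>) \<le> real (Suc m) * real (Suc m)}" by blast
    then show ?case using elim(1) finite_subset by blast
  qed
  define Q where "Q \<omega> \<longleftrightarrow> holder_space \<alpha> (fib E \<omega>) (u \<omega>) \<and> branched_map (fib E \<omega>) (fib E (\<theta> \<omega>)) (T \<omega>) (\<phi> \<omega>) (I \<omega>) (y \<omega>) (Db \<omega>) \<and>
    good_cone (S \<omega>) (fib E \<omega>) (K \<omega>) \<alpha> \<and> cone_step (S \<omega>) (S (\<theta> \<omega>)) (Lop E T \<phi> \<omega>) (\<Gamma> \<omega>) \<and> U \<omega> \<le> W \<omega> \<and>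
    perturbation_bound (S \<omega>) (S (\<theta> \<omega>)) (Lop E T \<phi> \<omega>) (\<Gamma> \<omega>) (fib E \<omega>) (U \<omega>) (W \<omega>) (ut \<omega>) \<and>
    (\<exists>G. infinite {n. \<Gamma> ((\<tau> ^^ n) \<omega>) \<le> G}) \<and>
    (prob_space (\<nu> \<omega>) \<and> sets (\<nu> \<omega>) = sets (restrict_space borel (fib E \<omega>)) \<and>
        (\<forall>g. holder_space \<alpha> (fib E \<omega>) g \<longrightarrow>
           (\<forall>xs. (\<forall>n. xs n \<in> fib E ((\<theta> ^^ n) \<omega>)) \<longrightarrow>
              (\<lambda>n. Lit E T \<phi> \<theta> n \<omega> g (xs n) / Lit E T \<phi> \<theta> n \<omega> (\<lambda>_. 1) (xs n))
                \<longlonglongrightarrow> integral\<^sup>L (\<nu> \<omega>) g)))" for \<omega>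
  have "AE \<omega> in P. Q \<omega>"
    unfolding Q_def using holder branched cone step UW perturb recurrent conf[unfolded conformal_family_def]
    by (simp only: AE_conj_iff simp_thms)
  then have N: "AE \<omega> in P. \<omega> \<in> orbit_set Q" by (rule AE_orbit_set)
  note QD = iffD1[OF Q_def orbit_setD(1)]
  interpret skew_observable "orbit_set Q" \<theta> \<tau> E T \<phi> \<alpha> I y Db S K \<Gamma> \<nu> ut U W
  proof (intro skew_observable.intro skew_product.intro skew_observable_axioms.intro)
    fix \<omega> assume \<omega>: "\<omega> \<in> orbit_set Q"
    note D = QD[OF \<omega>] and sp = orbit_setD(2)[OF \<omega>]
    show "\<theta> \<omega> \<in> orbit_set Q" "\<tau> \<omega> \<in> orbit_set Q" using \<omega> by (rule orbit_set_\<theta>, rule orbit_set_\<tau>)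
    show "\<theta> (\<tau> \<omega>) = \<omega>" "\<tau> (\<theta> \<omega>) = \<omega>" using sp by (rule \<theta>_\<tau>, rule \<tau>_\<theta>)
    show "branched_map (fib E \<omega>) (fib E (\<theta> \<omega>)) (T \<omega>) (\<phi> \<omega>) (I \<omega>) (y \<omega>) (Db \<omega>)" using D by (elim conjE)
    show "good_cone (S \<omega>) (fib E \<omega>) (K \<omega>) \<alpha>" using D by (elim conjE)
    show "cone_step (S \<omega>) (S (\<theta> \<omega>)) (Lop E T \<phi> \<omega>) (\<Gamma> \<omega>)" using D by (elim conjE)
    show "prob_space (\<nu> \<omega>)" using D by (elim conjE)
    show "sets (\<nu> \<omega>) = sets (restrict_space borel (fib E \<omega>))" using D by (elim conjE)
    show "dist x x' \<le> 1" if "x \<in> fib E \<omega>" "x' \<in> fib E \<omega>" for x x' using diam[OF sp that] .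
    show "\<exists>G. infinite {n. \<Gamma> ((\<tau> ^^ n) \<omega>) \<le> G}" using D by (elim conjE)
    show "holder_space \<alpha> (fib E \<omega>) (ut \<omega>)" using D by (intro holder_ut) (elim conjE)
    show "\<bar>ut \<omega> x\<bar> \<le> U \<omega>" if "x \<in> fib E \<omega>" for x using D by (intro ut_le that) (elim conjE)
    show "U \<omega> \<le> W \<omega>" using D by (elim conjE)
    show "perturbation_bound (S \<omega>) (S (\<theta> \<omega>)) (Lop E T \<phi> \<omega>) (\<Gamma> \<omega>) (fib E \<omega>) (U \<omega>) (W \<omega>) (ut \<omega>)" using D by (elim conjE)
  next
    fix \<omega> g xs assume \<omega>: "\<omega> \<in> orbit_set Q" and g: "holder_space \<alpha> (fib E \<omega>) g" "\<And>n. xs n \<in> fib E ((\<theta> ^^ n) \<omega>)"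
    have "\<forall>g. holder_space \<alpha> (fib E \<omega>) g \<longrightarrow> (\<forall>xs. (\<forall>n. xs n \<in> fib E ((\<theta> ^^ n) \<omega>)) \<longrightarrow>
              (\<lambda>n. Lit E T \<phi> \<theta> n \<omega> g (xs n) / Lit E T \<phi> \<theta> n \<omega> (\<lambda>_. 1) (xs n)) \<longlonglongrightarrow> integral\<^sup>L (\<nu> \<omega>) g)"
      using QD[OF \<omega>] by (elim conjE)
    with g show "(\<lambda>n. Lit E T \<phi> \<theta> n \<omega> g (xs n) / Lit E T \<phi> \<theta> n \<omega> (\<lambda>_. 1) (xs n)) \<longlonglongrightarrow> integral\<^sup>L (\<nu> \<omega>) g" by blast
  qed (use \<alpha> in auto)
  \<comment> \<open>The locale's \<open>hlim\<close> and \<open>mu\<close> unfold literally to the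
    terms behind \<open>gibbs\<close>, \<tau> being \<open>thinv P \<theta>\<close>.\<close>
  have \<mu>_eq: "\<mu> = mu" unfolding \<mu> gibbs_def[abs_def] gh_def mu_def[abs_def] hlim_def hn_def by (rule refl)
  have bmeas_u: "bmeas \<omega> (u \<omega>)" if "\<omega> \<in> orbit_set Q" for \<omega> using QD[OF that] by (intro bmeas_holder that) (elim conjE)
  have centred: "integral\<^sup>L (mu \<omega>) (ut \<omega>) = 0" if \<omega>: "\<omega> \<in> orbit_set Q" for \<omega>
  proof -
    interpret mu: prob_space "mu \<omega>" by (rule prob_space_mu[OF \<omega>])
    have "integrable (mu \<omega>) (u \<omega>)" by (rule bmeas_integrable_mu[OF \<omega> bmeas_u[OF \<omega>]])
    then show ?thesis by (simp add: ut ucent_def[abs_def] \<mu>_eq mu.prob_space)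
  qed
  have svar_eq: "svar \<mu> \<theta> T u \<omega> n = integral\<^sup>L (mu \<omega>) (\<lambda>x. (Ssum \<theta> T ut n \<omega> x)\<^sup>2)" if \<omega>: "\<omega> \<in> orbit_set Q" for \<omega> n
  proof -
    interpret mu: prob_space "mu \<omega>" by (rule prob_space_mu[OF \<omega>])
    define c where "c = (\<Sum>j<n. integral\<^sup>L (\<mu> ((\<theta> ^^ j) \<omega>)) (u ((\<theta> ^^ j) \<omega>)))"
    have S: "Ssum \<theta> T u n \<omega> = (\<lambda>x. Ssum \<theta> T ut n \<omega> x + c)"
      by (simp add: Ssum_def ut ucent_def c_def sum_subtractf fun_eq_iff)
    have "integrable (mu \<omega>) (Ssum \<theta> T ut n \<omega>)" by (rule bmeas_integrable_mu[OF \<omega> bmeas_Ssum[OF \<omega>]])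
    then have "integral\<^sup>L (mu \<omega>) (\<lambda>x. Ssum \<theta> T ut n \<omega> x + c) = c"
      using mean_Ssum[OF \<omega> centred, of n] by (simp add: mu.prob_space)
    then show ?thesis unfolding svar_def \<mu>_eq S by simp
  qed
  show ?thesis
    using N W_growth(1) K_growth(1) \<sigma>(2)
  proof eventually_elim
    case (elim \<omega>)
    obtain CW CK where C: "\<And>j. W ((\<theta> ^^ j) \<omega>) \<le> CW * real (Suc j) powr b" "0 < CW"
      "\<And>j. K ((\<theta> ^^ j) \<omega>) \<le> CK * real (Suc j) powr a" "1 \<le> CK" using elim(2,3) by blast
    have "(\<lambda>n. integral\<^sup>L (mu \<omega>) (\<lambda>x. (Ssum \<theta> T ut n \<omega> x)\<^sup>2) / real n) \<longlonglongrightarrow> \<sigma>\<^sup>2"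
      using elim(4) by (simp add: svar_eq[OF elim(1)])
    from Berry_Esseen_fibre[OF elim(1) centred C(1,2) W_growth(2,3) C(3,4) K_growth(2) this \<sigma>(1)]
    show ?case unfolding svar_eq[OF elim(1)] unfolding \<mu>_eq space_mu[OF elim(1)] .
  qed
qed

section \<open>Settings A and B\<close>

lemma (in invertible_mps) AE_growth_inLp:
  assumes "inLp P p Y" "0 < p"
  shows "AE \<omega> in P. \<exists>C\<ge>1. \<forall>j. Y ((\<theta> ^^ j) \<omega>) \<le> C * real (Suc j) powr (3 / (2 * p))"
proof -
  have "Y \<in> borel_measurable P" "integrable P (\<lambda>\<omega>. \<bar>Y \<omega>\<bar> powr p)" using assms(1) by (auto simp: inLp_def)
  from AE_growth[OF this assms(2)] show ?thesis
  proof eventually_elim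
    case (elim \<omega>)
    then obtain C where C: "0 \<le> C" "\<And>j. \<bar>Y ((\<theta> ^^ j) \<omega>)\<bar> \<le> C * real (Suc j) powr (3 / (2 * p))" by blast
    have "Y ((\<theta> ^^ j) \<omega>) \<le> (C + 1) * real (Suc j) powr (3 / (2 * p))" for j
    proof -
      have "Y ((\<theta> ^^ j) \<omega>) \<le> C * real (Suc j) powr (3 / (2 * p))" by (rule abs_le_D1[OF C(2)])
      also have "\<dots> \<le> (C + 1) * real (Suc j) powr (3 / (2 * p))" by (intro mult_right_mono) auto
      finally show ?thesis .
    qed
    then show ?case using C(1) by (intro exI[of _ "C + 1"]) auto
  qed
qed

text \<open>Centring leaves differences unchanged, so the bound may be checked with the Hoelder
  seminorm of the uncentred observable.\<close>

lemma perturbation_boundI: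
  assumes g: "holder_space \<alpha> X g" "\<And>x. x \<in> X \<Longrightarrow> f x = g x - c"
    and bound: "\<And>r \<psi> p m. 0 \<le> r \<Longrightarrow> r * W \<le> 1/2 \<Longrightarrow> (\<And>x. x \<in> X \<Longrightarrow> \<bar>\<psi> x\<bar> \<le> 2 * r * U) \<Longrightarrow>
      (\<And>x x'. x \<in> X \<Longrightarrow> x' \<in> X \<Longrightarrow> \<bar>\<psi> x - \<psi> x'\<bar> \<le> 2 * r * hvar \<alpha> X g * dist x x' powr \<alpha>) \<Longrightarrow>
      p \<in> fcone S \<Longrightarrow> m \<in> S' \<Longrightarrow> 6 * \<Gamma> * feval m (L (\<lambda>x. \<psi> x * p x)) \<le> feval m (L p)"
  shows "perturbation_bound S S' L \<Gamma> X U W f"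
  unfolding perturbation_bound_def
proof (intro allI impI)
  fix r \<psi> p m
  assume r: "0 \<le> r" "r * W \<le> 1/2" and \<psi>: "\<forall>x\<in>X. \<bar>\<psi> x\<bar> \<le> 2 * r * U"
    "\<forall>x\<in>X. \<forall>x'\<in>X. \<bar>\<psi> x - \<psi> x'\<bar> \<le> 2 * r * \<bar>f x - f x'\<bar>" and p: "p \<in> fcone S" "m \<in> S'"
  show "6 * \<Gamma> * feval m (L (\<lambda>x. \<psi> x * p x)) \<le> feval m (L p)"
  proof (rule bound[OF r _ _ p])
    show "\<bar>\<psi> x\<bar> \<le> 2 * r * U" if "x \<in> X" for x using \<psi>(1) that by blast
    show "\<bar>\<psi> x - \<psi> x'\<bar> \<le> 2 * r * hvar \<alpha> X g * dist x x' powr \<alpha>" if x: "x \<in> X" "x' \<in> X" for x x'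
    proof -
      have "\<bar>\<psi> x - \<psi> x'\<bar> \<le> 2 * r * \<bar>g x - g x'\<bar>" using \<psi>(2) x g(2) by fastforce
      also have "\<dots> \<le> 2 * r * (hvar \<alpha> X g * dist x x' powr \<alpha>)" using r by (intro mult_left_mono hvar_le(1)[OF g(1) x]) auto
      finally show ?thesis by (simp add: mult.assoc)
    qed
  qed
qed

section \<open>Consequences of the standing setup\<close>

lemma standing_invertible_mps: "standing_setup P \<theta> X E T \<phi> \<alpha> \<Longrightarrow> invertible_mps P \<theta>"
  by (simp add: standing_setup_def invertible_mps_def invertible_mps_axioms_def)

lemma standing_dist_le_1:
  assumes "standing_setup P \<theta> X E T \<phi> \<alpha>" "x \<in> fib E \<omega>" "x' \<in> fib E \<omega>"
  shows "dist x x' \<le> 1"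
proof -
  have X: "compact X" "diameter X \<le> 1" "E \<subseteq> space P \<times> X" using assms(1) by (auto simp: standing_setup_def)
  then have "x \<in> X" "x' \<in> X" using assms(2,3) by (auto simp: fib_def)
  then show ?thesis using diameter_bounded_bound[OF compact_imp_bounded[OF X(1)], of x x'] X(2) by linarith
qed

lemma standing_T_measurable:
  assumes st: "standing_setup P \<theta> X E T \<phi> \<alpha>" and \<omega>: "\<omega> \<in> space P"
  shows "T \<omega> \<in> measurable (restrict_space borel (fib E \<omega>)) (restrict_space borel (fib E (\<theta> \<omega>)))"
proof (rule measurable_restrict_space2)
  show "T \<omega> \<in> space (restrict_space borel (fib E \<omega>)) \<rightarrow> fib E (\<theta> \<omega>)"
    using st \<omega> by (auto simp: standing_setup_def space_restrict_space)
  have Tm: "(\<lambda>(\<omega>, x). T \<omega> x) \<in> borel_measurable (restrict_space (P \<Otimes>\<^sub>M borel) E)"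
    using st by (auto simp: standing_setup_def)
  have "(\<lambda>x. (\<omega>, x)) \<in> measurable (restrict_space borel (fib E \<omega>)) (restrict_space (P \<Otimes>\<^sub>M borel) E)"
  proof (rule measurable_restrict_space2)
    show "(\<lambda>x. (\<omega>, x)) \<in> space (restrict_space borel (fib E \<omega>)) \<rightarrow> E" by (auto simp: fib_def space_restrict_space)
    show "(\<lambda>x. (\<omega>, x)) \<in> measurable (restrict_space borel (fib E \<omega>)) (P \<Otimes>\<^sub>M borel)"
      by (rule measurable_restrict_space1) (use \<omega> in measurable)
  qed
  from measurable_compose[OF this Tm] show "T \<omega> \<in> borel_measurable (restrict_space borel (fib E \<omega>))" by simp
qed

lemma conformal_family_fib_nonempty:
  assumes "conformal_family P \<theta> E T \<phi> \<alpha> \<nu>"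
  shows "AE \<omega> in P. fib E \<omega> \<noteq> {}"
  using assms unfolding conformal_family_def
proof eventually_elim
  case (elim \<omega>)
  interpret prob_space "\<nu> \<omega>" using elim by blast
  have "space (\<nu> \<omega>) = fib E \<omega>" using elim sets_eq_imp_space_eq[of "\<nu> \<omega>" "restrict_space borel (fib E \<omega>)"] by (simp add: space_restrict_space)
  then show ?case using not_empty by simp
qed

text \<open>Links a cross-ratio constant R exp t to the cosh in E: with D = t + 2 ln R one has R exp
  t \<le> exp (7 D / 2) \<le> 2 cosh (7 D / 2).\<close>

lemma exp_ln_cosh_bound:
  fixes R :: real
  assumes "1 \<le> R" "0 \<le> t"
  shows "R * exp t \<le> 2 * (1 + cosh (7 * (t + 2 * ln R) / 2))"
proof -
  let ?D = "7 * (t + 2 * ln R) / 2"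
  have "0 \<le> ln R" using assms(1) by simp
  then have "ln R + t \<le> ?D" using assms(2) by (simp add: field_simps)
  then have "exp (ln R + t) \<le> exp ?D" by simp
  moreover have "exp ?D \<le> 2 * cosh ?D" by (simp add: cosh_def)
  moreover have "exp (ln R + t) = R * exp t" using assms by (simp add: exp_add)
  ultimately show ?thesis by simp
qed

text \<open>Since H + 1 = q \<gamma>^\<alpha> \<le> \<gamma>^\<alpha>, with \<gamma> taken at
  \<open>\<theta> \<omega>\<close>, twice the hyperbolic factor of E dominates \<Gamma>, and c0
  dominates size and scaled oscillation of the observable. So \<open>c0 * \<Gamma>\<close> is
  essentially bounded and the radius constant, which is the case b = 0.\<close>

lemma Berry_Esseen_setting_A:
  fixes P :: "'w measure" and E :: "('w \<times> 'x::metric_space) set"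
  assumes standing: "standing_setup P \<theta> X E T \<phi> \<alpha>" and conf: "conformal_family P \<theta> E T \<phi> \<alpha> \<nu>"
    and obs: "observable P E \<alpha> u" and A: "setting_A P \<theta> E T \<phi> \<alpha> I y \<gamma> H D"
    and Eb: "AE \<omega> in P. qA \<theta> \<alpha> \<gamma> H \<omega> < 1 \<and> HtA E \<alpha> u \<gamma> H \<omega> < \<gamma> (\<theta> \<omega>) powr \<alpha> - 1 \<and>
      Equant (c0A \<theta> E \<alpha> u (ucent (gibbs P \<nu> E T \<phi> \<theta>) u) \<gamma> H) (DA \<theta> \<alpha> \<gamma> H) \<omega> \<le> Eb"
    and K: "inLp P p (KA \<alpha> \<gamma>)"
    and U: "inLp P p (\<lambda>\<omega>. supabs (fib E \<omega>) (ucent (gibbs P \<nu> E T \<phi> \<theta>) u \<omega>))"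
    and p: "0 < p" and \<sigma>: "0 < \<sigma>"
    and var: "AE \<omega> in P. (\<lambda>n. svar (gibbs P \<nu> E T \<phi> \<theta>) \<theta> T u \<omega> n / real n) \<longlonglongrightarrow> \<sigma>\<^sup>2"
  shows "AE \<omega> in P. \<exists>C. \<forall>n\<ge>1. \<forall>t. \<bar>measure (gibbs P \<nu> E T \<phi> \<theta> \<omega>)
      {x \<in> fib E \<omega>. Ssum \<theta> T (ucent (gibbs P \<nu> E T \<phi> \<theta>) u) n \<omega> x \<le> t * sqrt (svar (gibbs P \<nu> E T \<phi> \<theta>) \<theta> T u \<omega> n)} - Phi t\<bar>
      \<le> C * real n powr (- (1/2 - 8/p))"
proof -
  interpret invertible_mps P \<theta> by (rule standing_invertible_mps[OF standing])
  define ut where "ut = ucent (gibbs P \<nu> E T \<phi> \<theta>) u"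
  define Ub where "Ub = (\<lambda>\<omega>. supabs (fib E \<omega>) (ut \<omega>))"
  define S where "S \<omega> = SA (\<gamma> \<omega> powr \<alpha>) (fib E \<omega>) \<alpha>" for \<omega>
  define qq where "qq = qA \<theta> \<alpha> \<gamma> H"
  define \<Gamma> where "\<Gamma> \<omega> = (1 + qq \<omega>) / (1 - qq \<omega>) * exp (H \<omega> + 1)" for \<omega>
  \<comment> \<open>6 from the tolerance, 2 from the Lipschitz constant of exp and 2 from
    \<open>c0 * \<Gamma> \<le> 2 * Eb\<close> multiply to 24.\<close>
  define W where "W = (\<lambda>\<omega>::'w. 24 * Eb)"
  have \<alpha>: "0 < \<alpha>" "\<alpha> \<le> 1" and compact: "\<And>\<omega>. \<omega> \<in> space P \<Longrightarrow> compact (fib E \<omega>)" and erg: "ergodic P \<theta>"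
    using standing by (auto simp: standing_setup_def)
  note diam = standing_dist_le_1[OF standing]
  have holder: "AE \<omega> in P. holder_space \<alpha> (fib E \<omega>) (u \<omega>)" using obs by (simp add: observable_def)
  define R0 where "R0 \<omega> \<longleftrightarrow> \<omega> \<in> space P \<and> fib E \<omega> \<noteq> {} \<and> 1 < \<gamma> \<omega>" for \<omega>
  define R where "R \<omega> \<longleftrightarrow> R0 \<omega> \<and> R0 (\<theta> \<omega>) \<and> H \<omega> \<ge> 0 \<and> holder_space \<alpha> (fib E \<omega>) (u \<omega>) \<and>
        (\<forall>x\<in>fib E (\<theta> \<omega>). bij_betw (\<lambda>i. y \<omega> i x) (I \<omega>) {z \<in> fib E \<omega>. T \<omega> z = x}) \<and>
        (\<forall>x\<in>fib E (\<theta> \<omega>). \<forall>x'\<in>fib E (\<theta> \<omega>). \<forall>i\<in>I \<omega>.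
            dist (y \<omega> i x) (y \<omega> i x') \<le> dist x x' / \<gamma> \<omega> \<and>
            \<bar>\<phi> \<omega> (y \<omega> i x) - \<phi> \<omega> (y \<omega> i x')\<bar> \<le> H \<omega> * dist x x' powr \<alpha>) \<and>
        (\<forall>x\<in>fib E (\<theta> \<omega>). (\<lambda>z. exp (\<phi> \<omega> z)) summable_on {z \<in> fib E \<omega>. T \<omega> z = x} \<and>
            (\<Sum>\<^sub>\<infinity>z\<in>{z \<in> fib E \<omega>. T \<omega> z = x}. exp (\<phi> \<omega> z)) \<le> D \<omega>) \<and>
        qq \<omega> < 1 \<and> HtA E \<alpha> u \<gamma> H \<omega> < \<gamma> (\<theta> \<omega>) powr \<alpha> - 1 \<and>
        Equant (c0A \<theta> E \<alpha> u ut \<gamma> H) (DA \<theta> \<alpha> \<gamma> H) \<omega> \<le> Eb" for \<omega>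
  have "AE \<omega> in P. R0 \<omega>"
    using AE_space conformal_family_fib_nonempty[OF conf] conjunct2[OF conjunct2[OF conjunct2[OF A[unfolded setting_A_def]]]]
    unfolding R0_def by eventually_elim blast
  from AE_shift[OF this] have R0: "AE \<omega> in P. R0 \<omega> \<and> R0 (\<theta> \<omega>)" .
  have R: "AE \<omega> in P. R \<omega>"
    using R0 holder conjunct2[OF conjunct2[OF conjunct2[OF A[unfolded setting_A_def]]]] Eb[folded ut_def]
    unfolding R_def qq_def by eventually_elim blast
  have branched: "branched_map (fib E \<omega>) (fib E (\<theta> \<omega>)) (T \<omega>) (\<phi> \<omega>) (I \<omega>) (y \<omega>) (D \<omega>)" if \<omega>: "R \<omega>" for \<omega>
  proof
    show "compact (fib E \<omega>)" "compact (fib E (\<theta> \<omega>))" "fib E (\<theta> \<omega>) \<noteq> {}" using \<omega> by (auto simp: R_def R0_def intro: compact)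
    show "T \<omega> \<in> measurable (restrict_space borel (fib E \<omega>)) (restrict_space borel (fib E (\<theta> \<omega>)))"
      using \<omega> by (intro standing_T_measurable[OF standing]) (auto simp: R_def R0_def)
    show "continuous_on (fib E (\<theta> \<omega>)) (y \<omega> i)" if "i \<in> I \<omega>" for i
      by (rule continuous_on_Holder[of 1 _ _ "1 / \<gamma> \<omega>"]) (use \<omega> that in \<open>auto simp: R_def\<close>)
    show "continuous_on (fib E (\<theta> \<omega>)) (\<lambda>x. \<phi> \<omega> (y \<omega> i x))" if "i \<in> I \<omega>" for i
      by (rule continuous_on_Holder[OF \<alpha>(1), of _ _ "H \<omega>"]) (use \<omega> that in \<open>auto simp: R_def dist_real_def\<close>)
  qed (use \<omega> in \<open>auto simp: R_def\<close>)
  have q: "qq \<omega> * \<gamma> (\<theta> \<omega>) powr \<alpha> = H \<omega> + 1" if "R \<omega>" for \<omega>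
    using that by (simp add: qq_def qA_def R_def R0_def powr_minus field_simps)
  have q0: "0 \<le> qq \<omega>" if "R \<omega>" for \<omega> using that by (simp add: qq_def qA_def R_def)
  have step: "cone_step (S \<omega>) (S (\<theta> \<omega>)) (Lop E T \<phi> \<omega>) (\<Gamma> \<omega>)"
    and pert: "\<And>\<psi> p m A B. (\<And>x. x \<in> fib E \<omega> \<Longrightarrow> \<bar>\<psi> x\<bar> \<le> A) \<Longrightarrow> 0 \<le> B \<Longrightarrow>
      (\<And>x x'. x \<in> fib E \<omega> \<Longrightarrow> x' \<in> fib E \<omega> \<Longrightarrow> \<bar>\<psi> x - \<psi> x'\<bar> \<le> B * dist x x' powr \<alpha>) \<Longrightarrow>
      p \<in> fcone (S \<omega>) \<Longrightarrow> m \<in> S (\<theta> \<omega>) \<Longrightarrow>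
      feval m (Lop E T \<phi> \<omega> (\<lambda>x. \<psi> x * p x)) \<le> (A + \<gamma> \<omega> powr (- \<alpha>) * B / (\<gamma> (\<theta> \<omega>) powr \<alpha> - 1 - H \<omega>)) * feval m (Lop E T \<phi> \<omega> p)"
    if \<omega>: "R \<omega>" for \<omega>
  proof -
    interpret branched_map "fib E \<omega>" "fib E (\<theta> \<omega>)" "T \<omega>" "\<phi> \<omega>" "I \<omega>" "y \<omega>" "D \<omega>" by (rule branched[OF \<omega>])
    have \<gamma>: "1 < \<gamma> \<omega>" "1 < \<gamma> (\<theta> \<omega>)" and H: "0 \<le> H \<omega>" and q1: "qq \<omega> < 1" and ne: "fib E \<omega> \<noteq> {}" using \<omega> by (auto simp: R_def R0_def)
    have contr: "dist (y \<omega> i x) (y \<omega> i x') \<le> dist x x' / \<gamma> \<omega>" and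
      osc: "\<bar>\<phi> \<omega> (y \<omega> i x) - \<phi> \<omega> (y \<omega> i x')\<bar> \<le> H \<omega> * dist x x' powr \<alpha>"
      if "x \<in> fib E (\<theta> \<omega>)" "x' \<in> fib E (\<theta> \<omega>)" "i \<in> I \<omega>" for x x' i using \<omega> that by (auto simp: R_def)
    show "cone_step (S \<omega>) (S (\<theta> \<omega>)) (Lop E T \<phi> \<omega>) (\<Gamma> \<omega>)"
      unfolding Lop_eq_transfer S_def \<Gamma>_def
      by (rule SA_cone_step(1)[OF \<gamma> \<alpha>(1) H _ _ q[OF \<omega>] q1 ne]) (blast intro: contr osc diam)+
    show "feval m (Lop E T \<phi> \<omega> (\<lambda>x. \<psi> x * p x)) \<le> (A + \<gamma> \<omega> powr (- \<alpha>) * B / (\<gamma> (\<theta> \<omega>) powr \<alpha> - 1 - H \<omega>)) * feval m (Lop E T \<phi> \<omega> p)"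
      if "\<And>x. x \<in> fib E \<omega> \<Longrightarrow> \<bar>\<psi> x\<bar> \<le> A" "0 \<le> B" "\<And>x x'. x \<in> fib E \<omega> \<Longrightarrow> x' \<in> fib E \<omega> \<Longrightarrow> \<bar>\<psi> x - \<psi> x'\<bar> \<le> B * dist x x' powr \<alpha>"
      "p \<in> fcone (S \<omega>)" "m \<in> S (\<theta> \<omega>)" for \<psi> p m A B
      unfolding Lop_eq_transfer
      by (rule SA_cone_step(2)[OF \<gamma> \<alpha>(1) H _ _ q[OF \<omega>] q1 ne]) (blast intro: contr osc diam that[unfolded S_def])+
  qed
  define c0 where "c0 = c0A \<theta> E \<alpha> u ut \<gamma> H"
  define V where "V \<omega> = hvar \<alpha> (fib E \<omega>) (u \<omega>)" for \<omega>
  have V0: "0 \<le> V \<omega>" if "R \<omega>" for \<omega>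
    using that hvar_le(2)[of \<alpha> "fib E \<omega>" "u \<omega>"] by (auto simp: R_def R0_def V_def)
  have holder_ut: "holder_space \<alpha> (fib E \<omega>) (ut \<omega>)" if "R \<omega>" for \<omega>
    unfolding ut_def by (rule holder_space_ucent) (use that in \<open>simp add: R_def\<close>)
  have Ub: "0 \<le> Ub \<omega>" if "R \<omega>" for \<omega>
    unfolding Ub_def using supabs_ge(2)[of "ut \<omega>" "fib E \<omega>"] holder_ut[OF that] by (simp add: holder_space_def)
  have c0_ge: "3 * Ub \<omega> \<le> c0 \<omega>" "Ub \<omega> + \<gamma> \<omega> powr (- \<alpha>) * V \<omega> / (\<gamma> (\<theta> \<omega>) powr \<alpha> - 1 - H \<omega>) \<le> c0 \<omega>" if \<omega>: "R \<omega>" for \<omega>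
  proof -
    let ?Ht = "HtA E \<alpha> u \<gamma> H \<omega>" and ?Q = "\<gamma> (\<theta> \<omega>) powr \<alpha>"
    have Ht: "?Ht < ?Q - 1" "\<gamma> \<omega> powr (- \<alpha>) * V \<omega> \<le> ?Ht" "H \<omega> \<le> ?Ht" "0 \<le> ?Ht"
      using \<omega> V0[OF \<omega>] by (auto simp: R_def HtA_def V_def)
    \<comment> \<open>The scaled seminorm and H are the two summands of \<open>HtA\<close>;
      replacing each by the sum enlarges the numerator and shrinks the denominator.\<close>
    have 1: "\<gamma> \<omega> powr (- \<alpha>) * V \<omega> / (?Q - 1 - H \<omega>) \<le> ?Ht / (?Q - 1 - ?Ht)"
      using Ht by (intro frac_le) auto
    have 2: "0 \<le> ?Ht / (?Q - 1 - ?Ht)" using Ht by simp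
    have c: "c0 \<omega> = 3 * Ub \<omega> + ?Ht / (?Q - 1 - ?Ht)" by (simp add: c0_def c0A_def Ub_def)
    show "3 * Ub \<omega> \<le> c0 \<omega>" "Ub \<omega> + \<gamma> \<omega> powr (- \<alpha>) * V \<omega> / (?Q - 1 - H \<omega>) \<le> c0 \<omega>"
      using 1 2 Ub[OF \<omega>] unfolding c by linarith+
  qed
  have \<Gamma>1: "1 \<le> \<Gamma> \<omega>" if "R \<omega>" for \<omega> using step[OF that] by (simp add: cone_step_def)
  have c0\<Gamma>: "c0 \<omega> * \<Gamma> \<omega> \<le> 2 * Eb" if \<omega>: "R \<omega>" for \<omega>
  proof -
    let ?r = "(1 + qq \<omega>) / (1 - qq \<omega>)"
    have r1: "1 \<le> ?r" using q0[OF \<omega>] \<omega> by (simp add: R_def field_simps)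
    have "\<Gamma> \<omega> \<le> ?r * exp (\<gamma> (\<theta> \<omega>) powr \<alpha>)"
    proof -
      have "qq \<omega> * \<gamma> (\<theta> \<omega>) powr \<alpha> \<le> 1 * \<gamma> (\<theta> \<omega>) powr \<alpha>" using \<omega> by (intro mult_right_mono) (auto simp: R_def)
      then have "exp (H \<omega> + 1) \<le> exp (\<gamma> (\<theta> \<omega>) powr \<alpha>)" unfolding q[OF \<omega>, symmetric] by simp
      then show ?thesis unfolding \<Gamma>_def using r1 by (intro mult_left_mono) auto
    qed
    also have "\<dots> \<le> 2 * (1 + cosh (7 * DA \<theta> \<alpha> \<gamma> H \<omega> / 2))"
      unfolding DA_def qq_def[symmetric] by (rule exp_ln_cosh_bound[OF r1]) simp
    finally have "\<Gamma> \<omega> \<le> 2 * (1 + cosh (7 * DA \<theta> \<alpha> \<gamma> H \<omega> / 2))" .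
    then have "c0 \<omega> * \<Gamma> \<omega> \<le> c0 \<omega> * (2 * (1 + cosh (7 * DA \<theta> \<alpha> \<gamma> H \<omega> / 2)))"
      using c0_ge(1)[OF \<omega>] Ub[OF \<omega>] by (intro mult_left_mono) auto
    also have "\<dots> = 2 * Equant c0 (DA \<theta> \<alpha> \<gamma> H) \<omega>" by (simp add: Equant_def)
    also have "\<dots> \<le> 2 * Eb" using \<omega> by (simp add: R_def c0_def)
    finally show ?thesis .
  qed
  have U\<Gamma>: "Ub \<omega> * \<Gamma> \<omega> \<le> W \<omega>" and UW: "Ub \<omega> \<le> W \<omega>" if \<omega>: "R \<omega>" for \<omega>
  proof -
    have "3 * (Ub \<omega> * \<Gamma> \<omega>) \<le> c0 \<omega> * \<Gamma> \<omega>" using mult_right_mono[OF c0_ge(1)[OF \<omega>], of "\<Gamma> \<omega>"] \<Gamma>1[OF \<omega>] by simp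
    moreover have "Ub \<omega> * 1 \<le> Ub \<omega> * \<Gamma> \<omega>" using Ub[OF \<omega>] \<Gamma>1[OF \<omega>] by (intro mult_left_mono)
    ultimately show "Ub \<omega> * \<Gamma> \<omega> \<le> W \<omega>" "Ub \<omega> \<le> W \<omega>" using c0\<Gamma>[OF \<omega>] Ub[OF \<omega>] unfolding W_def by argo+
  qed
  have perturb: "perturbation_bound (S \<omega>) (S (\<theta> \<omega>)) (Lop E T \<phi> \<omega>) (\<Gamma> \<omega>) (fib E \<omega>) (Ub \<omega>) (W \<omega>) (ut \<omega>)" if \<omega>: "R \<omega>" for \<omega>
  proof (rule perturbation_boundI[where c="integral\<^sup>L (gibbs P \<nu> E T \<phi> \<theta> \<omega>) (u \<omega>)"])
    show "holder_space \<alpha> (fib E \<omega>) (u \<omega>)" using \<omega> by (simp add: R_def)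
    show "ut \<omega> x = u \<omega> x - integral\<^sup>L (gibbs P \<nu> E T \<phi> \<theta> \<omega>) (u \<omega>)" for x by (simp add: ut_def ucent_def)
    fix r \<psi> p m
    assume r: "0 \<le> r" "r * W \<omega> \<le> 1/2" and p: "p \<in> fcone (S \<omega>)" "m \<in> S (\<theta> \<omega>)"
      and \<psi>: "\<And>x. x \<in> fib E \<omega> \<Longrightarrow> \<bar>\<psi> x\<bar> \<le> 2 * r * Ub \<omega>"
        "\<And>x x'. x \<in> fib E \<omega> \<Longrightarrow> x' \<in> fib E \<omega> \<Longrightarrow> \<bar>\<psi> x - \<psi> x'\<bar> \<le> 2 * r * hvar \<alpha> (fib E \<omega>) (u \<omega>) * dist x x' powr \<alpha>"
    let ?L = "feval m (Lop E T \<phi> \<omega> p)"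
    have L0: "0 \<le> ?L" using step[OF \<omega>] p unfolding cone_step_def by (auto intro: fconeD)
    have "feval m (Lop E T \<phi> \<omega> (\<lambda>x. \<psi> x * p x)) \<le>
        (2 * r * Ub \<omega> + \<gamma> \<omega> powr (- \<alpha>) * (2 * r * V \<omega>) / (\<gamma> (\<theta> \<omega>) powr \<alpha> - 1 - H \<omega>)) * ?L"
      using r V0[OF \<omega>] by (intro pert[OF \<omega> _ _ _ p]) (auto intro: \<psi> simp: V_def)
    also have "\<dots> = 2 * r * (Ub \<omega> + \<gamma> \<omega> powr (- \<alpha>) * V \<omega> / (\<gamma> (\<theta> \<omega>) powr \<alpha> - 1 - H \<omega>)) * ?L"
      by (simp add: algebra_simps)
    also have "\<dots> \<le> 2 * r * c0 \<omega> * ?L" using c0_ge(2)[OF \<omega>] r L0 by (intro mult_right_mono mult_left_mono) auto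
    finally have "6 * \<Gamma> \<omega> * feval m (Lop E T \<phi> \<omega> (\<lambda>x. \<psi> x * p x)) \<le> 6 * \<Gamma> \<omega> * (2 * r * c0 \<omega> * ?L)"
      using \<Gamma>1[OF \<omega>] by (intro mult_left_mono) auto
    also have "\<dots> = 12 * r * (c0 \<omega> * \<Gamma> \<omega>) * ?L" by simp
    also have "\<dots> \<le> 12 * r * (2 * Eb) * ?L" using c0\<Gamma>[OF \<omega>] r L0 by (intro mult_right_mono mult_left_mono) auto
    also have "\<dots> = r * W \<omega> * ?L" by (simp add: W_def)
    also have "\<dots> \<le> 1 * ?L" using r L0 by (intro mult_right_mono) auto
    finally show "6 * \<Gamma> \<omega> * feval m (Lop E T \<phi> \<omega> (\<lambda>x. \<psi> x * p x)) \<le> ?L" by simp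
  qed
  have good: "good_cone (S \<omega>) (fib E \<omega>) (KA \<alpha> \<gamma> \<omega>) \<alpha>" if "R \<omega>" for \<omega>
    unfolding S_def by (rule good_cone_SA[OF _ _ \<alpha>(1) _ diam]) (use that in \<open>auto simp: R_def R0_def KA_def\<close>)
  show ?thesis unfolding ut_def[symmetric]
  proof (rule skew_product_Berry_Esseen[where \<mu>="gibbs P \<nu> E T \<phi> \<theta>" and ut=ut and U=Ub and S=S and K="KA \<alpha> \<gamma>" and \<Gamma>=\<Gamma> and W=W
        and b=0 and a="3 / (2 * p)"])
    show "Ub \<in> borel_measurable P" using U by (simp add: inLp_def Ub_def ut_def)
    show "W \<in> borel_measurable P" by (simp add: W_def)
    show "AE \<omega> in P. \<exists>C>0. \<forall>j. W ((\<theta> ^^ j) \<omega>) \<le> C * real (Suc j) powr 0"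
      by (intro AE_I2 exI[of _ "\<bar>24 * Eb\<bar> + 1"]) (simp add: W_def, argo)
    show "AE \<omega> in P. \<exists>C\<ge>1. \<forall>j. KA \<alpha> \<gamma> ((\<theta> ^^ j) \<omega>) \<le> C * real (Suc j) powr (3 / (2 * p))"
      by (rule AE_growth_inLp[OF K p])
    show "AE \<omega> in P. branched_map (fib E \<omega>) (fib E (\<theta> \<omega>)) (T \<omega>) (\<phi> \<omega>) (I \<omega>) (y \<omega>) (D \<omega>)"
      using R by eventually_elim (rule branched)
    show "AE \<omega> in P. good_cone (S \<omega>) (fib E \<omega>) (KA \<alpha> \<gamma> \<omega>) \<alpha>" using R by eventually_elim (rule good)
    show "AE \<omega> in P. cone_step (S \<omega>) (S (\<theta> \<omega>)) (Lop E T \<phi> \<omega>) (\<Gamma> \<omega>)" using R by eventually_elim (rule step)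
    show "AE \<omega> in P. Ub \<omega> \<le> W \<omega>" using R by eventually_elim (rule UW)
    show "AE \<omega> in P. Ub \<omega> * \<Gamma> \<omega> \<le> W \<omega>" using R by eventually_elim (rule U\<Gamma>)
    show "AE \<omega> in P. perturbation_bound (S \<omega>) (S (\<theta> \<omega>)) (Lop E T \<phi> \<omega>) (\<Gamma> \<omega>) (fib E \<omega>) (Ub \<omega>) (W \<omega>) (ut \<omega>)" using R by eventually_elim (rule perturb)
  qed (use ut_def Ub_def erg \<alpha> diam conf holder \<sigma> var p in auto)
qed

text \<open>Two regimes. For \<zeta> \<le> 1/2 the denominator is harmless and exp U (1 + V) already
  bounds U + V. For \<zeta> > 1/2 the factors of c0 that majorise \<zeta> are at least 1/2, and the
  cosh supplies the second factor 1 / (1 - \<zeta>), so E itself dominates the quotient.\<close>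

lemma setting_B_constant_bound:
  fixes U V s s' H \<epsilon> F \<zeta> :: real
  assumes s: "0 < s" "0 < s'" and UV: "0 \<le> U" "0 \<le> V" "0 \<le> H" "0 \<le> F" and \<epsilon>: "\<epsilon> \<le> 2 * F"
    and \<zeta>: "\<zeta> = s' * (1 + (1 + 1 / s) * exp \<epsilon> * H)" "\<zeta> < 1"
    and Db: "exp U * (1 + V) \<le> Db"
    and Eb: "32 * s' * (1 + 2 / s) * exp (U + 2 * F) * (U + V) * (1 + H) / (1 - \<zeta>)
      * (1 + cosh (7 * (2 * ln ((1 + \<zeta>) / (1 - \<zeta>)) + 2 * ln (1 + \<zeta> / s)) / 2)) \<le> Eb" (is "?c0 * ?ch \<le> Eb")
  shows "(U + V) / (1 - \<zeta>)\<^sup>2 \<le> 4 * Db + Eb"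
proof -
  have \<zeta>0: "0 \<le> \<zeta>" using s UV by (simp add: \<zeta>(1))
  have c0: "0 \<le> ?c0" using s UV \<zeta>(2) by simp
  have ch: "0 \<le> ?ch" using cosh_real_pos[of "7 * (2 * ln ((1 + \<zeta>) / (1 - \<zeta>)) + 2 * ln (1 + \<zeta> / s)) / 2"] by linarith
  have Eb0: "0 \<le> Eb" using mult_nonneg_nonneg[OF c0 ch] Eb by linarith
  have "(1 + U) * (1 + V) \<le> exp U * (1 + V)" using UV by (intro mult_right_mono exp_ge_add_one_self) auto
  then have UVD: "U + V \<le> Db" using Db mult_nonneg_nonneg[OF UV(1,2)] by (simp add: algebra_simps)
  show ?thesis
  proof (cases "\<zeta> \<le> 1/2")
    case True
    have "(1/2)\<^sup>2 \<le> (1 - \<zeta>)\<^sup>2" using True by (intro power_mono) auto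
    then have "(U + V) / (1 - \<zeta>)\<^sup>2 \<le> (U + V) / (1/2)\<^sup>2" using UV \<zeta>(2) by (intro divide_left_mono) auto
    also have "\<dots> = 4 * (U + V)" by (simp add: power2_eq_square)
    also have "\<dots> \<le> 4 * Db + Eb" using UVD Eb0 by argo
    finally show ?thesis .
  next
    case False
    \<comment> \<open>These are the factors of c0; they majorise \<zeta> one by one, exp \<epsilon>
      being at most exp (U + 2 F).\<close>
    have sk: "\<zeta> \<le> s' * ((1 + 2 / s) * exp (U + 2 * F) * (1 + H))"
    proof -
      let ?e = "exp (U + 2 * F)"
      have e: "1 \<le> ?e" "exp \<epsilon> \<le> ?e" using UV \<epsilon> by auto
      have "(1 + 1 / s) * exp \<epsilon> * H \<le> (1 + 2 / s) * ?e * H"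
        using s UV e by (intro mult_right_mono mult_mono) (auto simp: divide_right_mono)
      moreover have "1 * 1 \<le> (1 + 2 / s) * ?e" using s e by (intro mult_mono) auto
      ultimately have "1 + (1 + 1 / s) * exp \<epsilon> * H \<le> (1 + 2 / s) * ?e * (1 + H)"
        unfolding distrib_left[of "(1 + 2 / s) * ?e"] by linarith
      then show ?thesis unfolding \<zeta>(1) using s by (intro mult_left_mono) auto
    qed
    have c0': "16 * (U + V) / (1 - \<zeta>) \<le> ?c0"
    proof -
      have "1/2 \<le> s' * ((1 + 2 / s) * exp (U + 2 * F) * (1 + H))" using sk False by linarith
      then have "32 * (U + V) / (1 - \<zeta>) * (1/2) \<le> 32 * (U + V) / (1 - \<zeta>) * (s' * ((1 + 2 / s) * exp (U + 2 * F) * (1 + H)))"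
        using UV \<zeta>(2) by (intro mult_left_mono) auto
      moreover have "?c0 = 32 * (U + V) / (1 - \<zeta>) * (s' * ((1 + 2 / s) * exp (U + 2 * F) * (1 + H)))"
        by (simp only: times_divide_eq_left times_divide_eq_right mult_ac)
      moreover have "32 * A / B * (1/2) = 16 * A / B" for A B :: real by (cases "B = 0") (simp_all add: field_simps)
      ultimately show ?thesis by (simp only:)
    qed
    have ch': "1 / (2 * (1 - \<zeta>)) \<le> ?ch"
    proof -
      let ?R = "(1 + \<zeta>) / (1 - \<zeta>)"
      have R: "1 \<le> ?R" using \<zeta>0 \<zeta>(2) by (simp add: field_simps)
      have l: "0 \<le> 2 * ln (1 + \<zeta> / s)" using \<zeta>0 s by simp
      have "1 / (1 - \<zeta>) \<le> ?R" using \<zeta>0 \<zeta>(2) by (intro divide_right_mono) auto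
      also have "\<dots> \<le> ?R * exp (2 * ln (1 + \<zeta> / s))" using mult_left_mono[of 1 "exp (2 * ln (1 + \<zeta> / s))" ?R] l R by simp
      also have "\<dots> \<le> 2 * ?ch" using exp_ln_cosh_bound[OF R l] by (simp only: add.commute)
      finally have "1 / (1 - \<zeta>) / 2 \<le> 2 * ?ch / 2" by (intro divide_right_mono) auto
      then show ?thesis by (simp add: mult.commute)
    qed
    have "0 \<le> (U + V) / (1 - \<zeta>)\<^sup>2" using UV by simp
    then have "(U + V) / (1 - \<zeta>)\<^sup>2 \<le> 8 * ((U + V) / (1 - \<zeta>)\<^sup>2)" by argo
    also have "\<dots> = 16 * (U + V) / (1 - \<zeta>) * (1 / (2 * (1 - \<zeta>)))"
    proof -
      have "8 * (A / B\<^sup>2) = 16 * A / B * (1 / (2 * B))" for A B :: real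
        by (cases "B = 0") (simp_all add: power2_eq_square field_simps)
      then show ?thesis .
    qed
    also have "\<dots> \<le> ?c0 * ?ch" using c0' ch' c0 \<zeta>(2) by (intro mult_mono) auto
    also have "\<dots> \<le> 4 * Db + Eb" using Eb UVD UV by argo
    finally show ?thesis .
  qed
qed

text \<open>Bounding \<zeta> by 1 in the summand \<zeta> / s (\<theta> \<omega>) of \<Gamma> leaves
  1 / s (\<theta> \<omega>), which integrability of K controls along the orbit, while
  \<open>Db\<close> and the bound on E control (U + V) / (1 - \<zeta>)^2. The radius may therefore
  shrink, but at most polynomially.\<close>

lemma Berry_Esseen_setting_B:
  fixes P :: "'w measure" and E :: "('w \<times> 'x::metric_space) set" and l sg :: "'w \<Rightarrow> real" and q d :: "'w \<Rightarrow> nat"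
  assumes standing: "standing_setup P \<theta> X E T \<phi> \<alpha>" and conf: "conformal_family P \<theta> E T \<phi> \<alpha> \<nu>"
    and obs: "observable P E \<alpha> u" and B: "setting_B P \<theta> E T y l sg q d" "setting_B_cond P \<theta> E \<phi> \<alpha> y l sg q d"
    and Eb: "AE \<omega> in P. zetaB \<theta> (sB E \<phi> \<alpha> l sg q d) (epsB E \<phi>) (HB \<theta> E \<phi> \<alpha> y d) \<omega> < 1 \<and>
      Equant (c0B \<theta> E \<alpha> \<phi> (ucent (gibbs P \<nu> E T \<phi> \<theta>) u) (sB E \<phi> \<alpha> l sg q d) (epsB E \<phi>) (HB \<theta> E \<phi> \<alpha> y d))
        (DB \<theta> (sB E \<phi> \<alpha> l sg q d) (epsB E \<phi>) (HB \<theta> E \<phi> \<alpha> y d)) \<omega> \<le> Eb"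
    and D: "inLp P (2 * p) (Dbar E \<alpha> u (ucent (gibbs P \<nu> E T \<phi> \<theta>) u) (HB \<theta> E \<phi> \<alpha> y d) (DomB E \<phi> d))"
    and K: "inLp P p (KB (sB E \<phi> \<alpha> l sg q d))"
    and U: "inLp P p (\<lambda>\<omega>. supabs (fib E \<omega>) (ucent (gibbs P \<nu> E T \<phi> \<theta>) u \<omega>))"
    and p: "0 < p" and \<sigma>: "0 < \<sigma>"
    and var: "AE \<omega> in P. (\<lambda>n. svar (gibbs P \<nu> E T \<phi> \<theta>) \<theta> T u \<omega> n / real n) \<longlonglongrightarrow> \<sigma>\<^sup>2"
  shows "AE \<omega> in P. \<exists>C. \<forall>n\<ge>1. \<forall>t. \<bar>measure (gibbs P \<nu> E T \<phi> \<theta> \<omega>)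
      {x \<in> fib E \<omega>. Ssum \<theta> T (ucent (gibbs P \<nu> E T \<phi> \<theta>) u) n \<omega> x \<le> t * sqrt (svar (gibbs P \<nu> E T \<phi> \<theta>) \<theta> T u \<omega> n)} - Phi t\<bar>
      \<le> C * real n powr (- (1/2 - 8/p))"
proof -
  interpret invertible_mps P \<theta> by (rule standing_invertible_mps[OF standing])
  define ut where "ut = ucent (gibbs P \<nu> E T \<phi> \<theta>) u"
  define Ub where "Ub = (\<lambda>\<omega>. supabs (fib E \<omega>) (ut \<omega>))"
  define s where "s = sB E \<phi> \<alpha> l sg q d"
  define \<epsilon> where "\<epsilon> = epsB E \<phi>"
  define H where "H = HB \<theta> E \<phi> \<alpha> y d"
  define \<zeta> where "\<zeta> = zetaB \<theta> s \<epsilon> H"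
  define Db where "Db = Dbar E \<alpha> u ut H (DomB E \<phi> d)"
  define S where "S \<omega> = SB (s \<omega>) (fib E \<omega>) \<alpha>" for \<omega>
  define \<Gamma> where "\<Gamma> \<omega> = (1 + \<zeta> \<omega>) / (1 - \<zeta> \<omega>) * (1 + \<zeta> \<omega> / s (\<theta> \<omega>))" for \<omega>
  \<comment> \<open>18 = 6 * 3 combines the tolerance with the constant of
    \<open>SB_cone_step\<close>; \<Gamma> \<le> 4 / ((1 - \<zeta>) s') turns it into 72 / s', and 2
    / s' \<le> \<open>KB s (\<theta> \<omega>)\<close> leaves 36, where s' is s at
    \<open>\<theta> \<omega>\<close>.\<close>
  define W where "W = (\<lambda>\<omega>. 36 * (4 * Db \<omega> + Eb) * KB s (\<theta> \<omega>))"
  define V where "V \<omega> = hvar \<alpha> (fib E \<omega>) (u \<omega>)" for \<omega>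
  have \<alpha>: "0 < \<alpha>" "\<alpha> \<le> 1" and compact: "\<And>\<omega>. \<omega> \<in> space P \<Longrightarrow> compact (fib E \<omega>)" and erg: "ergodic P \<theta>"
    and \<phi>_bdd: "\<And>\<omega>. \<omega> \<in> space P \<Longrightarrow> bounded (\<phi> \<omega> ` fib E \<omega>)"
    using standing by (auto simp: standing_setup_def)
  note diam = standing_dist_le_1[OF standing]
  have holder: "AE \<omega> in P. holder_space \<alpha> (fib E \<omega>) (u \<omega>)" using obs by (simp add: observable_def)
  define R0 where "R0 \<omega> \<longleftrightarrow> \<omega> \<in> space P \<and> fib E \<omega> \<noteq> {} \<and> 1 \<le> l \<omega> \<and> 1 < sg \<omega> \<and> 0 < q \<omega> \<and> q \<omega> < d \<omega> \<and> s \<omega> < 1" for \<omega>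
  define R where "R \<omega> \<longleftrightarrow> R0 \<omega> \<and> R0 (\<theta> \<omega>) \<and> holder_space \<alpha> (fib E \<omega>) (u \<omega>) \<and>
        (\<forall>x\<in>fib E (\<theta> \<omega>). bij_betw (\<lambda>i. y \<omega> i x) {1..d \<omega>} {z \<in> fib E \<omega>. T \<omega> z = x}) \<and>
        (\<forall>x\<in>fib E (\<theta> \<omega>). \<forall>x'\<in>fib E (\<theta> \<omega>).
            (\<forall>i\<in>{1..q \<omega>}. dist (y \<omega> i x) (y \<omega> i x') \<le> l \<omega> * dist x x') \<and>
            (\<forall>i\<in>{q \<omega><..d \<omega>}. dist (y \<omega> i x) (y \<omega> i x') \<le> dist x x' / sg \<omega>)) \<and>
        (\<forall>i\<in>{1..d \<omega>}. holder_space \<alpha> (fib E (\<theta> \<omega>)) (\<lambda>x. \<phi> \<omega> (y \<omega> i x))) \<and>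
        \<zeta> \<omega> < 1 \<and> Equant (c0B \<theta> E \<alpha> \<phi> ut s \<epsilon> H) (DB \<theta> s \<epsilon> H) \<omega> \<le> Eb" for \<omega>
  note B' = conjunct2[OF conjunct2[OF conjunct2[OF conjunct2[OF B(1)[unfolded setting_B_def]]]]] B(2)[unfolded setting_B_cond_def]
  have "AE \<omega> in P. R0 \<omega>"
    using AE_space conformal_family_fib_nonempty[OF conf] B'
    unfolding R0_def s_def by eventually_elim blast
  from AE_shift[OF this] have R0: "AE \<omega> in P. R0 \<omega> \<and> R0 (\<theta> \<omega>)" .
  have R: "AE \<omega> in P. R \<omega>"
    using R0 holder B' Eb[folded ut_def s_def \<epsilon>_def H_def, folded \<zeta>_def]
    unfolding R_def by eventually_elim blast
  have s_pos: "0 < s \<omega>" if "R0 \<omega>" for \<omega>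
  proof -
    have "0 < real (q \<omega>) * l \<omega> powr \<alpha>" "0 \<le> real (d \<omega> - q \<omega>) * sg \<omega> powr (- \<alpha>)" using that by (auto simp: R0_def)
    then have "0 < real (q \<omega>) * l \<omega> powr \<alpha> + real (d \<omega> - q \<omega>) * sg \<omega> powr (- \<alpha>)" by linarith
    then show ?thesis using that by (simp add: s_def sB_def aB_def R0_def)
  qed
  define \<delta> where "\<delta> \<omega> i = (if i \<le> q \<omega> then l \<omega> powr \<alpha> else sg \<omega> powr (- \<alpha>))" for \<omega> i
  have sum_\<delta>: "exp (\<epsilon> \<omega>) * (\<Sum>i\<in>{1..d \<omega>}. \<delta> \<omega> i) \<le> real (d \<omega>) * s \<omega>" if \<omega>: "R0 \<omega>" for \<omega>
  proof -
    have "{1..d \<omega>} \<inter> {i. i \<le> q \<omega>} = {1..q \<omega>}" "{1..d \<omega>} \<inter> - {i. i \<le> q \<omega>} = {q \<omega><..d \<omega>}" using \<omega> by (auto simp: R0_def)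
    then have "(\<Sum>i\<in>{1..d \<omega>}. \<delta> \<omega> i) = real (q \<omega>) * l \<omega> powr \<alpha> + real (d \<omega> - q \<omega>) * sg \<omega> powr (- \<alpha>)"
      unfolding \<delta>_def by (simp add: sum.If_cases)
    then show ?thesis using \<omega> by (simp add: s_def sB_def aB_def \<epsilon>_def R0_def)
  qed
  have contr: "dist (y \<omega> i x) (y \<omega> i x') powr \<alpha> \<le> \<delta> \<omega> i * dist x x' powr \<alpha>"
    if \<omega>: "R \<omega>" and x: "x \<in> fib E (\<theta> \<omega>)" "x' \<in> fib E (\<theta> \<omega>)" and i: "i \<in> {1..d \<omega>}" for \<omega> x x' i
  proof (cases "i \<le> q \<omega>")
    case True
    then have "dist (y \<omega> i x) (y \<omega> i x') \<le> l \<omega> * dist x x'" using \<omega> x i by (auto simp: R_def)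
    then have "dist (y \<omega> i x) (y \<omega> i x') powr \<alpha> \<le> (l \<omega> * dist x x') powr \<alpha>" using \<alpha> by (intro powr_mono2) auto
    then show ?thesis using True \<omega> by (simp add: \<delta>_def powr_mult R_def R0_def)
  next
    case False
    then have "dist (y \<omega> i x) (y \<omega> i x') \<le> dist x x' / sg \<omega>" using \<omega> x i by (auto simp: R_def)
    then have "dist (y \<omega> i x) (y \<omega> i x') powr \<alpha> \<le> (dist x x' / sg \<omega>) powr \<alpha>" using \<alpha> by (intro powr_mono2) auto
    then show ?thesis using False \<omega> by (simp add: \<delta>_def powr_divide powr_minus R_def R0_def field_simps)
  qed
  have osc: "\<bar>\<phi> \<omega> (y \<omega> i x) - \<phi> \<omega> (y \<omega> i x')\<bar> \<le> H \<omega> * dist x x' powr \<alpha>" and H0: "0 \<le> H \<omega>"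
    if \<omega>: "R \<omega>" and x: "x \<in> fib E (\<theta> \<omega>)" "x' \<in> fib E (\<theta> \<omega>)" and i: "i \<in> {1..d \<omega>}" for \<omega> x x' i
  proof -
    let ?v = "\<lambda>i. hvar \<alpha> (fib E (\<theta> \<omega>)) (\<lambda>x. \<phi> \<omega> (y \<omega> i x))"
    have h: "holder_space \<alpha> (fib E (\<theta> \<omega>)) (\<lambda>x. \<phi> \<omega> (y \<omega> i x))" using \<omega> i by (auto simp: R_def)
    have vH: "?v i \<le> H \<omega>" unfolding H_def HB_def using i by (intro Max_ge) auto
    show "0 \<le> H \<omega>" using hvar_le(2)[OF h x] vH by linarith
    have "?v i * dist x x' powr \<alpha> \<le> H \<omega> * dist x x' powr \<alpha>" using vH by (intro mult_right_mono) auto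
    then show "\<bar>\<phi> \<omega> (y \<omega> i x) - \<phi> \<omega> (y \<omega> i x')\<bar> \<le> H \<omega> * dist x x' powr \<alpha>" using hvar_le(1)[OF h x] by linarith
  qed
  have H_nonneg: "0 \<le> H \<omega>" if \<omega>: "R \<omega>" for \<omega>
  proof -
    obtain x where "x \<in> fib E (\<theta> \<omega>)" using \<omega> by (auto simp: R_def R0_def)
    then show ?thesis using H0[OF \<omega>, of x x 1] \<omega> by (auto simp: R_def R0_def)
  qed
  have eps: "\<phi> \<omega> z \<le> \<epsilon> \<omega> + \<phi> \<omega> z'" if \<omega>: "R0 \<omega>" and z: "z \<in> fib E \<omega>" "z' \<in> fib E \<omega>" for \<omega> z z'
  proof -
    have "bounded (\<phi> \<omega> ` fib E \<omega>)" using \<omega> by (intro \<phi>_bdd) (simp add: R0_def)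
    then have b: "bdd_above (\<phi> \<omega> ` fib E \<omega>)" "bdd_below (\<phi> \<omega> ` fib E \<omega>)" by (rule bounded_imp_bdd_above, rule bounded_imp_bdd_below)
    show ?thesis using cSUP_upper[OF z(1) b(1)] cINF_lower[OF b(2) z(2)] by (simp add: \<epsilon>_def epsB_def)
  qed
  have \<phi>_le: "\<bar>\<phi> \<omega> z\<bar> \<le> supabs (fib E \<omega>) (\<phi> \<omega>)" if "R0 \<omega>" "z \<in> fib E \<omega>" for \<omega> z
    by (rule supabs_ge(1)[OF \<phi>_bdd that(2)]) (use that(1) in \<open>simp add: R0_def\<close>)
  have eps_le: "\<epsilon> \<omega> \<le> 2 * supabs (fib E \<omega>) (\<phi> \<omega>)" if \<omega>: "R0 \<omega>" for \<omega>
  proof -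
    have ne: "fib E \<omega> \<noteq> {}" using \<omega> by (simp add: R0_def)
    have "(SUP x\<in>fib E \<omega>. \<phi> \<omega> x) \<le> supabs (fib E \<omega>) (\<phi> \<omega>)" using \<phi>_le[OF \<omega>] by (intro cSUP_least ne) (auto simp: abs_le_iff)
    moreover have "- supabs (fib E \<omega>) (\<phi> \<omega>) \<le> (INF x\<in>fib E \<omega>. \<phi> \<omega> x)"
      by (intro cINF_greatest ne) (use \<phi>_le[OF \<omega>] abs_le_D2 in fastforce)
    ultimately show ?thesis by (simp add: \<epsilon>_def epsB_def)
  qed
  have branched: "branched_map (fib E \<omega>) (fib E (\<theta> \<omega>)) (T \<omega>) (\<phi> \<omega>) {1..d \<omega>} (y \<omega>) (DomB E \<phi> d \<omega>)" if \<omega>: "R \<omega>" for \<omega>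
  proof
    show "compact (fib E \<omega>)" "compact (fib E (\<theta> \<omega>))" "fib E (\<theta> \<omega>) \<noteq> {}" using \<omega> by (auto simp: R_def R0_def intro: compact)
    show "T \<omega> \<in> measurable (restrict_space borel (fib E \<omega>)) (restrict_space borel (fib E (\<theta> \<omega>)))"
      using \<omega> by (intro standing_T_measurable[OF standing]) (auto simp: R_def R0_def)
    show bij: "bij_betw (\<lambda>i. y \<omega> i x) {1..d \<omega>} {z \<in> fib E \<omega>. T \<omega> z = x}" if "x \<in> fib E (\<theta> \<omega>)" for x using \<omega> that by (auto simp: R_def)
    show "continuous_on (fib E (\<theta> \<omega>)) (y \<omega> i)" if i: "i \<in> {1..d \<omega>}" for i
    proof (cases "i \<le> q \<omega>")
      case True
      show ?thesis by (rule continuous_on_Holder[of 1 _ _ "l \<omega>"]) (use \<omega> i True in \<open>auto simp: R_def\<close>)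
    next
      case False
      show ?thesis by (rule continuous_on_Holder[of 1 _ _ "1 / sg \<omega>"]) (use \<omega> i False in \<open>auto simp: R_def\<close>)
    qed
    show "continuous_on (fib E (\<theta> \<omega>)) (\<lambda>x. \<phi> \<omega> (y \<omega> i x))" if i: "i \<in> {1..d \<omega>}" for i
      by (rule continuous_on_Holder[OF \<alpha>(1), of _ _ "H \<omega>"]) (use osc[OF \<omega> _ _ i] in \<open>auto simp: dist_real_def\<close>)
    fix x assume x: "x \<in> fib E (\<theta> \<omega>)"
    let ?Z = "{z \<in> fib E \<omega>. T \<omega> z = x}"
    have fin: "finite ?Z" using bij_betw_finite[OF bij[OF x]] by simp
    have card: "card ?Z = d \<omega>" using bij_betw_same_card[OF bij[OF x]] by simp
    show "(\<lambda>z. exp (\<phi> \<omega> z)) summable_on ?Z" using fin by (rule summable_on_finite)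
    have "(\<Sum>z\<in>?Z. exp (\<phi> \<omega> z)) \<le> of_nat (card ?Z) * exp (supabs (fib E \<omega>) (\<phi> \<omega>))"
      by (rule sum_bounded_above) (use \<phi>_le[of \<omega>] \<omega> in \<open>auto simp: R_def abs_le_iff\<close>)
    then show "(\<Sum>\<^sub>\<infinity>z\<in>?Z. exp (\<phi> \<omega> z)) \<le> DomB E \<phi> d \<omega>" using fin card by (simp add: DomB_def)
  qed
  have step: "cone_step (S \<omega>) (S (\<theta> \<omega>)) (Lop E T \<phi> \<omega>) (\<Gamma> \<omega>)"
    and pert: "\<And>\<psi> p m a b. (\<And>x. x \<in> fib E \<omega> \<Longrightarrow> \<bar>\<psi> x\<bar> \<le> a) \<Longrightarrow> 0 \<le> b \<Longrightarrow>
      (\<And>x x'. x \<in> fib E \<omega> \<Longrightarrow> x' \<in> fib E \<omega> \<Longrightarrow> \<bar>\<psi> x - \<psi> x'\<bar> \<le> b * dist x x' powr \<alpha>) \<Longrightarrow>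
      p \<in> fcone (S \<omega>) \<Longrightarrow> m \<in> S (\<theta> \<omega>) \<Longrightarrow>
      feval m (Lop E T \<phi> \<omega> (\<lambda>x. \<psi> x * p x)) \<le> 3 * (a + b) / (1 - \<zeta> \<omega>) * feval m (Lop E T \<phi> \<omega> p)"
    if \<omega>: "R \<omega>" for \<omega>
  proof -
    interpret branched_map "fib E \<omega>" "fib E (\<theta> \<omega>)" "T \<omega>" "\<phi> \<omega>" "{1..d \<omega>}" "y \<omega>" "DomB E \<phi> d \<omega>" by (rule branched[OF \<omega>])
    have R00: "R0 \<omega>" "R0 (\<theta> \<omega>)" and d: "0 < d \<omega>" and s: "s \<omega> \<le> 1" "s (\<theta> \<omega>) \<le> 1" and \<zeta>1: "\<zeta> \<omega> < 1" using \<omega> by (auto simp: R_def R0_def)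
    have \<zeta>_eq: "\<zeta> \<omega> = s (\<theta> \<omega>) * (1 + (1 + 1 / s \<omega>) * exp (\<epsilon> \<omega>) * H \<omega>)" by (simp add: \<zeta>_def zetaB_def)
    note * = refl d s_pos[OF R00(1)] s(1) s_pos[OF R00(2)] s(2) H_nonneg[OF \<omega>]
    show "cone_step (S \<omega>) (S (\<theta> \<omega>)) (Lop E T \<phi> \<omega>) (\<Gamma> \<omega>)"
      unfolding Lop_eq_transfer S_def \<Gamma>_def
      by (rule SB_cone_step(1)[OF * _ _ _ sum_\<delta>[OF R00(1)] \<zeta>_eq \<zeta>1 \<alpha>(1)]) (blast intro: contr[OF \<omega>] osc[OF \<omega>] eps[OF R00(1)] diam)+
    show "feval m (Lop E T \<phi> \<omega> (\<lambda>x. \<psi> x * p x)) \<le> 3 * (a + b) / (1 - \<zeta> \<omega>) * feval m (Lop E T \<phi> \<omega> p)"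
      if "\<And>x. x \<in> fib E \<omega> \<Longrightarrow> \<bar>\<psi> x\<bar> \<le> a" "0 \<le> b" "\<And>x x'. x \<in> fib E \<omega> \<Longrightarrow> x' \<in> fib E \<omega> \<Longrightarrow> \<bar>\<psi> x - \<psi> x'\<bar> \<le> b * dist x x' powr \<alpha>"
      "p \<in> fcone (S \<omega>)" "m \<in> S (\<theta> \<omega>)" for \<psi> p m a b
      unfolding Lop_eq_transfer
      by (rule SB_cone_step(2)[OF * _ _ _ sum_\<delta>[OF R00(1)] \<zeta>_eq \<zeta>1 \<alpha>(1)])
        (blast intro: contr[OF \<omega>] osc[OF \<omega>] eps[OF R00(1)] diam that[unfolded S_def])+
  qed
  have V0: "0 \<le> V \<omega>" if "R \<omega>" for \<omega>
    using that hvar_le(2)[of \<alpha> "fib E \<omega>" "u \<omega>"] by (auto simp: R_def R0_def V_def)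
  have V_ut: "hvar \<alpha> (fib E \<omega>) (ut \<omega>) = V \<omega>" for \<omega> by (simp add: V_def hvar_def ut_def ucent_def)
  have holder_ut: "holder_space \<alpha> (fib E \<omega>) (ut \<omega>)" if "R \<omega>" for \<omega>
    unfolding ut_def by (rule holder_space_ucent) (use that in \<open>simp add: R_def\<close>)
  have Ub: "0 \<le> Ub \<omega>" if "R \<omega>" for \<omega>
    unfolding Ub_def using supabs_ge(2)[of "ut \<omega>" "fib E \<omega>"] holder_ut[OF that] by (simp add: holder_space_def)
  have \<Gamma>1: "1 \<le> \<Gamma> \<omega>" if "R \<omega>" for \<omega> using step[OF that] by (simp add: cone_step_def)
  have \<zeta>0: "0 \<le> \<zeta> \<omega>" if \<omega>: "R \<omega>" for \<omega>
  proof -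
    have "0 < s \<omega>" "0 < s (\<theta> \<omega>)" using \<omega> by (auto intro: s_pos simp: R_def)
    then show ?thesis using H_nonneg[OF \<omega>] by (simp add: \<zeta>_def zetaB_def)
  qed
  have key: "18 * ((Ub \<omega> + V \<omega>) * \<Gamma> \<omega> / (1 - \<zeta> \<omega>)) \<le> W \<omega>" if \<omega>: "R \<omega>" for \<omega>
  proof -
    have R00: "R0 \<omega>" "R0 (\<theta> \<omega>)" and \<zeta>1: "\<zeta> \<omega> < 1" and s1: "s (\<theta> \<omega>) < 1" using \<omega> by (auto simp: R_def R0_def)
    note sp = s_pos[OF R00(1)] s_pos[OF R00(2)]
    have \<zeta>_eq: "\<zeta> \<omega> = s (\<theta> \<omega>) * (1 + (1 + 1 / s \<omega>) * exp (\<epsilon> \<omega>) * H \<omega>)" by (simp add: \<zeta>_def zetaB_def)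
    define F where "F = supabs (fib E \<omega>) (\<phi> \<omega>)"
    have F0: "0 \<le> F" unfolding F_def by (rule supabs_ge(2)[OF \<phi>_bdd]) (use R00 in \<open>simp add: R0_def\<close>)
    have Dge: "exp (Ub \<omega>) * (1 + V \<omega>) \<le> Db \<omega>"
    proof -
      have "1 * 1 \<le> real (d \<omega>) * exp F" using R00 F0 by (intro mult_mono) (auto simp: R0_def)
      then have "1 * 1 * 1 \<le> 16 * (1 + H \<omega>) * (real (d \<omega>) * exp F)" using H_nonneg[OF \<omega>] by (intro mult_mono) auto
      then have "exp (Ub \<omega>) * (1 + V \<omega>) * 1 \<le> exp (Ub \<omega>) * (1 + V \<omega>) * (16 * (1 + H \<omega>) * (real (d \<omega>) * exp F))"
        using V0[OF \<omega>] by (intro mult_left_mono) auto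
      moreover have "Db \<omega> = exp (Ub \<omega>) * (1 + V \<omega>) * (16 * (1 + H \<omega>) * (real (d \<omega>) * exp F))"
        unfolding Db_def Dbar_def DomB_def Ub_def V_def F_def by (simp only: mult_ac)
      ultimately show ?thesis by (simp only: mult_1_right)
    qed
    have "(Ub \<omega> + V \<omega>) / (1 - \<zeta> \<omega>)\<^sup>2 \<le> 4 * Db \<omega> + Eb"
    proof (rule setting_B_constant_bound[OF sp Ub[OF \<omega>] V0[OF \<omega>] H_nonneg[OF \<omega>] F0 _ \<zeta>_eq \<zeta>1 Dge])
      show "\<epsilon> \<omega> \<le> 2 * F" unfolding F_def by (rule eps_le[OF R00(1)])
      show "32 * s (\<theta> \<omega>) * (1 + 2 / s \<omega>) * exp (Ub \<omega> + 2 * F) * (Ub \<omega> + V \<omega>) * (1 + H \<omega>) / (1 - \<zeta> \<omega>) *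
        (1 + cosh (7 * (2 * ln ((1 + \<zeta> \<omega>) / (1 - \<zeta> \<omega>)) + 2 * ln (1 + \<zeta> \<omega> / s \<omega>)) / 2)) \<le> Eb"
        using \<omega> unfolding R_def Equant_def c0B_def DB_def hnorm_def V_ut \<zeta>_def[symmetric] Ub_def[symmetric] F_def
        by (simp only: Ub_def)
    qed
    then have 1: "(Ub \<omega> + V \<omega>) / (1 - \<zeta> \<omega>)\<^sup>2 * (72 / s (\<theta> \<omega>)) \<le> (4 * Db \<omega> + Eb) * (72 / s (\<theta> \<omega>))"
      using sp by (intro mult_right_mono) auto
    have "0 \<le> (Ub \<omega> + V \<omega>) / (1 - \<zeta> \<omega>)\<^sup>2" using Ub[OF \<omega>] V0[OF \<omega>] by simp
    then have D0: "0 \<le> 4 * Db \<omega> + Eb" using \<open>(Ub \<omega> + V \<omega>) / (1 - \<zeta> \<omega>)\<^sup>2 \<le> 4 * Db \<omega> + Eb\<close> by linarith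
    have "\<Gamma> \<omega> \<le> 2 / (1 - \<zeta> \<omega>) * (2 / s (\<theta> \<omega>))"
      unfolding \<Gamma>_def
    proof (rule mult_mono)
      show "(1 + \<zeta> \<omega>) / (1 - \<zeta> \<omega>) \<le> 2 / (1 - \<zeta> \<omega>)" using \<zeta>1 by (intro divide_right_mono) auto
      show "1 + \<zeta> \<omega> / s (\<theta> \<omega>) \<le> 2 / s (\<theta> \<omega>)"
      proof -
        have "1 \<le> 1 / s (\<theta> \<omega>)" "\<zeta> \<omega> / s (\<theta> \<omega>) \<le> 1 / s (\<theta> \<omega>)" using sp s1 \<zeta>1 by (auto intro: divide_right_mono)
        then show ?thesis by simp
      qed
    qed (use sp \<zeta>0[OF \<omega>] \<zeta>1 in auto)
    then have "18 * ((Ub \<omega> + V \<omega>) * \<Gamma> \<omega> / (1 - \<zeta> \<omega>)) \<le> 18 * ((Ub \<omega> + V \<omega>) * (2 / (1 - \<zeta> \<omega>) * (2 / s (\<theta> \<omega>))) / (1 - \<zeta> \<omega>))"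
      using Ub[OF \<omega>] V0[OF \<omega>] \<zeta>1 by (intro mult_left_mono divide_right_mono) auto
    also have "\<dots> = (Ub \<omega> + V \<omega>) / (1 - \<zeta> \<omega>)\<^sup>2 * (72 / s (\<theta> \<omega>))" by (simp add: power2_eq_square mult_ac)
    also have "\<dots> \<le> (4 * Db \<omega> + Eb) * (72 / s (\<theta> \<omega>))" by (rule 1)
    also have "\<dots> \<le> (4 * Db \<omega> + Eb) * (36 * KB s (\<theta> \<omega>))"
      using D0 sp by (intro mult_left_mono) (auto simp: KB_def)
    finally show ?thesis by (simp add: W_def mult_ac)
  qed
  have U\<Gamma>: "Ub \<omega> * \<Gamma> \<omega> \<le> W \<omega>" and UW: "Ub \<omega> \<le> W \<omega>" if \<omega>: "R \<omega>" for \<omega>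
  proof -
    have \<zeta>1: "0 < 1 - \<zeta> \<omega>" "1 - \<zeta> \<omega> \<le> 1" using \<omega> \<zeta>0[OF \<omega>] by (auto simp: R_def)
    have "Ub \<omega> * \<Gamma> \<omega> \<le> (Ub \<omega> + V \<omega>) * \<Gamma> \<omega>" using V0[OF \<omega>] \<Gamma>1[OF \<omega>] by (intro mult_right_mono) auto
    also have "\<dots> / 1 \<le> (Ub \<omega> + V \<omega>) * \<Gamma> \<omega> / (1 - \<zeta> \<omega>)"
      using \<zeta>1 Ub[OF \<omega>] V0[OF \<omega>] \<Gamma>1[OF \<omega>] by (intro divide_left_mono) auto
    finally have 1: "Ub \<omega> * \<Gamma> \<omega> \<le> (Ub \<omega> + V \<omega>) * \<Gamma> \<omega> / (1 - \<zeta> \<omega>)" by simp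
    moreover have 2: "Ub \<omega> * 1 \<le> Ub \<omega> * \<Gamma> \<omega>" using Ub[OF \<omega>] \<Gamma>1[OF \<omega>] by (intro mult_left_mono)
    ultimately show "Ub \<omega> * \<Gamma> \<omega> \<le> W \<omega>" "Ub \<omega> \<le> W \<omega>" using key[OF \<omega>] Ub[OF \<omega>] by argo+
  qed
  have perturb: "perturbation_bound (S \<omega>) (S (\<theta> \<omega>)) (Lop E T \<phi> \<omega>) (\<Gamma> \<omega>) (fib E \<omega>) (Ub \<omega>) (W \<omega>) (ut \<omega>)" if \<omega>: "R \<omega>" for \<omega>
  proof (rule perturbation_boundI[where c="integral\<^sup>L (gibbs P \<nu> E T \<phi> \<theta> \<omega>) (u \<omega>)"])
    show "holder_space \<alpha> (fib E \<omega>) (u \<omega>)" using \<omega> by (simp add: R_def)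
    show "ut \<omega> x = u \<omega> x - integral\<^sup>L (gibbs P \<nu> E T \<phi> \<theta> \<omega>) (u \<omega>)" for x by (simp add: ut_def ucent_def)
    fix r \<psi> p m
    assume r: "0 \<le> r" "r * W \<omega> \<le> 1/2" and p: "p \<in> fcone (S \<omega>)" "m \<in> S (\<theta> \<omega>)"
      and \<psi>: "\<And>x. x \<in> fib E \<omega> \<Longrightarrow> \<bar>\<psi> x\<bar> \<le> 2 * r * Ub \<omega>"
        "\<And>x x'. x \<in> fib E \<omega> \<Longrightarrow> x' \<in> fib E \<omega> \<Longrightarrow> \<bar>\<psi> x - \<psi> x'\<bar> \<le> 2 * r * hvar \<alpha> (fib E \<omega>) (u \<omega>) * dist x x' powr \<alpha>"
    let ?L = "feval m (Lop E T \<phi> \<omega> p)"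
    have L0: "0 \<le> ?L" using step[OF \<omega>] p unfolding cone_step_def by (auto intro: fconeD)
    have "feval m (Lop E T \<phi> \<omega> (\<lambda>x. \<psi> x * p x)) \<le> 3 * (2 * r * Ub \<omega> + 2 * r * V \<omega>) / (1 - \<zeta> \<omega>) * ?L"
      using r V0[OF \<omega>] by (intro pert[OF \<omega> _ _ _ p]) (auto intro: \<psi> simp: V_def)
    then have "6 * \<Gamma> \<omega> * feval m (Lop E T \<phi> \<omega> (\<lambda>x. \<psi> x * p x)) \<le> 6 * \<Gamma> \<omega> * (3 * (2 * r * Ub \<omega> + 2 * r * V \<omega>) / (1 - \<zeta> \<omega>) * ?L)"
      using \<Gamma>1[OF \<omega>] by (intro mult_left_mono) auto
    also have "\<dots> = 2 * r * (18 * ((Ub \<omega> + V \<omega>) * \<Gamma> \<omega> / (1 - \<zeta> \<omega>))) * ?L" by (simp add: field_simps)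
    also have "\<dots> \<le> 2 * r * W \<omega> * ?L" using key[OF \<omega>] r L0 by (intro mult_right_mono mult_left_mono) auto
    also have "\<dots> \<le> 1 * ?L" using r L0 by (intro mult_right_mono) auto
    finally show "6 * \<Gamma> \<omega> * feval m (Lop E T \<phi> \<omega> (\<lambda>x. \<psi> x * p x)) \<le> ?L" by simp
  qed
  have good: "good_cone (S \<omega>) (fib E \<omega>) (KB s \<omega>) \<alpha>" if "R \<omega>" for \<omega>
    unfolding S_def by (rule good_cone_SB[OF _ _ \<alpha>(1) _ diam]) (use that s_pos[of \<omega>] in \<open>auto simp: R_def R0_def KB_def divide_right_mono\<close>)
  have D': "inLp P (2 * p) Db" using D by (simp add: Db_def ut_def H_def)
  have K': "inLp P p (KB s)" using K by (simp add: s_def)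
  \<comment> \<open>\<open>Db\<close> is in \<open>L\<close> to the power \<open>2p\<close> and \<open>KB\<close> in \<open>L\<close> to the power \<open>p\<close>: \<open>9/(4p) = 3/(4p) + 3/(2p)\<close>.\<close>
  have p2: "0 < 2 * p" using p by simp
  have W_growth: "AE \<omega> in P. \<exists>C>0. \<forall>j. W ((\<theta> ^^ j) \<omega>) \<le> C * real (Suc j) powr (9 / (4 * p))"
    using AE_growth_inLp[OF D' p2] AE_growth_inLp[OF K' p] AE_orbit[OF R]
  proof eventually_elim
    case (elim \<omega>)
    obtain C1 where C1: "1 \<le> C1" "\<And>j. Db ((\<theta> ^^ j) \<omega>) \<le> C1 * real (Suc j) powr (3 / (2 * (2 * p)))" using elim(1) by auto
    obtain C2 where C2: "1 \<le> C2" "\<And>j. KB s ((\<theta> ^^ j) \<omega>) \<le> C2 * real (Suc j) powr (3 / (2 * p))" using elim(2) by auto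
    let ?C = "36 * (4 * C1 + \<bar>Eb\<bar>) * (C2 * 2 powr (3 / (2 * p)))"
    have "W ((\<theta> ^^ j) \<omega>) \<le> ?C * real (Suc j) powr (9 / (4 * p))" for j
    proof -
      let ?J = "real (Suc j)" and ?v = "(\<theta> ^^ j) \<omega>"
      have Rv: "R ?v" using elim(3) by blast
      have J1: "1 \<le> ?J powr (3 / (4 * p))" using p by (intro ge_one_powr_ge_zero) auto
      have X: "4 * Db ?v + Eb \<le> (4 * C1 + \<bar>Eb\<bar>) * ?J powr (3 / (4 * p))"
      proof -
        have "\<bar>Eb\<bar> * 1 \<le> \<bar>Eb\<bar> * ?J powr (3 / (4 * p))" using J1 by (intro mult_left_mono) auto
        moreover have "Db ?v \<le> C1 * ?J powr (3 / (4 * p))" using C1(2)[of j] by simp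
        ultimately show ?thesis by (simp only: distrib_right mult.assoc)
      qed
      have Y: "KB s (\<theta> ?v) \<le> C2 * 2 powr (3 / (2 * p)) * ?J powr (3 / (2 * p))"
      proof -
        have "KB s (\<theta> ?v) \<le> C2 * real (Suc (Suc j)) powr (3 / (2 * p))" using C2(2)[of "Suc j"] by simp
        \<comment> \<open>K is evaluated one fibre later; j + 2 \<le> 2 (j + 1) brings its growth
          back to the index j.\<close>
        also have "\<dots> \<le> C2 * (2 * ?J) powr (3 / (2 * p))" using C2(1) p by (intro mult_left_mono powr_mono2) auto
        also have "\<dots> = C2 * 2 powr (3 / (2 * p)) * ?J powr (3 / (2 * p))" by (simp only: powr_mult mult.assoc)
        finally show ?thesis .
      qed
      have "R0 (\<theta> ?v)" using Rv by (simp add: R_def)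
      from s_pos[OF this] have KB0: "0 \<le> KB s (\<theta> ?v)" by (simp add: KB_def)
      have "W ?v = 36 * ((4 * Db ?v + Eb) * KB s (\<theta> ?v))" by (simp add: W_def)
      also have "\<dots> \<le> 36 * (((4 * C1 + \<bar>Eb\<bar>) * ?J powr (3 / (4 * p))) * (C2 * 2 powr (3 / (2 * p)) * ?J powr (3 / (2 * p))))"
        using C1(1) by (intro mult_left_mono mult_mono X Y KB0 mult_nonneg_nonneg) auto
      also have "\<dots> = ?C * (?J powr (3 / (4 * p)) * ?J powr (3 / (2 * p)))" by (simp only: mult_ac)
      also have "?J powr (3 / (4 * p)) * ?J powr (3 / (2 * p)) = ?J powr (9 / (4 * p))"
        using p by (simp add: powr_add[symmetric] field_simps)
      finally show ?thesis .
    qed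
    moreover have "0 < ?C" using C1(1) C2(1) by (intro mult_pos_pos) auto
    ultimately show ?case by blast
  qed
  show ?thesis unfolding ut_def[symmetric]
  proof (rule skew_product_Berry_Esseen[where \<mu>="gibbs P \<nu> E T \<phi> \<theta>" and ut=ut and U=Ub and S=S and K="KB s" and \<Gamma>=\<Gamma> and W=W
        and b="9 / (4 * p)" and a="3 / (2 * p)"])
    show "Ub \<in> borel_measurable P" using U by (simp add: inLp_def Ub_def ut_def)
    have "(\<lambda>\<omega>. KB s (\<theta> \<omega>)) \<in> borel_measurable P"
      using K' by (intro measurable_compose[OF \<theta>_measurable]) (simp add: inLp_def)
    moreover have "Db \<in> borel_measurable P" using D' by (simp add: inLp_def)
    ultimately show "W \<in> borel_measurable P" unfolding W_def by measurable
    show "AE \<omega> in P. \<exists>C>0. \<forall>j. W ((\<theta> ^^ j) \<omega>) \<le> C * real (Suc j) powr (9 / (4 * p))" by (rule W_growth)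
    \<comment> \<open>The gap 8 / p - 27 / (4p) = 5 / (4p) is the room left for the logarithm in
      A.\<close>
    show "3 * (9 / (4 * p)) < 8 / p" using p by (simp add: field_simps)
    show "AE \<omega> in P. \<exists>C\<ge>1. \<forall>j. KB s ((\<theta> ^^ j) \<omega>) \<le> C * real (Suc j) powr (3 / (2 * p))"
      by (rule AE_growth_inLp[OF K' p])
    show "AE \<omega> in P. branched_map (fib E \<omega>) (fib E (\<theta> \<omega>)) (T \<omega>) (\<phi> \<omega>) {1..d \<omega>} (y \<omega>) (DomB E \<phi> d \<omega>)"
      using R by eventually_elim (rule branched)
    show "AE \<omega> in P. good_cone (S \<omega>) (fib E \<omega>) (KB s \<omega>) \<alpha>" using R by eventually_elim (rule good)
    show "AE \<omega> in P. cone_step (S \<omega>) (S (\<theta> \<omega>)) (Lop E T \<phi> \<omega>) (\<Gamma> \<omega>)" using R by eventually_elim (rule step)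
    show "AE \<omega> in P. Ub \<omega> \<le> W \<omega>" using R by eventually_elim (rule UW)
    show "AE \<omega> in P. Ub \<omega> * \<Gamma> \<omega> \<le> W \<omega>" using R by eventually_elim (rule U\<Gamma>)
    show "AE \<omega> in P. perturbation_bound (S \<omega>) (S (\<theta> \<omega>)) (Lop E T \<phi> \<omega>) (\<Gamma> \<omega>) (fib E \<omega>) (Ub \<omega>) (W \<omega>) (ut \<omega>)" using R by eventually_elim (rule perturb)
  qed (use ut_def Ub_def erg \<alpha> diam conf holder \<sigma> var p in auto)
qed

text \<open>Boundedness of E is accompanied by strict inequalities that keep the denominators in D
  and c0 positive: division by 0 yields 0 here, so an infinite value could otherwise pass for a
  finite one.\<close>

theorem mainTheorem7:
  fixes P :: "'w measure" and \<theta> :: "'w \<Rightarrow> 'w"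
    and X :: "'x::metric_space set" and E :: "('w \<times> 'x) set"
    and T :: "'w \<Rightarrow> 'x \<Rightarrow> 'x" and \<phi> :: "'w \<Rightarrow> 'x \<Rightarrow> real" and \<alpha> :: real
    and \<nu> :: "'w \<Rightarrow> 'x measure" and u :: "'w \<Rightarrow> 'x \<Rightarrow> real"
    and p :: real and \<sigma> :: real
    and y :: "'w \<Rightarrow> nat \<Rightarrow> 'x \<Rightarrow> 'x"
    and I :: "'w \<Rightarrow> nat set" and \<gamma> H D :: "'w \<Rightarrow> real"
    and l sg :: "'w \<Rightarrow> real" and q d :: "'w \<Rightarrow> nat"
  assumes standing: "standing_setup P \<theta> X E T \<phi> \<alpha>"
    and gibbs_nu: "conformal_family P \<theta> E T \<phi> \<alpha> \<nu>"
    and obs: "observable P E \<alpha> u"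
    and settings:
      "(setting_A P \<theta> E T \<phi> \<alpha> I y \<gamma> H D \<and>
        (\<exists>Eb. AE \<omega> in P. qA \<theta> \<alpha> \<gamma> H \<omega> < 1 \<and>
            HtA E \<alpha> u \<gamma> H \<omega> < \<gamma> (\<theta> \<omega>) powr \<alpha> - 1 \<and>
            Equant (c0A \<theta> E \<alpha> u (ucent (gibbs P \<nu> E T \<phi> \<theta>) u) \<gamma> H) (DA \<theta> \<alpha> \<gamma> H) \<omega> \<le> Eb) \<and>
        (AE \<omega> in P. HtA E \<alpha> u \<gamma> H \<omega> \<le> \<gamma> (\<theta> \<omega>) powr \<alpha> - 1) \<and>
        inLp P (2 * p) (Dbar E \<alpha> u (ucent (gibbs P \<nu> E T \<phi> \<theta>) u) (HtA E \<alpha> u \<gamma> H) D) \<and>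
        inLp P p (KA \<alpha> \<gamma>) \<and> inLp P p (MA \<alpha> \<gamma>) \<and>
        inLp P p (\<lambda>\<omega>. supabs (fib E \<omega>) (ucent (gibbs P \<nu> E T \<phi> \<theta>) u \<omega>)))
     \<or>
       (setting_B P \<theta> E T y l sg q d \<and> setting_B_cond P \<theta> E \<phi> \<alpha> y l sg q d \<and>
        (\<exists>Eb. AE \<omega> in P.
            zetaB \<theta> (sB E \<phi> \<alpha> l sg q d) (epsB E \<phi>) (HB \<theta> E \<phi> \<alpha> y d) \<omega> < 1 \<and>
            Equant (c0B \<theta> E \<alpha> \<phi> (ucent (gibbs P \<nu> E T \<phi> \<theta>) u) (sB E \<phi> \<alpha> l sg q d) (epsB E \<phi>)
                      (HB \<theta> E \<phi> \<alpha> y d))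
                   (DB \<theta> (sB E \<phi> \<alpha> l sg q d) (epsB E \<phi>) (HB \<theta> E \<phi> \<alpha> y d)) \<omega> \<le> Eb) \<and>
        inLp P (2 * p) (Dbar E \<alpha> u (ucent (gibbs P \<nu> E T \<phi> \<theta>) u) (HB \<theta> E \<phi> \<alpha> y d) (DomB E \<phi> d)) \<and>
        inLp P p (KB (sB E \<phi> \<alpha> l sg q d)) \<and> inLp P p (MB (sB E \<phi> \<alpha> l sg q d)) \<and>
        inLp P p (\<lambda>\<omega>. supabs (fib E \<omega>) (ucent (gibbs P \<nu> E T \<phi> \<theta>) u \<omega>)))"
    and p: "p > 16"
    and sigma_pos: "\<sigma> > 0"
    and sigma_lim: "AE \<omega> in P. (\<lambda>n. svar (gibbs P \<nu> E T \<phi> \<theta>) \<theta> T u \<omega> n / real n) \<longlonglongrightarrow> \<sigma>\<^sup>2"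
  shows "AE \<omega> in P. \<exists>C. \<forall>n\<ge>1. \<forall>t::real.
           \<bar>measure (gibbs P \<nu> E T \<phi> \<theta> \<omega>)
               {x \<in> fib E \<omega>. Ssum \<theta> T (ucent (gibbs P \<nu> E T \<phi> \<theta>) u) n \<omega> x
                              \<le> t * sqrt (svar (gibbs P \<nu> E T \<phi> \<theta>) \<theta> T u \<omega> n)}
            - Phi t\<bar> \<le> C * real n powr (- (1/2 - 8/p))"
proof -
  have p0: "0 < p" using p by simp
  from settings show ?thesis
  proof (elim disjE conjE exE)
    fix Eb
    assume A: "setting_A P \<theta> E T \<phi> \<alpha> I y \<gamma> H D"
      and Eb: "AE \<omega> in P. qA \<theta> \<alpha> \<gamma> H \<omega> < 1 \<and> HtA E \<alpha> u \<gamma> H \<omega> < \<gamma> (\<theta> \<omega>) powr \<alpha> - 1 \<and>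
            Equant (c0A \<theta> E \<alpha> u (ucent (gibbs P \<nu> E T \<phi> \<theta>) u) \<gamma> H) (DA \<theta> \<alpha> \<gamma> H) \<omega> \<le> Eb"
      and K: "inLp P p (KA \<alpha> \<gamma>)" and U: "inLp P p (\<lambda>\<omega>. supabs (fib E \<omega>) (ucent (gibbs P \<nu> E T \<phi> \<theta>) u \<omega>))"
    show ?thesis by (rule Berry_Esseen_setting_A[OF standing gibbs_nu obs A Eb K U p0 sigma_pos sigma_lim])
  next
    fix Eb
    assume B: "setting_B P \<theta> E T y l sg q d" "setting_B_cond P \<theta> E \<phi> \<alpha> y l sg q d"
      and Eb: "AE \<omega> in P. zetaB \<theta> (sB E \<phi> \<alpha> l sg q d) (epsB E \<phi>) (HB \<theta> E \<phi> \<alpha> y d) \<omega> < 1 \<and>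
            Equant (c0B \<theta> E \<alpha> \<phi> (ucent (gibbs P \<nu> E T \<phi> \<theta>) u) (sB E \<phi> \<alpha> l sg q d) (epsB E \<phi>)
                      (HB \<theta> E \<phi> \<alpha> y d))
                   (DB \<theta> (sB E \<phi> \<alpha> l sg q d) (epsB E \<phi>) (HB \<theta> E \<phi> \<alpha> y d)) \<omega> \<le> Eb"
      and D: "inLp P (2 * p) (Dbar E \<alpha> u (ucent (gibbs P \<nu> E T \<phi> \<theta>) u) (HB \<theta> E \<phi> \<alpha> y d) (DomB E \<phi> d))"
      and K: "inLp P p (KB (sB E \<phi> \<alpha> l sg q d))" and U: "inLp P p (\<lambda>\<omega>. supabs (fib E \<omega>) (ucent (gibbs P \<nu> E T \<phi> \<theta>) u \<omega>))"
    show ?thesis by (rule Berry_Esseen_setting_B[OF standing gibbs_nu obs B Eb D K U p0 sigma_pos sigma_lim])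
  qed
qed

end
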